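(* Let $\mathcal{V}$ be a closed symmetric monoidal homotopical category. If $\mathcal{M}$ is a $\mathcal{V}$-homotopical category, then $\operatorname{Ho}(\mathcal{M}_0)$ is the underlying category of a tensored and cotensored $\operatorname{Ho}\mathcal{V}$-category, which is denoted $\operatorname{Ho}\mathcal{M}$.
   Context: A homotopical category is a category with a class of weak equivalences containing the identities and such that if $hg$ and $gf$ are weak equivalences then so are $f,g,h,hgf$; $\operatorname{Ho}$ denotes localization at the weak equivalences. A functor is homotopical if it preserves weak equivalences. A left (right) deformation of $\mathcal{A}$ is a functor $Q$ (resp. $R$) $\colon\mathcal{A}\to\mathcal{A}$ with a natural weak equivalence $Q\to\mathrm{Id}$ (resp. $\mathrm{Id}\to R$); a left (right) deformation retract is a full subcategory containing the image of some left (right) deformation. A closed symmetric monoidal homotopical category is a bicomplete closed symmetric monoidal category $\mathcal{V}_0$ (product $\otimes$, unit $E$, internal hom $[-,-]$) which is a homotopical category, equipped with a left deformation retract $\mathcal{V}_Q$ and a right deformation retract $\mathcal{V}_R$ (with deformations $Q$, $R$) such that: $\otimes$ is homotopical on $\mathcal{V}_Q\times\mathcal{V}_Q$ and maps it into $\mathcal{V}_Q$; $[-,-]$ is homotopical on $\mathcal{V}_Q^{op}\times\mathcal{V}_R$ and maps it into $\mathcal{V}_R$; $QE\otimes X\to X$ and $X\otimes QE\to X$ are weak equivalences for $X\in\mathcal{V}_Q$; $Y\to[QE,Y]$ is a weak equivalence for $Y\in\mathcal{V}_R$. Then $\operatorname{Ho}\mathcal{V}_0$ is closed symmetric monoidal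 under the derived product induced by $QX\otimes QY$ and the derived internal hom induced by $[QX,RY]$; $\operatorname{Ho}\mathcal{V}$-categories are categories enriched over it. A $\mathcal{V}$-homotopical category is a tensored and cotensored $\mathcal{V}$-category $\mathcal{M}$ (tensor $\odot$, cotensor $\{-,-\}$, underlying category $\mathcal{M}_0$) such that $\mathcal{M}_0$ is a homotopical category, equipped with a left deformation retract $\mathcal{M}_Q$ and a right deformation retract $\mathcal{M}_R$ of $\mathcal{M}_0$ such that: $\odot$ is homotopical on $\mathcal{V}_Q\times\mathcal{M}_Q$ and maps it into $\mathcal{M}_Q$; $\{-,-\}$ is homotopical on $\mathcal{V}_Q^{op}\times\mathcal{M}_R$ and maps it into $\mathcal{M}_R$; $\mathcal{M}(-,-)$ is homotopical on $\mathcal{M}_Q^{op}\times\mathcal{M}_R$; $QE\odot X\to E\odot X\cong X$ is a weak equivalence for all $X\in\mathcal{M}_Q$; $Y\cong\{E,Y\}\to\{QE,Y\}$ is a weak equivalence for all $Y\in\mathcal{M}_R$. *)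

theory Defs
  imports Main
begin

section \<open>Categories, functors, natural transformations\<close>

record ('o, 'a) cat =
  Obj :: "'o set"
  Arr :: "'a set"
  Dom :: "'a \<Rightarrow> 'o"
  Cod :: "'a \<Rightarrow> 'o"
  Ide :: "'o \<Rightarrow> 'a"
  Comp :: "'a \<Rightarrow> 'a \<Rightarrow> 'a" (infixr "\<cdot>\<index>" 70)

text \<open>\<open>g \<cdot> f\<close> is ``\<open>g\<close> after \<open>f\<close>''; it is meaningful only when \<open>Dom g = Cod f\<close>.\<close>

definition hom :: "('o, 'a, 'z) cat_scheme \<Rightarrow> 'o \<Rightarrow> 'o \<Rightarrow> 'a set" where
  "hom C X Y = {f \<in> Arr C. Dom C f = X \<and> Cod C f = Y}"

locale category =
  fixes C :: "('o, 'a, 'z) cat_scheme" (structure)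
  assumes Dom_in_Obj: "f \<in> Arr C \<Longrightarrow> Dom C f \<in> Obj C"
    and Cod_in_Obj: "f \<in> Arr C \<Longrightarrow> Cod C f \<in> Obj C"
    and Ide_in_hom: "X \<in> Obj C \<Longrightarrow> Ide C X \<in> hom C X X"
    and Comp_in_hom: "f \<in> hom C X Y \<Longrightarrow> g \<in> hom C Y Z \<Longrightarrow> g \<cdot> f \<in> hom C X Z"
    and Comp_Ide: "f \<in> hom C X Y \<Longrightarrow> f \<cdot> Ide C X = f"
    and Ide_Comp: "f \<in> hom C X Y \<Longrightarrow> Ide C Y \<cdot> f = f"
    and Comp_assoc: "f \<in> hom C W X \<Longrightarrow> g \<in> hom C X Y \<Longrightarrow> h \<in> hom C Y Z
                       \<Longrightarrow> (h \<cdot> g) \<cdot> f = h \<cdot> (g \<cdot> f)"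

definition op_cat :: "('o, 'a, 'z) cat_scheme \<Rightarrow> ('o, 'a) cat" where
  "op_cat C = \<lparr>Obj = Obj C, Arr = Arr C, Dom = Cod C, Cod = Dom C, Ide = Ide C,
               Comp = (\<lambda>g f. f \<cdot>\<^bsub>C\<^esub> g)\<rparr>"

definition prod_cat :: "('o1, 'a1, 'z1) cat_scheme \<Rightarrow> ('o2, 'a2, 'z2) cat_scheme
    \<Rightarrow> ('o1 \<times> 'o2, 'a1 \<times> 'a2) cat" where
  "prod_cat C D = \<lparr>Obj = Obj C \<times> Obj D, Arr = Arr C \<times> Arr D,
     Dom = map_prod (Dom C) (Dom D), Cod = map_prod (Cod C) (Cod D),
     Ide = map_prod (Ide C) (Ide D),
     Comp = (\<lambda>(g, g') (f, f'). (g \<cdot>\<^bsub>C\<^esub> f, g' \<cdot>\<^bsub>D\<^esub> f'))\<rparr>"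

definition inverse_arrs :: "('o, 'a, 'z) cat_scheme \<Rightarrow> 'a \<Rightarrow> 'a \<Rightarrow> bool" where
  "inverse_arrs C f g \<longleftrightarrow> f \<in> Arr C \<and> g \<in> hom C (Cod C f) (Dom C f)
     \<and> g \<cdot>\<^bsub>C\<^esub> f = Ide C (Dom C f) \<and> f \<cdot>\<^bsub>C\<^esub> g = Ide C (Cod C f)"

definition iso :: "('o, 'a, 'z) cat_scheme \<Rightarrow> 'a \<Rightarrow> bool" where
  "iso C f \<longleftrightarrow> (\<exists>g. inverse_arrs C f g)"

definition inv_arr :: "('o, 'a, 'z) cat_scheme \<Rightarrow> 'a \<Rightarrow> 'a" where
  "inv_arr C f = (THE g. inverse_arrs C f g)"

record ('o1, 'a1, 'o2, 'a2) ftor =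
  FO :: "'o1 \<Rightarrow> 'o2"
  FA :: "'a1 \<Rightarrow> 'a2"

locale cat_functor = C: category C + D: category D
  for C :: "('o1, 'a1, 'z1) cat_scheme" and D :: "('o2, 'a2, 'z2) cat_scheme" +
  fixes F :: "('o1, 'a1, 'o2, 'a2) ftor"
  assumes FO_in_Obj: "X \<in> Obj C \<Longrightarrow> FO F X \<in> Obj D"
    and FA_in_hom: "f \<in> hom C X Y \<Longrightarrow> FA F f \<in> hom D (FO F X) (FO F Y)"
    and FA_Ide: "X \<in> Obj C \<Longrightarrow> FA F (Ide C X) = Ide D (FO F X)"
    and FA_Comp: "f \<in> hom C X Y \<Longrightarrow> g \<in> hom C Y Z
                    \<Longrightarrow> FA F (g \<cdot>\<^bsub>C\<^esub> f) = FA F g \<cdot>\<^bsub>D\<^esub> FA F f"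

definition id_ftor :: "('o, 'a, 'o, 'a) ftor" where
  "id_ftor = \<lparr>FO = (\<lambda>X. X), FA = (\<lambda>f. f)\<rparr>"

definition cat_isomorphism :: "('o1, 'a1, 'z1) cat_scheme \<Rightarrow> ('o2, 'a2, 'z2) cat_scheme
    \<Rightarrow> ('o1, 'a1, 'o2, 'a2) ftor \<Rightarrow> bool" where
  "cat_isomorphism C D F \<longleftrightarrow> cat_functor C D F
     \<and> bij_betw (FO F) (Obj C) (Obj D) \<and> bij_betw (FA F) (Arr C) (Arr D)"

definition nat_trans :: "('o1, 'a1, 'z1) cat_scheme \<Rightarrow> ('o2, 'a2, 'z2) cat_scheme
    \<Rightarrow> ('o1, 'a1, 'o2, 'a2) ftor \<Rightarrow> ('o1, 'a1, 'o2, 'a2) ftor \<Rightarrow> ('o1 \<Rightarrow> 'a2) \<Rightarrow> bool" where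
  "nat_trans C D F G t \<longleftrightarrow> cat_functor C D F \<and> cat_functor C D G
     \<and> (\<forall>X\<in>Obj C. t X \<in> hom D (FO F X) (FO G X))
     \<and> (\<forall>X Y. \<forall>f\<in>hom C X Y. t Y \<cdot>\<^bsub>D\<^esub> FA F f = FA G f \<cdot>\<^bsub>D\<^esub> t X)"


section \<open>Limits\<close>

definition is_cone :: "('j, 'u, 'y) cat_scheme \<Rightarrow> ('o, 'a, 'z) cat_scheme \<Rightarrow> ('j, 'u, 'o, 'a) ftor
    \<Rightarrow> 'o \<Rightarrow> ('j \<Rightarrow> 'a) \<Rightarrow> bool" where
  "is_cone J C D L p \<longleftrightarrow> L \<in> Obj C \<and> (\<forall>j\<in>Obj J. p j \<in> hom C L (FO D j))
     \<and> (\<forall>j k. \<forall>u\<in>hom J j k. FA D u \<cdot>\<^bsub>C\<^esub> p j = p k)"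

definition is_limit :: "('j, 'u, 'y) cat_scheme \<Rightarrow> ('o, 'a, 'z) cat_scheme \<Rightarrow> ('j, 'u, 'o, 'a) ftor
    \<Rightarrow> 'o \<Rightarrow> ('j \<Rightarrow> 'a) \<Rightarrow> bool" where
  "is_limit J C D L p \<longleftrightarrow> is_cone J C D L p
     \<and> (\<forall>L' p'. is_cone J C D L' p' \<longrightarrow>
          (\<exists>!h. h \<in> hom C L' L \<and> (\<forall>j\<in>Obj J. p j \<cdot>\<^bsub>C\<^esub> h = p' j)))"

text \<open>``Small'' is relative to a type \<open>'i\<close>: a diagram is small when its objects and arrows are
  indexed by elements of \<open>'i\<close>. The type \<open>'i\<close> is a free parameter throughout, so that any size of
  universe can be chosen for it. Colimits in \<open>C\<close> are limits in the opposite of \<open>C\<close>; every small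
  diagram in the opposite of \<open>C\<close> is the opposite of a small diagram in \<open>C\<close>.\<close>

definition complete :: "'i itself \<Rightarrow> ('o, 'a, 'z) cat_scheme \<Rightarrow> bool" where
  "complete _ C \<longleftrightarrow> (\<forall>(J :: ('i, 'i) cat) D. cat_functor J C D \<longrightarrow> (\<exists>L p. is_limit J C D L p))"

definition bicomplete :: "'i itself \<Rightarrow> ('o, 'a, 'z) cat_scheme \<Rightarrow> bool" where
  "bicomplete I C \<longleftrightarrow> complete I C \<and> complete I (op_cat C)"


section \<open>Homotopical categories and their localization\<close>

locale homotopical_category = category C
  for C :: "('o, 'a, 'z) cat_scheme" (structure) +
  fixes W :: "'a set"
  assumes weq_Arr: "W \<subseteq> Arr C"
    and Ide_weq: "X \<in> Obj C \<Longrightarrow> Ide C X \<in> W"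
    and two_of_six: "f \<in> hom C X Y \<Longrightarrow> g \<in> hom C Y Z \<Longrightarrow> h \<in> hom C Z T
                       \<Longrightarrow> h \<cdot> g \<in> W \<Longrightarrow> g \<cdot> f \<in> W
                       \<Longrightarrow> f \<in> W \<and> g \<in> W \<and> h \<in> W \<and> h \<cdot> g \<cdot> f \<in> W"

definition weq_on :: "('o, 'a, 'z) cat_scheme \<Rightarrow> 'a set \<Rightarrow> 'o set \<Rightarrow> 'a set" where
  "weq_on C W S = {w \<in> W. Dom C w \<in> S \<and> Cod C w \<in> S}"

definition left_deformation :: "('o, 'a, 'z) cat_scheme \<Rightarrow> 'a set
    \<Rightarrow> ('o, 'a, 'o, 'a) ftor \<Rightarrow> ('o \<Rightarrow> 'a) \<Rightarrow> bool" where
  "left_deformation C W Q q \<longleftrightarrow> nat_trans C C Q id_ftor q \<and> (\<forall>X\<in>Obj C. q X \<in> W)"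

definition right_deformation :: "('o, 'a, 'z) cat_scheme \<Rightarrow> 'a set
    \<Rightarrow> ('o, 'a, 'o, 'a) ftor \<Rightarrow> ('o \<Rightarrow> 'a) \<Rightarrow> bool" where
  "right_deformation C W R r \<longleftrightarrow> nat_trans C C id_ftor R r \<and> (\<forall>X\<in>Obj C. r X \<in> W)"

text \<open>A full subcategory is represented by its set of objects.\<close>

definition left_deformation_retract :: "('o, 'a, 'z) cat_scheme \<Rightarrow> 'a set \<Rightarrow> 'o set \<Rightarrow> bool" where
  "left_deformation_retract C W S \<longleftrightarrow> S \<subseteq> Obj C
     \<and> (\<exists>Q q. left_deformation C W Q q \<and> FO Q ` Obj C \<subseteq> S)"

definition right_deformation_retract :: "('o, 'a, 'z) cat_scheme \<Rightarrow> 'a set \<Rightarrow> 'o set \<Rightarrow> bool" where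
  "right_deformation_retract C W S \<longleftrightarrow> S \<subseteq> Obj C
     \<and> (\<exists>R r. right_deformation C W R r \<and> FO R ` Obj C \<subseteq> S)"

text \<open>The localization at \<open>W\<close> is the category of zigzags modulo the least congruence making
  \<open>C \<rightarrow> Ho C\<close> a functor and each \<open>Bwd w\<close> inverse to \<open>Fwd w\<close>. Zigzags are read in diagrammatic
  order; an arrow of the localization carries its domain, its codomain and a class of zigzags.\<close>

datatype 'a zz = Fwd 'a | Bwd 'a

inductive zz_path :: "('o, 'a, 'z) cat_scheme \<Rightarrow> 'a set \<Rightarrow> 'o \<Rightarrow> 'a zz list \<Rightarrow> 'o \<Rightarrow> bool"
  for C :: "('o, 'a, 'z) cat_scheme" and W :: "'a set" where
  Nil: "X \<in> Obj C \<Longrightarrow> zz_path C W X [] X"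
| Fwd: "f \<in> Arr C \<Longrightarrow> zz_path C W (Cod C f) p Y \<Longrightarrow> zz_path C W (Dom C f) (Fwd f # p) Y"
| Bwd: "w \<in> W \<Longrightarrow> zz_path C W (Dom C w) p Y \<Longrightarrow> zz_path C W (Cod C w) (Bwd w # p) Y"

inductive zz_rule :: "('o, 'a, 'z) cat_scheme \<Rightarrow> 'a set \<Rightarrow> 'a zz list \<Rightarrow> 'a zz list \<Rightarrow> bool"
  for C :: "('o, 'a, 'z) cat_scheme" and W :: "'a set" where
  Ide: "X \<in> Obj C \<Longrightarrow> zz_rule C W [Fwd (Ide C X)] []"
| Comp: "f \<in> hom C X Y \<Longrightarrow> g \<in> hom C Y Z \<Longrightarrow> zz_rule C W [Fwd f, Fwd g] [Fwd (g \<cdot>\<^bsub>C\<^esub> f)]"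
| Fwd_Bwd: "w \<in> W \<Longrightarrow> zz_rule C W [Fwd w, Bwd w] []"
| Bwd_Fwd: "w \<in> W \<Longrightarrow> zz_rule C W [Bwd w, Fwd w] []"

inductive zz_eq :: "('o, 'a, 'z) cat_scheme \<Rightarrow> 'a set \<Rightarrow> 'o \<Rightarrow> 'o \<Rightarrow> 'a zz list \<Rightarrow> 'a zz list \<Rightarrow> bool"
  for C :: "('o, 'a, 'z) cat_scheme" and W :: "'a set" and X Y :: 'o where
  rule: "zz_rule C W l l' \<Longrightarrow> zz_path C W X (p @ l @ s) Y \<Longrightarrow> zz_path C W X (p @ l' @ s) Y
           \<Longrightarrow> zz_eq C W X Y (p @ l @ s) (p @ l' @ s)"
| refl: "zz_path C W X p Y \<Longrightarrow> zz_eq C W X Y p p"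
| sym: "zz_eq C W X Y p s \<Longrightarrow> zz_eq C W X Y s p"
| trans: "zz_eq C W X Y p s \<Longrightarrow> zz_eq C W X Y s t \<Longrightarrow> zz_eq C W X Y p t"

type_synonym ('o, 'a) ho_arr = "'o \<times> 'o \<times> 'a zz list set"

definition ho_class :: "('o, 'a, 'z) cat_scheme \<Rightarrow> 'a set \<Rightarrow> 'o \<Rightarrow> 'o \<Rightarrow> 'a zz list \<Rightarrow> ('o, 'a) ho_arr"
  where "ho_class C W X Y p = (X, Y, {s. zz_eq C W X Y p s})"

definition ho_comp :: "('o, 'a, 'z) cat_scheme \<Rightarrow> 'a set
    \<Rightarrow> ('o, 'a) ho_arr \<Rightarrow> ('o, 'a) ho_arr \<Rightarrow> ('o, 'a) ho_arr" where
  "ho_comp C W = (\<lambda>(_, Z, d) (X, _, c). (X, Z, {t. \<exists>p\<in>c. \<exists>s\<in>d. zz_eq C W X Z (p @ s) t}))"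

definition ho_cat :: "('o, 'a, 'z) cat_scheme \<Rightarrow> 'a set \<Rightarrow> ('o, ('o, 'a) ho_arr) cat" where
  "ho_cat C W = \<lparr>Obj = Obj C, Arr = {ho_class C W X Y p | X Y p. zz_path C W X p Y},
     Dom = fst, Cod = fst \<circ> snd, Ide = (\<lambda>X. ho_class C W X X []), Comp = ho_comp C W\<rparr>"

definition ho_arr :: "('o, 'a, 'z) cat_scheme \<Rightarrow> 'a set \<Rightarrow> 'a \<Rightarrow> ('o, 'a) ho_arr" where
  "ho_arr C W f = ho_class C W (Dom C f) (Cod C f) [Fwd f]"

definition ho_ftor :: "('o, 'a, 'z) cat_scheme \<Rightarrow> 'a set \<Rightarrow> ('o, 'a, 'o, ('o, 'a) ho_arr) ftor" where
  "ho_ftor C W = \<lparr>FO = (\<lambda>X. X), FA = ho_arr C W\<rparr>"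

text \<open>The functor out of the localization induced by a functor \<open>F\<close> that inverts \<open>W\<close>.\<close>

fun zz_eval :: "('o, 'a, 'z) cat_scheme \<Rightarrow> ('o2, 'a2, 'z2) cat_scheme \<Rightarrow> ('o, 'a, 'o2, 'a2) ftor
    \<Rightarrow> 'o \<Rightarrow> 'a zz list \<Rightarrow> 'a2" where
  "zz_eval C D F X [] = Ide D (FO F X)"
| "zz_eval C D F X (Fwd f # p) = zz_eval C D F (Cod C f) p \<cdot>\<^bsub>D\<^esub> FA F f"
| "zz_eval C D F X (Bwd w # p) = zz_eval C D F (Dom C w) p \<cdot>\<^bsub>D\<^esub> inv_arr D (FA F w)"

definition ho_lift :: "('o, 'a, 'z) cat_scheme \<Rightarrow> ('o2, 'a2, 'z2) cat_scheme
    \<Rightarrow> ('o, 'a, 'o2, 'a2) ftor \<Rightarrow> ('o, ('o, 'a) ho_arr, 'o2, 'a2) ftor" where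
  "ho_lift C D F = \<lparr>FO = FO F, FA = (\<lambda>(X, _, c). zz_eval C D F X (SOME p. p \<in> c))\<rparr>"

text \<open>The universal property of the localization: a functor inverting \<open>W\<close> factors uniquely
  through \<open>ho_ftor C W\<close>.\<close>

lemma homD: "f \<in> hom C X Y \<Longrightarrow> f \<in> Arr C" "f \<in> hom C X Y \<Longrightarrow> Dom C f = X"
  "f \<in> hom C X Y \<Longrightarrow> Cod C f = Y"
  by (auto simp: hom_def)

lemma homI: "f \<in> Arr C \<Longrightarrow> f \<in> hom C (Dom C f) (Cod C f)"
  by (simp add: hom_def)

context category
begin

lemma hom_Obj: "f \<in> hom C X Y \<Longrightarrow> X \<in> Obj C" "f \<in> hom C X Y \<Longrightarrow> Y \<in> Obj C"
  using Dom_in_Obj Cod_in_Obj by (auto simp: hom_def)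

lemma inverse_arrs_unique:
  assumes "inverse_arrs C f g" "inverse_arrs C f h"
  shows "g = h"
proof -
  have f: "f \<in> hom C (Dom C f) (Cod C f)" and g: "g \<in> hom C (Cod C f) (Dom C f)"
    and h: "h \<in> hom C (Cod C f) (Dom C f)"
    using assms by (auto simp: inverse_arrs_def hom_def)
  have "g = g \<cdot> (f \<cdot> h)" using assms Comp_Ide[OF g] by (simp add: inverse_arrs_def)
  also have "\<dots> = (g \<cdot> f) \<cdot> h" using Comp_assoc[OF h f g] by simp
  also have "\<dots> = h" using assms Ide_Comp[OF h] by (simp add: inverse_arrs_def)
  finally show ?thesis .
qed

lemma inv_arr_eq: "inverse_arrs C f g \<Longrightarrow> inv_arr C f = g"
  unfolding inv_arr_def using inverse_arrs_unique by blast

lemma iso_inv: "iso C f \<Longrightarrow> inverse_arrs C f (inv_arr C f)"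
  using inv_arr_eq by (auto simp: iso_def)

end

locale localizable = category C
  for C :: "('o, 'a, 'z) cat_scheme" (structure) +
  fixes W :: "'a set"
  assumes W_Arr: "W \<subseteq> Arr C"
begin

lemma zz_path_Obj: "zz_path C W X p Y \<Longrightarrow> X \<in> Obj C \<and> Y \<in> Obj C"
  by (induction rule: zz_path.induct) (use Dom_in_Obj Cod_in_Obj W_Arr in auto)

lemma zz_path_append: "zz_path C W X p Y \<Longrightarrow> zz_path C W Y s Z \<Longrightarrow> zz_path C W X (p @ s) Z"
  by (induction rule: zz_path.induct) (auto intro: zz_path.intros)

lemma zz_eq_path: "zz_eq C W X Y p s \<Longrightarrow> zz_path C W X p Y \<and> zz_path C W X s Y"
  by (induction rule: zz_eq.induct) auto

lemma zz_eq_append_left: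
  assumes "zz_path C W X t Y" "zz_eq C W Y Z p s"
  shows "zz_eq C W X Z (t @ p) (t @ s)"
  using assms(2)
proof (induction rule: zz_eq.induct)
  case (rule l l' p s)
  have "zz_path C W X ((t @ p) @ l @ s) Z" "zz_path C W X ((t @ p) @ l' @ s) Z"
    using zz_path_append[OF assms(1)] rule by auto
  from zz_eq.rule[OF rule(1) this] show ?case by simp
qed (auto intro: zz_eq.intros zz_path_append[OF assms(1)])

lemma zz_eq_append_right:
  assumes "zz_path C W Y t Z" "zz_eq C W X Y p s"
  shows "zz_eq C W X Z (p @ t) (s @ t)"
  using assms(2)
proof (induction rule: zz_eq.induct)
  case (rule l l' p s)
  have "zz_path C W X (p @ l @ (s @ t)) Z" "zz_path C W X (p @ l' @ (s @ t)) Z"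
    using zz_path_append[OF rule(2) assms(1)] zz_path_append[OF rule(3) assms(1)] by auto
  from zz_eq.rule[OF rule(1) this] show ?case by simp
qed (auto intro: zz_eq.intros zz_path_append[OF _ assms(1)])

lemma zz_eq_append:
  assumes "zz_eq C W X Y p p'" "zz_eq C W Y Z s s'"
  shows "zz_eq C W X Z (p @ s) (p' @ s')"
  by (meson assms zz_eq.trans zz_eq_append_left zz_eq_append_right zz_eq_path)

lemma ho_class_eq_iff:
  assumes "zz_path C W X p Y"
  shows "ho_class C W X Y p = ho_class C W X' Y' s \<longleftrightarrow> X = X' \<and> Y = Y' \<and> zz_eq C W X Y p s"
proof
  assume "ho_class C W X Y p = ho_class C W X' Y' s"
  then show "X = X' \<and> Y = Y' \<and> zz_eq C W X Y p s"
    using zz_eq.refl[OF assms] by (auto simp: ho_class_def set_eq_iff intro: zz_eq.sym)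
qed (auto simp: ho_class_def intro: zz_eq.sym zz_eq.trans)

lemma ho_comp_class:
  assumes "zz_path C W X p Y" "zz_path C W Y s Z"
  shows "ho_comp C W (ho_class C W Y Z s) (ho_class C W X Y p) = ho_class C W X Z (p @ s)"
proof -
  have "(\<exists>p'. zz_eq C W X Y p p' \<and> (\<exists>s'. zz_eq C W Y Z s s' \<and> zz_eq C W X Z (p' @ s') t))
          \<longleftrightarrow> zz_eq C W X Z (p @ s) t" for t
    using assms by (meson zz_eq.refl zz_eq.trans zz_eq_append)
  then show ?thesis by (auto simp: ho_comp_def ho_class_def)
qed

lemma ho_hom_iff:
  "\<alpha> \<in> hom (ho_cat C W) X Y \<longleftrightarrow> (\<exists>p. zz_path C W X p Y \<and> \<alpha> = ho_class C W X Y p)"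
  by (auto simp: hom_def ho_cat_def ho_class_def)

lemma category_ho_cat: "category (ho_cat C W)"
proof
  fix f assume "f \<in> Arr (ho_cat C W)"
  then show "Dom (ho_cat C W) f \<in> Obj (ho_cat C W)" "Cod (ho_cat C W) f \<in> Obj (ho_cat C W)"
    using zz_path_Obj by (auto simp: ho_cat_def ho_class_def)
next
  fix X assume "X \<in> Obj (ho_cat C W)"
  then show "Ide (ho_cat C W) X \<in> hom (ho_cat C W) X X"
    by (auto simp: ho_hom_iff) (auto simp: ho_cat_def intro: zz_path.intros)
next
  fix f g X Y Z assume "f \<in> hom (ho_cat C W) X Y" "g \<in> hom (ho_cat C W) Y Z"
  then show "g \<cdot>\<^bsub>ho_cat C W\<^esub> f \<in> hom (ho_cat C W) X Z"
    by (auto simp: ho_hom_iff) (auto simp: ho_cat_def ho_comp_class intro: zz_path_append)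
next
  fix f X Y assume "f \<in> hom (ho_cat C W) X Y"
  then obtain p where p: "zz_path C W X p Y" "f = ho_class C W X Y p" by (auto simp: ho_hom_iff)
  then have "zz_path C W X [] X" "zz_path C W Y [] Y"
    using zz_path_Obj by (auto intro: zz_path.intros)
  then show "f \<cdot>\<^bsub>ho_cat C W\<^esub> Ide (ho_cat C W) X = f" "Ide (ho_cat C W) Y \<cdot>\<^bsub>ho_cat C W\<^esub> f = f"
    using p by (auto simp: ho_cat_def ho_comp_class)
next
  fix f g h A X Y Z
  assume "f \<in> hom (ho_cat C W) A X" "g \<in> hom (ho_cat C W) X Y" "h \<in> hom (ho_cat C W) Y Z"
  then show "(h \<cdot>\<^bsub>ho_cat C W\<^esub> g) \<cdot>\<^bsub>ho_cat C W\<^esub> f = h \<cdot>\<^bsub>ho_cat C W\<^esub> g \<cdot>\<^bsub>ho_cat C W\<^esub> f"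
    by (auto simp: ho_hom_iff) (simp add: ho_cat_def ho_comp_class zz_path_append)
qed

lemma zz_path_Fwd: "f \<in> hom C X Y \<Longrightarrow> zz_path C W X [Fwd f] Y"
  using zz_path.intros(2)[of f C W "[]" Y] hom_Obj zz_path.Nil by (fastforce simp: hom_def)

lemma zz_path_Bwd: "w \<in> W \<Longrightarrow> zz_path C W (Cod C w) [Bwd w] (Dom C w)"
  using W_Arr Dom_in_Obj by (auto intro!: zz_path.intros)

lemma ho_comp_Fwd:
  assumes f: "f \<in> hom C X Y" and g: "g \<in> hom C Y Z"
  shows "ho_arr C W g \<cdot>\<^bsub>ho_cat C W\<^esub> ho_arr C W f = ho_arr C W (g \<cdot> f)"
proof -
  have gf: "g \<cdot> f \<in> hom C X Z" using f g by (rule Comp_in_hom)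
  have "zz_eq C W X Z ([] @ [Fwd f, Fwd g] @ []) ([] @ [Fwd (g \<cdot> f)] @ [])"
    using zz_path_append[OF zz_path_Fwd[OF f] zz_path_Fwd[OF g]] zz_path_Fwd[OF gf]
    by (intro zz_eq.rule zz_rule.Comp[OF f g]) auto
  then have "ho_class C W X Z [Fwd f, Fwd g] = ho_class C W X Z [Fwd (g \<cdot> f)]"
    using zz_eq_path by (subst ho_class_eq_iff) auto
  then show ?thesis
    using ho_comp_class[OF zz_path_Fwd[OF f] zz_path_Fwd[OF g]] f g gf
    by (simp add: ho_arr_def ho_cat_def homD)
qed

lemma ho_ftor_functor: "cat_functor C (ho_cat C W) (ho_ftor C W)"
proof (intro cat_functor.intro cat_functor_axioms.intro category_axioms category_ho_cat)
  fix X assume X: "X \<in> Obj C"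
  then show "FO (ho_ftor C W) X \<in> Obj (ho_cat C W)" by (simp add: ho_ftor_def ho_cat_def)
  have path: "zz_path C W X ([] @ [] @ []) X" "zz_path C W X ([] @ [Fwd (Ide C X)] @ []) X"
    using X zz_path_Fwd[OF Ide_in_hom[OF X]] by (auto intro: zz_path.intros)
  have "zz_eq C W X X ([] @ [Fwd (Ide C X)] @ []) ([] @ [] @ [])"
    by (rule zz_eq.rule[OF zz_rule.Ide[OF X] path(2,1)])
  then show "FA (ho_ftor C W) (Ide C X) = Ide (ho_cat C W) (FO (ho_ftor C W) X)"
    using path homD[OF Ide_in_hom[OF X]]
    by (simp add: ho_ftor_def ho_arr_def ho_cat_def ho_class_eq_iff)
next
  fix f X Y assume "f \<in> hom C X Y"
  then show "FA (ho_ftor C W) f \<in> hom (ho_cat C W) (FO (ho_ftor C W) X) (FO (ho_ftor C W) Y)"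
    using zz_path_Fwd by (auto simp: ho_hom_iff ho_ftor_def ho_arr_def homD)
next
  fix f g X Y Z assume "f \<in> hom C X Y" "g \<in> hom C Y Z"
  then show "FA (ho_ftor C W) (g \<cdot> f) = FA (ho_ftor C W) g \<cdot>\<^bsub>ho_cat C W\<^esub> FA (ho_ftor C W) f"
    using ho_comp_Fwd by (simp add: ho_ftor_def)
qed

lemma ho_arr_inverse:
  assumes w: "w \<in> W"
  shows "inverse_arrs (ho_cat C W) (ho_arr C W w) (ho_class C W (Cod C w) (Dom C w) [Bwd w])"
proof -
  let ?X = "Dom C w" and ?Y = "Cod C w"
  have w': "w \<in> hom C ?X ?Y" using w W_Arr by (auto intro: homI)
  note f = zz_path_Fwd[OF w'] and b = zz_path_Bwd[OF w]
  have n: "zz_path C W ?X [] ?X" "zz_path C W ?Y [] ?Y"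
    using hom_Obj[OF w'] by (auto intro: zz_path.intros)
  have "zz_eq C W ?X ?X ([] @ [Fwd w, Bwd w] @ []) ([] @ [] @ [])"
    using zz_path_append[OF f b] n by (intro zz_eq.rule zz_rule.intros w) auto
  moreover have "zz_eq C W ?Y ?Y ([] @ [Bwd w, Fwd w] @ []) ([] @ [] @ [])"
    using zz_path_append[OF b f] n by (intro zz_eq.rule zz_rule.intros w) auto
  ultimately have e: "ho_class C W ?X ?X [Fwd w, Bwd w] = ho_class C W ?X ?X []"
    "ho_class C W ?Y ?Y [Bwd w, Fwd w] = ho_class C W ?Y ?Y []"
    using zz_path_append[OF f b] zz_path_append[OF b f] by (simp_all add: ho_class_eq_iff)
  have "ho_arr C W w \<in> hom (ho_cat C W) ?X ?Y"
    "ho_class C W ?Y ?X [Bwd w] \<in> hom (ho_cat C W) ?Y ?X"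
    using f b by (auto simp: ho_hom_iff ho_arr_def)
  moreover have "ho_class C W ?Y ?X [Bwd w] \<cdot>\<^bsub>ho_cat C W\<^esub> ho_arr C W w = Ide (ho_cat C W) ?X"
    "ho_arr C W w \<cdot>\<^bsub>ho_cat C W\<^esub> ho_class C W ?Y ?X [Bwd w] = Ide (ho_cat C W) ?Y"
    using ho_comp_class[OF f b] ho_comp_class[OF b f] e by (simp_all add: ho_arr_def ho_cat_def)
  ultimately show ?thesis by (simp add: inverse_arrs_def homD)
qed

lemma ho_arr_iso: "w \<in> W \<Longrightarrow> iso (ho_cat C W) (ho_arr C W w)"
  unfolding iso_def using ho_arr_inverse by blast

end

locale localizing_functor = localizable C W + cat_functor C D F
  for C :: "('o, 'a, 'z) cat_scheme" (structure) and W
    and D :: "('o2, 'a2, 'z2) cat_scheme" and F +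
  assumes inverts: "w \<in> W \<Longrightarrow> iso D (FA F w)"
begin

lemma inverts': "w \<in> W \<Longrightarrow> inverse_arrs D (FA F w) (inv_arr D (FA F w))"
  using inverts D.iso_inv by blast

lemma FA_W: "w \<in> W \<Longrightarrow> FA F w \<in> hom D (FO F (Dom C w)) (FO F (Cod C w))"
  using FA_in_hom[OF homI] W_Arr by auto

lemma inv_FA_W: "w \<in> W \<Longrightarrow> inv_arr D (FA F w) \<in> hom D (FO F (Cod C w)) (FO F (Dom C w))"
  using inverts'[of w] FA_W[of w] by (simp add: inverse_arrs_def homD)

lemma zz_eval_in_hom:
  "zz_path C W X p Y \<Longrightarrow> zz_eval C D F X p \<in> hom D (FO F X) (FO F Y)"
proof (induction rule: zz_path.induct)
  case (Nil X)
  then show ?case using D.Ide_in_hom FO_in_Obj by simp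
next
  case (Fwd f p Y)
  then show ?case using D.Comp_in_hom[OF FA_in_hom[OF homI]] by simp
next
  case (Bwd w p Y)
  then show ?case using D.Comp_in_hom[OF inv_FA_W] by simp
qed

lemma zz_eval_append:
  "zz_path C W X p Y \<Longrightarrow> zz_path C W Y s Z
     \<Longrightarrow> zz_eval C D F X (p @ s) = zz_eval C D F Y s \<cdot>\<^bsub>D\<^esub> zz_eval C D F X p"
proof (induction rule: zz_path.induct)
  case (Nil X)
  then show ?case using D.Comp_Ide[OF zz_eval_in_hom] by simp
next
  case (Fwd f p Y)
  then show ?case
    using D.Comp_assoc[OF FA_in_hom[OF homI] zz_eval_in_hom zz_eval_in_hom] by simp
next
  case (Bwd w p Y)
  then show ?case
    using D.Comp_assoc[OF inv_FA_W zz_eval_in_hom zz_eval_in_hom] by simp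
qed

lemma zz_path_appendD:
  "zz_path C W X (p @ s) Z \<Longrightarrow> \<exists>Y. zz_path C W X p Y \<and> zz_path C W Y s Z"
proof (induction p arbitrary: X)
  case Nil
  then show ?case using zz_path_Obj zz_path.Nil by fastforce
next
  case (Cons a p)
  from Cons.prems show ?case
    by (cases rule: zz_path.cases) (auto dest!: Cons.IH intro: zz_path.intros)
qed

lemma zz_eval_rule:
  assumes "zz_rule C W l l'" "zz_path C W X l Y" "zz_path C W X l' Y'"
  shows "zz_eval C D F X l = zz_eval C D F X l'"
  using assms
proof (induction rule: zz_rule.induct)
  case (Ide A)
  then have "X = A" using homD[OF Ide_in_hom[OF Ide(1)]] by (auto elim: zz_path.cases)
  with Ide show ?case
    using homD[OF Ide_in_hom[OF Ide(1)]] D.Ide_Comp[OF D.Ide_in_hom] FA_Ide FO_in_Obj by auto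
next
  case (Comp f A B g E)
  have gf: "g \<cdot> f \<in> hom C A E" using Comp Comp_in_hom by blast
  have h: "FA F f \<in> hom D (FO F A) (FO F B)" "FA F g \<in> hom D (FO F B) (FO F E)"
    using Comp FA_in_hom by auto
  show ?case
    using Comp gf h FA_Comp[OF Comp(1,2)] D.Comp_assoc[OF h D.Ide_in_hom] hom_Obj[OF gf] FO_in_Obj
    by (simp add: homD)
next
  case (Fwd_Bwd w)
  then have "X = Dom C w" by (auto elim: zz_path.cases)
  with Fwd_Bwd show ?case
    using inverts'[of w] FA_W[of w] inv_FA_W[of w] D.Ide_Comp by (simp add: inverse_arrs_def homD)
next
  case (Bwd_Fwd w)
  then have "X = Cod C w" by (auto elim: zz_path.cases)
  with Bwd_Fwd show ?case
    using inverts'[of w] FA_W[of w] inv_FA_W[of w] D.Ide_Comp by (simp add: inverse_arrs_def homD)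
qed

lemma zz_rule_cod:
  assumes "zz_rule C W l l'" "zz_path C W X l Y" "zz_path C W X l' Y'"
  shows "Y = Y'"
  using assms
proof (induction rule: zz_rule.induct)
  case (Ide A)
  with homD[OF Ide_in_hom[OF Ide(1)]] show ?case by (auto elim!: zz_path.cases)
next
  case (Comp f A B g E)
  with homD[OF Comp_in_hom[OF Comp(1,2)]] homD[OF Comp(2)] show ?case
    by (auto elim!: zz_path.cases)
qed (auto elim!: zz_path.cases)

lemma zz_eval_eq: "zz_eq C W X Y p s \<Longrightarrow> zz_eval C D F X p = zz_eval C D F X s"
proof (induction rule: zz_eq.induct)
  case (rule l l' p s)
  obtain A B where 1: "zz_path C W X p A" "zz_path C W A l B" "zz_path C W B s Y"
    using zz_path_appendD[OF rule(2)] zz_path_appendD by blast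
  obtain A' B' where 2: "zz_path C W X p A'" "zz_path C W A' l' B'" "zz_path C W B' s Y"
    using zz_path_appendD[OF rule(3)] zz_path_appendD by blast
  have det: "zz_path C W X p A \<Longrightarrow> zz_path C W X p A' \<Longrightarrow> A = A'" for X p A A'
  proof (induction arbitrary: A' rule: zz_path.induct)
    case Nil then show ?case by (auto elim: zz_path.cases)
  next
    case Fwd from Fwd.prems show ?case by (cases rule: zz_path.cases) (auto dest: Fwd.IH)
  next
    case Bwd from Bwd.prems show ?case by (cases rule: zz_path.cases) (auto dest: Bwd.IH)
  qed
  have A: "A' = A" using det[OF 1(1) 2(1)] by simp
  then have B: "B' = B" using zz_rule_cod[OF rule(1) 1(2)] 2(2) by simp
  have l': "zz_path C W A l' B" using 2 A B by simp
  have "zz_eval C D F A (l @ s) = zz_eval C D F A (l' @ s)"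
    using zz_eval_append[OF 1(2,3)] zz_eval_append[OF l' 1(3)] zz_eval_rule[OF rule(1) 1(2) l']
    by simp
  then show ?case
    using zz_eval_append[OF 1(1) zz_path_append[OF 1(2,3)]]
      zz_eval_append[OF 1(1) zz_path_append[OF l' 1(3)]] by simp
qed auto

lemma ho_lift_class:
  assumes "zz_path C W X p Y"
  shows "FA (ho_lift C D F) (ho_class C W X Y p) = zz_eval C D F X p"
proof -
  have "zz_eq C W X Y p (SOME s. zz_eq C W X Y p s)"
    using zz_eq.refl[OF assms] by (rule someI)
  then show ?thesis using zz_eval_eq by (simp add: ho_lift_def ho_class_def)
qed

theorem ho_lift_functor: "cat_functor (ho_cat C W) D (ho_lift C D F)"
proof (intro cat_functor.intro cat_functor_axioms.intro category_ho_cat D.category_axioms)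
  fix X assume "X \<in> Obj (ho_cat C W)"
  then have X: "X \<in> Obj C" by (simp add: ho_cat_def)
  then show "FO (ho_lift C D F) X \<in> Obj D" using FO_in_Obj by (simp add: ho_lift_def)
  show "FA (ho_lift C D F) (Ide (ho_cat C W) X) = Ide D (FO (ho_lift C D F) X)"
    using ho_lift_class[OF zz_path.Nil[OF X]] by (simp add: ho_cat_def) (simp add: ho_lift_def)
next
  fix f X Y assume "f \<in> hom (ho_cat C W) X Y"
  then show "FA (ho_lift C D F) f \<in> hom D (FO (ho_lift C D F) X) (FO (ho_lift C D F) Y)"
    using zz_eval_in_hom ho_lift_class by (auto simp: ho_hom_iff) (simp add: ho_lift_def)
next
  fix f g X Y Z assume "f \<in> hom (ho_cat C W) X Y" "g \<in> hom (ho_cat C W) Y Z"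
  then obtain p s where "zz_path C W X p Y" "f = ho_class C W X Y p"
    "zz_path C W Y s Z" "g = ho_class C W Y Z s" by (auto simp: ho_hom_iff)
  then show "FA (ho_lift C D F) (g \<cdot>\<^bsub>ho_cat C W\<^esub> f) = FA (ho_lift C D F) g \<cdot>\<^bsub>D\<^esub> FA (ho_lift C D F) f"
    using ho_comp_class zz_path_append zz_eval_append
    by (simp add: ho_lift_class) (simp add: ho_cat_def ho_lift_class)
qed

theorem ho_lift_ho_arr: "f \<in> Arr C \<Longrightarrow> FA (ho_lift C D F) (ho_arr C W f) = FA F f"
  using ho_lift_class[OF zz_path_Fwd[OF homI]] D.Ide_Comp[OF FA_in_hom[OF homI]]
  by (simp add: ho_arr_def)

theorem ho_lift_unique:
  assumes "cat_functor (ho_cat C W) D G"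
    and GO: "\<And>X. X \<in> Obj C \<Longrightarrow> FO G X = FO F X"
    and GA: "\<And>f. f \<in> Arr C \<Longrightarrow> FA G (ho_arr C W f) = FA F f"
    and "\<alpha> \<in> Arr (ho_cat C W)"
  shows "FA G \<alpha> = FA (ho_lift C D F) \<alpha>"
proof -
  interpret G: cat_functor "ho_cat C W" D G by fact
  have inv: "FA G (ho_class C W (Cod C w) (Dom C w) [Bwd w]) = inv_arr D (FA F w)" if w: "w \<in> W" for w
  proof -
    let ?b = "ho_class C W (Cod C w) (Dom C w) [Bwd w]"
    have w': "w \<in> hom C (Dom C w) (Cod C w)" using w W_Arr by (auto intro: homI)
    note i = ho_arr_inverse[OF w]
    have f: "ho_arr C W w \<in> hom (ho_cat C W) (Dom C w) (Cod C w)"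
      and b: "?b \<in> hom (ho_cat C W) (Cod C w) (Dom C w)"
      using zz_path_Fwd[OF w'] zz_path_Bwd[OF w] by (auto simp: ho_hom_iff ho_arr_def)
    have "inverse_arrs D (FA F w) (FA G ?b)"
      using G.FA_Comp[OF f b] G.FA_Comp[OF b f] G.FA_in_hom[OF b] G.FA_Ide GA[of w] GO i
        FA_W[OF w] hom_Obj[OF w'] f b homD(1)[OF w']
      by (simp add: inverse_arrs_def homD) (simp add: ho_cat_def)
    then show ?thesis using D.inv_arr_eq by simp
  qed
  have "FA G (ho_class C W X Y p) = zz_eval C D F X p" if "zz_path C W X p Y" for X Y p
    using that
  proof (induction rule: zz_path.induct)
    case (Nil X)
    then show ?case using G.FA_Ide[of X] GO by (simp add: ho_cat_def)
  next
    case (Fwd f p Y)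
    note f = zz_path_Fwd[OF homI[OF Fwd(1)]]
    have "ho_class C W (Dom C f) Y (Fwd f # p)
        = ho_class C W (Cod C f) Y p \<cdot>\<^bsub>ho_cat C W\<^esub> ho_arr C W f"
      using ho_comp_class[OF f Fwd(2)] by (simp add: ho_cat_def ho_arr_def)
    moreover have "ho_arr C W f \<in> hom (ho_cat C W) (Dom C f) (Cod C f)"
      "ho_class C W (Cod C f) Y p \<in> hom (ho_cat C W) (Cod C f) Y"
      using f Fwd by (auto simp: ho_hom_iff ho_arr_def)
    ultimately show ?case using G.FA_Comp GA[OF Fwd(1)] Fwd(3) by simp
  next
    case (Bwd w p Y)
    note b = zz_path_Bwd[OF Bwd(1)]
    have "ho_class C W (Cod C w) Y (Bwd w # p)
        = ho_class C W (Dom C w) Y p \<cdot>\<^bsub>ho_cat C W\<^esub> ho_class C W (Cod C w) (Dom C w) [Bwd w]"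
      using ho_comp_class[OF b Bwd(2)] by (simp add: ho_cat_def)
    moreover have "ho_class C W (Cod C w) (Dom C w) [Bwd w] \<in> hom (ho_cat C W) (Cod C w) (Dom C w)"
      "ho_class C W (Dom C w) Y p \<in> hom (ho_cat C W) (Dom C w) Y"
      using b Bwd by (auto simp: ho_hom_iff)
    ultimately show ?case using G.FA_Comp inv[OF Bwd(1)] Bwd(3) by simp
  qed
  then show ?thesis using assms(4) ho_lift_class by (auto simp: ho_cat_def)
qed

end


section \<open>Closed symmetric monoidal categories\<close>

text \<open>The internal hom is given on objects together with its evaluation maps, from which its
  action on arrows is derived.\<close>

record ('o, 'a) csm = "('o, 'a) cat" +
  tens :: "'o \<Rightarrow> 'o \<Rightarrow> 'o" (infixr "\<otimes>\<index>" 75)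
  tens_arr :: "'a \<Rightarrow> 'a \<Rightarrow> 'a" (infixr "\<otimes>\<^sub>1\<index>" 75)
  unit_obj :: 'o
  assoc :: "'o \<Rightarrow> 'o \<Rightarrow> 'o \<Rightarrow> 'a"
  lunit :: "'o \<Rightarrow> 'a"
  runit :: "'o \<Rightarrow> 'a"
  symm :: "'o \<Rightarrow> 'o \<Rightarrow> 'a"
  ihom :: "'o \<Rightarrow> 'o \<Rightarrow> 'o"
  ev :: "'o \<Rightarrow> 'o \<Rightarrow> 'a"

definition tens_ftor :: "('o, 'a, 'z) csm_scheme \<Rightarrow> ('o \<times> 'o, 'a \<times> 'a, 'o, 'a) ftor" where
  "tens_ftor V = \<lparr>FO = (\<lambda>(X, Y). X \<otimes>\<^bsub>V\<^esub> Y), FA = (\<lambda>(f, g). f \<otimes>\<^sub>1\<^bsub>V\<^esub> g)\<rparr>"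

locale closed_symmetric_monoidal_category = category V
  for V :: "('o, 'a, 'z) csm_scheme" (structure) +
  assumes tens_functor: "cat_functor (prod_cat V V) V (tens_ftor V)"
    and unit_in_Obj: "unit_obj V \<in> Obj V"
    and assoc_in_hom: "X \<in> Obj V \<Longrightarrow> Y \<in> Obj V \<Longrightarrow> Z \<in> Obj V
          \<Longrightarrow> assoc V X Y Z \<in> hom V ((X \<otimes> Y) \<otimes> Z) (X \<otimes> (Y \<otimes> Z))"
    and assoc_iso: "X \<in> Obj V \<Longrightarrow> Y \<in> Obj V \<Longrightarrow> Z \<in> Obj V \<Longrightarrow> iso V (assoc V X Y Z)"
    and assoc_natural: "f \<in> hom V X X' \<Longrightarrow> g \<in> hom V Y Y' \<Longrightarrow> h \<in> hom V Z Z'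
          \<Longrightarrow> assoc V X' Y' Z' \<cdot> ((f \<otimes>\<^sub>1 g) \<otimes>\<^sub>1 h) = (f \<otimes>\<^sub>1 (g \<otimes>\<^sub>1 h)) \<cdot> assoc V X Y Z"
    and lunit_in_hom: "X \<in> Obj V \<Longrightarrow> lunit V X \<in> hom V (unit_obj V \<otimes> X) X"
    and lunit_iso: "X \<in> Obj V \<Longrightarrow> iso V (lunit V X)"
    and lunit_natural: "f \<in> hom V X Y
          \<Longrightarrow> lunit V Y \<cdot> (Ide V (unit_obj V) \<otimes>\<^sub>1 f) = f \<cdot> lunit V X"
    and runit_in_hom: "X \<in> Obj V \<Longrightarrow> runit V X \<in> hom V (X \<otimes> unit_obj V) X"
    and runit_iso: "X \<in> Obj V \<Longrightarrow> iso V (runit V X)"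
    and runit_natural: "f \<in> hom V X Y
          \<Longrightarrow> runit V Y \<cdot> (f \<otimes>\<^sub>1 Ide V (unit_obj V)) = f \<cdot> runit V X"
    and pentagon: "W \<in> Obj V \<Longrightarrow> X \<in> Obj V \<Longrightarrow> Y \<in> Obj V \<Longrightarrow> Z \<in> Obj V
          \<Longrightarrow> (Ide V W \<otimes>\<^sub>1 assoc V X Y Z) \<cdot> assoc V W (X \<otimes> Y) Z \<cdot> (assoc V W X Y \<otimes>\<^sub>1 Ide V Z)
              = assoc V W X (Y \<otimes> Z) \<cdot> assoc V (W \<otimes> X) Y Z"
    and triangle: "X \<in> Obj V \<Longrightarrow> Y \<in> Obj V
          \<Longrightarrow> (Ide V X \<otimes>\<^sub>1 lunit V Y) \<cdot> assoc V X (unit_obj V) Y = runit V X \<otimes>\<^sub>1 Ide V Y"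
    and symm_in_hom: "X \<in> Obj V \<Longrightarrow> Y \<in> Obj V \<Longrightarrow> symm V X Y \<in> hom V (X \<otimes> Y) (Y \<otimes> X)"
    and symm_natural: "f \<in> hom V X X' \<Longrightarrow> g \<in> hom V Y Y'
          \<Longrightarrow> symm V X' Y' \<cdot> (f \<otimes>\<^sub>1 g) = (g \<otimes>\<^sub>1 f) \<cdot> symm V X Y"
    and symm_symm: "X \<in> Obj V \<Longrightarrow> Y \<in> Obj V \<Longrightarrow> symm V Y X \<cdot> symm V X Y = Ide V (X \<otimes> Y)"
    and hexagon: "X \<in> Obj V \<Longrightarrow> Y \<in> Obj V \<Longrightarrow> Z \<in> Obj V
          \<Longrightarrow> assoc V Y Z X \<cdot> symm V X (Y \<otimes> Z) \<cdot> assoc V X Y Z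
              = (Ide V Y \<otimes>\<^sub>1 symm V X Z) \<cdot> assoc V Y X Z \<cdot> (symm V X Y \<otimes>\<^sub>1 Ide V Z)"
    and ihom_in_Obj: "Y \<in> Obj V \<Longrightarrow> Z \<in> Obj V \<Longrightarrow> ihom V Y Z \<in> Obj V"
    and ev_in_hom: "Y \<in> Obj V \<Longrightarrow> Z \<in> Obj V \<Longrightarrow> ev V Y Z \<in> hom V (ihom V Y Z \<otimes> Y) Z"
    and ev_universal: "X \<in> Obj V \<Longrightarrow> Y \<in> Obj V \<Longrightarrow> Z \<in> Obj V \<Longrightarrow> f \<in> hom V (X \<otimes> Y) Z
          \<Longrightarrow> \<exists>!g. g \<in> hom V X (ihom V Y Z) \<and> ev V Y Z \<cdot> (g \<otimes>\<^sub>1 Ide V Y) = f"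

definition curry :: "('o, 'a, 'z) csm_scheme \<Rightarrow> 'o \<Rightarrow> 'o \<Rightarrow> 'o \<Rightarrow> 'a \<Rightarrow> 'a" where
  "curry V X Y Z f =
     (THE g. g \<in> hom V X (ihom V Y Z) \<and> ev V Y Z \<cdot>\<^bsub>V\<^esub> (g \<otimes>\<^sub>1\<^bsub>V\<^esub> Ide V Y) = f)"

text \<open>For \<open>f : X' \<rightarrow> X\<close> and \<open>g : Y \<rightarrow> Y'\<close>, the map \<open>[f, g] : [X, Y] \<rightarrow> [X', Y']\<close>.\<close>

definition ihom_arr :: "('o, 'a, 'z) csm_scheme \<Rightarrow> 'a \<Rightarrow> 'a \<Rightarrow> 'a" where
  "ihom_arr V f g =
     curry V (ihom V (Cod V f) (Dom V g)) (Dom V f) (Cod V g)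
       (g \<cdot>\<^bsub>V\<^esub> ev V (Cod V f) (Dom V g) \<cdot>\<^bsub>V\<^esub> (Ide V (ihom V (Cod V f) (Dom V g)) \<otimes>\<^sub>1\<^bsub>V\<^esub> f))"


section \<open>Closed symmetric monoidal homotopical categories\<close>

record ('o, 'a) hcsm = "('o, 'a) csm" +
  Weq :: "'a set"
  VQ :: "'o set"
  VR :: "'o set"
  Qf :: "('o, 'a, 'o, 'a) ftor"
  qt :: "'o \<Rightarrow> 'a"
  Rf :: "('o, 'a, 'o, 'a) ftor"
  rt :: "'o \<Rightarrow> 'a"

locale closed_symmetric_monoidal_homotopical_category =
  closed_symmetric_monoidal_category V + homotopical_category V "Weq V"
  for I :: "'i itself" and V :: "('o, 'a, 'z) hcsm_scheme" (structure) +
  assumes bicomplete: "bicomplete I V"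
    and VQ_Obj: "VQ V \<subseteq> Obj V"
    and VR_Obj: "VR V \<subseteq> Obj V"
    and Q_deformation: "left_deformation V (Weq V) (Qf V) (qt V)"
    and Q_in_VQ: "X \<in> Obj V \<Longrightarrow> FO (Qf V) X \<in> VQ V"
    and R_deformation: "right_deformation V (Weq V) (Rf V) (rt V)"
    and R_in_VR: "X \<in> Obj V \<Longrightarrow> FO (Rf V) X \<in> VR V"
    and tens_homotopical: "f \<in> weq_on V (Weq V) (VQ V) \<Longrightarrow> g \<in> weq_on V (Weq V) (VQ V)
          \<Longrightarrow> f \<otimes>\<^sub>1 g \<in> Weq V"
    and tens_in_VQ: "X \<in> VQ V \<Longrightarrow> Y \<in> VQ V \<Longrightarrow> X \<otimes> Y \<in> VQ V"
    and ihom_homotopical: "f \<in> weq_on V (Weq V) (VQ V) \<Longrightarrow> g \<in> weq_on V (Weq V) (VR V)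
          \<Longrightarrow> ihom_arr V f g \<in> Weq V"
    and ihom_in_VR: "X \<in> VQ V \<Longrightarrow> Y \<in> VR V \<Longrightarrow> ihom V X Y \<in> VR V"
    and lunit_weq: "X \<in> VQ V \<Longrightarrow> lunit V X \<cdot> (qt V (unit_obj V) \<otimes>\<^sub>1 Ide V X) \<in> Weq V"
    and runit_weq: "X \<in> VQ V \<Longrightarrow> runit V X \<cdot> (Ide V X \<otimes>\<^sub>1 qt V (unit_obj V)) \<in> Weq V"
    and ihom_unit_weq: "Y \<in> VR V \<Longrightarrow>
          ihom_arr V (qt V (unit_obj V)) (Ide V Y) \<cdot> curry V Y (unit_obj V) Y (runit V Y) \<in> Weq V"

text \<open>The derived closed symmetric monoidal structure on the homotopy category, with
  \<open>X \<otimes> Y = QX \<otimes> QY\<close> and \<open>[X, Y] = [QX, RY]\<close>. The tensor product of arrows is the functor induced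
  in each variable separately; the structure maps are the composites
  \<^item> associativity: \<open>Q(QX \<otimes> QY) \<otimes> QZ \<rightarrow> (QX \<otimes> QY) \<otimes> QZ \<cong> QX \<otimes> (QY \<otimes> QZ) \<leftarrow> QX \<otimes> Q(QY \<otimes> QZ)\<close>,
  \<^item> units: \<open>QE \<otimes> QX \<rightarrow> E \<otimes> QX \<cong> QX \<rightarrow> X\<close> and \<open>QX \<otimes> QE \<rightarrow> QX \<otimes> E \<cong> QX \<rightarrow> X\<close>,
  \<^item> evaluation: \<open>Q[QX, RY] \<otimes> QX \<rightarrow> [QX, RY] \<otimes> QX \<rightarrow> RY \<leftarrow> Y\<close>.\<close>

abbreviation V_ho_cat :: "('o, 'a, 'z) hcsm_scheme \<Rightarrow> ('o, ('o, 'a) ho_arr) cat" where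
  "V_ho_cat V \<equiv> ho_cat V (Weq V)"

abbreviation V_ho_arr :: "('o, 'a, 'z) hcsm_scheme \<Rightarrow> 'a \<Rightarrow> ('o, 'a) ho_arr" where
  "V_ho_arr V \<equiv> ho_arr V (Weq V)"

definition derived_tens_left :: "('o, 'a, 'z) hcsm_scheme \<Rightarrow> 'o \<Rightarrow> ('o, 'a, 'o, ('o, 'a) ho_arr) ftor"
  where "derived_tens_left V Y =
    \<lparr>FO = (\<lambda>X. FO (Qf V) X \<otimes>\<^bsub>V\<^esub> FO (Qf V) Y),
     FA = (\<lambda>f. V_ho_arr V (FA (Qf V) f \<otimes>\<^sub>1\<^bsub>V\<^esub> Ide V (FO (Qf V) Y)))\<rparr>"

definition derived_tens_right :: "('o, 'a, 'z) hcsm_scheme \<Rightarrow> 'o \<Rightarrow> ('o, 'a, 'o, ('o, 'a) ho_arr) ftor"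
  where "derived_tens_right V X =
    \<lparr>FO = (\<lambda>Y. FO (Qf V) X \<otimes>\<^bsub>V\<^esub> FO (Qf V) Y),
     FA = (\<lambda>g. V_ho_arr V (Ide V (FO (Qf V) X) \<otimes>\<^sub>1\<^bsub>V\<^esub> FA (Qf V) g))\<rparr>"

definition derived_tens_arr :: "('o, 'a, 'z) hcsm_scheme
    \<Rightarrow> ('o, 'a) ho_arr \<Rightarrow> ('o, 'a) ho_arr \<Rightarrow> ('o, 'a) ho_arr" where
  "derived_tens_arr V f g =
     FA (ho_lift V (V_ho_cat V) (derived_tens_left V (Cod (V_ho_cat V) g))) f
       \<cdot>\<^bsub>V_ho_cat V\<^esub> FA (ho_lift V (V_ho_cat V) (derived_tens_right V (Dom (V_ho_cat V) f))) g"

definition derived_assoc :: "('o, 'a, 'z) hcsm_scheme \<Rightarrow> 'o \<Rightarrow> 'o \<Rightarrow> 'o \<Rightarrow> ('o, 'a) ho_arr" where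
  "derived_assoc V X Y Z = (let X' = FO (Qf V) X; Y' = FO (Qf V) Y; Z' = FO (Qf V) Z in
     inv_arr (V_ho_cat V) (V_ho_arr V (Ide V X' \<otimes>\<^sub>1\<^bsub>V\<^esub> qt V (Y' \<otimes>\<^bsub>V\<^esub> Z')))
       \<cdot>\<^bsub>V_ho_cat V\<^esub> V_ho_arr V (assoc V X' Y' Z' \<cdot>\<^bsub>V\<^esub> (qt V (X' \<otimes>\<^bsub>V\<^esub> Y') \<otimes>\<^sub>1\<^bsub>V\<^esub> Ide V Z')))"

definition derived_lunit :: "('o, 'a, 'z) hcsm_scheme \<Rightarrow> 'o \<Rightarrow> ('o, 'a) ho_arr" where
  "derived_lunit V X = (let X' = FO (Qf V) X in
     V_ho_arr V (qt V X \<cdot>\<^bsub>V\<^esub> lunit V X' \<cdot>\<^bsub>V\<^esub> (qt V (unit_obj V) \<otimes>\<^sub>1\<^bsub>V\<^esub> Ide V X')))"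

definition derived_runit :: "('o, 'a, 'z) hcsm_scheme \<Rightarrow> 'o \<Rightarrow> ('o, 'a) ho_arr" where
  "derived_runit V X = (let X' = FO (Qf V) X in
     V_ho_arr V (qt V X \<cdot>\<^bsub>V\<^esub> runit V X' \<cdot>\<^bsub>V\<^esub> (Ide V X' \<otimes>\<^sub>1\<^bsub>V\<^esub> qt V (unit_obj V))))"

definition derived_symm :: "('o, 'a, 'z) hcsm_scheme \<Rightarrow> 'o \<Rightarrow> 'o \<Rightarrow> ('o, 'a) ho_arr" where
  "derived_symm V X Y = V_ho_arr V (symm V (FO (Qf V) X) (FO (Qf V) Y))"

definition derived_ihom :: "('o, 'a, 'z) hcsm_scheme \<Rightarrow> 'o \<Rightarrow> 'o \<Rightarrow> 'o" where
  "derived_ihom V X Y = ihom V (FO (Qf V) X) (FO (Rf V) Y)"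

definition derived_ev :: "('o, 'a, 'z) hcsm_scheme \<Rightarrow> 'o \<Rightarrow> 'o \<Rightarrow> ('o, 'a) ho_arr" where
  "derived_ev V X Y = (let X' = FO (Qf V) X; Y' = FO (Rf V) Y in
     inv_arr (V_ho_cat V) (V_ho_arr V (rt V Y))
       \<cdot>\<^bsub>V_ho_cat V\<^esub> V_ho_arr V (ev V X' Y' \<cdot>\<^bsub>V\<^esub> (qt V (ihom V X' Y') \<otimes>\<^sub>1\<^bsub>V\<^esub> Ide V X')))"

definition Ho :: "('o, 'a, 'z) hcsm_scheme \<Rightarrow> ('o, ('o, 'a) ho_arr) csm" where
  "Ho V = cat.extend (V_ho_cat V)
     (csm.fields (\<lambda>X Y. FO (Qf V) X \<otimes>\<^bsub>V\<^esub> FO (Qf V) Y) (derived_tens_arr V) (unit_obj V)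
        (derived_assoc V) (derived_lunit V) (derived_runit V) (derived_symm V)
        (derived_ihom V) (derived_ev V))"


section \<open>Enriched categories\<close>

text \<open>\<open>vcomp M X Y Z : M(Y, Z) \<otimes> M(X, Y) \<rightarrow> M(X, Z)\<close>.\<close>

record ('m, 'o, 'a) vcat =
  VObj :: "'m set"
  VHom :: "'m \<Rightarrow> 'm \<Rightarrow> 'o"
  vcomp :: "'m \<Rightarrow> 'm \<Rightarrow> 'm \<Rightarrow> 'a"
  vid :: "'m \<Rightarrow> 'a"

locale enriched_category = closed_symmetric_monoidal_category V
  for V :: "('o, 'a, 'z) csm_scheme" (structure) +
  fixes M :: "('m, 'o, 'a, 'y) vcat_scheme"
  assumes VHom_in_Obj: "X \<in> VObj M \<Longrightarrow> Y \<in> VObj M \<Longrightarrow> VHom M X Y \<in> Obj V"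
    and vcomp_in_hom: "X \<in> VObj M \<Longrightarrow> Y \<in> VObj M \<Longrightarrow> Z \<in> VObj M
          \<Longrightarrow> vcomp M X Y Z \<in> hom V (VHom M Y Z \<otimes> VHom M X Y) (VHom M X Z)"
    and vid_in_hom: "X \<in> VObj M \<Longrightarrow> vid M X \<in> hom V (unit_obj V) (VHom M X X)"
    and vcomp_assoc: "W \<in> VObj M \<Longrightarrow> X \<in> VObj M \<Longrightarrow> Y \<in> VObj M \<Longrightarrow> Z \<in> VObj M
          \<Longrightarrow> vcomp M W Y Z \<cdot> (Ide V (VHom M Y Z) \<otimes>\<^sub>1 vcomp M W X Y)
                \<cdot> assoc V (VHom M Y Z) (VHom M X Y) (VHom M W X)
              = vcomp M W X Z \<cdot> (vcomp M X Y Z \<otimes>\<^sub>1 Ide V (VHom M W X))"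
    and vcomp_vid_left: "X \<in> VObj M \<Longrightarrow> Y \<in> VObj M
          \<Longrightarrow> vcomp M X Y Y \<cdot> (vid M Y \<otimes>\<^sub>1 Ide V (VHom M X Y)) = lunit V (VHom M X Y)"
    and vcomp_vid_right: "X \<in> VObj M \<Longrightarrow> Y \<in> VObj M
          \<Longrightarrow> vcomp M X X Y \<cdot> (Ide V (VHom M X Y) \<otimes>\<^sub>1 vid M X) = runit V (VHom M X Y)"

text \<open>An arrow \<open>X \<rightarrow> Y\<close> of the underlying category is an arrow \<open>f : E \<rightarrow> M(X, Y)\<close> of the base. It is
  stored as \<open>(X, Y, f)\<close>, since \<open>f\<close> alone need not determine \<open>X\<close> and \<open>Y\<close>.\<close>

type_synonym ('m, 'a) und_arr = "'m \<times> 'm \<times> 'a"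

definition underlying :: "('o, 'a, 'z) csm_scheme \<Rightarrow> ('m, 'o, 'a, 'y) vcat_scheme
    \<Rightarrow> ('m, ('m, 'a) und_arr) cat" where
  "underlying V M = \<lparr>Obj = VObj M,
     Arr = {(X, Y, f). X \<in> VObj M \<and> Y \<in> VObj M \<and> f \<in> hom V (unit_obj V) (VHom M X Y)},
     Dom = fst, Cod = fst \<circ> snd, Ide = (\<lambda>X. (X, X, vid M X)),
     Comp = (\<lambda>(Y, Z, g) (X, _, f).
       (X, Z, vcomp M X Y Z \<cdot>\<^bsub>V\<^esub> (g \<otimes>\<^sub>1\<^bsub>V\<^esub> f) \<cdot>\<^bsub>V\<^esub> inv_arr V (lunit V (unit_obj V))))\<rparr>"

text \<open>For \<open>f : X' \<rightarrow> X\<close> and \<open>g : Y \<rightarrow> Y'\<close> in the underlying category, the maps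
  \<open>M(f, Y) : M(X, Y) \<rightarrow> M(X', Y)\<close>, \<open>M(X, g) : M(X, Y) \<rightarrow> M(X, Y')\<close> and
  \<open>M(f, g) : M(X, Y) \<rightarrow> M(X', Y')\<close>.\<close>

definition vhom_pre :: "('o, 'a, 'z) csm_scheme \<Rightarrow> ('m, 'o, 'a, 'y) vcat_scheme
    \<Rightarrow> ('m, 'a) und_arr \<Rightarrow> 'm \<Rightarrow> 'a" where
  "vhom_pre V M = (\<lambda>(X', X, f) Y.
     vcomp M X' X Y \<cdot>\<^bsub>V\<^esub> (Ide V (VHom M X Y) \<otimes>\<^sub>1\<^bsub>V\<^esub> f) \<cdot>\<^bsub>V\<^esub> inv_arr V (runit V (VHom M X Y)))"

definition vhom_post :: "('o, 'a, 'z) csm_scheme \<Rightarrow> ('m, 'o, 'a, 'y) vcat_scheme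
    \<Rightarrow> 'm \<Rightarrow> ('m, 'a) und_arr \<Rightarrow> 'a" where
  "vhom_post V M X = (\<lambda>(Y, Y', g).
     vcomp M X Y Y' \<cdot>\<^bsub>V\<^esub> (g \<otimes>\<^sub>1\<^bsub>V\<^esub> Ide V (VHom M X Y)) \<cdot>\<^bsub>V\<^esub> inv_arr V (lunit V (VHom M X Y)))"

definition vhom_arr :: "('o, 'a, 'z) csm_scheme \<Rightarrow> ('m, 'o, 'a, 'y) vcat_scheme
    \<Rightarrow> ('m, 'a) und_arr \<Rightarrow> ('m, 'a) und_arr \<Rightarrow> 'a" where
  "vhom_arr V M f g = vhom_post V M (fst f) g \<cdot>\<^bsub>V\<^esub> vhom_pre V M f (fst g)"


section \<open>Tensors and cotensors\<close>

text \<open>\<open>ten_iso M K X Y : M(K \<odot> X, Y) \<cong> [K, M(X, Y)]\<close> and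
  \<open>cot_iso M K X Y : M(X, {K, Y}) \<cong> [K, M(X, Y)]\<close>.\<close>

record ('m, 'o, 'a) tcvcat = "('m, 'o, 'a) vcat" +
  ten :: "'o \<Rightarrow> 'm \<Rightarrow> 'm"
  ten_iso :: "'o \<Rightarrow> 'm \<Rightarrow> 'm \<Rightarrow> 'a"
  cot :: "'o \<Rightarrow> 'm \<Rightarrow> 'm"
  cot_iso :: "'o \<Rightarrow> 'm \<Rightarrow> 'm \<Rightarrow> 'a"

text \<open>The action of the enriched functor \<open>[K, M(X, -)]\<close> on hom-objects, transposed to a map
  \<open>M(Y, Z) \<otimes> [K, M(X, Y)] \<rightarrow> [K, M(X, Z)]\<close>.\<close>

definition cov_act :: "('o, 'a, 'z) csm_scheme \<Rightarrow> ('m, 'o, 'a, 'y) vcat_scheme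
    \<Rightarrow> 'o \<Rightarrow> 'm \<Rightarrow> 'm \<Rightarrow> 'm \<Rightarrow> 'a" where
  "cov_act V M K X Y Z =
     curry V (VHom M Y Z \<otimes>\<^bsub>V\<^esub> ihom V K (VHom M X Y)) K (VHom M X Z)
       (vcomp M X Y Z \<cdot>\<^bsub>V\<^esub> (Ide V (VHom M Y Z) \<otimes>\<^sub>1\<^bsub>V\<^esub> ev V K (VHom M X Y))
          \<cdot>\<^bsub>V\<^esub> assoc V (VHom M Y Z) (ihom V K (VHom M X Y)) K)"

text \<open>The action of the contravariant enriched functor \<open>[K, M(-, Z)]\<close>, transposed to a map
  \<open>[K, M(Y, Z)] \<otimes> M(X, Y) \<rightarrow> [K, M(X, Z)]\<close>.\<close>

definition contra_act :: "('o, 'a, 'z) csm_scheme \<Rightarrow> ('m, 'o, 'a, 'y) vcat_scheme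
    \<Rightarrow> 'o \<Rightarrow> 'm \<Rightarrow> 'm \<Rightarrow> 'm \<Rightarrow> 'a" where
  "contra_act V M K X Y Z = (let H = ihom V K (VHom M Y Z); N = VHom M X Y in
     curry V (H \<otimes>\<^bsub>V\<^esub> N) K (VHom M X Z)
       (vcomp M X Y Z \<cdot>\<^bsub>V\<^esub> (ev V K (VHom M Y Z) \<otimes>\<^sub>1\<^bsub>V\<^esub> Ide V N)
          \<cdot>\<^bsub>V\<^esub> inv_arr V (assoc V H K N) \<cdot>\<^bsub>V\<^esub> (Ide V H \<otimes>\<^sub>1\<^bsub>V\<^esub> symm V N K) \<cdot>\<^bsub>V\<^esub> assoc V H N K))"

text \<open>The assumptions \<open>ten_natural\<close> and \<open>cot_natural\<close> are enriched naturality in \<open>Y\<close> and in \<open>X\<close>,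
  respectively. Functoriality of \<open>K \<odot> X\<close> and \<open>{K, Y}\<close> in both variables follows by
  representability, see \<open>ten_arr\<close> and \<open>cot_arr\<close> below.\<close>

locale tensored_cotensored_category = enriched_category V M
  for V :: "('o, 'a, 'z) csm_scheme" (structure) and M :: "('m, 'o, 'a, 'y) tcvcat_scheme" +
  assumes ten_in_VObj: "K \<in> Obj V \<Longrightarrow> X \<in> VObj M \<Longrightarrow> ten M K X \<in> VObj M"
    and ten_iso_in_hom: "K \<in> Obj V \<Longrightarrow> X \<in> VObj M \<Longrightarrow> Y \<in> VObj M
          \<Longrightarrow> ten_iso M K X Y \<in> hom V (VHom M (ten M K X) Y) (ihom V K (VHom M X Y))"
    and ten_iso_iso: "K \<in> Obj V \<Longrightarrow> X \<in> VObj M \<Longrightarrow> Y \<in> VObj M \<Longrightarrow> iso V (ten_iso M K X Y)"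
    and ten_natural: "K \<in> Obj V \<Longrightarrow> X \<in> VObj M \<Longrightarrow> Y \<in> VObj M \<Longrightarrow> Z \<in> VObj M
          \<Longrightarrow> ten_iso M K X Z \<cdot> vcomp M (ten M K X) Y Z
              = cov_act V M K X Y Z \<cdot> (Ide V (VHom M Y Z) \<otimes>\<^sub>1 ten_iso M K X Y)"
    and cot_in_VObj: "K \<in> Obj V \<Longrightarrow> Y \<in> VObj M \<Longrightarrow> cot M K Y \<in> VObj M"
    and cot_iso_in_hom: "K \<in> Obj V \<Longrightarrow> X \<in> VObj M \<Longrightarrow> Y \<in> VObj M
          \<Longrightarrow> cot_iso M K X Y \<in> hom V (VHom M X (cot M K Y)) (ihom V K (VHom M X Y))"
    and cot_iso_iso: "K \<in> Obj V \<Longrightarrow> X \<in> VObj M \<Longrightarrow> Y \<in> VObj M \<Longrightarrow> iso V (cot_iso M K X Y)"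
    and cot_natural: "K \<in> Obj V \<Longrightarrow> X \<in> VObj M \<Longrightarrow> Y \<in> VObj M \<Longrightarrow> Z \<in> VObj M
          \<Longrightarrow> cot_iso M K X Z \<cdot> vcomp M X Y (cot M K Z)
              = contra_act V M K X Y Z \<cdot> (cot_iso M K Y Z \<otimes>\<^sub>1 Ide V (VHom M X Y))"

text \<open>The arrows \<open>K \<odot> X \<rightarrow> Y\<close> and \<open>X \<rightarrow> {K, Y}\<close> of the underlying category that correspond to
  \<open>h : K \<rightarrow> M(X, Y)\<close>, and conversely the universal maps \<open>K \<rightarrow> M(X, K \<odot> X)\<close> and
  \<open>K \<rightarrow> M({K, Y}, Y)\<close> that correspond to identities.\<close>

definition name :: "('o, 'a, 'z) csm_scheme \<Rightarrow> 'o \<Rightarrow> 'o \<Rightarrow> 'a \<Rightarrow> 'a" where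
  "name V K L h = curry V (unit_obj V) K L (h \<cdot>\<^bsub>V\<^esub> lunit V K)"

definition unname :: "('o, 'a, 'z) csm_scheme \<Rightarrow> 'o \<Rightarrow> 'o \<Rightarrow> 'a \<Rightarrow> 'a" where
  "unname V K L e = ev V K L \<cdot>\<^bsub>V\<^esub> (e \<otimes>\<^sub>1\<^bsub>V\<^esub> Ide V K) \<cdot>\<^bsub>V\<^esub> inv_arr V (lunit V K)"

definition ten_transpose :: "('o, 'a, 'z) csm_scheme \<Rightarrow> ('m, 'o, 'a, 'y) tcvcat_scheme
    \<Rightarrow> 'o \<Rightarrow> 'm \<Rightarrow> 'm \<Rightarrow> 'a \<Rightarrow> ('m, 'a) und_arr" where
  "ten_transpose V M K X Y h =
     (ten M K X, Y, inv_arr V (ten_iso M K X Y) \<cdot>\<^bsub>V\<^esub> name V K (VHom M X Y) h)"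

definition ten_univ :: "('o, 'a, 'z) csm_scheme \<Rightarrow> ('m, 'o, 'a, 'y) tcvcat_scheme
    \<Rightarrow> 'o \<Rightarrow> 'm \<Rightarrow> 'a" where
  "ten_univ V M K X =
     unname V K (VHom M X (ten M K X)) (ten_iso M K X (ten M K X) \<cdot>\<^bsub>V\<^esub> vid M (ten M K X))"

definition cot_transpose :: "('o, 'a, 'z) csm_scheme \<Rightarrow> ('m, 'o, 'a, 'y) tcvcat_scheme
    \<Rightarrow> 'o \<Rightarrow> 'm \<Rightarrow> 'm \<Rightarrow> 'a \<Rightarrow> ('m, 'a) und_arr" where
  "cot_transpose V M K X Y h =
     (X, cot M K Y, inv_arr V (cot_iso M K X Y) \<cdot>\<^bsub>V\<^esub> name V K (VHom M X Y) h)"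

definition cot_univ :: "('o, 'a, 'z) csm_scheme \<Rightarrow> ('m, 'o, 'a, 'y) tcvcat_scheme
    \<Rightarrow> 'o \<Rightarrow> 'm \<Rightarrow> 'a" where
  "cot_univ V M K Y =
     unname V K (VHom M (cot M K Y) Y) (cot_iso M K (cot M K Y) Y \<cdot>\<^bsub>V\<^esub> vid M (cot M K Y))"

text \<open>For \<open>k : K \<rightarrow> K'\<close> in the base and \<open>f : X \<rightarrow> X'\<close> in the underlying category,
  \<open>k \<odot> f : K \<odot> X \<rightarrow> K' \<odot> X'\<close> is the transpose of
  \<open>K \<rightarrow> K' \<rightarrow> M(X', K' \<odot> X') \<rightarrow> M(X, K' \<odot> X')\<close>. For \<open>g : Y \<rightarrow> Y'\<close>,
  \<open>{k, g} : {K', Y} \<rightarrow> {K, Y'}\<close> is the transpose of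
  \<open>K \<rightarrow> K' \<rightarrow> M({K', Y}, Y) \<rightarrow> M({K', Y}, Y')\<close>.\<close>

definition ten_arr :: "('o, 'a, 'z) csm_scheme \<Rightarrow> ('m, 'o, 'a, 'y) tcvcat_scheme
    \<Rightarrow> 'a \<Rightarrow> ('m, 'a) und_arr \<Rightarrow> ('m, 'a) und_arr" where
  "ten_arr V M k f = (case f of (X, X', _) \<Rightarrow>
     ten_transpose V M (Dom V k) X (ten M (Cod V k) X')
       (vhom_pre V M f (ten M (Cod V k) X') \<cdot>\<^bsub>V\<^esub> ten_univ V M (Cod V k) X' \<cdot>\<^bsub>V\<^esub> k))"

definition cot_arr :: "('o, 'a, 'z) csm_scheme \<Rightarrow> ('m, 'o, 'a, 'y) tcvcat_scheme
    \<Rightarrow> 'a \<Rightarrow> ('m, 'a) und_arr \<Rightarrow> ('m, 'a) und_arr" where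
  "cot_arr V M k g = (case g of (Y, Y', _) \<Rightarrow>
     cot_transpose V M (Dom V k) (cot M (Cod V k) Y) Y'
       (vhom_post V M (cot M (Cod V k) Y) g \<cdot>\<^bsub>V\<^esub> cot_univ V M (Cod V k) Y \<cdot>\<^bsub>V\<^esub> k))"

text \<open>The canonical isomorphisms \<open>E \<odot> X \<cong> X\<close> and \<open>Y \<cong> {E, Y}\<close>.\<close>

definition ten_unit :: "('o, 'a, 'z) csm_scheme \<Rightarrow> ('m, 'o, 'a, 'y) tcvcat_scheme
    \<Rightarrow> 'm \<Rightarrow> ('m, 'a) und_arr" where
  "ten_unit V M X = ten_transpose V M (unit_obj V) X X (vid M X)"

definition cot_unit :: "('o, 'a, 'z) csm_scheme \<Rightarrow> ('m, 'o, 'a, 'y) tcvcat_scheme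
    \<Rightarrow> 'm \<Rightarrow> ('m, 'a) und_arr" where
  "cot_unit V M Y = cot_transpose V M (unit_obj V) Y Y (vid M Y)"


section \<open>Enriched homotopical categories\<close>

record ('m, 'o, 'a) hvcat = "('m, 'o, 'a) tcvcat" +
  MWeq :: "('m, 'a) und_arr set"
  MQ :: "'m set"
  MR :: "'m set"

locale enriched_homotopical_category = tensored_cotensored_category V M
  for V :: "('o, 'a, 'z) hcsm_scheme" (structure) and M :: "('m, 'o, 'a, 'y) hvcat_scheme" +
  assumes M0_homotopical: "homotopical_category (underlying V M) (MWeq M)"
    and MQ_retract: "left_deformation_retract (underlying V M) (MWeq M) (MQ M)"
    and MR_retract: "right_deformation_retract (underlying V M) (MWeq M) (MR M)"
    and ten_homotopical: "k \<in> weq_on V (Weq V) (VQ V)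
          \<Longrightarrow> f \<in> weq_on (underlying V M) (MWeq M) (MQ M) \<Longrightarrow> ten_arr V M k f \<in> MWeq M"
    and ten_in_MQ: "K \<in> VQ V \<Longrightarrow> X \<in> MQ M \<Longrightarrow> ten M K X \<in> MQ M"
    and cot_homotopical: "k \<in> weq_on V (Weq V) (VQ V)
          \<Longrightarrow> g \<in> weq_on (underlying V M) (MWeq M) (MR M) \<Longrightarrow> cot_arr V M k g \<in> MWeq M"
    and cot_in_MR: "K \<in> VQ V \<Longrightarrow> Y \<in> MR M \<Longrightarrow> cot M K Y \<in> MR M"
    and vhom_homotopical: "f \<in> weq_on (underlying V M) (MWeq M) (MQ M)
          \<Longrightarrow> g \<in> weq_on (underlying V M) (MWeq M) (MR M) \<Longrightarrow> vhom_arr V M f g \<in> Weq V"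
    and ten_unit_weq: "X \<in> MQ M \<Longrightarrow>
          ten_unit V M X \<cdot>\<^bsub>underlying V M\<^esub> ten_arr V M (qt V (unit_obj V)) (Ide (underlying V M) X)
            \<in> MWeq M"
    and cot_unit_weq: "Y \<in> MR M \<Longrightarrow>
          cot_arr V M (qt V (unit_obj V)) (Ide (underlying V M) Y) \<cdot>\<^bsub>underlying V M\<^esub> cot_unit V M Y
            \<in> MWeq M"

end

theory Submission
  imports Defs
begin

text \<open>
  A tensored and cotensored \<open>V\<close>-category amounts to a closed module over the monoidal category \<open>V\<close>: an
  action \<open>K \<odot> X\<close> with coherent constraints \<open>(K \<otimes> L) \<odot> X \<cong> K \<odot> (L \<odot> X)\<close> and \<open>E \<odot> X \<cong> X\<close>, such that
  every \<open>- \<odot> X\<close> has a right adjoint \<open>M(X, -)\<close> and every \<open>K \<odot> -\<close> has a right adjoint \<open>{K, -}\<close>.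
  Composition is then the transpose of \<open>M(Y, Z) \<odot> (M(X, Y) \<odot> X) \<rightarrow> M(Y, Z) \<odot> Y \<rightarrow> Z\<close>.

  Closed modules can be derived. The action \<open>QK \<odot> QX\<close> descends to the homotopy categories; composed
  with the invertible maps \<open>1 \<odot> q\<close>, the derived constraints become images of arrows of the original
  categories, so that naturality and the coherence laws are inherited. Each of the adjunctions has a
  left adjoint that is homotopical on a left deformation retract and a right adjoint that is
  homotopical on a right deformation retract, and therefore derives to an adjunction. For \<open>V\<close> acting on
  itself this gives the closed monoidal structure of \<open>Ho V\<close>; for \<open>M\<close> it gives a closed
  \<open>Ho V\<close>-module with underlying category \<open>Ho M\<^sub>0\<close> and hom objects \<open>M(QX, RY)\<close>.
\<close>

section \<open>Categories\<close>

text \<open>The detour through modules has a concrete cause. A composition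
  \<open>M(QY, RZ) \<otimes> M(QX, RY) \<rightarrow> M(QX, RZ)\<close> cannot be taken from
  \<open>M\<close>, because the middle objects \<open>QY\<close> and \<open>RY\<close> differ. In a
  closed module composition is a transpose, so only the action has to be derived. The action is
  covariant in both variables and uses left deformations alone; right deformations enter only
  through right adjoints. Two obstacles shape the proof. The universal property of a localization
  concerns one category at a time, so bifunctors and constraints are derived in each variable
  separately and then assembled (\<open>ho_natural\<close>, \<open>dT_interchange\<close>). Moreover
  \<open>Q q\<close> and \<open>q Q\<close> are different maps in general, while the unit triangles
  and the triangle identities of derived adjunctions produce both; \<open>Q_q_eq_q_Q\<close>
  reconciles them after localization. For the module structure of \<open>M\<close> itself, equations
  are tested on the universal maps \<open>K \<rightarrow> M(X, K \<odot> X)\<close>, by enriched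
  Yoneda.\<close>

context category
begin

lemma Obj_simps [simp]: "f \<in> Arr C \<Longrightarrow> Dom C f \<in> Obj C" "f \<in> Arr C \<Longrightarrow> Cod C f \<in> Obj C"
  by (simp_all add: Dom_in_Obj Cod_in_Obj)

lemma Ide_simps [simp]:
  assumes "X \<in> Obj C"
  shows "Ide C X \<in> Arr C" "Dom C (Ide C X) = X" "Cod C (Ide C X) = X"
  using Ide_in_hom[OF assms] by (auto simp: hom_def)

lemma Comp_simps [simp]:
  assumes "f \<in> Arr C" "g \<in> Arr C" "Dom C g = Cod C f"
  shows "g \<cdot> f \<in> Arr C" "Dom C (g \<cdot> f) = Dom C f" "Cod C (g \<cdot> f) = Cod C g"
  using Comp_in_hom[of f "Dom C f" "Cod C f" g "Cod C g"] assms by (auto simp: hom_def)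

lemma Comp_Ide_simps [simp]:
  "f \<in> Arr C \<Longrightarrow> Dom C f = X \<Longrightarrow> f \<cdot> Ide C X = f"
  "f \<in> Arr C \<Longrightarrow> Cod C f = Y \<Longrightarrow> Ide C Y \<cdot> f = f"
  using Comp_Ide Ide_Comp by (auto simp: hom_def)

lemma assoc':
  "f \<in> Arr C \<Longrightarrow> g \<in> Arr C \<Longrightarrow> h \<in> Arr C \<Longrightarrow> Dom C g = Cod C f \<Longrightarrow> Dom C h = Cod C g
     \<Longrightarrow> (h \<cdot> g) \<cdot> f = h \<cdot> g \<cdot> f"
  using Comp_assoc by (auto simp: hom_def)

text \<open>Composites are kept nested to the right by \<open>assoc'\<close>, so a commuting square
  usually occurs in front of a further factor \<open>x\<close>; in this form it can be rewritten
  there.\<close>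

lemma square_tail:
  assumes "g \<cdot> f = g' \<cdot> f'" "f \<in> Arr C" "g \<in> Arr C" "f' \<in> Arr C" "g' \<in> Arr C" "x \<in> Arr C"
    "Dom C g = Cod C f" "Dom C g' = Cod C f'" "Dom C f = Cod C x" "Dom C f' = Cod C x"
  shows "g \<cdot> f \<cdot> x = g' \<cdot> f' \<cdot> x"
  using assms by (metis assoc')

lemma triangle_tail:
  assumes "g \<cdot> f = h" "f \<in> Arr C" "g \<in> Arr C" "x \<in> Arr C"
    "Dom C g = Cod C f" "Dom C f = Cod C x"
  shows "g \<cdot> f \<cdot> x = h \<cdot> x"
  using assms by (metis assoc')

lemma iso_Arr: "iso C f \<Longrightarrow> f \<in> Arr C"
  by (auto simp: iso_def inverse_arrs_def)

lemma iso_simps [simp]: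
  assumes "iso C f"
  shows "inv_arr C f \<in> Arr C" "Dom C (inv_arr C f) = Cod C f"
    "Cod C (inv_arr C f) = Dom C f" "inv_arr C f \<cdot> f = Ide C (Dom C f)"
    "f \<cdot> inv_arr C f = Ide C (Cod C f)"
  using iso_inv[OF assms] by (auto simp: inverse_arrs_def hom_def)

lemma iso_tail [simp]:
  assumes "iso C f" "x \<in> Arr C"
  shows "Cod C x = Dom C f \<Longrightarrow> inv_arr C f \<cdot> f \<cdot> x = x"
    "Cod C x = Cod C f \<Longrightarrow> f \<cdot> inv_arr C f \<cdot> x = x"
  by (metis assoc' assms iso_Arr iso_simps Comp_Ide_simps(2))+

lemma isoI:
  assumes "f \<in> Arr C" "g \<in> Arr C" "Dom C g = Cod C f" "Cod C g = Dom C f"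
    "g \<cdot> f = Ide C (Dom C f)" "f \<cdot> g = Ide C (Cod C f)"
  shows "iso C f" "inv_arr C f = g"
proof -
  have "inverse_arrs C f g" using assms by (simp add: inverse_arrs_def hom_def)
  then show "iso C f" "inv_arr C f = g" by (auto simp: iso_def inv_arr_eq)
qed

lemma iso_Ide [simp]: "X \<in> Obj C \<Longrightarrow> iso C (Ide C X)"
  "X \<in> Obj C \<Longrightarrow> inv_arr C (Ide C X) = Ide C X"
  using isoI[of "Ide C X" "Ide C X"] by auto

lemma iso_inv_arr [simp]: "iso C f \<Longrightarrow> iso C (inv_arr C f)"
  by (rule isoI[of _ f]) (auto simp: iso_Arr)

lemma iso_Comp [simp]:
  assumes "iso C f" "iso C g" "Dom C g = Cod C f"
  shows "iso C (g \<cdot> f)" "inv_arr C (g \<cdot> f) = inv_arr C f \<cdot> inv_arr C g"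
proof -
  have "(inv_arr C f \<cdot> inv_arr C g) \<cdot> g \<cdot> f = Ide C (Dom C (g \<cdot> f))"
    "(g \<cdot> f) \<cdot> inv_arr C f \<cdot> inv_arr C g = Ide C (Cod C (g \<cdot> f))"
    using assms assms(1,2)[THEN iso_Arr] by (simp_all add: assoc')
  then show "iso C (g \<cdot> f)" "inv_arr C (g \<cdot> f) = inv_arr C f \<cdot> inv_arr C g"
    using assms assms(1,2)[THEN iso_Arr] isoI[of "g \<cdot> f" "inv_arr C f \<cdot> inv_arr C g"] by auto
qed

lemma iso_cancel_left:
  assumes "f \<cdot> x = f \<cdot> y" "iso C f" "x \<in> Arr C" "y \<in> Arr C" "Cod C x = Dom C f" "Cod C y = Dom C f"
  shows "x = y"
  using assms iso_tail(1) by metis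

lemma iso_cancel_right:
  assumes "x \<cdot> f = y \<cdot> f" "iso C f" "x \<in> Arr C" "y \<in> Arr C" "Dom C x = Cod C f" "Dom C y = Cod C f"
  shows "x = y"
proof -
  have "(x \<cdot> f) \<cdot> inv_arr C f = (y \<cdot> f) \<cdot> inv_arr C f" using assms by simp
  then show ?thesis using assms(2-) iso_Arr[OF assms(2)] by (simp add: assoc')
qed

text \<open>Inverts two opposite sides of a commuting square. In this way naturality passes to
  inverses of constraints and to backward arrows of a localization.\<close>

lemma slide:
  assumes "p \<cdot> f = g \<cdot> q" "iso C p" "iso C q" "f \<in> Arr C" "g \<in> Arr C"
    "Dom C p = Cod C f" "Dom C g = Cod C q"
  shows "f \<cdot> inv_arr C q = inv_arr C p \<cdot> g"
proof -
  \<comment> \<open>The remaining types are read off from the equation itself.\<close>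
  have d: "Dom C f = Dom C q" "Cod C g = Cod C p"
    using arg_cong[OF assms(1), of "Dom C"] arg_cong[OF assms(1), of "Cod C"] assms(2-7)
      assms(2,3)[THEN iso_Arr] by simp_all
  note i = d assms(2-7) assms(2,3)[THEN iso_Arr]
  have "p \<cdot> f \<cdot> inv_arr C q = (p \<cdot> f) \<cdot> inv_arr C q" using i by (simp add: assoc')
  also have "\<dots> = (g \<cdot> q) \<cdot> inv_arr C q" by (simp only: assms(1))
  also have "\<dots> = g" using i by (simp add: assoc')
  finally have "inv_arr C p \<cdot> p \<cdot> f \<cdot> inv_arr C q = inv_arr C p \<cdot> g" by simp
  then show ?thesis using i by simp
qed

lemma slide_tail:
  assumes "p \<cdot> f = g \<cdot> q" "iso C p" "iso C q" "f \<in> Arr C" "g \<in> Arr C"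
    "Dom C p = Cod C f" "Dom C g = Cod C q" "x \<in> Arr C" "Cod C x = Cod C q"
  shows "f \<cdot> inv_arr C q \<cdot> x = inv_arr C p \<cdot> g \<cdot> x"
proof -
  have d: "Dom C f = Dom C q" "Cod C g = Cod C p"
    using arg_cong[OF assms(1), of "Dom C"] arg_cong[OF assms(1), of "Cod C"] assms(2-7)
      assms(2,3)[THEN iso_Arr] by simp_all
  show ?thesis
    by (rule square_tail[OF slide[OF assms(1-7)]]) (use assms d in \<open>auto simp: iso_Arr\<close>)
qed

text \<open>A right inverse \<open>j\<close> satisfies \<open>f \<cdot> j \<cdot> f = f\<close>, and
  injectivity cancels the outer \<open>f\<close>. This suits \<open>mten_iso\<close> and
  \<open>mcot_iso\<close>, where composition with the map is understood through a chain of
  transpositions.\<close>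

lemma iso_via_hom:
  assumes f: "f \<in> Arr C"
    and ex: "\<exists>j\<in>hom C (Cod C f) (Dom C f). f \<cdot> j = Ide C (Cod C f)"
    and inj: "\<And>x y. x \<in> hom C (Dom C f) (Dom C f) \<Longrightarrow> y \<in> hom C (Dom C f) (Dom C f)
                \<Longrightarrow> f \<cdot> x = f \<cdot> y \<Longrightarrow> x = y"
  shows "iso C f"
proof -
  obtain j where j: "j \<in> Arr C" "Dom C j = Cod C f" "Cod C j = Dom C f" "f \<cdot> j = Ide C (Cod C f)"
    using ex by (auto simp: hom_def)
  have "f \<cdot> j \<cdot> f = f \<cdot> Ide C (Dom C f)" using f j triangle_tail[OF j(4), of f] by simp
  then have "j \<cdot> f = Ide C (Dom C f)" using f j inj[of "j \<cdot> f" "Ide C (Dom C f)"] by (simp add: hom_def)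
  with f j show ?thesis by (intro isoI[of f j]) auto
qed

end

text \<open>A functor on \<open>prod_cat A B\<close> in curried form, so that the typing laws of
  \<open>T0\<close> and \<open>T1\<close> work as simplification rules without pairs.
  \<open>bifunctor_of_prod\<close> and \<open>prod_functor\<close> translate in the two
  directions.\<close>

locale bifunctor = A: category A + B: category B + D: category D
  for A :: "('o1, 'a1, 'z1) cat_scheme" and B :: "('o2, 'a2, 'z2) cat_scheme"
    and D :: "('o3, 'a3, 'z3) cat_scheme" +
  fixes T0 :: "'o1 \<Rightarrow> 'o2 \<Rightarrow> 'o3" and T1 :: "'a1 \<Rightarrow> 'a2 \<Rightarrow> 'a3"
  assumes T0_Obj [simp]: "X \<in> Obj A \<Longrightarrow> Y \<in> Obj B \<Longrightarrow> T0 X Y \<in> Obj D"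
    and T1_simps [simp]: "f \<in> Arr A \<Longrightarrow> g \<in> Arr B \<Longrightarrow> T1 f g \<in> Arr D"
      "f \<in> Arr A \<Longrightarrow> g \<in> Arr B \<Longrightarrow> Dom D (T1 f g) = T0 (Dom A f) (Dom B g)"
      "f \<in> Arr A \<Longrightarrow> g \<in> Arr B \<Longrightarrow> Cod D (T1 f g) = T0 (Cod A f) (Cod B g)"
    and T1_Ide [simp]: "X \<in> Obj A \<Longrightarrow> Y \<in> Obj B \<Longrightarrow> T1 (Ide A X) (Ide B Y) = Ide D (T0 X Y)"
    and T1_Comp: "f \<in> Arr A \<Longrightarrow> f' \<in> Arr A \<Longrightarrow> g \<in> Arr B \<Longrightarrow> g' \<in> Arr B
      \<Longrightarrow> Dom A f' = Cod A f \<Longrightarrow> Dom B g' = Cod B g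
      \<Longrightarrow> T1 (f' \<cdot>\<^bsub>A\<^esub> f) (g' \<cdot>\<^bsub>B\<^esub> g) = T1 f' g' \<cdot>\<^bsub>D\<^esub> T1 f g"
begin

lemma T1_merge:
  "f \<in> Arr A \<Longrightarrow> f' \<in> Arr A \<Longrightarrow> g \<in> Arr B \<Longrightarrow> g' \<in> Arr B
      \<Longrightarrow> Dom A f' = Cod A f \<Longrightarrow> Dom B g' = Cod B g
      \<Longrightarrow> T1 f' g' \<cdot>\<^bsub>D\<^esub> T1 f g = T1 (f' \<cdot>\<^bsub>A\<^esub> f) (g' \<cdot>\<^bsub>B\<^esub> g)"
  by (simp add: T1_Comp)

lemma T1_merge_tail:
  "f \<in> Arr A \<Longrightarrow> f' \<in> Arr A \<Longrightarrow> g \<in> Arr B \<Longrightarrow> g' \<in> Arr B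
      \<Longrightarrow> Dom A f' = Cod A f \<Longrightarrow> Dom B g' = Cod B g \<Longrightarrow> x \<in> Arr D
      \<Longrightarrow> Cod D x = T0 (Dom A f) (Dom B g)
      \<Longrightarrow> T1 f' g' \<cdot>\<^bsub>D\<^esub> T1 f g \<cdot>\<^bsub>D\<^esub> x = T1 (f' \<cdot>\<^bsub>A\<^esub> f) (g' \<cdot>\<^bsub>B\<^esub> g) \<cdot>\<^bsub>D\<^esub> x"
  by (rule D.triangle_tail[OF T1_merge]) auto

lemma T1_Comp_left:
  "f \<in> Arr A \<Longrightarrow> f' \<in> Arr A \<Longrightarrow> Dom A f' = Cod A f \<Longrightarrow> Y \<in> Obj B
     \<Longrightarrow> T1 (f' \<cdot>\<^bsub>A\<^esub> f) (Ide B Y) = T1 f' (Ide B Y) \<cdot>\<^bsub>D\<^esub> T1 f (Ide B Y)"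
  using T1_Comp[of f f' "Ide B Y" "Ide B Y"] by simp

lemma T1_Comp_right:
  "g \<in> Arr B \<Longrightarrow> g' \<in> Arr B \<Longrightarrow> Dom B g' = Cod B g \<Longrightarrow> X \<in> Obj A
     \<Longrightarrow> T1 (Ide A X) (g' \<cdot>\<^bsub>B\<^esub> g) = T1 (Ide A X) g' \<cdot>\<^bsub>D\<^esub> T1 (Ide A X) g"
  using T1_Comp[of "Ide A X" "Ide A X" g g'] by simp

lemma T1_iso [simp]:
  assumes "iso A f" "iso B g"
  shows "iso D (T1 f g)" "inv_arr D (T1 f g) = T1 (inv_arr A f) (inv_arr B g)"
  using assms A.iso_Arr[OF assms(1)] B.iso_Arr[OF assms(2)] D.isoI[of "T1 f g" "T1 (inv_arr A f) (inv_arr B g)"] by (auto simp: T1_merge)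

lemma functor_left:
  "Y \<in> Obj B \<Longrightarrow> cat_functor A D \<lparr>FO = (\<lambda>X. T0 X Y), FA = (\<lambda>f. T1 f (Ide B Y))\<rparr>"
  by unfold_locales (auto simp: hom_def T1_Comp_left)

lemma functor_right:
  "X \<in> Obj A \<Longrightarrow> cat_functor B D \<lparr>FO = T0 X, FA = T1 (Ide A X)\<rparr>"
  by unfold_locales (auto simp: hom_def T1_Comp_right)

end

lemma bifunctor_of_prod:
  assumes "cat_functor (prod_cat A B) D F" "category A" "category B"
  shows "bifunctor A B D (\<lambda>X Y. FO F (X, Y)) (\<lambda>f g. FA F (f, g))"
proof -
  interpret F: cat_functor "prod_cat A B" D F by fact
  interpret A: category A by fact
  interpret B: category B by fact
  have h: "FA F (f, g) \<in> hom D (FO F (Dom A f, Dom B g)) (FO F (Cod A f, Cod B g))"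
    if "f \<in> Arr A" "g \<in> Arr B" for f g
    using F.FA_in_hom[of "(f, g)" "(Dom A f, Dom B g)" "(Cod A f, Cod B g)"] that
    by (simp add: prod_cat_def hom_def)
  show ?thesis
  proof
    show "FO F (X, Y) \<in> Obj D" if "X \<in> Obj A" "Y \<in> Obj B" for X Y
      using F.FO_in_Obj[of "(X, Y)"] that by (simp add: prod_cat_def)
    show "FA F (Ide A X, Ide B Y) = Ide D (FO F (X, Y))" if "X \<in> Obj A" "Y \<in> Obj B" for X Y
      using F.FA_Ide[of "(X, Y)"] that by (simp add: prod_cat_def)
    show "FA F (f' \<cdot>\<^bsub>A\<^esub> f, g' \<cdot>\<^bsub>B\<^esub> g) = FA F (f', g') \<cdot>\<^bsub>D\<^esub> FA F (f, g)"
      if "f \<in> Arr A" "f' \<in> Arr A" "g \<in> Arr B" "g' \<in> Arr B" "Dom A f' = Cod A f" "Dom B g' = Cod B g"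
      for f f' g g'
      using F.FA_Comp[of "(f, g)" "(Dom A f, Dom B g)" "(Cod A f, Cod B g)" "(f', g')"
          "(Cod A f', Cod B g')"] that
      by (simp add: prod_cat_def hom_def)
  qed (use h in \<open>auto simp: hom_def\<close>)
qed

lemma (in bifunctor) prod_functor:
  "cat_functor (prod_cat A B) D \<lparr>FO = (\<lambda>(X, Y). T0 X Y), FA = (\<lambda>(f, g). T1 f g)\<rparr>"
  by unfold_locales (auto simp: prod_cat_def hom_def T1_Comp A.assoc' B.assoc')

section \<open>Coherence in symmetric monoidal categories\<close>

context closed_symmetric_monoidal_category
begin

sublocale T: bifunctor V V V "tens V" "tens_arr V"
  using bifunctor_of_prod[OF tens_functor category_axioms category_axioms]
  by (simp add: tens_ftor_def)

lemma csm_simps [simp]: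
  "unit_obj V \<in> Obj V"
  "X \<in> Obj V \<Longrightarrow> Y \<in> Obj V \<Longrightarrow> ihom V X Y \<in> Obj V"
  "X \<in> Obj V \<Longrightarrow> lunit V X \<in> Arr V" "X \<in> Obj V \<Longrightarrow> Dom V (lunit V X) = unit_obj V \<otimes> X"
  "X \<in> Obj V \<Longrightarrow> Cod V (lunit V X) = X" "X \<in> Obj V \<Longrightarrow> iso V (lunit V X)"
  "X \<in> Obj V \<Longrightarrow> runit V X \<in> Arr V" "X \<in> Obj V \<Longrightarrow> Dom V (runit V X) = X \<otimes> unit_obj V"
  "X \<in> Obj V \<Longrightarrow> Cod V (runit V X) = X" "X \<in> Obj V \<Longrightarrow> iso V (runit V X)"
  "X \<in> Obj V \<Longrightarrow> Y \<in> Obj V \<Longrightarrow> symm V X Y \<in> Arr V"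
  "X \<in> Obj V \<Longrightarrow> Y \<in> Obj V \<Longrightarrow> Dom V (symm V X Y) = X \<otimes> Y"
  "X \<in> Obj V \<Longrightarrow> Y \<in> Obj V \<Longrightarrow> Cod V (symm V X Y) = Y \<otimes> X"
  "X \<in> Obj V \<Longrightarrow> Y \<in> Obj V \<Longrightarrow> ev V X Y \<in> Arr V"
  "X \<in> Obj V \<Longrightarrow> Y \<in> Obj V \<Longrightarrow> Dom V (ev V X Y) = ihom V X Y \<otimes> X"
  "X \<in> Obj V \<Longrightarrow> Y \<in> Obj V \<Longrightarrow> Cod V (ev V X Y) = Y"
  using unit_in_Obj ihom_in_Obj lunit_in_hom lunit_iso runit_in_hom runit_iso symm_in_hom ev_in_hom
  by (auto simp: hom_def)

lemma assoc_simps [simp]: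
  assumes "X \<in> Obj V" "Y \<in> Obj V" "Z \<in> Obj V"
  shows "assoc V X Y Z \<in> Arr V" "Dom V (assoc V X Y Z) = (X \<otimes> Y) \<otimes> Z"
    "Cod V (assoc V X Y Z) = X \<otimes> Y \<otimes> Z" "iso V (assoc V X Y Z)"
  using assoc_in_hom[OF assms] assoc_iso[OF assms] by (auto simp: hom_def)

lemma symm_iso [simp]:
  assumes "X \<in> Obj V" "Y \<in> Obj V"
  shows "iso V (symm V X Y)" "inv_arr V (symm V X Y) = symm V Y X"
  using isoI[of "symm V X Y" "symm V Y X"] assms symm_symm[of X Y] symm_symm[of Y X] by auto

lemma assoc_nat:
  "f \<in> Arr V \<Longrightarrow> g \<in> Arr V \<Longrightarrow> h \<in> Arr V \<Longrightarrow> Cod V f = X \<Longrightarrow> Cod V g = Y \<Longrightarrow> Cod V h = Z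
    \<Longrightarrow> assoc V X Y Z \<cdot> ((f \<otimes>\<^sub>1 g) \<otimes>\<^sub>1 h)
          = (f \<otimes>\<^sub>1 (g \<otimes>\<^sub>1 h)) \<cdot> assoc V (Dom V f) (Dom V g) (Dom V h)"
  using assoc_natural[OF homI homI homI] by blast

lemma lunit_nat:
  "f \<in> Arr V \<Longrightarrow> Cod V f = X \<Longrightarrow> lunit V X \<cdot> (Ide V (unit_obj V) \<otimes>\<^sub>1 f) = f \<cdot> lunit V (Dom V f)"
  using lunit_natural[OF homI] by blast

lemma runit_nat:
  "f \<in> Arr V \<Longrightarrow> Cod V f = X \<Longrightarrow> runit V X \<cdot> (f \<otimes>\<^sub>1 Ide V (unit_obj V)) = f \<cdot> runit V (Dom V f)"
  using runit_natural[OF homI] by blast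

lemma symm_nat:
  "f \<in> Arr V \<Longrightarrow> g \<in> Arr V \<Longrightarrow> Cod V f = X \<Longrightarrow> Cod V g = Y
    \<Longrightarrow> symm V X Y \<cdot> (f \<otimes>\<^sub>1 g) = (g \<otimes>\<^sub>1 f) \<cdot> symm V (Dom V f) (Dom V g)"
  using symm_natural[OF homI homI] by blast

text \<open>Naturality of the invertible \<open>lunit\<close> makes tensoring with the unit
  conjugate to the identity functor. Equations may thus be tested after tensoring with the unit,
  where pentagon and triangle apply.\<close>

lemma unit_tens_faithful:
  assumes "f \<in> Arr V" "g \<in> Arr V" "Dom V f = Dom V g" "Cod V f = Cod V g"
    "Ide V (unit_obj V) \<otimes>\<^sub>1 f = Ide V (unit_obj V) \<otimes>\<^sub>1 g"
  shows "f = g"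
proof -
  have "f \<cdot> lunit V (Dom V f) = g \<cdot> lunit V (Dom V f)"
    using assms lunit_nat[of f "Cod V f"] lunit_nat[of g "Cod V g"] by simp
  then show ?thesis by (rule iso_cancel_right) (use assms in auto)
qed

lemma tens_unit_faithful:
  assumes "f \<in> Arr V" "g \<in> Arr V" "Dom V f = Dom V g" "Cod V f = Cod V g"
    "f \<otimes>\<^sub>1 Ide V (unit_obj V) = g \<otimes>\<^sub>1 Ide V (unit_obj V)"
  shows "f = g"
proof -
  have "f \<cdot> runit V (Dom V f) = g \<cdot> runit V (Dom V f)"
    using assms runit_nat[of f "Cod V f"] runit_nat[of g "Cod V g"] by simp
  then show ?thesis by (rule iso_cancel_right) (use assms in auto)
qed

text \<open>Kelly's observation: the axioms contain only the triangle with the unit in the middle,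
  and this one follows. After tensoring with the unit and composing with the invertible
  \<open>?p\<close>, the sides are linked by the pentagon for \<open>E, E, X, Y\<close> and two
  instances of the triangle.\<close>

lemma lunit_tens:
  assumes X: "X \<in> Obj V" and Y: "Y \<in> Obj V"
  shows "lunit V (X \<otimes> Y) \<cdot> assoc V (unit_obj V) X Y = lunit V X \<otimes>\<^sub>1 Ide V Y"
proof (rule unit_tens_faithful)
  let ?E = "unit_obj V"
  let ?p = "assoc V ?E (?E \<otimes> X) Y \<cdot> (assoc V ?E ?E X \<otimes>\<^sub>1 Ide V Y)"
  have "(Ide V ?E \<otimes>\<^sub>1 (lunit V (X \<otimes> Y) \<cdot> assoc V ?E X Y)) \<cdot> ?p
      = (Ide V ?E \<otimes>\<^sub>1 lunit V (X \<otimes> Y)) \<cdot> (Ide V ?E \<otimes>\<^sub>1 assoc V ?E X Y) \<cdot> ?p"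
    using X Y by (simp add: T.T1_Comp_right assoc')
  also have "\<dots> = (Ide V ?E \<otimes>\<^sub>1 lunit V (X \<otimes> Y)) \<cdot> assoc V ?E ?E (X \<otimes> Y) \<cdot> assoc V (?E \<otimes> ?E) X Y"
    using X Y pentagon[of ?E ?E X Y] by simp
  also have "\<dots> = (runit V ?E \<otimes>\<^sub>1 Ide V (X \<otimes> Y)) \<cdot> assoc V (?E \<otimes> ?E) X Y"
    using X Y by (intro triangle_tail[OF triangle]) auto
  also have "\<dots> = assoc V ?E X Y \<cdot> ((runit V ?E \<otimes>\<^sub>1 Ide V X) \<otimes>\<^sub>1 Ide V Y)"
    using X Y assoc_nat[of "runit V ?E" "Ide V X" "Ide V Y"] by simp
  also have "\<dots> = assoc V ?E X Y \<cdot> ((Ide V ?E \<otimes>\<^sub>1 lunit V X) \<otimes>\<^sub>1 Ide V Y)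
      \<cdot> (assoc V ?E ?E X \<otimes>\<^sub>1 Ide V Y)"
    using X Y triangle[of ?E X] by (simp add: T.T1_merge)
  also have "\<dots> = (Ide V ?E \<otimes>\<^sub>1 (lunit V X \<otimes>\<^sub>1 Ide V Y)) \<cdot> ?p"
    using X Y square_tail[OF assoc_nat[of "Ide V ?E" "lunit V X" "Ide V Y"]] by simp
  finally show "Ide V ?E \<otimes>\<^sub>1 (lunit V (X \<otimes> Y) \<cdot> assoc V ?E X Y) = Ide V ?E \<otimes>\<^sub>1 (lunit V X \<otimes>\<^sub>1 Ide V Y)"
    by (rule iso_cancel_right) (use X Y in auto)
qed (use X Y in auto)

text \<open>Mirror image of \<open>lunit_tens\<close>: tensor with the unit on the right and use the
  pentagon for \<open>X, Y, E, E\<close>.\<close>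

lemma runit_tens:
  assumes X: "X \<in> Obj V" and Y: "Y \<in> Obj V"
  shows "(Ide V X \<otimes>\<^sub>1 runit V Y) \<cdot> assoc V X Y (unit_obj V) = runit V (X \<otimes> Y)"
proof (rule tens_unit_faithful)
  let ?E = "unit_obj V"
  let ?a = "assoc V X Y ?E"
  have "?a \<cdot> (((Ide V X \<otimes>\<^sub>1 runit V Y) \<cdot> ?a) \<otimes>\<^sub>1 Ide V ?E)
      = ?a \<cdot> ((Ide V X \<otimes>\<^sub>1 runit V Y) \<otimes>\<^sub>1 Ide V ?E) \<cdot> (?a \<otimes>\<^sub>1 Ide V ?E)"
    using X Y by (simp add: T.T1_Comp_left)
  also have "\<dots> = (Ide V X \<otimes>\<^sub>1 runit V Y \<otimes>\<^sub>1 Ide V ?E) \<cdot> assoc V X (Y \<otimes> ?E) ?E \<cdot> (?a \<otimes>\<^sub>1 Ide V ?E)"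
    using X Y square_tail[OF assoc_nat[of "Ide V X" "runit V Y" "Ide V ?E"]] by simp
  also have "\<dots> = (Ide V X \<otimes>\<^sub>1 Ide V Y \<otimes>\<^sub>1 lunit V ?E) \<cdot> (Ide V X \<otimes>\<^sub>1 assoc V Y ?E ?E)
      \<cdot> assoc V X (Y \<otimes> ?E) ?E \<cdot> (?a \<otimes>\<^sub>1 Ide V ?E)"
    using X Y triangle[of Y ?E] by (simp add: T.T1_merge_tail)
  also have "\<dots> = (Ide V X \<otimes>\<^sub>1 Ide V Y \<otimes>\<^sub>1 lunit V ?E) \<cdot> assoc V X Y (?E \<otimes> ?E) \<cdot> assoc V (X \<otimes> Y) ?E ?E"
    using X Y pentagon[of X Y ?E ?E] by simp
  also have "\<dots> = ?a \<cdot> (Ide V (X \<otimes> Y) \<otimes>\<^sub>1 lunit V ?E) \<cdot> assoc V (X \<otimes> Y) ?E ?E"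
    using X Y square_tail[OF assoc_nat[of "Ide V X" "Ide V Y" "lunit V ?E" X Y ?E]] by simp
  also have "\<dots> = ?a \<cdot> (runit V (X \<otimes> Y) \<otimes>\<^sub>1 Ide V ?E)"
    using X Y triangle[of "X \<otimes> Y" ?E] by simp
  finally show "((Ide V X \<otimes>\<^sub>1 runit V Y) \<cdot> ?a) \<otimes>\<^sub>1 Ide V ?E = runit V (X \<otimes> Y) \<otimes>\<^sub>1 Ide V ?E"
    by (rule iso_cancel_left) (use X Y in auto)
qed (use X Y in auto)

text \<open>Naturality of \<open>lunit\<close> at \<open>lunit V E\<close> turns
  \<open>E \<otimes> lunit E\<close> into \<open>lunit (E \<otimes> E)\<close>; comparing the
  triangle with \<open>lunit_tens\<close> then gives the equality tensored with
  \<open>E\<close>.\<close>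

lemma lunit_unit: "lunit V (unit_obj V) = runit V (unit_obj V)"
proof (rule tens_unit_faithful)
  let ?E = "unit_obj V"
  have "lunit V ?E \<cdot> (Ide V ?E \<otimes>\<^sub>1 lunit V ?E) = lunit V ?E \<cdot> lunit V (?E \<otimes> ?E)"
    by (simp add: lunit_nat)
  then have "Ide V ?E \<otimes>\<^sub>1 lunit V ?E = lunit V (?E \<otimes> ?E)" by (rule iso_cancel_left) auto
  then show "lunit V ?E \<otimes>\<^sub>1 Ide V ?E = runit V ?E \<otimes>\<^sub>1 Ide V ?E"
    using triangle[of ?E ?E] lunit_tens[of ?E ?E] by simp
qed auto

text \<open>Follows from the hexagon for \<open>X, E, E\<close>: the sides are compared after
  tensoring with \<open>E\<close> and composing with the invertible symmetry.\<close>

lemma lunit_symm: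
  assumes X: "X \<in> Obj V"
  shows "lunit V X \<cdot> symm V X (unit_obj V) = runit V X"
proof -
  let ?E = "unit_obj V"
  let ?s = "symm V X ?E"
  have "?s \<cdot> (runit V X \<otimes>\<^sub>1 Ide V ?E) = ?s \<cdot> (Ide V X \<otimes>\<^sub>1 lunit V ?E) \<cdot> assoc V X ?E ?E"
    using X triangle[of X ?E] by simp
  also have "\<dots> = (lunit V ?E \<otimes>\<^sub>1 Ide V X) \<cdot> symm V X (?E \<otimes> ?E) \<cdot> assoc V X ?E ?E"
    using X square_tail[OF symm_nat[of "Ide V X" "lunit V ?E"]] by simp
  also have "\<dots> = lunit V (?E \<otimes> X) \<cdot> assoc V ?E ?E X \<cdot> symm V X (?E \<otimes> ?E) \<cdot> assoc V X ?E ?E"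
    using X lunit_tens[of ?E X] triangle_tail[of "lunit V (?E \<otimes> X)" "assoc V ?E ?E X"] by simp
  also have "\<dots> = lunit V (?E \<otimes> X) \<cdot> (Ide V ?E \<otimes>\<^sub>1 ?s) \<cdot> assoc V ?E X ?E \<cdot> (?s \<otimes>\<^sub>1 Ide V ?E)"
    using X hexagon[of X ?E ?E] by simp
  also have "\<dots> = ?s \<cdot> lunit V (X \<otimes> ?E) \<cdot> assoc V ?E X ?E \<cdot> (?s \<otimes>\<^sub>1 Ide V ?E)"
    using X square_tail[OF lunit_nat[of ?s]] by simp
  also have "\<dots> = ?s \<cdot> (lunit V X \<otimes>\<^sub>1 Ide V ?E) \<cdot> (?s \<otimes>\<^sub>1 Ide V ?E)"
    using X triangle_tail[OF lunit_tens[of X ?E]] by simp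
  also have "\<dots> = ?s \<cdot> ((lunit V X \<cdot> ?s) \<otimes>\<^sub>1 Ide V ?E)"
    using X by (simp add: T.T1_merge)
  finally have "runit V X \<otimes>\<^sub>1 Ide V ?E = (lunit V X \<cdot> ?s) \<otimes>\<^sub>1 Ide V ?E"
    by (rule iso_cancel_left) (use X in auto)
  from this[symmetric] show ?thesis by (rule tens_unit_faithful[rotated 4]) (use X in auto)
qed

text \<open>The second hexagon. It comes from the first one for \<open>Z, X, Y\<close>, because the
  symmetries there are inverse to those occurring here. It is needed for
  \<open>mcot_natural\<close>.\<close>

lemma hexagon_inv:
  assumes "X \<in> Obj V" "Y \<in> Obj V" "Z \<in> Obj V"
  shows "assoc V Z X Y \<cdot> (symm V X Z \<otimes>\<^sub>1 Ide V Y) \<cdot> inv_arr V (assoc V X Z Y)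
      \<cdot> (Ide V X \<otimes>\<^sub>1 symm V Y Z) \<cdot> assoc V X Y Z = symm V (X \<otimes> Y) Z"
proof -
  let ?p = "assoc V X Z Y \<cdot> (symm V Z X \<otimes>\<^sub>1 Ide V Y)"
  have "(Ide V X \<otimes>\<^sub>1 symm V Y Z) \<cdot> assoc V X Y Z \<cdot> symm V Z (X \<otimes> Y) \<cdot> assoc V Z X Y
      = (Ide V X \<otimes>\<^sub>1 symm V Y Z) \<cdot> (Ide V X \<otimes>\<^sub>1 symm V Z Y) \<cdot> ?p"
    using assms hexagon[of Z X Y] by simp
  also have "\<dots> = ?p"
    using assms by (simp add: T.T1_merge_tail symm_symm)
  finally have h: "(Ide V X \<otimes>\<^sub>1 symm V Y Z) \<cdot> assoc V X Y Z \<cdot> symm V Z (X \<otimes> Y) \<cdot> assoc V Z X Y = ?p" .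
  have "(assoc V Z X Y \<cdot> (symm V X Z \<otimes>\<^sub>1 Ide V Y) \<cdot> inv_arr V (assoc V X Z Y)
      \<cdot> (Ide V X \<otimes>\<^sub>1 symm V Y Z) \<cdot> assoc V X Y Z) \<cdot> symm V Z (X \<otimes> Y) \<cdot> assoc V Z X Y
      = assoc V Z X Y \<cdot> (symm V X Z \<otimes>\<^sub>1 Ide V Y) \<cdot> inv_arr V (assoc V X Z Y) \<cdot> ?p"
    using assms h by (simp add: assoc')
  also have "\<dots> = assoc V Z X Y"
    using assms by (simp add: T.T1_merge symm_symm)
  also have "\<dots> = symm V (X \<otimes> Y) Z \<cdot> symm V Z (X \<otimes> Y) \<cdot> assoc V Z X Y"
    using assms triangle_tail[OF symm_symm[of Z "X \<otimes> Y"], of "assoc V Z X Y"] by simp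
  finally show ?thesis
    by (rule iso_cancel_right) (use assms in auto)
qed

lemma curry:
  assumes "f \<in> Arr V" "Dom V f = X \<otimes> Y" "Cod V f = Z" "X \<in> Obj V" "Y \<in> Obj V"
  shows "curry V X Y Z f \<in> Arr V" "Dom V (curry V X Y Z f) = X" "Cod V (curry V X Y Z f) = ihom V Y Z"
    "ev V Y Z \<cdot> (curry V X Y Z f \<otimes>\<^sub>1 Ide V Y) = f"
proof -
  have Z: "Z \<in> Obj V" using assms by auto
  have "f \<in> hom V (X \<otimes> Y) Z" using assms by (simp add: hom_def)
  from theI'[OF ev_universal[OF assms(4,5) Z this]]
  show "curry V X Y Z f \<in> Arr V" "Dom V (curry V X Y Z f) = X"
    "Cod V (curry V X Y Z f) = ihom V Y Z" "ev V Y Z \<cdot> (curry V X Y Z f \<otimes>\<^sub>1 Ide V Y) = f"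
    by (auto simp: curry_def hom_def)
qed

lemma ev_cancel:
  assumes "ev V Y Z \<cdot> (g \<otimes>\<^sub>1 Ide V Y) = ev V Y Z \<cdot> (g' \<otimes>\<^sub>1 Ide V Y)"
    "g \<in> Arr V" "g' \<in> Arr V" "Dom V g = Dom V g'" "Cod V g = ihom V Y Z" "Cod V g' = ihom V Y Z"
    "Y \<in> Obj V" "Z \<in> Obj V"
  shows "g = g'"
proof -
  have "ev V Y Z \<cdot> (g \<otimes>\<^sub>1 Ide V Y) \<in> hom V (Dom V g \<otimes> Y) Z" using assms(2-) by (simp add: hom_def)
  from ev_universal[OF _ assms(7,8) this] assms show ?thesis by (auto simp: hom_def)
qed

end

section \<open>Closed modules and enriched categories\<close>

text \<open>Each unit triangle yields one unit law of composition: \<open>mtriangle_left\<close>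
  gives \<open>mcomp_mid_left\<close>, and \<open>mtriangle_right\<close> gives
  \<open>mcomp_mid_right\<close>. Invertibility of \<open>munit\<close> is a separate hypothesis of
  \<open>underlying_enrichment_iso\<close>.\<close>

locale module_category = closed_symmetric_monoidal_category V + N: category N +
  act: bifunctor V N N act act1
  for V :: "('o, 'a, 'z) csm_scheme" (structure) and N :: "('n, 'b, 'y) cat_scheme"
    and act :: "'o \<Rightarrow> 'n \<Rightarrow> 'n" (infixr "\<odot>" 75)
    and act1 :: "'a \<Rightarrow> 'b \<Rightarrow> 'b" (infixr "\<odot>\<^sub>1" 75) +
  fixes massoc :: "'o \<Rightarrow> 'o \<Rightarrow> 'n \<Rightarrow> 'b" and munit :: "'n \<Rightarrow> 'b"
  assumes massoc_simps [simp]: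
      "K \<in> Obj V \<Longrightarrow> L \<in> Obj V \<Longrightarrow> X \<in> Obj N \<Longrightarrow> massoc K L X \<in> Arr N"
      "K \<in> Obj V \<Longrightarrow> L \<in> Obj V \<Longrightarrow> X \<in> Obj N \<Longrightarrow> Dom N (massoc K L X) = (K \<otimes> L) \<odot> X"
      "K \<in> Obj V \<Longrightarrow> L \<in> Obj V \<Longrightarrow> X \<in> Obj N \<Longrightarrow> Cod N (massoc K L X) = K \<odot> L \<odot> X"
      "K \<in> Obj V \<Longrightarrow> L \<in> Obj V \<Longrightarrow> X \<in> Obj N \<Longrightarrow> iso N (massoc K L X)"
    and massoc_nat: "k \<in> Arr V \<Longrightarrow> l \<in> Arr V \<Longrightarrow> f \<in> Arr N \<Longrightarrow> Cod V k = K \<Longrightarrow> Cod V l = L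
      \<Longrightarrow> Cod N f = X \<Longrightarrow> massoc K L X \<cdot>\<^bsub>N\<^esub> ((k \<otimes>\<^sub>1 l) \<odot>\<^sub>1 f)
            = (k \<odot>\<^sub>1 l \<odot>\<^sub>1 f) \<cdot>\<^bsub>N\<^esub> massoc (Dom V k) (Dom V l) (Dom N f)"
    and munit_simps [simp]:
      "X \<in> Obj N \<Longrightarrow> munit X \<in> Arr N" "X \<in> Obj N \<Longrightarrow> Dom N (munit X) = unit_obj V \<odot> X"
      "X \<in> Obj N \<Longrightarrow> Cod N (munit X) = X"
    and munit_nat: "f \<in> Arr N \<Longrightarrow> Cod N f = X
      \<Longrightarrow> munit X \<cdot>\<^bsub>N\<^esub> (Ide V (unit_obj V) \<odot>\<^sub>1 f) = f \<cdot>\<^bsub>N\<^esub> munit (Dom N f)"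
    and mpentagon: "J \<in> Obj V \<Longrightarrow> K \<in> Obj V \<Longrightarrow> L \<in> Obj V \<Longrightarrow> X \<in> Obj N
      \<Longrightarrow> (Ide V J \<odot>\<^sub>1 massoc K L X) \<cdot>\<^bsub>N\<^esub> massoc J (K \<otimes> L) X \<cdot>\<^bsub>N\<^esub> (assoc V J K L \<odot>\<^sub>1 Ide N X)
            = massoc J K (L \<odot> X) \<cdot>\<^bsub>N\<^esub> massoc (J \<otimes> K) L X"
    and mtriangle_right: "K \<in> Obj V \<Longrightarrow> X \<in> Obj N
      \<Longrightarrow> (Ide V K \<odot>\<^sub>1 munit X) \<cdot>\<^bsub>N\<^esub> massoc K (unit_obj V) X = runit V K \<odot>\<^sub>1 Ide N X"
    and mtriangle_left: "K \<in> Obj V \<Longrightarrow> X \<in> Obj N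
      \<Longrightarrow> munit (K \<odot> X) \<cdot>\<^bsub>N\<^esub> massoc (unit_obj V) K X = lunit V K \<odot>\<^sub>1 Ide N X"
begin

abbreviation compN (infixr "\<bullet>" 70) where "g \<bullet> f \<equiv> g \<cdot>\<^bsub>N\<^esub> f"
abbreviation "iV \<equiv> Ide V"
abbreviation "iN \<equiv> Ide N"
abbreviation "E \<equiv> unit_obj V"

end

text \<open>The right adjoint of \<open>- \<odot> X\<close> is given by universal arrows
  \<open>mev X Y\<close>, and functoriality in the second variable is recovered as
  \<open>mhom_arr\<close>. Adjunctions are later derived in the same form, by a universal
  counit.\<close>

locale closed_module = module_category V N act act1 massoc munit
  for V :: "('o, 'a, 'z) csm_scheme" (structure) and N :: "('n, 'b, 'y) cat_scheme"
    and act (infixr "\<odot>" 75) and act1 (infixr "\<odot>\<^sub>1" 75) and massoc munit +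
  fixes mhom :: "'n \<Rightarrow> 'n \<Rightarrow> 'o" and mev :: "'n \<Rightarrow> 'n \<Rightarrow> 'b"
  assumes mhom_simps [simp]:
      "X \<in> Obj N \<Longrightarrow> Y \<in> Obj N \<Longrightarrow> mhom X Y \<in> Obj V"
      "X \<in> Obj N \<Longrightarrow> Y \<in> Obj N \<Longrightarrow> mev X Y \<in> Arr N"
      "X \<in> Obj N \<Longrightarrow> Y \<in> Obj N \<Longrightarrow> Dom N (mev X Y) = mhom X Y \<odot> X"
      "X \<in> Obj N \<Longrightarrow> Y \<in> Obj N \<Longrightarrow> Cod N (mev X Y) = Y"
    and mev_universal: "K \<in> Obj V \<Longrightarrow> X \<in> Obj N \<Longrightarrow> Y \<in> Obj N \<Longrightarrow> f \<in> hom N (K \<odot> X) Y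
      \<Longrightarrow> \<exists>!g. g \<in> hom V K (mhom X Y) \<and> mev X Y \<cdot>\<^bsub>N\<^esub> (g \<odot>\<^sub>1 Ide N X) = f"

locale biclosed_module = closed_module V N act act1 massoc munit mhom mev
  for V :: "('o, 'a, 'z) csm_scheme" (structure) and N :: "('n, 'b, 'y) cat_scheme"
    and act (infixr "\<odot>" 75) and act1 (infixr "\<odot>\<^sub>1" 75) and massoc munit mhom mev +
  fixes mcot :: "'o \<Rightarrow> 'n \<Rightarrow> 'n" and mcev :: "'o \<Rightarrow> 'n \<Rightarrow> 'b"
  assumes mcot_simps [simp]:
      "K \<in> Obj V \<Longrightarrow> Y \<in> Obj N \<Longrightarrow> mcot K Y \<in> Obj N"
      "K \<in> Obj V \<Longrightarrow> Y \<in> Obj N \<Longrightarrow> mcev K Y \<in> Arr N"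
      "K \<in> Obj V \<Longrightarrow> Y \<in> Obj N \<Longrightarrow> Dom N (mcev K Y) = K \<odot> mcot K Y"
      "K \<in> Obj V \<Longrightarrow> Y \<in> Obj N \<Longrightarrow> Cod N (mcev K Y) = Y"
    and mcev_universal: "K \<in> Obj V \<Longrightarrow> X \<in> Obj N \<Longrightarrow> Y \<in> Obj N \<Longrightarrow> f \<in> hom N (K \<odot> X) Y
      \<Longrightarrow> \<exists>!g. g \<in> hom N X (mcot K Y) \<and> mcev K Y \<cdot>\<^bsub>N\<^esub> (Ide V K \<odot>\<^sub>1 g) = f"

section \<open>Composition, identities and tensors on the hom objects of a closed module\<close>

context closed_module
begin

text \<open>Transposition from \<open>K \<rightarrow> mhom X Y\<close> to
  \<open>K \<odot> X \<rightarrow> Y\<close>; \<open>sharp\<close> is its inverse. Equations between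
  arrows into hom objects are proved by applying \<open>flat\<close> and cancelling it with
  \<open>flat_inj\<close>.\<close>

definition flat :: "'n \<Rightarrow> 'n \<Rightarrow> 'a \<Rightarrow> 'b" where
  "flat X Y g = mev X Y \<bullet> (g \<odot>\<^sub>1 iN X)"

definition sharp :: "'o \<Rightarrow> 'n \<Rightarrow> 'n \<Rightarrow> 'b \<Rightarrow> 'a" where
  "sharp K X Y f = (THE g. g \<in> hom V K (mhom X Y) \<and> flat X Y g = f)"

lemma flat_simps [simp]:
  assumes "X \<in> Obj N" "Y \<in> Obj N" "g \<in> Arr V" "Cod V g = mhom X Y"
  shows "flat X Y g \<in> Arr N" "Dom N (flat X Y g) = Dom V g \<odot> X" "Cod N (flat X Y g) = Y"
  using assms by (simp_all add: flat_def)

lemma sharp_simps [simp]: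
  assumes "K \<in> Obj V" "X \<in> Obj N" "Y \<in> Obj N" "f \<in> Arr N" "Dom N f = K \<odot> X" "Cod N f = Y"
  shows "sharp K X Y f \<in> Arr V" "Dom V (sharp K X Y f) = K" "Cod V (sharp K X Y f) = mhom X Y"
    "flat X Y (sharp K X Y f) = f"
proof -
  have "f \<in> hom N (K \<odot> X) Y" using assms by (simp add: hom_def)
  from theI'[OF mev_universal[OF assms(1-3) this]]
  show "sharp K X Y f \<in> Arr V" "Dom V (sharp K X Y f) = K" "Cod V (sharp K X Y f) = mhom X Y"
    "flat X Y (sharp K X Y f) = f"
    by (auto simp: sharp_def flat_def hom_def)
qed

lemma flat_inj:
  assumes "flat X Y g = flat X Y g'" "X \<in> Obj N" "Y \<in> Obj N" "g \<in> Arr V" "g' \<in> Arr V"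
    "Dom V g = Dom V g'" "Cod V g = mhom X Y" "Cod V g' = mhom X Y"
  shows "g = g'"
proof -
  have "flat X Y g \<in> hom N (Dom V g \<odot> X) Y" using assms(2-) by (simp add: hom_def)
  from mev_universal[OF _ assms(2,3) this] assms show ?thesis by (auto simp: flat_def hom_def)
qed

lemma flat_Comp:
  "X \<in> Obj N \<Longrightarrow> Y \<in> Obj N \<Longrightarrow> g \<in> Arr V \<Longrightarrow> Cod V g = mhom X Y \<Longrightarrow> k \<in> Arr V \<Longrightarrow> Dom V g = Cod V k
     \<Longrightarrow> flat X Y (g \<cdot> k) = flat X Y g \<bullet> (k \<odot>\<^sub>1 iN X)"
  by (simp add: flat_def act.T1_Comp_left N.assoc')

lemma flat_Ide [simp]: "X \<in> Obj N \<Longrightarrow> Y \<in> Obj N \<Longrightarrow> flat X Y (iV (mhom X Y)) = mev X Y"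
  by (simp add: flat_def)

text \<open>Postcomposition with \<open>g\<close>. It makes \<open>mhom X\<close> a functor, as
  \<open>deformable_adjunction\<close> requires of a right adjoint.\<close>

definition mhom_arr :: "'n \<Rightarrow> 'b \<Rightarrow> 'a" where
  "mhom_arr X g = sharp (mhom X (Dom N g)) X (Cod N g) (g \<bullet> mev X (Dom N g))"

lemma mhom_arr_simps [simp]:
  assumes "X \<in> Obj N" "g \<in> Arr N"
  shows "mhom_arr X g \<in> Arr V" "Dom V (mhom_arr X g) = mhom X (Dom N g)"
    "Cod V (mhom_arr X g) = mhom X (Cod N g)"
    "flat X (Cod N g) (mhom_arr X g) = g \<bullet> mev X (Dom N g)"
  using assms by (simp_all add: mhom_arr_def)

lemma mhom_arr_functor:
  assumes X: "X \<in> Obj N"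
  shows "cat_functor N V \<lparr>FO = mhom X, FA = mhom_arr X\<rparr>"
proof unfold_locales
  fix Y assume Y: "Y \<in> Obj N"
  have "mhom_arr X (iN Y) = iV (mhom X Y)"
    by (rule flat_inj[of X Y]) (use X Y mhom_arr_simps(4)[of X "iN Y"] in simp_all)
  then show "FA \<lparr>FO = mhom X, FA = mhom_arr X\<rparr> (iN Y) = iV (FO \<lparr>FO = mhom X, FA = mhom_arr X\<rparr> Y)"
    by simp
next
  fix f g Y Z T assume "f \<in> hom N Y Z" "g \<in> hom N Z T"
  then have t: "f \<in> Arr N" "Dom N f = Y" "Cod N f = Z" "g \<in> Arr N" "Dom N g = Z" "Cod N g = T"
    by (auto simp: hom_def)
  then have O: "Y \<in> Obj N" "Z \<in> Obj N" "T \<in> Obj N" by auto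
  have "flat X T (mhom_arr X g \<cdot> mhom_arr X f) = (g \<bullet> mev X Z) \<bullet> (mhom_arr X f \<odot>\<^sub>1 iN X)"
    using X t O mhom_arr_simps(4)[of X g] by (simp add: flat_Comp)
  also have "\<dots> = g \<bullet> flat X Z (mhom_arr X f)"
    using X t O by (simp add: flat_def N.assoc')
  also have "\<dots> = flat X T (mhom_arr X (g \<bullet> f))"
    using X t O mhom_arr_simps(4)[of X f] mhom_arr_simps(4)[of X "g \<bullet> f"] by (simp add: N.assoc')
  finally have "mhom_arr X g \<cdot> mhom_arr X f = mhom_arr X (g \<bullet> f)"
    by (rule flat_inj) (use X t O in auto)
  then show "FA \<lparr>FO = mhom X, FA = mhom_arr X\<rparr> (g \<bullet> f)
      = FA \<lparr>FO = mhom X, FA = mhom_arr X\<rparr> g \<cdot> FA \<lparr>FO = mhom X, FA = mhom_arr X\<rparr> f" by simp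
qed (use X in \<open>auto simp: hom_def\<close>)

definition mcomp :: "'n \<Rightarrow> 'n \<Rightarrow> 'n \<Rightarrow> 'a" where
  "mcomp X Y Z = sharp (mhom Y Z \<otimes> mhom X Y) X Z
     (mev Y Z \<bullet> (iV (mhom Y Z) \<odot>\<^sub>1 mev X Y) \<bullet> massoc (mhom Y Z) (mhom X Y) X)"

lemma mcomp_simps [simp]:
  assumes "X \<in> Obj N" "Y \<in> Obj N" "Z \<in> Obj N"
  shows "mcomp X Y Z \<in> Arr V" "Dom V (mcomp X Y Z) = mhom Y Z \<otimes> mhom X Y"
    "Cod V (mcomp X Y Z) = mhom X Z"
    "flat X Z (mcomp X Y Z)
       = mev Y Z \<bullet> (iV (mhom Y Z) \<odot>\<^sub>1 mev X Y) \<bullet> massoc (mhom Y Z) (mhom X Y) X"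
  using assms by (simp_all add: mcomp_def)

text \<open>The working form of composition, for arbitrary arrows into the hom objects: under
  \<open>flat\<close> it is composition in \<open>N\<close> along \<open>massoc\<close>, so enriched
  laws turn into coherence laws of the action.\<close>

lemma flat_mcomp:
  assumes "X \<in> Obj N" "Y \<in> Obj N" "Z \<in> Obj N" "g \<in> Arr V" "f \<in> Arr V"
    "Cod V g = mhom Y Z" "Cod V f = mhom X Y"
  shows "flat X Z (mcomp X Y Z \<cdot> (g \<otimes>\<^sub>1 f))
      = flat Y Z g \<bullet> (iV (Dom V g) \<odot>\<^sub>1 flat X Y f) \<bullet> massoc (Dom V g) (Dom V f) X"
proof -
  have "flat X Z (mcomp X Y Z \<cdot> (g \<otimes>\<^sub>1 f)) = mev Y Z \<bullet> (iV (mhom Y Z) \<odot>\<^sub>1 mev X Y)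
      \<bullet> massoc (mhom Y Z) (mhom X Y) X \<bullet> ((g \<otimes>\<^sub>1 f) \<odot>\<^sub>1 iN X)"
    using assms by (simp add: flat_Comp N.assoc')
  also have "\<dots> = mev Y Z \<bullet> (iV (mhom Y Z) \<odot>\<^sub>1 mev X Y) \<bullet> (g \<odot>\<^sub>1 f \<odot>\<^sub>1 iN X)
      \<bullet> massoc (Dom V g) (Dom V f) X"
    using assms by (simp add: massoc_nat)
  also have "\<dots> = mev Y Z \<bullet> (g \<odot>\<^sub>1 flat X Y f) \<bullet> massoc (Dom V g) (Dom V f) X"
    using assms by (simp add: act.T1_merge_tail flat_def)
  also have "\<dots> = mev Y Z \<bullet> (g \<odot>\<^sub>1 iN Y) \<bullet> (iV (Dom V g) \<odot>\<^sub>1 flat X Y f)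
      \<bullet> massoc (Dom V g) (Dom V f) X"
    using assms by (simp add: act.T1_merge_tail)
  finally show ?thesis using assms by (simp add: flat_def N.assoc')
qed

definition mid :: "'n \<Rightarrow> 'a" where
  "mid X = sharp E X X (munit X)"

lemma mid_simps [simp]:
  assumes "X \<in> Obj N"
  shows "mid X \<in> Arr V" "Dom V (mid X) = E" "Cod V (mid X) = mhom X X" "flat X X (mid X) = munit X"
  using assms by (simp_all add: mid_def)

text \<open>Under \<open>flat\<close> both sides consist of three evaluations; their regrouping is
  \<open>mpentagon\<close>, and naturality of \<open>massoc\<close> moves \<open>mev W X\<close>
  into place.\<close>

lemma mcomp_assoc:
  assumes O: "W \<in> Obj N" "X \<in> Obj N" "Y \<in> Obj N" "Z \<in> Obj N"
  shows "mcomp W Y Z \<cdot> (iV (mhom Y Z) \<otimes>\<^sub>1 mcomp W X Y) \<cdot> assoc V (mhom Y Z) (mhom X Y) (mhom W X)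
    = mcomp W X Z \<cdot> (mcomp X Y Z \<otimes>\<^sub>1 iV (mhom W X))"
proof (rule flat_inj[of W Z])
  let ?A = "mhom Y Z" and ?B = "mhom X Y" and ?C = "mhom W X"
  have "flat W Z (mcomp W Y Z \<cdot> (iV ?A \<otimes>\<^sub>1 mcomp W X Y) \<cdot> assoc V ?A ?B ?C)
      = flat W Z ((mcomp W Y Z \<cdot> (iV ?A \<otimes>\<^sub>1 mcomp W X Y)) \<cdot> assoc V ?A ?B ?C)"
    using O by (simp add: assoc')
  also have "\<dots> = mev Y Z \<bullet> (iV ?A \<odot>\<^sub>1 mev X Y) \<bullet> (iV ?A \<odot>\<^sub>1 iV ?B \<odot>\<^sub>1 mev W X)
      \<bullet> (iV ?A \<odot>\<^sub>1 massoc ?B ?C W) \<bullet> massoc ?A (?B \<otimes> ?C) W \<bullet> (assoc V ?A ?B ?C \<odot>\<^sub>1 iN W)"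
    using O flat_Comp[of W Z "mcomp W Y Z \<cdot> (iV ?A \<otimes>\<^sub>1 mcomp W X Y)" "assoc V ?A ?B ?C"]
    by (simp add: flat_mcomp act.T1_Comp_right N.assoc')
  also have "\<dots> = mev Y Z \<bullet> (iV ?A \<odot>\<^sub>1 mev X Y) \<bullet> (iV ?A \<odot>\<^sub>1 iV ?B \<odot>\<^sub>1 mev W X)
      \<bullet> massoc ?A ?B (?C \<odot> W) \<bullet> massoc (?A \<otimes> ?B) ?C W"
    using O by (simp add: mpentagon)
  also have "\<dots> = mev Y Z \<bullet> (iV ?A \<odot>\<^sub>1 mev X Y) \<bullet> massoc ?A ?B X
      \<bullet> (iV (?A \<otimes> ?B) \<odot>\<^sub>1 mev W X) \<bullet> massoc (?A \<otimes> ?B) ?C W"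
    using O N.square_tail[OF massoc_nat[of "iV ?A" "iV ?B" "mev W X" ?A ?B X]] by simp
  also have "\<dots> = flat W Z (mcomp W X Z \<cdot> (mcomp X Y Z \<otimes>\<^sub>1 iV ?C))"
    using O by (simp add: flat_mcomp N.assoc')
  finally show "flat W Z (mcomp W Y Z \<cdot> (iV ?A \<otimes>\<^sub>1 mcomp W X Y) \<cdot> assoc V ?A ?B ?C)
      = flat W Z (mcomp W X Z \<cdot> (mcomp X Y Z \<otimes>\<^sub>1 iV ?C))" .
qed (use O in simp_all)

lemma mcomp_mid_left:
  assumes O: "X \<in> Obj N" "Y \<in> Obj N"
  shows "mcomp X Y Y \<cdot> (mid Y \<otimes>\<^sub>1 iV (mhom X Y)) = lunit V (mhom X Y)"
proof (rule flat_inj[of X Y])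
  have "flat X Y (mcomp X Y Y \<cdot> (mid Y \<otimes>\<^sub>1 iV (mhom X Y)))
      = mev X Y \<bullet> munit (mhom X Y \<odot> X) \<bullet> massoc E (mhom X Y) X"
    using O N.square_tail[OF munit_nat[of "mev X Y"]] by (simp add: flat_mcomp)
  also have "\<dots> = flat X Y (lunit V (mhom X Y))"
    using O by (simp add: mtriangle_left) (simp add: flat_def)
  finally show "flat X Y (mcomp X Y Y \<cdot> (mid Y \<otimes>\<^sub>1 iV (mhom X Y))) = flat X Y (lunit V (mhom X Y))" .
qed (use O in simp_all)

lemma mcomp_mid_right:
  assumes O: "X \<in> Obj N" "Y \<in> Obj N"
  shows "mcomp X X Y \<cdot> (iV (mhom X Y) \<otimes>\<^sub>1 mid X) = runit V (mhom X Y)"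
proof (rule flat_inj[of X Y])
  show "flat X Y (mcomp X X Y \<cdot> (iV (mhom X Y) \<otimes>\<^sub>1 mid X)) = flat X Y (runit V (mhom X Y))"
    using O by (simp add: flat_mcomp mtriangle_right) (simp add: flat_def)
qed (use O in simp_all)

text \<open>Double transposition, from \<open>L \<rightarrow> ihom K (mhom X Y)\<close> to
  \<open>(L \<otimes> K) \<odot> X \<rightarrow> Y\<close>. The isomorphisms of tensors and of
  cotensors are both studied through it.\<close>

definition dflat :: "'o \<Rightarrow> 'n \<Rightarrow> 'n \<Rightarrow> 'a \<Rightarrow> 'b" where
  "dflat K X Y g = flat X Y (ev V K (mhom X Y) \<cdot> (g \<otimes>\<^sub>1 iV K))"

lemma dflat_inj:
  assumes "dflat K X Y g = dflat K X Y g'" "K \<in> Obj V" "X \<in> Obj N" "Y \<in> Obj N" "g \<in> Arr V" "g' \<in> Arr V"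
    "Dom V g = Dom V g'" "Cod V g = ihom V K (mhom X Y)" "Cod V g' = ihom V K (mhom X Y)"
  shows "g = g'"
  by (rule ev_cancel[OF flat_inj[OF assms(1)[unfolded dflat_def]]]) (use assms in auto)

definition mten_pre :: "'o \<Rightarrow> 'n \<Rightarrow> 'n \<Rightarrow> 'a" where
  "mten_pre K X Y = sharp (mhom (K \<odot> X) Y \<otimes> K) X Y
     (mev (K \<odot> X) Y \<bullet> massoc (mhom (K \<odot> X) Y) K X)"

lemma mten_pre_simps [simp]:
  assumes "K \<in> Obj V" "X \<in> Obj N" "Y \<in> Obj N"
  shows "mten_pre K X Y \<in> Arr V" "Dom V (mten_pre K X Y) = mhom (K \<odot> X) Y \<otimes> K"
    "Cod V (mten_pre K X Y) = mhom X Y"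
    "flat X Y (mten_pre K X Y) = mev (K \<odot> X) Y \<bullet> massoc (mhom (K \<odot> X) Y) K X"
  using assms by (simp_all add: mten_pre_def)

definition mten_iso :: "'o \<Rightarrow> 'n \<Rightarrow> 'n \<Rightarrow> 'a" where
  "mten_iso K X Y = curry V (mhom (K \<odot> X) Y) K (mhom X Y) (mten_pre K X Y)"

lemma mten_iso_simps [simp]:
  assumes "K \<in> Obj V" "X \<in> Obj N" "Y \<in> Obj N"
  shows "mten_iso K X Y \<in> Arr V" "Dom V (mten_iso K X Y) = mhom (K \<odot> X) Y"
    "Cod V (mten_iso K X Y) = ihom V K (mhom X Y)"
    "ev V K (mhom X Y) \<cdot> (mten_iso K X Y \<otimes>\<^sub>1 iV K) = mten_pre K X Y"
  using assms curry[of "mten_pre K X Y"] by (simp_all add: mten_iso_def)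

text \<open>On generalized elements \<open>mten_iso\<close> is transposition followed by
  precomposition with the invertible \<open>massoc\<close>. Invertibility and naturality of
  \<open>mten_iso\<close> both rest on this.\<close>

lemma dflat_mten_iso:
  assumes "K \<in> Obj V" "X \<in> Obj N" "Y \<in> Obj N" "g \<in> Arr V" "Cod V g = mhom (K \<odot> X) Y"
  shows "dflat K X Y (mten_iso K X Y \<cdot> g) = flat (K \<odot> X) Y g \<bullet> massoc (Dom V g) K X"
proof -
  have "ev V K (mhom X Y) \<cdot> ((mten_iso K X Y \<cdot> g) \<otimes>\<^sub>1 iV K) = mten_pre K X Y \<cdot> (g \<otimes>\<^sub>1 iV K)"
    using assms triangle_tail[OF mten_iso_simps(4)] by (simp add: T.T1_Comp_left)
  then have "dflat K X Y (mten_iso K X Y \<cdot> g)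
      = (mev (K \<odot> X) Y \<bullet> massoc (mhom (K \<odot> X) Y) K X) \<bullet> ((g \<otimes>\<^sub>1 iV K) \<odot>\<^sub>1 iN X)"
    using assms by (simp add: dflat_def flat_Comp)
  also have "\<dots> = flat (K \<odot> X) Y g \<bullet> massoc (Dom V g) K X"
    using assms by (simp add: N.assoc' massoc_nat flat_def)
  finally show ?thesis .
qed

lemma mten_iso_iso:
  assumes O: "K \<in> Obj V" "X \<in> Obj N" "Y \<in> Obj N"
  shows "iso V (mten_iso K X Y)"
proof (rule iso_via_hom)
  let ?I = "ihom V K (mhom X Y)"
  let ?f = "dflat K X Y (iV ?I)"
  \<comment> \<open>The universal element, the identity of \<open>?I\<close>, carried backwards
    through the bijections.\<close>
  let ?j = "sharp ?I (K \<odot> X) Y (?f \<bullet> inv_arr N (massoc ?I K X))"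
  have f: "?f \<in> Arr N" "Dom N ?f = (?I \<otimes> K) \<odot> X" "Cod N ?f = Y"
    using O by (simp_all add: dflat_def)
  have j: "?j \<in> Arr V" "Dom V ?j = ?I" "Cod V ?j = mhom (K \<odot> X) Y"
    "flat (K \<odot> X) Y ?j = ?f \<bullet> inv_arr N (massoc ?I K X)"
    using O f by simp_all
  have "dflat K X Y (mten_iso K X Y \<cdot> ?j) = ?f"
    using O f j dflat_mten_iso[of K X Y ?j] by (simp add: N.assoc')
  then have "mten_iso K X Y \<cdot> ?j = iV ?I"
    by (rule dflat_inj) (use O j in auto)
  then show "\<exists>j\<in>hom V (Cod V (mten_iso K X Y)) (Dom V (mten_iso K X Y)).
      mten_iso K X Y \<cdot> j = iV (Cod V (mten_iso K X Y))"
    using O j by (intro bexI[of _ ?j]) (auto simp: hom_def)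
next
  fix x y
  assume x: "x \<in> hom V (Dom V (mten_iso K X Y)) (Dom V (mten_iso K X Y))"
    and y: "y \<in> hom V (Dom V (mten_iso K X Y)) (Dom V (mten_iso K X Y))"
    and e: "mten_iso K X Y \<cdot> x = mten_iso K X Y \<cdot> y"
  have t: "x \<in> Arr V" "Dom V x = mhom (K \<odot> X) Y" "Cod V x = mhom (K \<odot> X) Y"
    "y \<in> Arr V" "Dom V y = mhom (K \<odot> X) Y" "Cod V y = mhom (K \<odot> X) Y"
    using x y O by (auto simp: hom_def)
  have "flat (K \<odot> X) Y x \<bullet> massoc (Dom V x) K X = flat (K \<odot> X) Y y \<bullet> massoc (Dom V x) K X"
    using dflat_mten_iso[of K X Y x] dflat_mten_iso[of K X Y y] e t O by simp
  then have "flat (K \<odot> X) Y x = flat (K \<odot> X) Y y"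
    by (rule N.iso_cancel_right) (use t O in auto)
  then show "x = y" by (rule flat_inj) (use t O in auto)
qed (use O in simp)

text \<open>Stated for any \<open>c\<close> with the property that characterizes
  \<open>cov_act\<close>, so that the tensor axiom follows by supplying the facts
  \<open>curry\<close>. Under \<open>dflat\<close> the sides are related by
  \<open>mpentagon\<close>.\<close>

lemma mten_natural:
  assumes O: "K \<in> Obj V" "X \<in> Obj N" "Y \<in> Obj N" "Z \<in> Obj N"
    and c: "c \<in> Arr V" "Dom V c = mhom Y Z \<otimes> ihom V K (mhom X Y)" "Cod V c = ihom V K (mhom X Z)"
      "ev V K (mhom X Z) \<cdot> (c \<otimes>\<^sub>1 iV K) = mcomp X Y Z \<cdot> (iV (mhom Y Z) \<otimes>\<^sub>1 ev V K (mhom X Y))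
          \<cdot> assoc V (mhom Y Z) (ihom V K (mhom X Y)) K"
  shows "mten_iso K X Z \<cdot> mcomp (K \<odot> X) Y Z = c \<cdot> (iV (mhom Y Z) \<otimes>\<^sub>1 mten_iso K X Y)"
proof (rule dflat_inj[of K X Z])
  let ?A = "mhom Y Z" and ?B = "mhom (K \<odot> X) Y"
  have "ev V K (mhom X Z) \<cdot> ((c \<cdot> (iV ?A \<otimes>\<^sub>1 mten_iso K X Y)) \<otimes>\<^sub>1 iV K)
      = ev V K (mhom X Z) \<cdot> (c \<otimes>\<^sub>1 iV K) \<cdot> ((iV ?A \<otimes>\<^sub>1 mten_iso K X Y) \<otimes>\<^sub>1 iV K)"
    using O c(1-3) by (simp add: T.T1_Comp_left)
  also have "\<dots> = (mcomp X Y Z \<cdot> (iV ?A \<otimes>\<^sub>1 ev V K (mhom X Y)) \<cdot> assoc V ?A (ihom V K (mhom X Y)) K)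
      \<cdot> ((iV ?A \<otimes>\<^sub>1 mten_iso K X Y) \<otimes>\<^sub>1 iV K)"
    by (rule triangle_tail[OF c(4)]) (use O c(1-3) in auto)
  also have "\<dots> = mcomp X Y Z \<cdot> (iV ?A \<otimes>\<^sub>1 mten_pre K X Y) \<cdot> assoc V ?A ?B K"
    using O by (simp add: assoc' assoc_nat T.T1_merge_tail)
  also have "\<dots> = (mcomp X Y Z \<cdot> (iV ?A \<otimes>\<^sub>1 mten_pre K X Y)) \<cdot> assoc V ?A ?B K"
    using O by (simp add: assoc')
  finally have "dflat K X Z (c \<cdot> (iV ?A \<otimes>\<^sub>1 mten_iso K X Y))
      = mev Y Z \<bullet> (iV ?A \<odot>\<^sub>1 mev (K \<odot> X) Y) \<bullet> (iV ?A \<odot>\<^sub>1 massoc ?B K X) \<bullet> massoc ?A (?B \<otimes> K) X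
          \<bullet> (assoc V ?A ?B K \<odot>\<^sub>1 iN X)"
    using O flat_Comp[of X Z "mcomp X Y Z \<cdot> (iV ?A \<otimes>\<^sub>1 mten_pre K X Y)" "assoc V ?A ?B K"]
    by (simp add: dflat_def flat_mcomp act.T1_Comp_right N.assoc')
  also have "\<dots> = dflat K X Z (mten_iso K X Z \<cdot> mcomp (K \<odot> X) Y Z)"
    using O by (simp add: dflat_mten_iso mpentagon N.assoc')
  finally show "dflat K X Z (mten_iso K X Z \<cdot> mcomp (K \<odot> X) Y Z)
      = dflat K X Z (c \<cdot> (iV ?A \<otimes>\<^sub>1 mten_iso K X Y))" by simp
qed (use O c(1-3) in simp_all)

end

section \<open>Cotensors, and the enrichment of a biclosed module\<close>

context biclosed_module
begin

lemma mcev_cancel: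
  assumes "mcev K Y \<bullet> (iV K \<odot>\<^sub>1 g) = mcev K Y \<bullet> (iV K \<odot>\<^sub>1 g')" "K \<in> Obj V" "Y \<in> Obj N"
    "g \<in> Arr N" "g' \<in> Arr N" "Dom N g = Dom N g'" "Cod N g = mcot K Y" "Cod N g' = mcot K Y"
  shows "g = g'"
proof -
  have "mcev K Y \<bullet> (iV K \<odot>\<^sub>1 g) \<in> hom N (K \<odot> Dom N g) Y" using assms(2-) by (simp add: hom_def)
  from mcev_universal[OF assms(2) _ assms(3) this] assms show ?thesis by (auto simp: hom_def)
qed

definition mcot_arr :: "'o \<Rightarrow> 'b \<Rightarrow> 'b" where
  "mcot_arr K g = (THE h. h \<in> hom N (mcot K (Dom N g)) (mcot K (Cod N g))
     \<and> mcev K (Cod N g) \<bullet> (iV K \<odot>\<^sub>1 h) = g \<bullet> mcev K (Dom N g))"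

lemma mcot_arr_simps [simp]:
  assumes "K \<in> Obj V" "g \<in> Arr N"
  shows "mcot_arr K g \<in> Arr N" "Dom N (mcot_arr K g) = mcot K (Dom N g)"
    "Cod N (mcot_arr K g) = mcot K (Cod N g)"
    "mcev K (Cod N g) \<bullet> (iV K \<odot>\<^sub>1 mcot_arr K g) = g \<bullet> mcev K (Dom N g)"
proof -
  have "g \<bullet> mcev K (Dom N g) \<in> hom N (K \<odot> mcot K (Dom N g)) (Cod N g)"
    using assms by (simp add: hom_def)
  from theI'[OF mcev_universal[OF assms(1) _ _ this]] assms
  show "mcot_arr K g \<in> Arr N" "Dom N (mcot_arr K g) = mcot K (Dom N g)"
    "Cod N (mcot_arr K g) = mcot K (Cod N g)"
    "mcev K (Cod N g) \<bullet> (iV K \<odot>\<^sub>1 mcot_arr K g) = g \<bullet> mcev K (Dom N g)"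
    by (simp_all add: mcot_arr_def hom_def)
qed

lemma mcot_arr_functor:
  assumes K: "K \<in> Obj V"
  shows "cat_functor N N \<lparr>FO = mcot K, FA = mcot_arr K\<rparr>"
proof unfold_locales
  fix Y assume Y: "Y \<in> Obj N"
  have "mcot_arr K (iN Y) = iN (mcot K Y)"
    by (rule mcev_cancel[of K Y]) (use K Y mcot_arr_simps(4)[of K "iN Y"] in simp_all)
  then show "FA \<lparr>FO = mcot K, FA = mcot_arr K\<rparr> (iN Y) = iN (FO \<lparr>FO = mcot K, FA = mcot_arr K\<rparr> Y)"
    by simp
next
  fix f g Y Z T assume "f \<in> hom N Y Z" "g \<in> hom N Z T"
  then have t: "f \<in> Arr N" "Dom N f = Y" "Cod N f = Z" "g \<in> Arr N" "Dom N g = Z" "Cod N g = T"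
    by (auto simp: hom_def)
  then have O: "Y \<in> Obj N" "Z \<in> Obj N" "T \<in> Obj N" by auto
  have e: "mcev K T \<bullet> (iV K \<odot>\<^sub>1 mcot_arr K g) = g \<bullet> mcev K Z"
    "mcev K Z \<bullet> (iV K \<odot>\<^sub>1 mcot_arr K f) = f \<bullet> mcev K Y"
    "mcev K T \<bullet> (iV K \<odot>\<^sub>1 mcot_arr K (g \<bullet> f)) = (g \<bullet> f) \<bullet> mcev K Y"
    using K t O mcot_arr_simps(4)[of K g] mcot_arr_simps(4)[of K f] mcot_arr_simps(4)[of K "g \<bullet> f"]
    by simp_all
  have "mcev K T \<bullet> (iV K \<odot>\<^sub>1 (mcot_arr K g \<bullet> mcot_arr K f))
      = mcev K T \<bullet> (iV K \<odot>\<^sub>1 mcot_arr K g) \<bullet> (iV K \<odot>\<^sub>1 mcot_arr K f)"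
    using K t O by (simp add: act.T1_merge)
  also have "\<dots> = g \<bullet> mcev K Z \<bullet> (iV K \<odot>\<^sub>1 mcot_arr K f)"
    by (rule N.square_tail[OF e(1)]) (use K t O in auto)
  also have "\<dots> = mcev K T \<bullet> (iV K \<odot>\<^sub>1 mcot_arr K (g \<bullet> f))"
    unfolding e using K t O by (simp add: N.assoc')
  finally have "mcot_arr K g \<bullet> mcot_arr K f = mcot_arr K (g \<bullet> f)"
    by (rule mcev_cancel) (use K t O in auto)
  then show "FA \<lparr>FO = mcot K, FA = mcot_arr K\<rparr> (g \<bullet> f)
      = FA \<lparr>FO = mcot K, FA = mcot_arr K\<rparr> g \<bullet> FA \<lparr>FO = mcot K, FA = mcot_arr K\<rparr> f" by simp
qed (use K in \<open>auto simp: hom_def\<close>)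

text \<open>The symmetry appears because \<open>mcev K Y\<close> evaluates a left factor
  \<open>K\<close>, whereas currying in \<open>V\<close> places \<open>K\<close> on the
  right.\<close>

definition mcot_pre :: "'o \<Rightarrow> 'n \<Rightarrow> 'n \<Rightarrow> 'a" where
  "mcot_pre K X Y = (let H = mhom X (mcot K Y) in sharp (H \<otimes> K) X Y
     (mcev K Y \<bullet> (iV K \<odot>\<^sub>1 mev X (mcot K Y)) \<bullet> massoc K H X \<bullet> (symm V H K \<odot>\<^sub>1 iN X)))"

lemma mcot_pre_simps [simp]:
  assumes "K \<in> Obj V" "X \<in> Obj N" "Y \<in> Obj N"
  shows "mcot_pre K X Y \<in> Arr V" "Dom V (mcot_pre K X Y) = mhom X (mcot K Y) \<otimes> K"
    "Cod V (mcot_pre K X Y) = mhom X Y"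
    "flat X Y (mcot_pre K X Y) = mcev K Y \<bullet> (iV K \<odot>\<^sub>1 mev X (mcot K Y))
      \<bullet> massoc K (mhom X (mcot K Y)) X \<bullet> (symm V (mhom X (mcot K Y)) K \<odot>\<^sub>1 iN X)"
  using assms by (simp_all add: mcot_pre_def Let_def)

definition mcot_iso :: "'o \<Rightarrow> 'n \<Rightarrow> 'n \<Rightarrow> 'a" where
  "mcot_iso K X Y = curry V (mhom X (mcot K Y)) K (mhom X Y) (mcot_pre K X Y)"

lemma mcot_iso_simps [simp]:
  assumes "K \<in> Obj V" "X \<in> Obj N" "Y \<in> Obj N"
  shows "mcot_iso K X Y \<in> Arr V" "Dom V (mcot_iso K X Y) = mhom X (mcot K Y)"
    "Cod V (mcot_iso K X Y) = ihom V K (mhom X Y)"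
    "ev V K (mhom X Y) \<cdot> (mcot_iso K X Y \<otimes>\<^sub>1 iV K) = mcot_pre K X Y"
  using assms curry[of "mcot_pre K X Y"] by (simp_all add: mcot_iso_def)

lemma dflat_mcot_iso:
  assumes "K \<in> Obj V" "X \<in> Obj N" "Y \<in> Obj N" "g \<in> Arr V" "Cod V g = mhom X (mcot K Y)"
  shows "dflat K X Y (mcot_iso K X Y \<cdot> g) = mcev K Y \<bullet> (iV K \<odot>\<^sub>1 flat X (mcot K Y) g)
    \<bullet> massoc K (Dom V g) X \<bullet> (symm V (Dom V g) K \<odot>\<^sub>1 iN X)"
proof -
  let ?H = "mhom X (mcot K Y)"
  have "ev V K (mhom X Y) \<cdot> ((mcot_iso K X Y \<cdot> g) \<otimes>\<^sub>1 iV K) = mcot_pre K X Y \<cdot> (g \<otimes>\<^sub>1 iV K)"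
    using assms triangle_tail[OF mcot_iso_simps(4)] by (simp add: T.T1_Comp_left)
  then have "dflat K X Y (mcot_iso K X Y \<cdot> g) = mcev K Y \<bullet> (iV K \<odot>\<^sub>1 mev X (mcot K Y))
      \<bullet> massoc K ?H X \<bullet> (symm V ?H K \<odot>\<^sub>1 iN X) \<bullet> ((g \<otimes>\<^sub>1 iV K) \<odot>\<^sub>1 iN X)"
    using assms by (simp add: dflat_def flat_Comp N.assoc')
  also have "\<dots> = mcev K Y \<bullet> (iV K \<odot>\<^sub>1 mev X (mcot K Y))
      \<bullet> massoc K ?H X \<bullet> ((iV K \<otimes>\<^sub>1 g) \<odot>\<^sub>1 iN X) \<bullet> (symm V (Dom V g) K \<odot>\<^sub>1 iN X)"
    using assms by (simp add: act.T1_merge symm_nat)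
  also have "\<dots> = mcev K Y \<bullet> (iV K \<odot>\<^sub>1 mev X (mcot K Y)) \<bullet> (iV K \<odot>\<^sub>1 g \<odot>\<^sub>1 iN X)
      \<bullet> massoc K (Dom V g) X \<bullet> (symm V (Dom V g) K \<odot>\<^sub>1 iN X)"
    using assms N.square_tail[OF massoc_nat[of "iV K" g "iN X"]] by simp
  also have "\<dots> = mcev K Y \<bullet> (iV K \<odot>\<^sub>1 flat X (mcot K Y) g)
      \<bullet> massoc K (Dom V g) X \<bullet> (symm V (Dom V g) K \<odot>\<^sub>1 iN X)"
    using assms by (simp add: act.T1_merge_tail flat_def)
  finally show ?thesis .
qed

lemma mcot_iso_iso:
  assumes O: "K \<in> Obj V" "X \<in> Obj N" "Y \<in> Obj N"
  shows "iso V (mcot_iso K X Y)"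
proof (rule iso_via_hom)
  let ?I = "ihom V K (mhom X Y)"
  let ?f = "dflat K X Y (iV ?I)"
  let ?u = "?f \<bullet> (symm V K ?I \<odot>\<^sub>1 iN X) \<bullet> inv_arr N (massoc K ?I X)"
  have f: "?f \<in> Arr N" "Dom N ?f = (?I \<otimes> K) \<odot> X" "Cod N ?f = Y"
    using O by (simp_all add: dflat_def)
  then have "?u \<in> hom N (K \<odot> ?I \<odot> X) Y" using O by (simp add: hom_def)
  \<comment> \<open>Two universal properties are inverted in turn: that of the cotensor gives
    \<open>h\<close>, that of the hom object gives \<open>?j\<close>.\<close>
  from mcev_universal[OF O(1) _ O(3) this] O
  obtain h where h: "h \<in> Arr N" "Dom N h = ?I \<odot> X" "Cod N h = mcot K Y"
    "mcev K Y \<bullet> (iV K \<odot>\<^sub>1 h) = ?u" by (auto simp: hom_def)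
  let ?j = "sharp ?I X (mcot K Y) h"
  have j: "?j \<in> Arr V" "Dom V ?j = ?I" "Cod V ?j = mhom X (mcot K Y)" "flat X (mcot K Y) ?j = h"
    using O h by simp_all
  have "dflat K X Y (mcot_iso K X Y \<cdot> ?j)
      = mcev K Y \<bullet> (iV K \<odot>\<^sub>1 h) \<bullet> massoc K ?I X \<bullet> (symm V ?I K \<odot>\<^sub>1 iN X)"
    using O j dflat_mcot_iso[of K X Y ?j] by simp
  also have "\<dots> = ?u \<bullet> massoc K ?I X \<bullet> (symm V ?I K \<odot>\<^sub>1 iN X)"
    by (rule N.triangle_tail[OF h(4)]) (use O h in auto)
  also have "\<dots> = ?f"
    using O f by (simp add: N.assoc' act.T1_merge symm_symm)
  finally have "mcot_iso K X Y \<cdot> ?j = iV ?I"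
    by (rule dflat_inj) (use O j in auto)
  then show "\<exists>j\<in>hom V (Cod V (mcot_iso K X Y)) (Dom V (mcot_iso K X Y)).
      mcot_iso K X Y \<cdot> j = iV (Cod V (mcot_iso K X Y))"
    using O j by (intro bexI[of _ ?j]) (auto simp: hom_def)
next
  let ?H = "mhom X (mcot K Y)"
  fix x y
  assume x: "x \<in> hom V (Dom V (mcot_iso K X Y)) (Dom V (mcot_iso K X Y))"
    and y: "y \<in> hom V (Dom V (mcot_iso K X Y)) (Dom V (mcot_iso K X Y))"
    and e: "mcot_iso K X Y \<cdot> x = mcot_iso K X Y \<cdot> y"
  have t: "x \<in> Arr V" "Dom V x = ?H" "Cod V x = ?H" "y \<in> Arr V" "Dom V y = ?H" "Cod V y = ?H"
    using x y O by (auto simp: hom_def)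
  have "(mcev K Y \<bullet> (iV K \<odot>\<^sub>1 flat X (mcot K Y) x)) \<bullet> massoc K ?H X \<bullet> (symm V ?H K \<odot>\<^sub>1 iN X)
      = (mcev K Y \<bullet> (iV K \<odot>\<^sub>1 flat X (mcot K Y) y)) \<bullet> massoc K ?H X \<bullet> (symm V ?H K \<odot>\<^sub>1 iN X)"
    using dflat_mcot_iso[of K X Y x] dflat_mcot_iso[of K X Y y] e t O by (simp add: N.assoc')
  then have "mcev K Y \<bullet> (iV K \<odot>\<^sub>1 flat X (mcot K Y) x) = mcev K Y \<bullet> (iV K \<odot>\<^sub>1 flat X (mcot K Y) y)"
    by (rule N.iso_cancel_right) (use t O in auto)
  then have "flat X (mcot K Y) x = flat X (mcot K Y) y"
    by (rule mcev_cancel) (use t O in auto)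
  then show "x = y" by (rule flat_inj) (use t O in auto)
qed (use O in simp)

text \<open>As in \<open>mten_natural\<close>, \<open>c\<close> stands for
  \<open>contra_act\<close>. Under \<open>dflat\<close>, one side moves \<open>K\<close> past the
  two hom objects one at a time, the other past their tensor product; \<open>hexagon_inv\<close>
  identifies the two.\<close>

lemma mcot_natural:
  assumes O: "K \<in> Obj V" "X \<in> Obj N" "Y \<in> Obj N" "Z \<in> Obj N"
    and c: "c \<in> Arr V" "Dom V c = ihom V K (mhom Y Z) \<otimes> mhom X Y" "Cod V c = ihom V K (mhom X Z)"
      "ev V K (mhom X Z) \<cdot> (c \<otimes>\<^sub>1 iV K) = mcomp X Y Z \<cdot> (ev V K (mhom Y Z) \<otimes>\<^sub>1 iV (mhom X Y))
          \<cdot> inv_arr V (assoc V (ihom V K (mhom Y Z)) K (mhom X Y))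
          \<cdot> (iV (ihom V K (mhom Y Z)) \<otimes>\<^sub>1 symm V (mhom X Y) K)
          \<cdot> assoc V (ihom V K (mhom Y Z)) (mhom X Y) K"
  shows "mcot_iso K X Z \<cdot> mcomp X Y (mcot K Z) = c \<cdot> (mcot_iso K Y Z \<otimes>\<^sub>1 iV (mhom X Y))"
proof (rule dflat_inj[of K X Z])
  let ?H = "mhom Y (mcot K Z)" and ?B = "mhom X Y" and ?I = "ihom V K (mhom Y Z)"
  let ?ci = "mcot_iso K Y Z"
  let ?r = "inv_arr V (assoc V ?H K ?B) \<cdot> (iV ?H \<otimes>\<^sub>1 symm V ?B K) \<cdot> assoc V ?H ?B K"
  have inv_nat: "inv_arr V (assoc V ?I K ?B) \<cdot> (?ci \<otimes>\<^sub>1 iV K \<otimes>\<^sub>1 iV ?B)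
      = ((?ci \<otimes>\<^sub>1 iV K) \<otimes>\<^sub>1 iV ?B) \<cdot> inv_arr V (assoc V ?H K ?B)"
    using O assoc_nat[of ?ci "iV K" "iV ?B"] by (intro slide[symmetric]) auto
  have "ev V K (mhom X Z) \<cdot> ((c \<cdot> (?ci \<otimes>\<^sub>1 iV ?B)) \<otimes>\<^sub>1 iV K)
      = ev V K (mhom X Z) \<cdot> (c \<otimes>\<^sub>1 iV K) \<cdot> ((?ci \<otimes>\<^sub>1 iV ?B) \<otimes>\<^sub>1 iV K)"
    using O c(1-3) by (simp add: T.T1_Comp_left)
  also have "\<dots> = (mcomp X Y Z \<cdot> (ev V K (mhom Y Z) \<otimes>\<^sub>1 iV ?B) \<cdot> inv_arr V (assoc V ?I K ?B)
      \<cdot> (iV ?I \<otimes>\<^sub>1 symm V ?B K) \<cdot> assoc V ?I ?B K) \<cdot> ((?ci \<otimes>\<^sub>1 iV ?B) \<otimes>\<^sub>1 iV K)"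
    by (rule triangle_tail[OF c(4)]) (use O c(1-3) in auto)
  also have "\<dots> = mcomp X Y Z \<cdot> (ev V K (mhom Y Z) \<otimes>\<^sub>1 iV ?B) \<cdot> inv_arr V (assoc V ?I K ?B)
      \<cdot> (iV ?I \<otimes>\<^sub>1 symm V ?B K) \<cdot> (?ci \<otimes>\<^sub>1 iV ?B \<otimes>\<^sub>1 iV K) \<cdot> assoc V ?H ?B K"
    using O assoc_nat[of ?ci "iV ?B" "iV K"] by (simp add: assoc')
  also have "\<dots> = mcomp X Y Z \<cdot> (ev V K (mhom Y Z) \<otimes>\<^sub>1 iV ?B) \<cdot> inv_arr V (assoc V ?I K ?B)
      \<cdot> (?ci \<otimes>\<^sub>1 iV K \<otimes>\<^sub>1 iV ?B) \<cdot> (iV ?H \<otimes>\<^sub>1 symm V ?B K) \<cdot> assoc V ?H ?B K"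
    using O by (simp add: T.T1_merge_tail)
  also have "\<dots> = mcomp X Y Z \<cdot> (ev V K (mhom Y Z) \<otimes>\<^sub>1 iV ?B) \<cdot> ((?ci \<otimes>\<^sub>1 iV K) \<otimes>\<^sub>1 iV ?B) \<cdot> ?r"
    using O square_tail[OF inv_nat] by simp
  also have "\<dots> = (mcomp X Y Z \<cdot> (mcot_pre K Y Z \<otimes>\<^sub>1 iV ?B)) \<cdot> ?r"
    using O by (simp add: assoc' T.T1_merge_tail)
  finally have "dflat K X Z (c \<cdot> (?ci \<otimes>\<^sub>1 iV ?B))
      = mcev K Z \<bullet> (iV K \<odot>\<^sub>1 mev Y (mcot K Z)) \<bullet> massoc K ?H Y
          \<bullet> (symm V ?H K \<odot>\<^sub>1 iN Y) \<bullet> (iV (?H \<otimes> K) \<odot>\<^sub>1 mev X Y) \<bullet> massoc (?H \<otimes> K) ?B X \<bullet> (?r \<odot>\<^sub>1 iN X)"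
    using O flat_Comp[of X Z "mcomp X Y Z \<cdot> (mcot_pre K Y Z \<otimes>\<^sub>1 iV ?B)" ?r]
    by (simp add: dflat_def flat_mcomp N.assoc')
  also have "\<dots> = mcev K Z \<bullet> (iV K \<odot>\<^sub>1 mev Y (mcot K Z)) \<bullet> massoc K ?H Y
      \<bullet> ((iV K \<otimes>\<^sub>1 iV ?H) \<odot>\<^sub>1 mev X Y) \<bullet> (symm V ?H K \<odot>\<^sub>1 iV ?B \<odot>\<^sub>1 iN X) \<bullet> massoc (?H \<otimes> K) ?B X
      \<bullet> (?r \<odot>\<^sub>1 iN X)"
    using O by (simp add: act.T1_merge_tail)
  also have "\<dots> = mcev K Z \<bullet> (iV K \<odot>\<^sub>1 mev Y (mcot K Z)) \<bullet> (iV K \<odot>\<^sub>1 iV ?H \<odot>\<^sub>1 mev X Y)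
      \<bullet> massoc K ?H (?B \<odot> X) \<bullet> massoc (K \<otimes> ?H) ?B X \<bullet> ((symm V ?H K \<otimes>\<^sub>1 iV ?B) \<odot>\<^sub>1 iN X)
      \<bullet> (?r \<odot>\<^sub>1 iN X)"
    using O N.square_tail[OF massoc_nat[of "iV K" "iV ?H" "mev X Y"]]
      N.square_tail[OF massoc_nat[of "symm V ?H K" "iV ?B" "iN X"]]
    by (simp del: T.T1_Ide act.T1_Ide)
  also have "\<dots> = mcev K Z \<bullet> (iV K \<odot>\<^sub>1 mev Y (mcot K Z)) \<bullet> (iV K \<odot>\<^sub>1 iV ?H \<odot>\<^sub>1 mev X Y)
      \<bullet> (iV K \<odot>\<^sub>1 massoc ?H ?B X) \<bullet> massoc K (?H \<otimes> ?B) X \<bullet> (assoc V K ?H ?B \<odot>\<^sub>1 iN X)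
      \<bullet> ((symm V ?H K \<otimes>\<^sub>1 iV ?B) \<odot>\<^sub>1 iN X) \<bullet> (?r \<odot>\<^sub>1 iN X)"
    using O N.square_tail[OF mpentagon[of K ?H ?B X, symmetric]] by (simp add: N.assoc')
  \<comment> \<open>The three factors acting through \<open>- \<odot>\<^sub>1 iN X\<close> on the
    right now merge to the left side of \<open>hexagon_inv\<close> for \<open>?H\<close>,
    \<open>?B\<close>, \<open>K\<close>.\<close>
  also have "\<dots> = mcev K Z \<bullet> (iV K \<odot>\<^sub>1 mev Y (mcot K Z)) \<bullet> (iV K \<odot>\<^sub>1 iV ?H \<odot>\<^sub>1 mev X Y)
      \<bullet> (iV K \<odot>\<^sub>1 massoc ?H ?B X) \<bullet> massoc K (?H \<otimes> ?B) X \<bullet> (symm V (?H \<otimes> ?B) K \<odot>\<^sub>1 iN X)"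
    using O hexagon_inv[of ?H ?B K] by (simp add: act.T1_merge)
  also have "\<dots> = dflat K X Z (mcot_iso K X Z \<cdot> mcomp X Y (mcot K Z))"
    using O by (simp add: dflat_mcot_iso act.T1_Comp_right N.assoc')
  finally show "dflat K X Z (mcot_iso K X Z \<cdot> mcomp X Y (mcot K Z))
      = dflat K X Z (c \<cdot> (?ci \<otimes>\<^sub>1 iV ?B))" by simp
qed (use O c(1-3) in simp_all)

definition enrichment :: "('n, 'o, 'a) tcvcat" where
  "enrichment = \<lparr>VObj = Obj N, VHom = mhom, vcomp = mcomp, vid = mid,
     ten = act, ten_iso = mten_iso, cot = mcot, cot_iso = mcot_iso\<rparr>"

lemma enrichment_sel [simp]:
  "VObj enrichment = Obj N" "VHom enrichment = mhom" "vcomp enrichment = mcomp" "vid enrichment = mid"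
  "ten enrichment = act" "ten_iso enrichment = mten_iso" "cot enrichment = mcot"
  "cot_iso enrichment = mcot_iso"
  by (simp_all add: enrichment_def)

lemma enrichment_tensored_cotensored: "tensored_cotensored_category V enrichment"
proof
  fix K X Y Z assume O: "K \<in> Obj V" "X \<in> VObj enrichment" "Y \<in> VObj enrichment" "Z \<in> VObj enrichment"
  show "ten_iso enrichment K X Z \<cdot> vcomp enrichment (ten enrichment K X) Y Z
      = cov_act V enrichment K X Y Z \<cdot> (iV (VHom enrichment Y Z) \<otimes>\<^sub>1 ten_iso enrichment K X Y)"
    unfolding cov_act_def enrichment_sel
    by (rule mten_natural; (rule curry)?) (use O in simp_all)
  show "cot_iso enrichment K X Z \<cdot> vcomp enrichment X Y (cot enrichment K Z)
      = contra_act V enrichment K X Y Z \<cdot> (cot_iso enrichment K Y Z \<otimes>\<^sub>1 iV (VHom enrichment X Y))"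
    unfolding contra_act_def enrichment_sel Let_def
    by (rule mcot_natural; (rule curry)?) (use O in simp_all)
qed (simp_all add: hom_def mcomp_assoc mcomp_mid_left mcomp_mid_right mten_iso_iso mcot_iso_iso)

text \<open>An arrow \<open>E \<rightarrow> mhom X Y\<close> is by transposition an arrow
  \<open>E \<odot> X \<rightarrow> Y\<close>; precomposition with \<open>munit X\<close> produces
  these from the arrows \<open>X \<rightarrow> Y\<close>.\<close>

definition underlying_iso :: "('n, 'b, 'n, ('n, 'a) und_arr) ftor" where
  "underlying_iso = \<lparr>FO = (\<lambda>X. X),
     FA = (\<lambda>f. (Dom N f, Cod N f, sharp E (Dom N f) (Cod N f) (f \<bullet> munit (Dom N f))))\<rparr>"

lemma underlying_enrichment_iso:
  assumes munit_iso: "\<And>X. X \<in> Obj N \<Longrightarrow> iso N (munit X)"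
  shows "cat_isomorphism N (underlying V enrichment) underlying_iso"
proof -
  let ?U = "underlying V enrichment"
  interpret H: tensored_cotensored_category V enrichment
    by (rule enrichment_tensored_cotensored)
  let ?s = "\<lambda>f. sharp E (Dom N f) (Cod N f) (f \<bullet> munit (Dom N f))"
  have s: "?s f \<in> Arr V" "Dom V (?s f) = E" "Cod V (?s f) = mhom (Dom N f) (Cod N f)"
    "flat (Dom N f) (Cod N f) (?s f) = f \<bullet> munit (Dom N f)" if "f \<in> Arr N" for f
    using that by simp_all
  have bij: "bij_betw (FA underlying_iso) (Arr N) (Arr ?U)"
  proof (rule bij_betwI')
    fix f g assume f: "f \<in> Arr N" and g: "g \<in> Arr N"
    show "FA underlying_iso f = FA underlying_iso g \<longleftrightarrow> f = g"
    proof
      assume "FA underlying_iso f = FA underlying_iso g"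
      then have e: "Dom N f = Dom N g" "Cod N f = Cod N g" "?s f = ?s g"
        by (auto simp: underlying_iso_def)
      have "f \<bullet> munit (Dom N f) = g \<bullet> munit (Dom N f)"
        using s(4)[OF f] s(4)[OF g] e by metis
      then show "f = g" by (rule N.iso_cancel_right) (use f g e munit_iso in auto)
    qed simp
  next
    fix f assume "f \<in> Arr N"
    then show "FA underlying_iso f \<in> Arr ?U"
      by (auto simp: underlying_def underlying_iso_def hom_def)
  next
    fix u assume "u \<in> Arr ?U"
    then obtain X Y g where u: "u = (X, Y, g)" "X \<in> Obj N" "Y \<in> Obj N" "g \<in> Arr V" "Dom V g = E"
      "Cod V g = mhom X Y" by (auto simp: underlying_def hom_def)
    \<comment> \<open>The preimage of \<open>g\<close>; it exists because \<open>munit X\<close> is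
      invertible.\<close>
    let ?f = "flat X Y g \<bullet> inv_arr N (munit X)"
    have f: "?f \<in> Arr N" "Dom N ?f = X" "Cod N ?f = Y" "?f \<bullet> munit X = flat X Y g"
      using u munit_iso by (simp_all add: N.assoc')
    have "flat X Y (sharp E X Y (flat X Y g)) = flat X Y g" using u by simp
    then have "sharp E X Y (flat X Y g) = g" by (rule flat_inj) (use u in auto)
    then show "\<exists>f\<in>Arr N. u = FA underlying_iso f"
      using f u by (intro bexI[of _ ?f]) (simp_all add: underlying_iso_def)
  qed
  have comp: "FA underlying_iso (g \<bullet> f) = FA underlying_iso g \<cdot>\<^bsub>?U\<^esub> FA underlying_iso f"
    if f: "f \<in> hom N X Y" and g: "g \<in> hom N Y Z" for f g X Y Z
  proof -
    have t: "f \<in> Arr N" "Dom N f = X" "Cod N f = Y" "g \<in> Arr N" "Dom N g = Y" "Cod N g = Z"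
      using f g by (auto simp: hom_def)
    then have O: "X \<in> Obj N" "Y \<in> Obj N" "Z \<in> Obj N" by auto
    let ?f = "sharp E X Y (f \<bullet> munit X)" and ?g = "sharp E Y Z (g \<bullet> munit Y)"
    have "sharp E X Z ((g \<bullet> f) \<bullet> munit X) = mcomp X Y Z \<cdot> (?g \<otimes>\<^sub>1 ?f) \<cdot> inv_arr V (lunit V E)"
    proof (rule flat_inj[of X Z])
      have "flat X Z (mcomp X Y Z \<cdot> (?g \<otimes>\<^sub>1 ?f) \<cdot> inv_arr V (lunit V E))
          = flat X Z (mcomp X Y Z \<cdot> (?g \<otimes>\<^sub>1 ?f)) \<bullet> (inv_arr V (lunit V E) \<odot>\<^sub>1 iN X)"
        using O t flat_Comp[of X Z "mcomp X Y Z \<cdot> (?g \<otimes>\<^sub>1 ?f)" "inv_arr V (lunit V E)"]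
        by (simp add: assoc')
      also have "\<dots> = g \<bullet> munit Y \<bullet> (iV E \<odot>\<^sub>1 (f \<bullet> munit X)) \<bullet> massoc E E X \<bullet> (inv_arr V (lunit V E) \<odot>\<^sub>1 iN X)"
        using O t by (simp add: flat_mcomp N.assoc')
      also have "\<dots> = g \<bullet> (f \<bullet> munit X) \<bullet> munit (E \<odot> X) \<bullet> massoc E E X \<bullet> (inv_arr V (lunit V E) \<odot>\<^sub>1 iN X)"
        using O t N.square_tail[OF munit_nat[of "f \<bullet> munit X" Y]] by simp
      also have "\<dots> = g \<bullet> (f \<bullet> munit X) \<bullet> (lunit V E \<odot>\<^sub>1 iN X) \<bullet> (inv_arr V (lunit V E) \<odot>\<^sub>1 iN X)"
        using O t N.triangle_tail[OF mtriangle_left[of E X]] by simp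
      also have "\<dots> = (g \<bullet> f) \<bullet> munit X"
        using O t by (simp add: act.T1_merge N.assoc')
      finally show "flat X Z (sharp E X Z ((g \<bullet> f) \<bullet> munit X))
          = flat X Z (mcomp X Y Z \<cdot> (?g \<otimes>\<^sub>1 ?f) \<cdot> inv_arr V (lunit V E))"
        using O t by simp
    qed (use O t in simp_all)
    then show ?thesis using t by (simp add: underlying_iso_def underlying_def)
  qed
  have sI: "sharp E X X (munit X) = mid X" for X by (simp add: mid_def)
  have F: "FA underlying_iso f \<in> hom ?U X Y" if "f \<in> hom N X Y" for f X Y
    using s[of f] that by (auto simp: underlying_iso_def underlying_def hom_def)
  have ex: "\<exists>f\<in>hom N X Y. u = FA underlying_iso f" if u: "u \<in> hom ?U X Y" for u X Y
  proof -
    obtain f where "f \<in> Arr N" "u = FA underlying_iso f"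
      using bij_betw_imp_surj_on[OF bij] homD(1)[OF u] by blast
    then show ?thesis using u by (auto simp: hom_def underlying_iso_def underlying_def)
  qed
  have I: "Ide ?U X = FA underlying_iso (iN X)" if "X \<in> Obj N" for X
    using that by (simp add: underlying_def underlying_iso_def sI)
  \<comment> \<open>The category laws are carried over from \<open>N\<close>: every arrow of
    \<open>?U\<close> is an image (\<open>ex\<close>), and composites are images of composites
    (\<open>comp\<close>).\<close>
  have U: "category ?U"
  proof
    fix f g X Y Z assume "f \<in> hom ?U X Y" "g \<in> hom ?U Y Z"
    then obtain f' g' where f: "f' \<in> hom N X Y" "g' \<in> hom N Y Z"
      "f = FA underlying_iso f'" "g = FA underlying_iso g'" using ex by blast
    show "g \<cdot>\<^bsub>?U\<^esub> f \<in> hom ?U X Z"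
      using F[OF N.Comp_in_hom[OF f(1,2)]] comp[OF f(1,2)] f(3,4) by simp
  next
    fix f X Y assume "f \<in> hom ?U X Y"
    then obtain f' where f': "f' \<in> hom N X Y" "f = FA underlying_iso f'" using ex by blast
    note O = N.hom_Obj[OF f'(1)]
    show "f \<cdot>\<^bsub>?U\<^esub> Ide ?U X = f" "Ide ?U Y \<cdot>\<^bsub>?U\<^esub> f = f"
      using comp[OF N.Ide_in_hom[OF O(1)] f'(1)] comp[OF f'(1) N.Ide_in_hom[OF O(2)]]
        N.Comp_Ide[OF f'(1)] N.Ide_Comp[OF f'(1)] I O f'(2) by simp_all
  next
    fix f g h A B C D assume h: "f \<in> hom ?U A B" "g \<in> hom ?U B C" "h \<in> hom ?U C D"
    obtain f' g' h' where f: "f' \<in> hom N A B" "g' \<in> hom N B C" "h' \<in> hom N C D"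
      "f = FA underlying_iso f'" "g = FA underlying_iso g'" "h = FA underlying_iso h'"
      using ex[OF h(1)] ex[OF h(2)] ex[OF h(3)] by (elim bexE)
    show "(h \<cdot>\<^bsub>?U\<^esub> g) \<cdot>\<^bsub>?U\<^esub> f = h \<cdot>\<^bsub>?U\<^esub> g \<cdot>\<^bsub>?U\<^esub> f"
      unfolding f(4-6) comp[OF f(1,2), symmetric] comp[OF f(2,3), symmetric]
        comp[OF f(1) N.Comp_in_hom[OF f(2,3)], symmetric] comp[OF N.Comp_in_hom[OF f(1,2)] f(3), symmetric]
        N.Comp_assoc[OF f(1-3)] ..
  next
    fix X assume "X \<in> Obj ?U"
    then show "Ide ?U X \<in> hom ?U X X" using I F N.Ide_in_hom by (simp add: underlying_def)
  qed (auto simp: underlying_def)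
  have "cat_functor N ?U underlying_iso"
  proof (intro cat_functor.intro cat_functor_axioms.intro U N.category_axioms comp)
    fix X assume X: "X \<in> Obj N"
    then show "FO underlying_iso X \<in> Obj ?U" by (simp add: underlying_def underlying_iso_def)
    show "FA underlying_iso (iN X) = Ide ?U (FO underlying_iso X)"
      using I[OF X] by (simp add: underlying_iso_def)
  next
    fix f X Y assume "f \<in> hom N X Y"
    then show "FA underlying_iso f \<in> hom ?U (FO underlying_iso X) (FO underlying_iso Y)"
      using F by (simp add: underlying_iso_def)
  qed
  then show ?thesis using bij
    by (simp add: cat_isomorphism_def) (simp add: underlying_iso_def underlying_def bij_betw_def)
qed

end

section \<open>Derived functors\<close>

context cat_functor
begin

lemma FA_simps [simp]:
  assumes "f \<in> Arr C"
  shows "FA F f \<in> Arr D" "Dom D (FA F f) = FO F (Dom C f)" "Cod D (FA F f) = FO F (Cod C f)"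
  using FA_in_hom[OF homI[OF assms]] by (auto simp: hom_def)

lemma FO_simps [simp]: "X \<in> Obj C \<Longrightarrow> FO F X \<in> Obj D"
  by (rule FO_in_Obj)

lemma FA_Ide' [simp]: "X \<in> Obj C \<Longrightarrow> FA F (Ide C X) = Ide D (FO F X)"
  by (rule FA_Ide)

lemma FA_Comp':
  "f \<in> Arr C \<Longrightarrow> g \<in> Arr C \<Longrightarrow> Dom C g = Cod C f \<Longrightarrow> FA F (g \<cdot>\<^bsub>C\<^esub> f) = FA F g \<cdot>\<^bsub>D\<^esub> FA F f"
  using FA_Comp[of f "Dom C f" "Cod C f" g "Cod C g"] by (auto simp: hom_def)

lemma FA_iso [simp]:
  assumes "iso C f"
  shows "iso D (FA F f)" "inv_arr D (FA F f) = FA F (inv_arr C f)"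
  using assms C.iso_Arr[OF assms] FA_Comp'[of f "inv_arr C f"] FA_Comp'[of "inv_arr C f" f]
    D.isoI[of "FA F f" "FA F (inv_arr C f)"] by simp_all

end

lemma (in category) id_functor: "cat_functor C C \<lparr>FO = (\<lambda>X. X), FA = (\<lambda>f. f)\<rparr>"
  by unfold_locales (auto simp: hom_def)

lemma cat_functor_comp:
  assumes "cat_functor C D F" "cat_functor D D' G"
  shows "cat_functor C D' \<lparr>FO = (\<lambda>X. FO G (FO F X)), FA = (\<lambda>f. FA G (FA F f))\<rparr>"
proof -
  interpret F: cat_functor C D F by fact
  interpret G: cat_functor D D' G by fact
  show ?thesis by unfold_locales (auto simp: hom_def F.FA_Comp' G.FA_Comp')
qed

section \<open>Induction and naturality in the localization\<close>

context localizable
begin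

sublocale Ho: category "ho_cat C W"
  by (rule category_ho_cat)

lemma Obj_ho_cat [simp]: "Obj (ho_cat C W) = Obj C"
  by (simp add: ho_cat_def)

lemma ho_arr_simps [simp]:
  assumes "f \<in> Arr C"
  shows "ho_arr C W f \<in> Arr (ho_cat C W)" "Dom (ho_cat C W) (ho_arr C W f) = Dom C f"
    "Cod (ho_cat C W) (ho_arr C W f) = Cod C f"
  using cat_functor.FA_simps[OF ho_ftor_functor assms] by (simp_all add: ho_ftor_def)

lemma ho_arr_Ide [simp]: "X \<in> Obj C \<Longrightarrow> ho_arr C W (Ide C X) = Ide (ho_cat C W) X"
  using cat_functor.FA_Ide[OF ho_ftor_functor] by (simp add: ho_ftor_def)

lemma ho_merge:
  "f \<in> Arr C \<Longrightarrow> g \<in> Arr C \<Longrightarrow> Dom C g = Cod C f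
     \<Longrightarrow> ho_arr C W g \<cdot>\<^bsub>ho_cat C W\<^esub> ho_arr C W f = ho_arr C W (g \<cdot> f)"
  using ho_comp_Fwd[of f "Dom C f" "Cod C f" g "Cod C g"] by (simp add: hom_def)

lemma ho_merge_tail:
  "f \<in> Arr C \<Longrightarrow> g \<in> Arr C \<Longrightarrow> Dom C g = Cod C f \<Longrightarrow> x \<in> Arr (ho_cat C W)
     \<Longrightarrow> Cod (ho_cat C W) x = Dom C f
     \<Longrightarrow> ho_arr C W g \<cdot>\<^bsub>ho_cat C W\<^esub> ho_arr C W f \<cdot>\<^bsub>ho_cat C W\<^esub> x = ho_arr C W (g \<cdot> f) \<cdot>\<^bsub>ho_cat C W\<^esub> x"
  by (rule Ho.triangle_tail[OF ho_merge]) auto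

lemma weq_simps [simp]: "w \<in> W \<Longrightarrow> iso (ho_cat C W) (ho_arr C W w)"
  by (rule ho_arr_iso)

lemma iso_ho_arr [simp]: "iso C f \<Longrightarrow> iso (ho_cat C W) (ho_arr C W f)"
  using cat_functor.FA_iso(1)[OF ho_ftor_functor] by (simp add: ho_ftor_def)

lemma weq_in_Arr: "w \<in> W \<Longrightarrow> w \<in> Arr C"
  using W_Arr by auto

lemma ho_slide:
  assumes "p \<cdot> f = g \<cdot> q" "p \<in> W" "q \<in> W" "f \<in> Arr C" "g \<in> Arr C"
    "Dom C p = Cod C f" "Dom C g = Cod C q"
  shows "ho_arr C W f \<cdot>\<^bsub>ho_cat C W\<^esub> inv_arr (ho_cat C W) (ho_arr C W q)
    = inv_arr (ho_cat C W) (ho_arr C W p) \<cdot>\<^bsub>ho_cat C W\<^esub> ho_arr C W g"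
proof (rule Ho.slide)
  show "ho_arr C W p \<cdot>\<^bsub>ho_cat C W\<^esub> ho_arr C W f = ho_arr C W g \<cdot>\<^bsub>ho_cat C W\<^esub> ho_arr C W q"
    using assms weq_in_Arr by (simp add: ho_merge)
qed (use assms weq_in_Arr in auto)

lemma ho_slide_tail:
  assumes "p \<cdot> f = g \<cdot> q" "p \<in> W" "q \<in> W" "f \<in> Arr C" "g \<in> Arr C"
    "Dom C p = Cod C f" "Dom C g = Cod C q"
    "x \<in> Arr (ho_cat C W)" "Cod (ho_cat C W) x = Cod C q"
  shows "ho_arr C W f \<cdot>\<^bsub>ho_cat C W\<^esub> inv_arr (ho_cat C W) (ho_arr C W q) \<cdot>\<^bsub>ho_cat C W\<^esub> x
    = inv_arr (ho_cat C W) (ho_arr C W p) \<cdot>\<^bsub>ho_cat C W\<^esub> ho_arr C W g \<cdot>\<^bsub>ho_cat C W\<^esub> x"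
proof (rule Ho.slide_tail)
  show "ho_arr C W p \<cdot>\<^bsub>ho_cat C W\<^esub> ho_arr C W f = ho_arr C W g \<cdot>\<^bsub>ho_cat C W\<^esub> ho_arr C W q"
    using assms weq_in_Arr by (simp add: ho_merge)
qed (use assms weq_in_Arr in auto)

text \<open>A zigzag is a composite of images of arrows and of inverses of images of weak
  equivalences, so these generate the localization.\<close>

lemma ho_arr_induct [consumes 1, case_names Fwd Bwd Comp]:
  assumes "\<alpha> \<in> Arr (ho_cat C W)"
    and F: "\<And>f. f \<in> Arr C \<Longrightarrow> P (ho_arr C W f)"
    and B: "\<And>w. w \<in> W \<Longrightarrow> P (inv_arr (ho_cat C W) (ho_arr C W w))"
    and comp: "\<And>\<alpha> \<beta>. \<alpha> \<in> Arr (ho_cat C W) \<Longrightarrow> \<beta> \<in> Arr (ho_cat C W)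
      \<Longrightarrow> Dom (ho_cat C W) \<beta> = Cod (ho_cat C W) \<alpha> \<Longrightarrow> P \<alpha> \<Longrightarrow> P \<beta> \<Longrightarrow> P (\<beta> \<cdot>\<^bsub>ho_cat C W\<^esub> \<alpha>)"
  shows "P \<alpha>"
proof -
  have cls: "ho_class C W X Y p \<in> Arr (ho_cat C W) \<and> Dom (ho_cat C W) (ho_class C W X Y p) = X
      \<and> Cod (ho_cat C W) (ho_class C W X Y p) = Y" if "zz_path C W X p Y" for X Y p
    using that ho_hom_iff[of "ho_class C W X Y p" X Y] by (auto simp: hom_def)
  have "P (ho_class C W X Y p)" if "zz_path C W X p Y" for X Y p
    using that
  proof (induction rule: zz_path.induct)
    case (Nil X)
    then show ?case using F[of "Ide C X"] by (simp add: ho_cat_def)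
  next
    case (Fwd f p Y)
    note f = zz_path_Fwd[OF homI[OF Fwd(1)]]
    have "ho_class C W (Dom C f) Y (Fwd f # p)
        = ho_class C W (Cod C f) Y p \<cdot>\<^bsub>ho_cat C W\<^esub> ho_arr C W f"
      using ho_comp_class[OF f Fwd(2)] by (simp add: ho_cat_def ho_arr_def)
    then show ?case using cls[OF Fwd(2)] Fwd(1,3) F comp by simp
  next
    case (Bwd w p Y)
    note b = zz_path_Bwd[OF Bwd(1)]
    have "ho_class C W (Cod C w) Y (Bwd w # p)
        = ho_class C W (Dom C w) Y p \<cdot>\<^bsub>ho_cat C W\<^esub> inv_arr (ho_cat C W) (ho_arr C W w)"
      using ho_comp_class[OF b Bwd(2)] Ho.inv_arr_eq[OF ho_arr_inverse[OF Bwd(1)]]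
      by (simp add: ho_cat_def)
    then show ?case using cls[OF Bwd(2)] Bwd(1,3) weq_in_Arr B comp by simp
  qed
  then show ?thesis using assms(1) by (auto simp: ho_cat_def)
qed

text \<open>The two-dimensional part of the universal property: naturality on images of arrows of
  \<open>C\<close> suffices. At a formal inverse the square is turned around by
  \<open>slide\<close>, and for composites squares are pasted.\<close>

lemma ho_natural:
  assumes "\<alpha> \<in> Arr (ho_cat C W)"
    and "cat_functor (ho_cat C W) D G" "cat_functor (ho_cat C W) D G'"
    and t: "\<And>X. X \<in> Obj C \<Longrightarrow> t X \<in> Arr D" "\<And>X. X \<in> Obj C \<Longrightarrow> Dom D (t X) = FO G X"
      "\<And>X. X \<in> Obj C \<Longrightarrow> Cod D (t X) = FO G' X"
    and nat: "\<And>f. f \<in> Arr C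
      \<Longrightarrow> t (Cod C f) \<cdot>\<^bsub>D\<^esub> FA G (ho_arr C W f) = FA G' (ho_arr C W f) \<cdot>\<^bsub>D\<^esub> t (Dom C f)"
  shows "t (Cod (ho_cat C W) \<alpha>) \<cdot>\<^bsub>D\<^esub> FA G \<alpha> = FA G' \<alpha> \<cdot>\<^bsub>D\<^esub> t (Dom (ho_cat C W) \<alpha>)"
proof -
  let ?H = "ho_cat C W"
  interpret G: cat_functor ?H D G by fact
  interpret G': cat_functor ?H D G' by fact
  have O: "Dom ?H x \<in> Obj C" "Cod ?H x \<in> Obj C" if "x \<in> Arr ?H" for x
    using Ho.Obj_simps[OF that] by simp_all
  from assms(1) show ?thesis
  proof (induction rule: ho_arr_induct)
    case (Fwd f)
    then show ?case using nat by simp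
  next
    case (Bwd w)
    note w = weq_in_Arr[OF Bwd]
    have "FA G' (ho_arr C W w) \<cdot>\<^bsub>D\<^esub> t (Dom C w) = t (Cod C w) \<cdot>\<^bsub>D\<^esub> FA G (ho_arr C W w)"
      using nat[OF w] by simp
    from G.D.slide[OF this] show ?case using w Bwd t by simp
  next
    case (Comp \<alpha> \<beta>)
    have "t (Cod ?H \<beta>) \<cdot>\<^bsub>D\<^esub> FA G \<beta> \<cdot>\<^bsub>D\<^esub> FA G \<alpha> = FA G' \<beta> \<cdot>\<^bsub>D\<^esub> t (Dom ?H \<beta>) \<cdot>\<^bsub>D\<^esub> FA G \<alpha>"
      by (rule G.D.square_tail[OF Comp(5)]) (use Comp(1-3) O t in auto)
    also have "\<dots> = FA G' \<beta> \<cdot>\<^bsub>D\<^esub> FA G' \<alpha> \<cdot>\<^bsub>D\<^esub> t (Dom ?H \<alpha>)"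
      using Comp(3,4) by simp
    finally show ?case
      using Comp(1-3) O t by (simp add: G.FA_Comp' G'.FA_Comp' G.D.assoc')
  qed
qed

end

context homotopical_category
begin

sublocale localizable C W
  by unfold_locales (rule weq_Arr)

lemma weq_Ide [simp]: "X \<in> Obj C \<Longrightarrow> Ide C X \<in> W"
  by (rule Ide_weq)

text \<open>Two-out-of-six with an identity between \<open>f\<close> and \<open>g\<close>; the two
  cancellation laws that follow place the identity at an end.\<close>

lemma weq_Comp:
  assumes "f \<in> W" "g \<in> W" "Dom C g = Cod C f"
  shows "g \<cdot> f \<in> W"
  using two_of_six[of f "Dom C f" "Cod C f" "Ide C (Cod C f)" "Cod C f" g "Cod C g"] assms
    weq_in_Arr[OF assms(1)] weq_in_Arr[OF assms(2)] by (simp add: hom_def)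

lemma weq_cancel_left:
  assumes "g \<in> W" "g \<cdot> f \<in> W" "f \<in> Arr C" "Dom C g = Cod C f"
  shows "f \<in> W"
  using two_of_six[of f "Dom C f" "Cod C f" g "Cod C g" "Ide C (Cod C g)" "Cod C g"] assms
    weq_in_Arr[OF assms(1)] by (simp add: hom_def)

lemma weq_cancel_right:
  assumes "f \<in> W" "g \<cdot> f \<in> W" "g \<in> Arr C" "Dom C g = Cod C f"
  shows "g \<in> W"
  using two_of_six[of "Ide C (Dom C f)" "Dom C f" "Dom C f" f "Cod C f" g "Cod C g"] assms
    weq_in_Arr[OF assms(1)] by (simp add: hom_def)

end

locale left_deformed = homotopical_category C W
  for C :: "('o, 'a, 'z) cat_scheme" (structure) and W +
  fixes Q :: "('o, 'a, 'o, 'a) ftor" and q :: "'o \<Rightarrow> 'a" and S :: "'o set"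
  assumes deformation: "left_deformation C W Q q"
    and Q_S: "X \<in> Obj C \<Longrightarrow> FO Q X \<in> S"
    and S_Obj: "S \<subseteq> Obj C"
begin

sublocale Q: cat_functor C C Q
  using deformation by (simp add: left_deformation_def nat_trans_def)

lemma q_simps [simp]:
  assumes "X \<in> Obj C"
  shows "q X \<in> Arr C" "Dom C (q X) = FO Q X" "Cod C (q X) = X" "q X \<in> W" "FO Q X \<in> S"
  using deformation assms Q_S by (auto simp: left_deformation_def nat_trans_def id_ftor_def hom_def)

lemma q_nat: "f \<in> Arr C \<Longrightarrow> Cod C f = Y \<Longrightarrow> q Y \<cdot> FA Q f = f \<cdot> q (Dom C f)"
  using deformation homI[of f C] by (auto simp: left_deformation_def nat_trans_def id_ftor_def)

lemma S_Obj' [simp]: "X \<in> S \<Longrightarrow> X \<in> Obj C"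
  using S_Obj by auto

text \<open>Two-out-of-three in the naturality square of \<open>q\<close> at
  \<open>w\<close>.\<close>

lemma Q_weq [simp]:
  assumes "w \<in> W"
  shows "FA Q w \<in> W"
proof -
  note w = weq_in_Arr[OF assms]
  have "w \<cdot> q (Dom C w) \<in> W" by (rule weq_Comp) (use w assms in auto)
  then have "q (Cod C w) \<cdot> FA Q w \<in> W" using q_nat[OF w HOL.refl] by simp
  then show ?thesis by (rule weq_cancel_left[rotated]) (use w in auto)
qed

lemma weq_onI [simp]: "w \<in> W \<Longrightarrow> Dom C w \<in> S \<Longrightarrow> Cod C w \<in> S \<Longrightarrow> w \<in> weq_on C W S"
  by (simp add: weq_on_def)

text \<open>\<open>Q q\<close> and \<open>q Q\<close> need not be equal, but every functor that inverts the weak equivalences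
  between objects of the retract identifies them.\<close>

lemma Q_q_eq_q_Q:
  assumes "cat_functor C D F" and inv: "\<And>w. w \<in> weq_on C W S \<Longrightarrow> iso D (FA F w)" and X: "X \<in> Obj C"
  shows "FA F (FA Q (q X)) = FA F (q (FO Q X))"
proof -
  interpret F: cat_functor C D F by fact
  let ?QX = "FO Q X"
  \<comment> \<open>\<open>Q\<close> applied to naturality of \<open>q\<close> at
    \<open>q X\<close>. Since \<open>F\<close> inverts \<open>FA Q (q X)\<close>, this yields
    \<open>e\<close>, which is the desired identity with one more \<open>Q\<close> applied on both
    sides.\<close>
  have "FA Q (q X) \<cdot> FA Q (FA Q (q X)) = FA Q (q X) \<cdot> FA Q (q ?QX)"
    using X q_nat[of "q X" X] by (simp add: Q.FA_Comp'[symmetric])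
  then have "FA F (FA Q (q X)) \<cdot>\<^bsub>D\<^esub> FA F (FA Q (FA Q (q X)))
      = FA F (FA Q (q X)) \<cdot>\<^bsub>D\<^esub> FA F (FA Q (q ?QX))"
    using X by (simp add: F.FA_Comp'[symmetric])
  then have e: "FA F (FA Q (FA Q (q X))) = FA F (FA Q (q ?QX))"
    by (rule F.D.iso_cancel_left) (use X inv in auto)
  \<comment> \<open>Naturality of \<open>q\<close> at \<open>FA Q (q X)\<close> and at
    \<open>q (FO Q X)\<close> removes the additional \<open>Q\<close>; the arrow
    \<open>q (FO Q (FO Q X))\<close> left over is inverted by \<open>F\<close>.\<close>
  have "FA F (FA Q (q X)) \<cdot>\<^bsub>D\<^esub> FA F (q (FO Q ?QX)) = FA F (q ?QX \<cdot> FA Q (FA Q (q X)))"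
    using X q_nat[of "FA Q (q X)" ?QX] by (simp add: F.FA_Comp'[symmetric])
  also have "\<dots> = FA F (q ?QX \<cdot> FA Q (q ?QX))"
    using X e by (simp add: F.FA_Comp')
  also have "\<dots> = FA F (q ?QX) \<cdot>\<^bsub>D\<^esub> FA F (q (FO Q ?QX))"
    using X q_nat[of "q ?QX" ?QX] by (simp add: F.FA_Comp'[symmetric])
  finally show ?thesis
    by (rule F.D.iso_cancel_right) (use X inv in auto)
qed

end

locale right_deformed = homotopical_category C W
  for C :: "('o, 'a, 'z) cat_scheme" (structure) and W +
  fixes R :: "('o, 'a, 'o, 'a) ftor" and r :: "'o \<Rightarrow> 'a" and S :: "'o set"
  assumes deformation: "right_deformation C W R r"
    and R_S: "X \<in> Obj C \<Longrightarrow> FO R X \<in> S"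
    and S_Obj: "S \<subseteq> Obj C"
begin

sublocale R: cat_functor C C R
  using deformation by (simp add: right_deformation_def nat_trans_def)

lemma r_simps [simp]:
  assumes "X \<in> Obj C"
  shows "r X \<in> Arr C" "Dom C (r X) = X" "Cod C (r X) = FO R X" "r X \<in> W" "FO R X \<in> S"
  using deformation assms R_S by (auto simp: right_deformation_def nat_trans_def id_ftor_def hom_def)

lemma r_nat: "f \<in> Arr C \<Longrightarrow> Cod C f = Y \<Longrightarrow> r Y \<cdot> f = FA R f \<cdot> r (Dom C f)"
  using deformation homI[of f C] by (auto simp: right_deformation_def nat_trans_def id_ftor_def)

lemma S_Obj' [simp]: "X \<in> S \<Longrightarrow> X \<in> Obj C"
  using S_Obj by auto

lemma R_weq [simp]:
  assumes "w \<in> W"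
  shows "FA R w \<in> W"
proof -
  note w = weq_in_Arr[OF assms]
  have "r (Cod C w) \<cdot> w \<in> W" by (rule weq_Comp) (use w assms in auto)
  then have "FA R w \<cdot> r (Dom C w) \<in> W" using r_nat[OF w HOL.refl] by simp
  then show ?thesis by (rule weq_cancel_right[rotated]) (use w in auto)
qed

lemma weq_onI [simp]: "w \<in> W \<Longrightarrow> Dom C w \<in> S \<Longrightarrow> Cod C w \<in> S \<Longrightarrow> w \<in> weq_on C W S"
  by (simp add: weq_on_def)

text \<open>Dual of \<open>Q_q_eq_q_Q\<close>, by the same uses of naturality with all arrows
  reversed.\<close>

lemma R_r_eq_r_R:
  assumes "cat_functor C D F" and inv: "\<And>w. w \<in> weq_on C W S \<Longrightarrow> iso D (FA F w)" and X: "X \<in> Obj C"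
  shows "FA F (FA R (r X)) = FA F (r (FO R X))"
proof -
  interpret F: cat_functor C D F by fact
  let ?RX = "FO R X"
  have "FA R (FA R (r X)) \<cdot> FA R (r X) = FA R (r ?RX) \<cdot> FA R (r X)"
    using X r_nat[of "r X" ?RX] by (simp add: R.FA_Comp'[symmetric])
  then have "FA F (FA R (FA R (r X))) \<cdot>\<^bsub>D\<^esub> FA F (FA R (r X))
      = FA F (FA R (r ?RX)) \<cdot>\<^bsub>D\<^esub> FA F (FA R (r X))"
    using X by (simp add: F.FA_Comp'[symmetric])
  then have e: "FA F (FA R (FA R (r X))) = FA F (FA R (r ?RX))"
    by (rule F.D.iso_cancel_right) (use X inv in auto)
  have "FA F (r (FO R ?RX)) \<cdot>\<^bsub>D\<^esub> FA F (FA R (r X)) = FA F (FA R (FA R (r X)) \<cdot> r ?RX)"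
    using X r_nat[of "FA R (r X)" "FO R ?RX"] by (simp add: F.FA_Comp'[symmetric])
  also have "\<dots> = FA F (FA R (r ?RX) \<cdot> r ?RX)"
    using X e by (simp add: F.FA_Comp')
  also have "\<dots> = FA F (r (FO R ?RX)) \<cdot>\<^bsub>D\<^esub> FA F (r ?RX)"
    using X r_nat[of "r ?RX" "FO R ?RX"] by (simp add: F.FA_Comp'[symmetric])
  finally show ?thesis
    by (rule F.D.iso_cancel_left) (use X inv in auto)
qed

end

section \<open>Derived functors of two variables\<close>

locale deformable_bifunctor = bifunctor A B D T0 T1 +
  A: left_deformed A WA QA qA SA + B: left_deformed B WB QB qB SB + D: homotopical_category D WD
  for A :: "('o1, 'a1, 'z1) cat_scheme" and B :: "('o2, 'a2, 'z2) cat_scheme"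
    and D :: "('o3, 'a3, 'z3) cat_scheme" and T0 T1 WA QA qA SA WB QB qB SB WD +
  assumes T1_weq: "f \<in> weq_on A WA SA \<Longrightarrow> g \<in> weq_on B WB SB \<Longrightarrow> T1 f g \<in> WD"
begin

abbreviation "HA \<equiv> ho_cat A WA"
abbreviation "HB \<equiv> ho_cat B WB"
abbreviation "HD \<equiv> ho_cat D WD"
abbreviation compHD (infixr "\<cdot>\<^sub>D" 70) where "g \<cdot>\<^sub>D f \<equiv> g \<cdot>\<^bsub>HD\<^esub> f"

definition dT0 :: "'o1 \<Rightarrow> 'o2 \<Rightarrow> 'o3" where
  "dT0 X Y = T0 (FO QA X) (FO QB Y)"

text \<open>The universal property behind \<open>ho_lift\<close> is that of a single localization,
  so each variable is lifted separately while the other is held at a deformed object.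
  \<open>derived_tens_arr\<close> follows the same pattern, hence agrees with \<open>dT1\<close> for
  the base by unfolding.\<close>

definition dT_left :: "'o2 \<Rightarrow> ('o1, ('o1, 'a1) ho_arr, 'o3, ('o3, 'a3) ho_arr) ftor" where
  "dT_left Y = ho_lift A HD \<lparr>FO = (\<lambda>X. T0 (FO QA X) (FO QB Y)),
     FA = (\<lambda>f. ho_arr D WD (T1 (FA QA f) (Ide B (FO QB Y))))\<rparr>"

definition dT_right :: "'o1 \<Rightarrow> ('o2, ('o2, 'a2) ho_arr, 'o3, ('o3, 'a3) ho_arr) ftor" where
  "dT_right X = ho_lift B HD \<lparr>FO = (\<lambda>Y. T0 (FO QA X) (FO QB Y)),
     FA = (\<lambda>g. ho_arr D WD (T1 (Ide A (FO QA X)) (FA QB g)))\<rparr>"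

definition dT1 :: "('o1, 'a1) ho_arr \<Rightarrow> ('o2, 'a2) ho_arr \<Rightarrow> ('o3, 'a3) ho_arr" where
  "dT1 f g = FA (dT_left (Cod HB g)) f \<cdot>\<^sub>D FA (dT_right (Dom HA f)) g"

lemma T1_weq' [simp]:
  "f \<in> WA \<Longrightarrow> g \<in> WB \<Longrightarrow> Dom A f \<in> SA \<Longrightarrow> Cod A f \<in> SA \<Longrightarrow> Dom B g \<in> SB \<Longrightarrow> Cod B g \<in> SB
     \<Longrightarrow> T1 f g \<in> WD"
  by (rule T1_weq) simp_all

lemma left_localizing:
  assumes Y: "Y \<in> Obj B"
  shows "localizing_functor A WA HD \<lparr>FO = (\<lambda>X. T0 (FO QA X) (FO QB Y)),
     FA = (\<lambda>f. ho_arr D WD (T1 (FA QA f) (Ide B (FO QB Y))))\<rparr>"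
proof unfold_locales
  fix w assume "w \<in> WA"
  then show "iso HD (FA \<lparr>FO = (\<lambda>X. T0 (FO QA X) (FO QB Y)),
     FA = (\<lambda>f. ho_arr D WD (T1 (FA QA f) (Ide B (FO QB Y))))\<rparr> w)"
    using Y A.weq_in_Arr by simp
qed (use Y in \<open>auto simp: hom_def D.ho_merge A.Q.FA_Comp' T1_Comp_left\<close>)

lemma right_localizing:
  assumes X: "X \<in> Obj A"
  shows "localizing_functor B WB HD \<lparr>FO = (\<lambda>Y. T0 (FO QA X) (FO QB Y)),
     FA = (\<lambda>g. ho_arr D WD (T1 (Ide A (FO QA X)) (FA QB g)))\<rparr>"
proof unfold_locales
  fix w assume "w \<in> WB"
  then show "iso HD (FA \<lparr>FO = (\<lambda>Y. T0 (FO QA X) (FO QB Y)),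
     FA = (\<lambda>g. ho_arr D WD (T1 (Ide A (FO QA X)) (FA QB g)))\<rparr> w)"
    using X B.weq_in_Arr by simp
qed (use X in \<open>auto simp: hom_def D.ho_merge B.Q.FA_Comp' T1_Comp_right\<close>)

lemma dT_left_functor: "Y \<in> Obj B \<Longrightarrow> cat_functor HA HD (dT_left Y)"
  unfolding dT_left_def by (rule localizing_functor.ho_lift_functor[OF left_localizing])

lemma dT_right_functor: "X \<in> Obj A \<Longrightarrow> cat_functor HB HD (dT_right X)"
  unfolding dT_right_def by (rule localizing_functor.ho_lift_functor[OF right_localizing])

lemma dT_left_FO [simp]: "FO (dT_left Y) X = dT0 X Y"
  by (simp add: dT_left_def ho_lift_def dT0_def)

lemma dT_right_FO [simp]: "FO (dT_right X) Y = dT0 X Y"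
  by (simp add: dT_right_def ho_lift_def dT0_def)

lemma dT_left_simps [simp]:
  assumes "Y \<in> Obj B" "f \<in> Arr HA"
  shows "FA (dT_left Y) f \<in> Arr HD" "Dom HD (FA (dT_left Y) f) = dT0 (Dom HA f) Y"
    "Cod HD (FA (dT_left Y) f) = dT0 (Cod HA f) Y"
  using cat_functor.FA_simps[OF dT_left_functor[OF assms(1)] assms(2)] by simp_all

lemma dT_right_simps [simp]:
  assumes "X \<in> Obj A" "g \<in> Arr HB"
  shows "FA (dT_right X) g \<in> Arr HD" "Dom HD (FA (dT_right X) g) = dT0 X (Dom HB g)"
    "Cod HD (FA (dT_right X) g) = dT0 X (Cod HB g)"
  using cat_functor.FA_simps[OF dT_right_functor[OF assms(1)] assms(2)] by simp_all

lemma dT_left_arr [simp]: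
  "Y \<in> Obj B \<Longrightarrow> f \<in> Arr A
     \<Longrightarrow> FA (dT_left Y) (ho_arr A WA f) = ho_arr D WD (T1 (FA QA f) (Ide B (FO QB Y)))"
  using localizing_functor.ho_lift_ho_arr[OF left_localizing] by (simp add: dT_left_def)

lemma dT_right_arr [simp]:
  "X \<in> Obj A \<Longrightarrow> g \<in> Arr B
     \<Longrightarrow> FA (dT_right X) (ho_arr B WB g) = ho_arr D WD (T1 (Ide A (FO QA X)) (FA QB g))"
  using localizing_functor.ho_lift_ho_arr[OF right_localizing] by (simp add: dT_right_def)

lemma Obj_Ho [simp]:
  "f \<in> Arr HA \<Longrightarrow> Dom HA f \<in> Obj A" "f \<in> Arr HA \<Longrightarrow> Cod HA f \<in> Obj A"
  "g \<in> Arr HB \<Longrightarrow> Dom HB g \<in> Obj B" "g \<in> Arr HB \<Longrightarrow> Cod HB g \<in> Obj B"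
  using A.Ho.Obj_simps B.Ho.Obj_simps by simp_all

text \<open>For a fixed \<open>g\<close> coming from \<open>B\<close>, the equation is naturality in
  \<open>f\<close> of a transformation between lifted partial functors, and likewise with the roles
  exchanged. So \<open>ho_natural\<close> extends it first to all \<open>f\<close> and then to all
  \<open>g\<close>.\<close>

lemma dT_interchange:
  assumes f: "f \<in> Arr HA" and g: "g \<in> Arr HB"
  shows "FA (dT_left (Cod HB g)) f \<cdot>\<^sub>D FA (dT_right (Dom HA f)) g
    = FA (dT_right (Cod HA f)) g \<cdot>\<^sub>D FA (dT_left (Dom HB g)) f"
proof -
  have h: "FA (dT_left (Cod B g)) f \<cdot>\<^sub>D FA (dT_right (Dom HA f)) (ho_arr B WB g)
      = FA (dT_right (Cod HA f)) (ho_arr B WB g) \<cdot>\<^sub>D FA (dT_left (Dom B g)) f"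
    if g: "g \<in> Arr B" for g
    using A.ho_natural[OF f dT_left_functor dT_left_functor,
        of "Dom B g" "Cod B g" "\<lambda>X. FA (dT_right X) (ho_arr B WB g)"] g
    by (simp add: D.ho_merge T1_merge dT0_def)
  from B.ho_natural[OF g dT_right_functor dT_right_functor,
        of "Dom HA f" "Cod HA f" "\<lambda>Y. FA (dT_left Y) f"] f h
  show ?thesis by simp
qed

lemma dT1_left: "f \<in> Arr HA \<Longrightarrow> Y \<in> Obj B \<Longrightarrow> dT1 f (Ide HB Y) = FA (dT_left Y) f"
  using cat_functor.FA_Ide[OF dT_right_functor, of "Dom HA f" Y] by (simp add: dT1_def)

lemma dT1_right: "g \<in> Arr HB \<Longrightarrow> X \<in> Obj A \<Longrightarrow> dT1 (Ide HA X) g = FA (dT_right X) g"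
  using cat_functor.FA_Ide[OF dT_left_functor, of "Cod HB g" X] by (simp add: dT1_def)

sublocale dT: bifunctor HA HB HD dT0 dT1
proof
  fix X Y assume "X \<in> Obj HA" "Y \<in> Obj HB"
  then show "dT1 (Ide HA X) (Ide HB Y) = Ide HD (dT0 X Y)"
    using cat_functor.FA_Ide[OF dT_left_functor, of Y X] by (simp add: dT1_left)
next
  fix f f' g g'
  assume a: "f \<in> Arr HA" "f' \<in> Arr HA" "g \<in> Arr HB" "g' \<in> Arr HB" "Dom HA f' = Cod HA f"
    "Dom HB g' = Cod HB g"
  let ?L = "\<lambda>Y. FA (dT_left Y)" and ?R = "\<lambda>X. FA (dT_right X)"
  have "dT1 (f' \<cdot>\<^bsub>HA\<^esub> f) (g' \<cdot>\<^bsub>HB\<^esub> g)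
      = ?L (Cod HB g') f' \<cdot>\<^sub>D (?L (Cod HB g') f \<cdot>\<^sub>D ?R (Dom HA f) g') \<cdot>\<^sub>D ?R (Dom HA f) g"
    using a cat_functor.FA_Comp'[OF dT_left_functor] cat_functor.FA_Comp'[OF dT_right_functor]
    by (simp add: dT1_def D.Ho.assoc')
  \<comment> \<open>Swapping the two middle factors by interchange is the one step beyond
    functoriality of the lifts.\<close>
  also have "\<dots> = ?L (Cod HB g') f' \<cdot>\<^sub>D (?R (Cod HA f) g' \<cdot>\<^sub>D ?L (Cod HB g) f) \<cdot>\<^sub>D ?R (Dom HA f) g"
    using a dT_interchange[of f g'] by simp
  also have "\<dots> = dT1 f' g' \<cdot>\<^sub>D dT1 f g"
    using a by (simp add: dT1_def D.Ho.assoc')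
  finally show "dT1 (f' \<cdot>\<^bsub>HA\<^esub> f) (g' \<cdot>\<^bsub>HB\<^esub> g) = dT1 f' g' \<cdot>\<^sub>D dT1 f g" .
next
  show "dT0 X Y \<in> Obj HD" if "X \<in> Obj HA" "Y \<in> Obj HB" for X Y
    using that by (simp add: dT0_def)
qed (simp_all add: dT1_def)

lemma dT0_Obj [simp]: "X \<in> Obj A \<Longrightarrow> Y \<in> Obj B \<Longrightarrow> dT0 X Y \<in> Obj D"
  by (simp add: dT0_def)

lemma dT1_Ide_right [simp]:
  "f \<in> Arr A \<Longrightarrow> Y \<in> Obj B
     \<Longrightarrow> dT1 (ho_arr A WA f) (Ide HB Y) = ho_arr D WD (T1 (FA QA f) (Ide B (FO QB Y)))"
  by (simp add: dT1_left)

lemma dT1_Ide_left [simp]: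
  "g \<in> Arr B \<Longrightarrow> X \<in> Obj A
     \<Longrightarrow> dT1 (Ide HA X) (ho_arr B WB g) = ho_arr D WD (T1 (Ide A (FO QA X)) (FA QB g))"
  by (simp add: dT1_right)

text \<open>The partial functor on \<open>A\<close> itself, with \<open>X\<close> not replaced. As
  \<open>Y\<close> lies in \<open>SB\<close>, it inverts weak equivalences between objects of
  \<open>SA\<close>, which is what \<open>Q_q_eq_q_Q\<close> asks for.\<close>

lemma left_functor_weq:
  assumes Y: "Y \<in> SB"
  shows "cat_functor A HD \<lparr>FO = (\<lambda>X. T0 X Y), FA = (\<lambda>f. ho_arr D WD (T1 f (Ide B Y)))\<rparr>"
  by unfold_locales (use Y in \<open>auto simp: hom_def D.ho_merge T1_Comp_left\<close>)

lemma right_functor_weq: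
  assumes X: "X \<in> SA"
  shows "cat_functor B HD \<lparr>FO = (\<lambda>Y. T0 X Y), FA = (\<lambda>g. ho_arr D WD (T1 (Ide A X) g))\<rparr>"
  by unfold_locales (use X in \<open>auto simp: hom_def D.ho_merge T1_Comp_right\<close>)

lemma ho_T1_Q_q_left:
  assumes "X \<in> Obj A" "Y \<in> SB"
  shows "ho_arr D WD (T1 (FA QA (qA X)) (Ide B Y)) = ho_arr D WD (T1 (qA (FO QA X)) (Ide B Y))"
  using A.Q_q_eq_q_Q[OF left_functor_weq[OF assms(2)] _ assms(1)] assms
  by (simp add: weq_on_def)

lemma ho_T1_Q_q_right:
  assumes "X \<in> SA" "Y \<in> Obj B"
  shows "ho_arr D WD (T1 (Ide A X) (FA QB (qB Y))) = ho_arr D WD (T1 (Ide A X) (qB (FO QB Y)))"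
  using B.Q_q_eq_q_Q[OF right_functor_weq[OF assms(1)] _ assms(2)] assms
  by (simp add: weq_on_def)

end

section \<open>Derived adjunctions, presented by universal counits\<close>

locale deformable_adjunction =
  C: left_deformed C W Q q S + D: right_deformed D WD R r S' +
  F: cat_functor C D F + G: cat_functor D C G
  for C :: "('o1, 'a1, 'z1) cat_scheme" (structure) and W Q q S
    and D :: "('o2, 'a2, 'z2) cat_scheme" and WD R r S' F G +
  fixes eps :: "'o2 \<Rightarrow> 'a2"
  assumes eps_simps [simp]:
      "Y \<in> Obj D \<Longrightarrow> eps Y \<in> Arr D" "Y \<in> Obj D \<Longrightarrow> Dom D (eps Y) = FO F (FO G Y)"
      "Y \<in> Obj D \<Longrightarrow> Cod D (eps Y) = Y"
    and eps_nat: "g \<in> Arr D \<Longrightarrow> Cod D g = Y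
      \<Longrightarrow> eps Y \<cdot>\<^bsub>D\<^esub> FA F (FA G g) = g \<cdot>\<^bsub>D\<^esub> eps (Dom D g)"
    and eps_universal: "X \<in> Obj C \<Longrightarrow> Y \<in> Obj D \<Longrightarrow> f \<in> hom D (FO F X) Y
      \<Longrightarrow> \<exists>!g. g \<in> hom C X (FO G Y) \<and> eps Y \<cdot>\<^bsub>D\<^esub> FA F g = f"
    and F_weq: "w \<in> weq_on C W S \<Longrightarrow> FA F w \<in> WD"
    and G_weq: "v \<in> weq_on D WD S' \<Longrightarrow> FA G v \<in> W"
begin

abbreviation "HC \<equiv> ho_cat C W"
abbreviation "HD \<equiv> ho_cat D WD"
abbreviation "\<gamma> \<equiv> ho_arr C W"
abbreviation "\<delta> \<equiv> ho_arr D WD"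
abbreviation compD (infixr "\<cdot>\<^sub>D" 70) where "g \<cdot>\<^sub>D f \<equiv> g \<cdot>\<^bsub>D\<^esub> f"
abbreviation compHC (infixr "\<cdot>\<^sub>H" 70) where "g \<cdot>\<^sub>H f \<equiv> g \<cdot>\<^bsub>HC\<^esub> f"
abbreviation compHD (infixr "\<cdot>\<^sub>K" 70) where "g \<cdot>\<^sub>K f \<equiv> g \<cdot>\<^bsub>HD\<^esub> f"

lemma eps_cancel:
  assumes "eps Y \<cdot>\<^sub>D FA F g = eps Y \<cdot>\<^sub>D FA F g'" "g \<in> Arr C" "g' \<in> Arr C" "Dom C g = Dom C g'"
    "Cod C g = FO G Y" "Cod C g' = FO G Y" "Y \<in> Obj D"
  shows "g = g'"
proof -
  have "eps Y \<cdot>\<^sub>D FA F g \<in> hom D (FO F (Dom C g)) Y" using assms(2-) by (simp add: hom_def)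
  from eps_universal[OF _ assms(7) this] assms show ?thesis by (auto simp: hom_def)
qed

lemma F_weq' [simp]: "w \<in> W \<Longrightarrow> Dom C w \<in> S \<Longrightarrow> Cod C w \<in> S \<Longrightarrow> FA F w \<in> WD"
  by (rule F_weq) simp

lemma G_weq' [simp]: "w \<in> WD \<Longrightarrow> Dom D w \<in> S' \<Longrightarrow> Cod D w \<in> S' \<Longrightarrow> FA G w \<in> W"
  by (rule G_weq) simp

definition "LF = ho_lift C HD \<lparr>FO = (\<lambda>X. FO F (FO Q X)), FA = (\<lambda>f. \<delta> (FA F (FA Q f)))\<rparr>"
definition "RG = ho_lift D HC \<lparr>FO = (\<lambda>Y. FO G (FO R Y)), FA = (\<lambda>g. \<gamma> (FA G (FA R g)))\<rparr>"

lemma LF_localizing: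
  "localizing_functor C W HD \<lparr>FO = (\<lambda>X. FO F (FO Q X)), FA = (\<lambda>f. \<delta> (FA F (FA Q f)))\<rparr>"
  by unfold_locales (auto simp: hom_def D.ho_merge C.Q.FA_Comp' F.FA_Comp' C.weq_in_Arr)

lemma RG_localizing:
  "localizing_functor D WD HC \<lparr>FO = (\<lambda>Y. FO G (FO R Y)), FA = (\<lambda>g. \<gamma> (FA G (FA R g)))\<rparr>"
  by unfold_locales (auto simp: hom_def C.ho_merge D.R.FA_Comp' G.FA_Comp' D.weq_in_Arr)

sublocale LF: cat_functor HC HD LF
  unfolding LF_def by (rule localizing_functor.ho_lift_functor[OF LF_localizing])

sublocale RG: cat_functor HD HC RG
  unfolding RG_def by (rule localizing_functor.ho_lift_functor[OF RG_localizing])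

lemma LF_arr [simp]: "f \<in> Arr C \<Longrightarrow> FA LF (\<gamma> f) = \<delta> (FA F (FA Q f))"
  using localizing_functor.ho_lift_ho_arr[OF LF_localizing] by (simp add: LF_def)

lemma RG_arr [simp]: "g \<in> Arr D \<Longrightarrow> FA RG (\<delta> g) = \<gamma> (FA G (FA R g))"
  using localizing_functor.ho_lift_ho_arr[OF RG_localizing] by (simp add: RG_def)

lemma LF_RG_FO [simp]: "FO LF X = FO F (FO Q X)" "FO RG Y = FO G (FO R Y)"
  by (simp_all add: LF_def RG_def ho_lift_def)

text \<open>The zigzag \<open>F Q G R Y \<rightarrow> F G R Y \<rightarrow> R Y \<leftarrow>
  Y\<close>. For the base acting on itself it is \<open>derived_ev\<close>.\<close>

definition derived_counit :: "'o2 \<Rightarrow> ('o2, 'a2) ho_arr" where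
  "derived_counit Y = inv_arr HD (\<delta> (r Y))
     \<cdot>\<^sub>K \<delta> (eps (FO R Y) \<cdot>\<^sub>D FA F (q (FO G (FO R Y))))"

text \<open>The composite \<open>QX \<rightarrow> GFQX \<rightarrow> GRFQX\<close> of the unit with \<open>G r\<close>, described by its transpose.\<close>

definition pre_unit :: "'o1 \<Rightarrow> 'a1" where
  "pre_unit X = (THE u. u \<in> hom C (FO Q X) (FO G (FO R (FO F (FO Q X))))
     \<and> eps (FO R (FO F (FO Q X))) \<cdot>\<^sub>D FA F u = r (FO F (FO Q X)))"

lemma pre_unit_simps [simp]:
  assumes X: "X \<in> Obj C"
  shows "pre_unit X \<in> Arr C" "Dom C (pre_unit X) = FO Q X"
    "Cod C (pre_unit X) = FO G (FO R (FO F (FO Q X)))"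
    "eps (FO R (FO F (FO Q X))) \<cdot>\<^sub>D FA F (pre_unit X) = r (FO F (FO Q X))"
proof -
  have "r (FO F (FO Q X)) \<in> hom D (FO F (FO Q X)) (FO R (FO F (FO Q X)))"
    using X by (simp add: hom_def)
  from theI'[OF eps_universal[OF _ _ this]] X
  show "pre_unit X \<in> Arr C" "Dom C (pre_unit X) = FO Q X"
    "Cod C (pre_unit X) = FO G (FO R (FO F (FO Q X)))"
    "eps (FO R (FO F (FO Q X))) \<cdot>\<^sub>D FA F (pre_unit X) = r (FO F (FO Q X))"
    by (simp_all add: pre_unit_def hom_def)
qed

text \<open>The zigzag \<open>X \<leftarrow> Q X \<rightarrow> G R F Q X\<close>.\<close>

definition derived_unit :: "'o1 \<Rightarrow> ('o1, 'a1) ho_arr" where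
  "derived_unit X = \<gamma> (pre_unit X) \<cdot>\<^sub>H inv_arr HC (\<gamma> (q X))"

lemma derived_unit_simps [simp]:
  assumes "X \<in> Obj C"
  shows "derived_unit X \<in> Arr HC" "Dom HC (derived_unit X) = X"
    "Cod HC (derived_unit X) = FO G (FO R (FO F (FO Q X)))"
  using assms by (simp_all add: derived_unit_def)

lemma derived_counit_simps [simp]:
  assumes "Y \<in> Obj D"
  shows "derived_counit Y \<in> Arr HD" "Dom HD (derived_counit Y) = FO F (FO Q (FO G (FO R Y)))"
    "Cod HD (derived_counit Y) = Y"
  using assms by (simp_all add: derived_counit_def)

lemma derived_counit_natural:
  assumes "\<beta> \<in> Arr HD"
  shows "derived_counit (Cod HD \<beta>) \<cdot>\<^sub>K FA LF (FA RG \<beta>) = \<beta> \<cdot>\<^sub>K derived_counit (Dom HD \<beta>)"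
proof -
  have "derived_counit (Cod D g) \<cdot>\<^sub>K \<delta> (FA F (FA Q (FA G (FA R g)))) = \<delta> g \<cdot>\<^sub>K derived_counit (Dom D g)"
    if g: "g \<in> Arr D" for g
  proof -
    let ?X = "FO R (Dom D g)" and ?Y = "FO R (Cod D g)"
    have "eps ?Y \<cdot>\<^sub>D FA F (q (FO G ?Y)) \<cdot>\<^sub>D FA F (FA Q (FA G (FA R g)))
        = eps ?Y \<cdot>\<^sub>D FA F (FA G (FA R g)) \<cdot>\<^sub>D FA F (q (FO G ?X))"
      using g C.q_nat[of "FA G (FA R g)" "FO G ?Y"] by (simp add: F.FA_Comp'[symmetric])
    also have "\<dots> = FA R g \<cdot>\<^sub>D eps ?X \<cdot>\<^sub>D FA F (q (FO G ?X))"
      using g D.square_tail[OF eps_nat[of "FA R g" ?Y]] by simp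
    finally have "derived_counit (Cod D g) \<cdot>\<^sub>K \<delta> (FA F (FA Q (FA G (FA R g))))
        = inv_arr HD (\<delta> (r (Cod D g))) \<cdot>\<^sub>K \<delta> (FA R g) \<cdot>\<^sub>K \<delta> (eps ?X \<cdot>\<^sub>D FA F (q (FO G ?X)))"
      using g by (simp add: derived_counit_def D.Ho.assoc' D.ho_merge D.assoc')
    also have "\<dots> = \<delta> g \<cdot>\<^sub>K derived_counit (Dom D g)"
      unfolding derived_counit_def
      using g D.r_nat[of g "Cod D g"] by (intro D.ho_slide_tail[symmetric]) auto
    finally show ?thesis .
  qed
  then show ?thesis
    using D.ho_natural[OF assms cat_functor_comp[OF RG.cat_functor_axioms LF.cat_functor_axioms]
        D.Ho.id_functor, of derived_counit]
    by simp
qed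

lemma derived_unit_natural:
  assumes "\<alpha> \<in> Arr HC"
  shows "derived_unit (Cod HC \<alpha>) \<cdot>\<^sub>H \<alpha> = FA RG (FA LF \<alpha>) \<cdot>\<^sub>H derived_unit (Dom HC \<alpha>)"
proof -
  have "derived_unit (Cod C f) \<cdot>\<^sub>H \<gamma> f = \<gamma> (FA G (FA R (FA F (FA Q f)))) \<cdot>\<^sub>H derived_unit (Dom C f)"
    if f: "f \<in> Arr C" for f
  proof -
    let ?X = "FO F (FO Q (Dom C f))" and ?Y = "FO F (FO Q (Cod C f))"
    let ?g = "FA F (FA Q f)"
    \<comment> \<open>\<open>pre_unit\<close> is known only through its transpose, so its naturality
      is computed on transposes and concluded with \<open>eps_cancel\<close>.\<close>
    have "eps (FO R ?Y) \<cdot>\<^sub>D FA F (FA G (FA R ?g)) \<cdot>\<^sub>D FA F (pre_unit (Dom C f))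
        = FA R ?g \<cdot>\<^sub>D eps (FO R ?X) \<cdot>\<^sub>D FA F (pre_unit (Dom C f))"
      using f D.square_tail[OF eps_nat[of "FA R ?g" "FO R ?Y"]] by simp
    also have "\<dots> = r ?Y \<cdot>\<^sub>D ?g"
      using f D.r_nat[of ?g ?Y] by simp
    also have "\<dots> = eps (FO R ?Y) \<cdot>\<^sub>D FA F (pre_unit (Cod C f)) \<cdot>\<^sub>D ?g"
      using f D.triangle_tail[OF pre_unit_simps(4)[of "Cod C f"], of ?g] by simp
    finally have "FA G (FA R ?g) \<cdot> pre_unit (Dom C f) = pre_unit (Cod C f) \<cdot> FA Q f"
      using f by (intro eps_cancel[of "FO R ?Y"]) (simp_all add: F.FA_Comp')
    then have "\<gamma> (FA G (FA R ?g)) \<cdot>\<^sub>H derived_unit (Dom C f)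
        = \<gamma> (pre_unit (Cod C f)) \<cdot>\<^sub>H \<gamma> (FA Q f) \<cdot>\<^sub>H inv_arr HC (\<gamma> (q (Dom C f)))"
      using f by (simp add: derived_unit_def C.ho_merge_tail)
    also have "\<gamma> (FA Q f) \<cdot>\<^sub>H inv_arr HC (\<gamma> (q (Dom C f))) = inv_arr HC (\<gamma> (q (Cod C f))) \<cdot>\<^sub>H \<gamma> f"
      using f C.q_nat[of f "Cod C f"] by (intro C.ho_slide) auto
    finally show ?thesis using f by (simp add: derived_unit_def C.Ho.assoc')
  qed
  then show ?thesis
    using C.ho_natural[OF assms C.Ho.id_functor
        cat_functor_comp[OF LF.cat_functor_axioms RG.cat_functor_axioms], of derived_unit]
    by simp
qed

text \<open>\<open>LF\<close> sends the inverse of \<open>q X\<close> to the inverse of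
  \<open>FA F (FA Q (q X))\<close>, while naturality leaves \<open>FA F (q (FO Q X))\<close>. These
  cancel since they have the same image in \<open>HD\<close>, by \<open>Q_q_eq_q_Q\<close>.\<close>

lemma derived_triangle_left:
  assumes X: "X \<in> Obj C"
  shows "derived_counit (FO F (FO Q X)) \<cdot>\<^sub>K FA LF (derived_unit X) = Ide HD (FO F (FO Q X))"
proof -
  let ?Y = "FO F (FO Q X)"
  let ?Z = "FO G (FO R ?Y)" and ?u = "pre_unit X"
  have FF: "cat_functor C HD \<lparr>FO = FO F, FA = (\<lambda>f. \<delta> (FA F f))\<rparr>"
    by unfold_locales (auto simp: hom_def D.ho_merge F.FA_Comp')
  have i: "\<delta> (FA F (FA Q (q X))) = \<delta> (FA F (q (FO Q X)))"
    using C.Q_q_eq_q_Q[OF FF _ X] by (simp add: weq_on_def)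
  have inv: "inv_arr HC (\<gamma> (q X)) \<in> Arr HC" "FA LF (inv_arr HC (\<gamma> (q X))) = inv_arr HD (\<delta> (FA F (FA Q (q X))))"
    using X LF.FA_iso(2)[of "\<gamma> (q X)"] by simp_all
  have "eps (FO R ?Y) \<cdot>\<^sub>D FA F (q ?Z) \<cdot>\<^sub>D FA F (FA Q ?u)
      = eps (FO R ?Y) \<cdot>\<^sub>D FA F ?u \<cdot>\<^sub>D FA F (q (FO Q X))"
    using X C.q_nat[of ?u ?Z] by (simp add: F.FA_Comp'[symmetric])
  also have "\<dots> = r ?Y \<cdot>\<^sub>D FA F (q (FO Q X))"
    using X D.triangle_tail[OF pre_unit_simps(4)[OF X], of "FA F (q (FO Q X))"] by simp
  finally have e: "(eps (FO R ?Y) \<cdot>\<^sub>D FA F (q ?Z)) \<cdot>\<^sub>D FA F (FA Q ?u) = r ?Y \<cdot>\<^sub>D FA F (q (FO Q X))"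
    using X by (simp add: D.assoc')
  have "derived_counit ?Y \<cdot>\<^sub>K FA LF (derived_unit X) = inv_arr HD (\<delta> (r ?Y))
      \<cdot>\<^sub>K \<delta> ((eps (FO R ?Y) \<cdot>\<^sub>D FA F (q ?Z)) \<cdot>\<^sub>D FA F (FA Q ?u)) \<cdot>\<^sub>K inv_arr HD (\<delta> (FA F (FA Q (q X))))"
    using X inv(1) by (simp add: derived_counit_def derived_unit_def LF.FA_Comp' inv(2) D.Ho.assoc' D.ho_merge_tail
        del: LF.FA_iso)
  also have "\<dots> = inv_arr HD (\<delta> (r ?Y)) \<cdot>\<^sub>K \<delta> (r ?Y) \<cdot>\<^sub>K \<delta> (FA F (q (FO Q X)))
      \<cdot>\<^sub>K inv_arr HD (\<delta> (FA F (q (FO Q X))))"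
    unfolding e i using X by (simp add: D.ho_merge[symmetric] D.Ho.assoc')
  also have "\<dots> = Ide HD ?Y"
    using X by simp
  finally show ?thesis .
qed

text \<open>The dual situation: \<open>RG\<close> turns the inverse inside the counit into the
  inverse of \<open>G R r\<close>, naturality leaves \<open>G r R\<close>, and
  \<open>R_r_eq_r_R\<close> identifies the two in \<open>HC\<close>.\<close>

lemma derived_triangle_right:
  assumes Y: "Y \<in> Obj D"
  shows "FA RG (derived_counit Y) \<cdot>\<^sub>H derived_unit (FO G (FO R Y)) = Ide HC (FO G (FO R Y))"
proof -
  let ?Z = "FO G (FO R Y)"
  let ?v = "eps (FO R Y) \<cdot>\<^sub>D FA F (q ?Z)"
  have FF: "cat_functor D HC \<lparr>FO = FO G, FA = (\<lambda>f. \<gamma> (FA G f))\<rparr>"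
    by unfold_locales (auto simp: hom_def C.ho_merge G.FA_Comp')
  have i: "\<gamma> (FA G (FA R (r Y))) = \<gamma> (FA G (r (FO R Y)))"
    using D.R_r_eq_r_R[OF FF _ Y] by (simp add: weq_on_def)
  have inv: "inv_arr HD (\<delta> (r Y)) \<in> Arr HD" "FA RG (inv_arr HD (\<delta> (r Y))) = inv_arr HC (\<gamma> (FA G (FA R (r Y))))"
    using Y RG.FA_iso(2)[of "\<delta> (r Y)"] by simp_all
  have "eps (FO R (FO R Y)) \<cdot>\<^sub>D FA F (FA G (FA R ?v)) \<cdot>\<^sub>D FA F (pre_unit ?Z)
      = FA R ?v \<cdot>\<^sub>D eps (FO R (FO F (FO Q ?Z))) \<cdot>\<^sub>D FA F (pre_unit ?Z)"
    using Y D.square_tail[OF eps_nat[of "FA R ?v" "FO R (FO R Y)"]] by simp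
  also have "\<dots> = r (FO R Y) \<cdot>\<^sub>D ?v"
    using Y D.r_nat[of ?v "FO R Y"] by simp
  also have "\<dots> = eps (FO R (FO R Y)) \<cdot>\<^sub>D FA F (FA G (r (FO R Y))) \<cdot>\<^sub>D FA F (q ?Z)"
    using Y D.square_tail[OF eps_nat[of "r (FO R Y)" "FO R (FO R Y)"], of "FA F (q ?Z)"] by simp
  finally have e: "FA G (FA R ?v) \<cdot> pre_unit ?Z = FA G (r (FO R Y)) \<cdot> q ?Z"
    using Y by (intro eps_cancel[of "FO R (FO R Y)"]) (simp_all add: F.FA_Comp')
  have "FA RG (derived_counit Y) \<cdot>\<^sub>H derived_unit ?Z = inv_arr HC (\<gamma> (FA G (FA R (r Y))))
      \<cdot>\<^sub>H \<gamma> (FA G (FA R ?v) \<cdot> pre_unit ?Z) \<cdot>\<^sub>H inv_arr HC (\<gamma> (q ?Z))"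
    using Y inv(1) by (simp add: derived_counit_def derived_unit_def RG.FA_Comp' inv(2) C.Ho.assoc' C.ho_merge_tail
        del: RG.FA_iso)
  also have "\<dots> = inv_arr HC (\<gamma> (FA G (r (FO R Y)))) \<cdot>\<^sub>H \<gamma> (FA G (r (FO R Y)))
      \<cdot>\<^sub>H \<gamma> (q ?Z) \<cdot>\<^sub>H inv_arr HC (\<gamma> (q ?Z))"
    unfolding e i using Y by (simp add: C.ho_merge[symmetric] C.Ho.assoc')
  also have "\<dots> = Ide HC ?Z"
    using Y by simp
  finally show ?thesis .
qed

text \<open>The standard passage from unit, counit and triangle identities to a universal arrow; the
  transpose of \<open>\<alpha>\<close> is \<open>FA RG \<alpha>\<close> after the derived
  unit.\<close>

theorem derived_counit_universal:
  assumes X: "X \<in> Obj C" and Y: "Y \<in> Obj D" and a: "\<alpha> \<in> hom HD (FO F (FO Q X)) Y"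
  shows "\<exists>!\<beta>. \<beta> \<in> hom HC X (FO G (FO R Y)) \<and> derived_counit Y \<cdot>\<^sub>K FA LF \<beta> = \<alpha>"
proof (rule ex1I)
  have t: "\<alpha> \<in> Arr HD" "Dom HD \<alpha> = FO F (FO Q X)" "Cod HD \<alpha> = Y"
    using a by (auto simp: hom_def)
  let ?b = "FA RG \<alpha> \<cdot>\<^sub>H derived_unit X"
  have "derived_counit Y \<cdot>\<^sub>K FA LF ?b
      = (derived_counit Y \<cdot>\<^sub>K FA LF (FA RG \<alpha>)) \<cdot>\<^sub>K FA LF (derived_unit X)"
    using X Y t by (simp add: LF.FA_Comp' D.Ho.assoc')
  also have "\<dots> = \<alpha> \<cdot>\<^sub>K derived_counit (FO F (FO Q X)) \<cdot>\<^sub>K FA LF (derived_unit X)"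
    using X Y t derived_counit_natural[OF t(1)] by (simp add: D.Ho.assoc')
  also have "\<dots> = \<alpha>"
    using X t by (simp add: derived_triangle_left)
  finally show "?b \<in> hom HC X (FO G (FO R Y)) \<and> derived_counit Y \<cdot>\<^sub>K FA LF ?b = \<alpha>"
    using X Y t by (simp add: hom_def)
next
  fix \<beta> assume b: "\<beta> \<in> hom HC X (FO G (FO R Y)) \<and> derived_counit Y \<cdot>\<^sub>K FA LF \<beta> = \<alpha>"
  then have t: "\<beta> \<in> Arr HC" "Dom HC \<beta> = X" "Cod HC \<beta> = FO G (FO R Y)"
    and e: "\<alpha> = derived_counit Y \<cdot>\<^sub>K FA LF \<beta>"
    by (auto simp: hom_def)
  have "FA RG \<alpha> \<cdot>\<^sub>H derived_unit X = FA RG (derived_counit Y) \<cdot>\<^sub>H FA RG (FA LF \<beta>) \<cdot>\<^sub>H derived_unit X"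
    unfolding e using X Y t by (simp add: RG.FA_Comp' C.Ho.assoc')
  also have "\<dots> = FA RG (derived_counit Y) \<cdot>\<^sub>H derived_unit (FO G (FO R Y)) \<cdot>\<^sub>H \<beta>"
    using derived_unit_natural[OF t(1)] t by simp
  also have "\<dots> = \<beta>"
    using Y t C.Ho.triangle_tail[OF derived_triangle_right[OF Y], of \<beta>] by simp
  finally show "\<beta> = FA RG \<alpha> \<cdot>\<^sub>H derived_unit X" by simp
qed

end

section \<open>Derived modules\<close>

context closed_symmetric_monoidal_homotopical_category
begin

sublocale L: left_deformed V "Weq V" "Qf V" "qt V" "VQ V"
  by unfold_locales (simp_all add: Q_deformation Q_in_VQ VQ_Obj)

sublocale R: right_deformed V "Weq V" "Rf V" "rt V" "VR V"
  by unfold_locales (simp_all add: R_deformation R_in_VR VR_Obj)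

sublocale DV: deformable_bifunctor V V V "tens V" "tens_arr V"
  "Weq V" "Qf V" "qt V" "VQ V" "Weq V" "Qf V" "qt V" "VQ V" "Weq V"
  by unfold_locales (rule tens_homotopical)

lemma dT1_eq_derived_tens_arr: "DV.dT1 = derived_tens_arr V"
  by (intro ext) (simp add: DV.dT1_def derived_tens_arr_def DV.dT_left_def DV.dT_right_def
      derived_tens_left_def derived_tens_right_def)

lemma tens_in_VQ' [simp]: "X \<in> VQ V \<Longrightarrow> Y \<in> VQ V \<Longrightarrow> X \<otimes> Y \<in> VQ V"
  by (rule tens_in_VQ)

lemma derived_assoc_simps [simp]:
  assumes "X \<in> Obj V" "Y \<in> Obj V" "Z \<in> Obj V"
  shows "derived_assoc V X Y Z \<in> Arr (V_ho_cat V)"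
    "Dom (V_ho_cat V) (derived_assoc V X Y Z) = DV.dT0 (DV.dT0 X Y) Z"
    "Cod (V_ho_cat V) (derived_assoc V X Y Z) = DV.dT0 X (DV.dT0 Y Z)"
    "iso (V_ho_cat V) (derived_assoc V X Y Z)"
  using assms by (simp_all add: derived_assoc_def Let_def DV.dT0_def ho_merge[symmetric])

text \<open>Clears the formal inverse from \<open>derived_assoc\<close>; coherence proofs use the
  associator in this form.\<close>

lemma derived_assoc_char:
  assumes "X \<in> Obj V" "Y \<in> Obj V" "Z \<in> Obj V"
  defines "X' \<equiv> FO (Qf V) X" and "Y' \<equiv> FO (Qf V) Y" and "Z' \<equiv> FO (Qf V) Z"
  shows "V_ho_arr V (Ide V X' \<otimes>\<^sub>1 qt V (Y' \<otimes> Z')) \<cdot>\<^bsub>V_ho_cat V\<^esub> derived_assoc V X Y Z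
    = V_ho_arr V (assoc V X' Y' Z' \<cdot> (qt V (X' \<otimes> Y') \<otimes>\<^sub>1 Ide V Z'))"
  using assms by (simp add: derived_assoc_def Let_def)

end

section \<open>The derived action and its coherence laws\<close>

locale homotopical_module =
  closed_symmetric_monoidal_homotopical_category I V +
  module_category V N act act1 massoc munit +
  N: left_deformed N WN QN p SN
  for I :: "'i itself" and V :: "('o, 'a, 'z) hcsm_scheme" (structure)
    and N :: "('n, 'b, 'y) cat_scheme" and act (infixr "\<odot>" 75) and act1 (infixr "\<odot>\<^sub>1" 75)
    and massoc munit WN QN p SN +
  assumes act_weq: "k \<in> weq_on V (Weq V) (VQ V) \<Longrightarrow> f \<in> weq_on N WN SN \<Longrightarrow> k \<odot>\<^sub>1 f \<in> WN"
    and act_S [simp]: "K \<in> VQ V \<Longrightarrow> X \<in> SN \<Longrightarrow> K \<odot> X \<in> SN"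
    and munit_weq: "X \<in> SN \<Longrightarrow> munit X \<cdot>\<^bsub>N\<^esub> (qt V (unit_obj V) \<odot>\<^sub>1 Ide N X) \<in> WN"
begin

sublocale DN: deformable_bifunctor V N N act act1 "Weq V" "Qf V" "qt V" "VQ V" WN QN p SN WN
  by unfold_locales (rule act_weq)

abbreviation "Q \<equiv> FO (Qf V)"
abbreviation "Q1 \<equiv> FA (Qf V)"
abbreviation "q \<equiv> qt V"
abbreviation "P \<equiv> FO QN"
abbreviation "P1 \<equiv> FA QN"
abbreviation "HV \<equiv> V_ho_cat V"
abbreviation "HN \<equiv> ho_cat N WN"
abbreviation "\<gamma> \<equiv> ho_arr N WN"
abbreviation compHN (infixr "\<star>" 70) where "g \<star> f \<equiv> g \<cdot>\<^bsub>HN\<^esub> f"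

text \<open>The zigzag \<open>Q(QK \<otimes> QL) \<odot> PX \<rightarrow> (QK \<otimes> QL) \<odot>
  PX \<rightarrow> QK \<odot> (QL \<odot> PX) \<leftarrow> QK \<odot> P(QL \<odot> PX)\<close>. Its
  outer maps are weak equivalences because \<open>VQ V\<close> is closed under the tensor product
  and \<open>SN\<close> under the action of \<open>VQ V\<close>.\<close>

definition dmassoc :: "'o \<Rightarrow> 'o \<Rightarrow> 'n \<Rightarrow> ('n, 'b) ho_arr" where
  "dmassoc K L X = inv_arr HN (\<gamma> (iV (Q K) \<odot>\<^sub>1 p (Q L \<odot> P X)))
     \<star> \<gamma> (massoc (Q K) (Q L) (P X) \<bullet> (q (Q K \<otimes> Q L) \<odot>\<^sub>1 iN (P X)))"

definition dmunit :: "'n \<Rightarrow> ('n, 'b) ho_arr" where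
  "dmunit X = \<gamma> (p X \<bullet> munit (P X) \<bullet> (q E \<odot>\<^sub>1 iN (P X)))"

lemma dmassoc_simps [simp]:
  assumes "K \<in> Obj V" "L \<in> Obj V" "X \<in> Obj N"
  shows "dmassoc K L X \<in> Arr HN" "Dom HN (dmassoc K L X) = DN.dT0 (DV.dT0 K L) X"
    "Cod HN (dmassoc K L X) = DN.dT0 K (DN.dT0 L X)" "iso HN (dmassoc K L X)"
  using assms by (simp_all add: dmassoc_def DV.dT0_def DN.dT0_def N.ho_merge[symmetric])

lemma dmunit_simps [simp]:
  assumes "X \<in> Obj N"
  shows "dmunit X \<in> Arr HN" "Dom HN (dmunit X) = DN.dT0 E X" "Cod HN (dmunit X) = X"
    "iso HN (dmunit X)"
proof -
  have "munit (P X) \<bullet> (q E \<odot>\<^sub>1 iN (P X)) \<in> WN" using assms by (simp add: munit_weq)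
  then have "p X \<bullet> munit (P X) \<bullet> (q E \<odot>\<^sub>1 iN (P X)) \<in> WN"
    by (rule N.weq_Comp) (use assms in auto)
  then show "iso HN (dmunit X)" by (simp add: dmunit_def)
qed (use assms in \<open>simp_all add: dmunit_def DN.dT0_def\<close>)

lemma dmassoc_char:
  assumes "K \<in> Obj V" "L \<in> Obj V" "X \<in> Obj N"
  shows "\<gamma> (iV (Q K) \<odot>\<^sub>1 p (Q L \<odot> P X)) \<star> dmassoc K L X
    = \<gamma> (massoc (Q K) (Q L) (P X) \<bullet> (q (Q K \<otimes> Q L) \<odot>\<^sub>1 iN (P X)))"
  using assms by (simp add: dmassoc_def)

text \<open>Followed by the invertible image of \<open>1 \<odot> p\<close>, both sides become images
  of arrows of \<open>N\<close>, where naturality of \<open>massoc\<close>, \<open>q\<close> and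
  \<open>p\<close> applies.\<close>

lemma dmassoc_nat_arr:
  assumes k: "k \<in> Arr V" and l: "l \<in> Arr V" and f: "f \<in> Arr N"
  shows "dmassoc (Cod V k) (Cod V l) (Cod N f) \<star> \<gamma> (Q1 (Q1 k \<otimes>\<^sub>1 Q1 l) \<odot>\<^sub>1 P1 f)
    = \<gamma> (Q1 k \<odot>\<^sub>1 P1 (Q1 l \<odot>\<^sub>1 P1 f)) \<star> dmassoc (Dom V k) (Dom V l) (Dom N f)"
proof -
  let ?K = "Q (Cod V k)" and ?L = "Q (Cod V l)" and ?X = "P (Cod N f)"
  let ?K' = "Q (Dom V k)" and ?L' = "Q (Dom V l)" and ?X' = "P (Dom N f)"
  have "\<gamma> (iV ?K \<odot>\<^sub>1 p (?L \<odot> ?X)) \<star> dmassoc (Cod V k) (Cod V l) (Cod N f)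
      \<star> \<gamma> (Q1 (Q1 k \<otimes>\<^sub>1 Q1 l) \<odot>\<^sub>1 P1 f)
      = \<gamma> (massoc ?K ?L ?X \<bullet> (q (?K \<otimes> ?L) \<odot>\<^sub>1 iN ?X)) \<star> \<gamma> (Q1 (Q1 k \<otimes>\<^sub>1 Q1 l) \<odot>\<^sub>1 P1 f)"
    by (rule N.Ho.triangle_tail[OF dmassoc_char]) (use assms in \<open>auto simp: DN.dT0_def DV.dT0_def\<close>)
  also have "\<dots> = \<gamma> (massoc ?K ?L ?X \<bullet> ((Q1 k \<otimes>\<^sub>1 Q1 l) \<odot>\<^sub>1 P1 f) \<bullet> (q (?K' \<otimes> ?L') \<odot>\<^sub>1 iN ?X'))"
    using assms L.q_nat[of "Q1 k \<otimes>\<^sub>1 Q1 l" "?K \<otimes> ?L"] by (simp add: N.ho_merge N.assoc' act.T1_merge)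
  also have "\<dots> = \<gamma> (Q1 k \<odot>\<^sub>1 Q1 l \<odot>\<^sub>1 P1 f) \<star> \<gamma> (massoc ?K' ?L' ?X' \<bullet> (q (?K' \<otimes> ?L') \<odot>\<^sub>1 iN ?X'))"
    using assms N.square_tail[OF massoc_nat[of "Q1 k" "Q1 l" "P1 f"]] by (simp add: N.ho_merge)
  also have "\<dots> = \<gamma> (Q1 k \<odot>\<^sub>1 Q1 l \<odot>\<^sub>1 P1 f) \<star> \<gamma> (iV ?K' \<odot>\<^sub>1 p (?L' \<odot> ?X'))
      \<star> dmassoc (Dom V k) (Dom V l) (Dom N f)"
    using assms by (simp add: dmassoc_char)
  also have "\<dots> = \<gamma> (iV ?K \<odot>\<^sub>1 p (?L \<odot> ?X)) \<star> \<gamma> (Q1 k \<odot>\<^sub>1 P1 (Q1 l \<odot>\<^sub>1 P1 f))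
      \<star> dmassoc (Dom V k) (Dom V l) (Dom N f)"
    using assms N.q_nat[of "Q1 l \<odot>\<^sub>1 P1 f" "?L \<odot> ?X"]
    by (simp add: N.ho_merge_tail act.T1_merge DN.dT0_def)
  finally show ?thesis
    by (rule N.Ho.iso_cancel_left) (use assms in \<open>auto simp: DN.dT0_def DV.dT0_def\<close>)
qed

text \<open>\<open>ho_natural\<close> handles one variable with identities in the other two, which
  gives the facts 1, 2 and 3; a general triple is a composite of three such cases.\<close>

lemma dmassoc_nat:
  assumes k: "k \<in> Arr HV" and l: "l \<in> Arr HV" and f: "f \<in> Arr HN"
  shows "dmassoc (Cod HV k) (Cod HV l) (Cod HN f) \<star> DN.dT1 (DV.dT1 k l) f
    = DN.dT1 k (DN.dT1 l f) \<star> dmassoc (Dom HV k) (Dom HV l) (Dom HN f)"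
proof -
  have 1: "dmassoc (Cod HV k) L X \<star> DN.dT1 (DV.dT1 k (Ide HV L)) (Ide HN X)
      = DN.dT1 k (Ide HN (DN.dT0 L X)) \<star> dmassoc (Dom HV k) L X"
    if "L \<in> Obj V" "X \<in> Obj N" for L X
    using ho_natural[OF k cat_functor_comp[OF DV.dT.functor_left DN.dT.functor_left] DN.dT.functor_left,
        of L X "DN.dT0 L X" "\<lambda>K. dmassoc K L X"] that dmassoc_nat_arr[OF _ Ide_simps(1) N.Ide_simps(1), of _ L X]
    by (simp add: DN.dT0_def)
  have 2: "dmassoc K (Cod HV l) X \<star> DN.dT1 (DV.dT1 (Ide HV K) l) (Ide HN X)
      = DN.dT1 (Ide HV K) (DN.dT1 l (Ide HN X)) \<star> dmassoc K (Dom HV l) X"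
    if "K \<in> Obj V" "X \<in> Obj N" for K X
    using ho_natural[OF l cat_functor_comp[OF DV.dT.functor_right DN.dT.functor_left]
        cat_functor_comp[OF DN.dT.functor_left DN.dT.functor_right],
        of K X X K "\<lambda>L. dmassoc K L X"] that dmassoc_nat_arr[OF Ide_simps(1) _ N.Ide_simps(1), of K _ X]
    by simp
  have 3: "dmassoc K L (Cod HN f) \<star> DN.dT1 (Ide HV (DV.dT0 K L)) f
      = DN.dT1 (Ide HV K) (DN.dT1 (Ide HV L) f) \<star> dmassoc K L (Dom HN f)"
    if "K \<in> Obj V" "L \<in> Obj V" for K L
    using N.ho_natural[OF f DN.dT.functor_right cat_functor_comp[OF DN.dT.functor_right DN.dT.functor_right],
        of "DV.dT0 K L" L K "\<lambda>X. dmassoc K L X"] that dmassoc_nat_arr[OF Ide_simps(1) Ide_simps(1), of K L]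
    by (simp add: DV.dT0_def)
  let ?K = "Cod HV k" and ?L = "Cod HV l" and ?X = "Cod HN f"
  let ?K' = "Dom HV k" and ?L' = "Dom HV l" and ?X' = "Dom HN f"
  note O = DN.Obj_Ho(1,2)[OF k] DN.Obj_Ho(1,2)[OF l] DN.Obj_Ho(3,4)[OF f]
  have "dmassoc ?K ?L ?X \<star> DN.dT1 (DV.dT1 k l) f
      = dmassoc ?K ?L ?X \<star> DN.dT1 (DV.dT1 k (Ide HV ?L)) (Ide HN ?X)
        \<star> DN.dT1 (DV.dT1 (Ide HV ?K') l) (Ide HN ?X) \<star> DN.dT1 (Ide HV (DV.dT0 ?K' ?L')) f"
    using k l f O by (simp add: DN.dT.T1_merge DV.dT.T1_merge)
  also have "\<dots> = DN.dT1 k (Ide HN (DN.dT0 ?L ?X)) \<star> dmassoc ?K' ?L ?X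
        \<star> DN.dT1 (DV.dT1 (Ide HV ?K') l) (Ide HN ?X) \<star> DN.dT1 (Ide HV (DV.dT0 ?K' ?L')) f"
    by (rule N.Ho.square_tail[OF 1]) (use k l f O in auto)
  also have "\<dots> = DN.dT1 k (Ide HN (DN.dT0 ?L ?X)) \<star> DN.dT1 (Ide HV ?K') (DN.dT1 l (Ide HN ?X))
        \<star> dmassoc ?K' ?L' ?X \<star> DN.dT1 (Ide HV (DV.dT0 ?K' ?L')) f"
    using k l f O by (subst N.Ho.square_tail[OF 2]) auto
  also have "\<dots> = DN.dT1 k (Ide HN (DN.dT0 ?L ?X)) \<star> DN.dT1 (Ide HV ?K') (DN.dT1 l (Ide HN ?X))
        \<star> DN.dT1 (Ide HV ?K') (DN.dT1 (Ide HV ?L') f) \<star> dmassoc ?K' ?L' ?X'"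
    using O by (simp add: 3)
  also have "\<dots> = DN.dT1 k (DN.dT1 l f) \<star> dmassoc ?K' ?L' ?X'"
    using k l f O by (simp add: DN.dT.T1_merge_tail DN.dT.T1_merge)
  finally show ?thesis .
qed

lemma dmunit_nat:
  assumes f: "f \<in> Arr HN"
  shows "dmunit (Cod HN f) \<star> DN.dT1 (Ide HV E) f = f \<star> dmunit (Dom HN f)"
proof -
  have "dmunit (Cod N g) \<star> \<gamma> (iV (Q E) \<odot>\<^sub>1 P1 g) = \<gamma> g \<star> dmunit (Dom N g)" if g: "g \<in> Arr N" for g
  proof -
    let ?X = "P (Dom N g)" and ?Y = "P (Cod N g)"
    have "(p (Cod N g) \<bullet> munit ?Y \<bullet> (q E \<odot>\<^sub>1 iN ?Y)) \<bullet> (iV (Q E) \<odot>\<^sub>1 P1 g)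
        = p (Cod N g) \<bullet> munit ?Y \<bullet> (iV E \<odot>\<^sub>1 P1 g) \<bullet> (q E \<odot>\<^sub>1 iN ?X)"
      using g by (simp add: N.assoc' act.T1_merge)
    also have "\<dots> = p (Cod N g) \<bullet> P1 g \<bullet> munit ?X \<bullet> (q E \<odot>\<^sub>1 iN ?X)"
      using g N.square_tail[OF munit_nat[of "P1 g" ?Y]] by simp
    also have "\<dots> = g \<bullet> p (Dom N g) \<bullet> munit ?X \<bullet> (q E \<odot>\<^sub>1 iN ?X)"
      using g N.square_tail[OF N.q_nat[of g "Cod N g"]] by simp
    finally show ?thesis using g by (simp add: dmunit_def N.ho_merge)
  qed
  then show ?thesis
    using N.ho_natural[OF f DN.dT.functor_right N.Ho.id_functor, of E dmunit] by simp
qed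

text \<open>\<open>?Phi\<close> is an invertible map that starts clearing the formal inverses at the
  target. Pushed through the left side it produces the image of one arrow of \<open>N\<close>; there
  \<open>mpentagon\<close> applies, and the result is folded back into the right side.\<close>

lemma dmpentagon:
  assumes O: "J \<in> Obj V" "K \<in> Obj V" "L \<in> Obj V" "X \<in> Obj N"
  shows "DN.dT1 (Ide HV J) (dmassoc K L X) \<star> dmassoc J (DV.dT0 K L) X
      \<star> DN.dT1 (derived_assoc V J K L) (Ide HN X)
    = dmassoc J K (DN.dT0 L X) \<star> dmassoc (DV.dT0 J K) L X"
proof -
  let ?J = "Q J" and ?K = "Q K" and ?L = "Q L" and ?X = "P X"
  let ?A = "Q (?K \<otimes> ?L)" and ?B = "Q (?J \<otimes> ?K)"
  let ?da = "derived_assoc V J K L"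
  let ?Phi = "\<gamma> (iV ?J \<odot>\<^sub>1 iV ?K \<odot>\<^sub>1 p (?L \<odot> ?X)) \<star> \<gamma> (iV ?J \<odot>\<^sub>1 p (?K \<odot> P (?L \<odot> ?X)))"
  let ?y = "massoc ?K ?L ?X \<bullet> (q (?K \<otimes> ?L) \<odot>\<^sub>1 iN ?X)"
  let ?b = "assoc V ?J ?K ?L \<cdot> (q (?J \<otimes> ?K) \<otimes>\<^sub>1 iV ?L)"
  let ?c = "iV ?J \<otimes>\<^sub>1 q (?K \<otimes> ?L)"
  note defs = DN.dT0_def DV.dT0_def
  have T: "dmassoc J (?K \<otimes> ?L) X \<in> Arr HN"
    "Dom HN (dmassoc J (?K \<otimes> ?L) X) = Q (?J \<otimes> ?A) \<odot> ?X"
    "Cod HN (dmassoc J (?K \<otimes> ?L) X) = ?J \<odot> P (?A \<odot> ?X)"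
    "DN.dT1 ?da (Ide HN X) \<in> Arr HN"
    "Dom HN (DN.dT1 ?da (Ide HN X)) = Q (?B \<otimes> ?L) \<odot> ?X"
    "Cod HN (DN.dT1 ?da (Ide HN X)) = Q (?J \<otimes> ?A) \<odot> ?X"
    "DN.dT1 (Ide HV J) (dmassoc K L X) \<in> Arr HN"
    "Dom HN (DN.dT1 (Ide HV J) (dmassoc K L X)) = ?J \<odot> P (?A \<odot> ?X)"
    "Cod HN (DN.dT1 (Ide HV J) (dmassoc K L X)) = ?J \<odot> P (?K \<odot> P (?L \<odot> ?X))"
    "dmassoc J K (?L \<odot> ?X) \<in> Arr HN"
    "Dom HN (dmassoc J K (?L \<odot> ?X)) = ?B \<odot> P (?L \<odot> ?X)"
    "Cod HN (dmassoc J K (?L \<odot> ?X)) = ?J \<odot> P (?K \<odot> P (?L \<odot> ?X))"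
    "dmassoc (?J \<otimes> ?K) L X \<in> Arr HN"
    "Dom HN (dmassoc (?J \<otimes> ?K) L X) = Q (?B \<otimes> ?L) \<odot> ?X"
    "Cod HN (dmassoc (?J \<otimes> ?K) L X) = ?B \<odot> P (?L \<odot> ?X)"
    using O by (simp_all add: defs)
  \<comment> \<open>The derived action of \<open>J\<close> applied to \<open>dmassoc_char\<close>;
    \<open>e2\<close> applies the derived action on \<open>X\<close> to
    \<open>derived_assoc_char\<close>.\<close>
  have e1: "\<gamma> (iV ?J \<odot>\<^sub>1 P1 (iV ?K \<odot>\<^sub>1 p (?L \<odot> ?X))) \<star> DN.dT1 (Ide HV J) (dmassoc K L X)
      = \<gamma> (iV ?J \<odot>\<^sub>1 P1 ?y)"
  proof -
    have "\<gamma> (iV ?J \<odot>\<^sub>1 P1 (iV ?K \<odot>\<^sub>1 p (?L \<odot> ?X))) \<star> DN.dT1 (Ide HV J) (dmassoc K L X)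
        = DN.dT1 (Ide HV J) (\<gamma> (iV ?K \<odot>\<^sub>1 p (?L \<odot> ?X))) \<star> DN.dT1 (Ide HV J) (dmassoc K L X)"
      using O by simp
    also have "\<dots> = DN.dT1 (Ide HV J) (\<gamma> (iV ?K \<odot>\<^sub>1 p (?L \<odot> ?X)) \<star> dmassoc K L X)"
      by (rule DN.dT.T1_Comp_right[symmetric]) (use O in \<open>auto simp: DN.dT0_def\<close>)
    also have "\<dots> = \<gamma> (iV ?J \<odot>\<^sub>1 P1 ?y)"
      using O by (simp add: dmassoc_char)
    finally show ?thesis .
  qed
  have e2: "\<gamma> (Q1 ?c \<odot>\<^sub>1 iN ?X) \<star> DN.dT1 ?da (Ide HN X) = \<gamma> (Q1 ?b \<odot>\<^sub>1 iN ?X)"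
  proof -
    have "\<gamma> (Q1 ?c \<odot>\<^sub>1 iN ?X) \<star> DN.dT1 ?da (Ide HN X)
        = DN.dT1 (V_ho_arr V ?c) (Ide HN X) \<star> DN.dT1 ?da (Ide HN X)"
      using O by simp
    also have "\<dots> = DN.dT1 (V_ho_arr V ?c \<cdot>\<^bsub>HV\<^esub> ?da) (Ide HN X)"
      by (rule DN.dT.T1_Comp_left[symmetric]) (use O in \<open>auto simp: DV.dT0_def\<close>)
    also have "\<dots> = \<gamma> (Q1 ?b \<odot>\<^sub>1 iN ?X)"
      using O by (simp add: derived_assoc_char)
    finally show ?thesis .
  qed
  have "?Phi \<star> DN.dT1 (Ide HV J) (dmassoc K L X) \<star> dmassoc J (?K \<otimes> ?L) X \<star> DN.dT1 ?da (Ide HN X)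
      = \<gamma> (iV ?J \<odot>\<^sub>1 p (?K \<odot> ?L \<odot> ?X)) \<star> \<gamma> (iV ?J \<odot>\<^sub>1 P1 (iV ?K \<odot>\<^sub>1 p (?L \<odot> ?X)))
        \<star> DN.dT1 (Ide HV J) (dmassoc K L X) \<star> dmassoc J (?K \<otimes> ?L) X \<star> DN.dT1 ?da (Ide HN X)"
    using O T N.q_nat[of "iV ?K \<odot>\<^sub>1 p (?L \<odot> ?X)" "?K \<odot> ?L \<odot> ?X"]
    by (simp add: N.Ho.assoc' N.ho_merge_tail act.T1_merge)
  also have "\<dots> = \<gamma> (iV ?J \<odot>\<^sub>1 p (?K \<odot> ?L \<odot> ?X)) \<star> \<gamma> (iV ?J \<odot>\<^sub>1 P1 ?y)
        \<star> dmassoc J (?K \<otimes> ?L) X \<star> DN.dT1 ?da (Ide HN X)"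
    using O T by (subst N.Ho.triangle_tail[OF e1]) auto
  also have "\<dots> = \<gamma> (iV ?J \<odot>\<^sub>1 ?y) \<star> \<gamma> (iV ?J \<odot>\<^sub>1 p (?A \<odot> ?X))
        \<star> dmassoc J (?K \<otimes> ?L) X \<star> DN.dT1 ?da (Ide HN X)"
    using O T N.q_nat[of ?y "?K \<odot> ?L \<odot> ?X"] by (simp add: N.ho_merge_tail act.T1_merge)
  also have "\<dots> = \<gamma> (iV ?J \<odot>\<^sub>1 ?y) \<star> \<gamma> (massoc ?J ?A ?X \<bullet> (q (?J \<otimes> ?A) \<odot>\<^sub>1 iN ?X))
        \<star> DN.dT1 ?da (Ide HN X)"
    using O T by (subst N.Ho.triangle_tail[OF dmassoc_char]) auto
  also have "\<dots> = \<gamma> ((iV ?J \<odot>\<^sub>1 ?y) \<bullet> massoc ?J ?A ?X \<bullet> (q (?J \<otimes> ?A) \<odot>\<^sub>1 iN ?X))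
        \<star> DN.dT1 ?da (Ide HN X)"
    using O T by (simp add: N.ho_merge_tail)
  also have "(iV ?J \<odot>\<^sub>1 ?y) \<bullet> massoc ?J ?A ?X \<bullet> (q (?J \<otimes> ?A) \<odot>\<^sub>1 iN ?X)
      = (iV ?J \<odot>\<^sub>1 massoc ?K ?L ?X) \<bullet> massoc ?J (?K \<otimes> ?L) ?X \<bullet> (?c \<odot>\<^sub>1 iN ?X) \<bullet> (q (?J \<otimes> ?A) \<odot>\<^sub>1 iN ?X)"
    using O N.square_tail[OF massoc_nat[of "iV ?J" "q (?K \<otimes> ?L)" "iN ?X"]]
    by (simp add: act.T1_Comp_right N.assoc')
  also have "\<dots> = ((iV ?J \<odot>\<^sub>1 massoc ?K ?L ?X) \<bullet> massoc ?J (?K \<otimes> ?L) ?X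
      \<bullet> (q (?J \<otimes> ?K \<otimes> ?L) \<odot>\<^sub>1 iN ?X)) \<bullet> (Q1 ?c \<odot>\<^sub>1 iN ?X)"
    using O L.q_nat[of ?c "?J \<otimes> ?K \<otimes> ?L"] by (simp add: act.T1_merge N.assoc')
  also have "\<gamma> \<dots> \<star> DN.dT1 ?da (Ide HN X) = \<gamma> ((iV ?J \<odot>\<^sub>1 massoc ?K ?L ?X) \<bullet> massoc ?J (?K \<otimes> ?L) ?X
      \<bullet> (q (?J \<otimes> ?K \<otimes> ?L) \<odot>\<^sub>1 iN ?X)) \<star> \<gamma> (Q1 ?b \<odot>\<^sub>1 iN ?X)"
    using O T e2 by (simp add: N.ho_merge[symmetric] N.Ho.assoc' del: iso_ho_arr)
  also have "\<dots> = \<gamma> ((iV ?J \<odot>\<^sub>1 massoc ?K ?L ?X) \<bullet> massoc ?J (?K \<otimes> ?L) ?X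
      \<bullet> (?b \<odot>\<^sub>1 iN ?X) \<bullet> (q (?B \<otimes> ?L) \<odot>\<^sub>1 iN ?X))"
    using O L.q_nat[of ?b "?J \<otimes> ?K \<otimes> ?L"] by (simp add: N.ho_merge act.T1_merge N.assoc')
  also have "\<dots> = \<gamma> ((iV ?J \<odot>\<^sub>1 massoc ?K ?L ?X) \<bullet> massoc ?J (?K \<otimes> ?L) ?X
      \<bullet> (assoc V ?J ?K ?L \<odot>\<^sub>1 iN ?X) \<bullet> ((q (?J \<otimes> ?K) \<otimes>\<^sub>1 iV ?L) \<odot>\<^sub>1 iN ?X) \<bullet> (q (?B \<otimes> ?L) \<odot>\<^sub>1 iN ?X))"
    using O by (simp add: act.T1_Comp_left N.assoc')
  also have "\<dots> = \<gamma> (massoc ?J ?K (?L \<odot> ?X) \<bullet> massoc (?J \<otimes> ?K) ?L ?X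
      \<bullet> ((q (?J \<otimes> ?K) \<otimes>\<^sub>1 iV ?L) \<odot>\<^sub>1 iN ?X) \<bullet> (q (?B \<otimes> ?L) \<odot>\<^sub>1 iN ?X))"
  \<comment> \<open>The pentagon of the original module, for the deformed objects.\<close>
  proof -
    let ?z = "((q (?J \<otimes> ?K) \<otimes>\<^sub>1 iV ?L) \<odot>\<^sub>1 iN ?X) \<bullet> (q (?B \<otimes> ?L) \<odot>\<^sub>1 iN ?X)"
    have "((iV ?J \<odot>\<^sub>1 massoc ?K ?L ?X) \<bullet> massoc ?J (?K \<otimes> ?L) ?X \<bullet> (assoc V ?J ?K ?L \<odot>\<^sub>1 iN ?X)) \<bullet> ?z
        = (massoc ?J ?K (?L \<odot> ?X) \<bullet> massoc (?J \<otimes> ?K) ?L ?X) \<bullet> ?z"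
      using O by (simp only: mpentagon[of ?J ?K ?L ?X] L.Q.FO_simps N.Q.FO_simps)
    then show ?thesis using O by (simp add: N.assoc')
  qed
  also have "\<dots> = \<gamma> (massoc ?J ?K (?L \<odot> ?X) \<bullet> (q (?J \<otimes> ?K) \<odot>\<^sub>1 iN (?L \<odot> ?X)) \<bullet> massoc ?B ?L ?X
      \<bullet> (q (?B \<otimes> ?L) \<odot>\<^sub>1 iN ?X))"
    using O N.square_tail[OF massoc_nat[of "q (?J \<otimes> ?K)" "iV ?L" "iN ?X"]] by simp
  also have "\<dots> = \<gamma> (massoc ?J ?K (?L \<odot> ?X) \<bullet> (q (?J \<otimes> ?K) \<odot>\<^sub>1 iN (?L \<odot> ?X)))
      \<star> \<gamma> (iV ?B \<odot>\<^sub>1 p (?L \<odot> ?X)) \<star> dmassoc (?J \<otimes> ?K) L X"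
    using O dmassoc_char[of "?J \<otimes> ?K" L X] by (simp add: N.ho_merge N.assoc')
  also have "\<dots> = \<gamma> (massoc ?J ?K (?L \<odot> ?X) \<bullet> ((iV ?J \<otimes>\<^sub>1 iV ?K) \<odot>\<^sub>1 p (?L \<odot> ?X))
      \<bullet> (q (?J \<otimes> ?K) \<odot>\<^sub>1 iN (P (?L \<odot> ?X)))) \<star> dmassoc (?J \<otimes> ?K) L X"
    using O T by (simp add: N.ho_merge_tail act.T1_merge N.assoc')
  also have "\<dots> = \<gamma> ((iV ?J \<odot>\<^sub>1 iV ?K \<odot>\<^sub>1 p (?L \<odot> ?X)) \<bullet> massoc ?J ?K (P (?L \<odot> ?X))
      \<bullet> (q (?J \<otimes> ?K) \<odot>\<^sub>1 iN (P (?L \<odot> ?X)))) \<star> dmassoc (?J \<otimes> ?K) L X"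
    using O N.square_tail[OF massoc_nat[of "iV ?J" "iV ?K" "p (?L \<odot> ?X)"]] by (simp del: T.T1_Ide)
  also have "\<dots> = \<gamma> (iV ?J \<odot>\<^sub>1 iV ?K \<odot>\<^sub>1 p (?L \<odot> ?X)) \<star> (\<gamma> (iV ?J \<odot>\<^sub>1 p (?K \<odot> P (?L \<odot> ?X)))
      \<star> dmassoc J K (?L \<odot> ?X)) \<star> dmassoc (?J \<otimes> ?K) L X"
    using O T by (simp add: N.ho_merge_tail dmassoc_char)
  finally have "?Phi \<star> DN.dT1 (Ide HV J) (dmassoc K L X) \<star> dmassoc J (?K \<otimes> ?L) X \<star> DN.dT1 ?da (Ide HN X)
      = ?Phi \<star> dmassoc J K (?L \<odot> ?X) \<star> dmassoc (?J \<otimes> ?K) L X"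
    using O T by (simp add: N.Ho.assoc')
  then have "DN.dT1 (Ide HV J) (dmassoc K L X) \<star> dmassoc J (?K \<otimes> ?L) X \<star> DN.dT1 ?da (Ide HN X)
      = dmassoc J K (?L \<odot> ?X) \<star> dmassoc (?J \<otimes> ?K) L X"
    by (rule N.Ho.iso_cancel_left) (use O T in auto)
  then show ?thesis by (simp add: defs)
qed

text \<open>\<open>dmunit X\<close> contains \<open>p X\<close>, so the derived action yields
  \<open>P1 (p X)\<close> where cancelling the inverse in \<open>dmassoc\<close> calls for
  \<open>p (P X)\<close>; on the other side \<open>q (Q K)\<close> meets \<open>Q1 (q K)\<close>.
  Both pairs agree in \<open>HN\<close>, by \<open>ho_T1_Q_q_right\<close> and
  \<open>ho_T1_Q_q_left\<close>.\<close>

lemma dmtriangle_right: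
  assumes O: "K \<in> Obj V" "X \<in> Obj N"
  shows "DN.dT1 (Ide HV K) (dmunit X) \<star> dmassoc K E X = DN.dT1 (derived_runit V K) (Ide HN X)"
proof -
  let ?K = "Q K" and ?E = "Q E" and ?X = "P X"
  let ?z = "munit ?X \<bullet> (q E \<odot>\<^sub>1 iN ?X)" and ?y = "runit V ?K \<cdot> (iV ?K \<otimes>\<^sub>1 q E)"
  have T: "dmassoc K E X \<in> Arr HN" "Cod HN (dmassoc K E X) = ?K \<odot> P (?E \<odot> ?X)"
    using O by (simp_all add: DN.dT0_def)
  have "DN.dT1 (Ide HV K) (dmunit X) = \<gamma> (iV ?K \<odot>\<^sub>1 P1 (p X)) \<star> \<gamma> (iV ?K \<odot>\<^sub>1 P1 ?z)"
    using O by (simp add: dmunit_def N.ho_merge act.T1_merge N.Q.FA_Comp')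
  also have "\<dots> = \<gamma> (iV ?K \<odot>\<^sub>1 p ?X) \<star> \<gamma> (iV ?K \<odot>\<^sub>1 P1 ?z)"
    using O by (simp add: DN.ho_T1_Q_q_right)
  also have "\<dots> = \<gamma> (iV ?K \<odot>\<^sub>1 ?z) \<star> \<gamma> (iV ?K \<odot>\<^sub>1 p (?E \<odot> ?X))"
    using O N.q_nat[of ?z ?X] by (simp add: N.ho_merge act.T1_merge)
  finally have "DN.dT1 (Ide HV K) (dmunit X) \<star> dmassoc K E X
      = \<gamma> (iV ?K \<odot>\<^sub>1 ?z) \<star> \<gamma> (iV ?K \<odot>\<^sub>1 p (?E \<odot> ?X)) \<star> dmassoc K E X"
    using O T by (simp add: N.Ho.assoc' del: N.iso_ho_arr)
  also have "\<dots> = \<gamma> ((iV ?K \<odot>\<^sub>1 ?z) \<bullet> massoc ?K ?E ?X \<bullet> (q (?K \<otimes> ?E) \<odot>\<^sub>1 iN ?X))"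
    using O by (simp add: dmassoc_char N.ho_merge)
  also have "(iV ?K \<odot>\<^sub>1 ?z) \<bullet> massoc ?K ?E ?X \<bullet> (q (?K \<otimes> ?E) \<odot>\<^sub>1 iN ?X)
      = (iV ?K \<odot>\<^sub>1 munit ?X) \<bullet> massoc ?K E ?X \<bullet> ((iV ?K \<otimes>\<^sub>1 q E) \<odot>\<^sub>1 iN ?X)
        \<bullet> (q (?K \<otimes> ?E) \<odot>\<^sub>1 iN ?X)"
    using O N.square_tail[OF massoc_nat[of "iV ?K" "q E" "iN ?X"]] by (simp add: act.T1_Comp_right N.assoc')
  also have "\<dots> = (runit V ?K \<odot>\<^sub>1 iN ?X) \<bullet> ((iV ?K \<otimes>\<^sub>1 q E) \<odot>\<^sub>1 iN ?X) \<bullet> (q (?K \<otimes> ?E) \<odot>\<^sub>1 iN ?X)"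
    by (rule N.triangle_tail[OF mtriangle_right]) (use O in auto)
  also have "\<dots> = (q ?K \<odot>\<^sub>1 iN ?X) \<bullet> (Q1 ?y \<odot>\<^sub>1 iN ?X)"
    using O L.q_nat[of ?y ?K] by (simp add: act.T1_merge assoc')
  also have "\<gamma> \<dots> = \<gamma> (q ?K \<odot>\<^sub>1 iN ?X) \<star> \<gamma> (Q1 ?y \<odot>\<^sub>1 iN ?X)"
    using O by (simp add: N.ho_merge)
  also have "\<dots> = \<gamma> (Q1 (q K) \<odot>\<^sub>1 iN ?X) \<star> \<gamma> (Q1 ?y \<odot>\<^sub>1 iN ?X)"
    using O by (simp add: DN.ho_T1_Q_q_left)
  also have "\<dots> = DN.dT1 (derived_runit V K) (Ide HN X)"
    using O by (simp add: derived_runit_def Let_def N.ho_merge act.T1_merge L.Q.FA_Comp')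
  finally show ?thesis .
qed

text \<open>Here \<open>dmunit\<close> stands outside the action and naturality of
  \<open>munit\<close> moves \<open>p\<close> into place; it remains to identify
  \<open>q (Q K)\<close> with \<open>Q1 (q K)\<close>.\<close>

lemma dmtriangle_left:
  assumes O: "K \<in> Obj V" "X \<in> Obj N"
  shows "dmunit (DN.dT0 K X) \<star> dmassoc E K X = DN.dT1 (derived_lunit V K) (Ide HN X)"
proof -
  let ?K = "Q K" and ?E = "Q E" and ?X = "P X"
  let ?y = "lunit V ?K \<cdot> (q E \<otimes>\<^sub>1 iV ?K)"
  have T: "dmassoc E K X \<in> Arr HN" "Cod HN (dmassoc E K X) = ?E \<odot> P (?K \<odot> ?X)"
    using O by (simp_all add: DN.dT0_def)
  have "p (?K \<odot> ?X) \<bullet> munit (P (?K \<odot> ?X)) \<bullet> (q E \<odot>\<^sub>1 iN (P (?K \<odot> ?X)))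
      = munit (?K \<odot> ?X) \<bullet> (iV E \<odot>\<^sub>1 p (?K \<odot> ?X)) \<bullet> (q E \<odot>\<^sub>1 iN (P (?K \<odot> ?X)))"
    using O N.square_tail[OF munit_nat[of "p (?K \<odot> ?X)" "?K \<odot> ?X"]] by simp
  also have "\<dots> = (munit (?K \<odot> ?X) \<bullet> (q E \<odot>\<^sub>1 iN (?K \<odot> ?X))) \<bullet> (iV ?E \<odot>\<^sub>1 p (?K \<odot> ?X))"
    using O by (simp add: act.T1_merge N.assoc')
  finally have "dmunit (DN.dT0 K X)
      = \<gamma> (munit (?K \<odot> ?X) \<bullet> (q E \<odot>\<^sub>1 iN (?K \<odot> ?X))) \<star> \<gamma> (iV ?E \<odot>\<^sub>1 p (?K \<odot> ?X))"
    using O by (simp add: dmunit_def DN.dT0_def N.ho_merge)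
  then have "dmunit (DN.dT0 K X) \<star> dmassoc E K X
      = \<gamma> (munit (?K \<odot> ?X) \<bullet> (q E \<odot>\<^sub>1 iN (?K \<odot> ?X))) \<star> \<gamma> (iV ?E \<odot>\<^sub>1 p (?K \<odot> ?X)) \<star> dmassoc E K X"
    using O T by (simp add: N.Ho.assoc')
  also have "\<dots> = \<gamma> (munit (?K \<odot> ?X) \<bullet> (q E \<odot>\<^sub>1 iN (?K \<odot> ?X)) \<bullet> massoc ?E ?K ?X
      \<bullet> (q (?E \<otimes> ?K) \<odot>\<^sub>1 iN ?X))"
    using O by (simp add: dmassoc_char N.ho_merge N.assoc')
  also have "munit (?K \<odot> ?X) \<bullet> (q E \<odot>\<^sub>1 iN (?K \<odot> ?X)) \<bullet> massoc ?E ?K ?X \<bullet> (q (?E \<otimes> ?K) \<odot>\<^sub>1 iN ?X)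
      = munit (?K \<odot> ?X) \<bullet> massoc E ?K ?X \<bullet> ((q E \<otimes>\<^sub>1 iV ?K) \<odot>\<^sub>1 iN ?X) \<bullet> (q (?E \<otimes> ?K) \<odot>\<^sub>1 iN ?X)"
    using O N.square_tail[OF massoc_nat[of "q E" "iV ?K" "iN ?X"]] by simp
  also have "\<dots> = (lunit V ?K \<odot>\<^sub>1 iN ?X) \<bullet> ((q E \<otimes>\<^sub>1 iV ?K) \<odot>\<^sub>1 iN ?X) \<bullet> (q (?E \<otimes> ?K) \<odot>\<^sub>1 iN ?X)"
    by (rule N.triangle_tail[OF mtriangle_left]) (use O in auto)
  also have "\<dots> = (q ?K \<odot>\<^sub>1 iN ?X) \<bullet> (Q1 ?y \<odot>\<^sub>1 iN ?X)"
    using O L.q_nat[of ?y ?K] by (simp add: act.T1_merge assoc')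
  also have "\<gamma> \<dots> = \<gamma> (q ?K \<odot>\<^sub>1 iN ?X) \<star> \<gamma> (Q1 ?y \<odot>\<^sub>1 iN ?X)"
    using O by (simp add: N.ho_merge)
  also have "\<dots> = \<gamma> (Q1 (q K) \<odot>\<^sub>1 iN ?X) \<star> \<gamma> (Q1 ?y \<odot>\<^sub>1 iN ?X)"
    using O by (simp add: DN.ho_T1_Q_q_left)
  also have "\<dots> = DN.dT1 (derived_lunit V K) (Ide HN X)"
    using O by (simp add: derived_lunit_def Let_def N.ho_merge act.T1_merge L.Q.FA_Comp')
  finally show ?thesis .
qed

end

section \<open>Derived hom objects and cotensors\<close>

locale homotopical_closed_module =
  homotopical_module I V N act act1 massoc munit WN QN p SN +
  closed_module V N act act1 massoc munit mhom mev +
  NR: right_deformed N WN RN r TN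
  for I :: "'i itself" and V :: "('o, 'a, 'z) hcsm_scheme" (structure)
    and N :: "('n, 'b, 'y) cat_scheme" and act (infixr "\<odot>" 75) and act1 (infixr "\<odot>\<^sub>1" 75)
    and massoc munit WN QN p SN mhom mev RN r TN +
  assumes mhom_weq: "X \<in> SN \<Longrightarrow> g \<in> weq_on N WN TN \<Longrightarrow> mhom_arr X g \<in> Weq V"
begin

definition dmhom :: "'n \<Rightarrow> 'n \<Rightarrow> 'o" where
  "dmhom X Y = mhom (P X) (FO RN Y)"

definition dmev :: "'n \<Rightarrow> 'n \<Rightarrow> ('n, 'b) ho_arr" where
  "dmev X Y = inv_arr HN (\<gamma> (r Y))
     \<star> \<gamma> (mev (P X) (FO RN Y) \<bullet> (q (mhom (P X) (FO RN Y)) \<odot>\<^sub>1 iN (P X)))"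

text \<open>The first variable stays fixed at an object of \<open>SN\<close>, so homotopical
  behaviour of the hom functor enters in the second variable, through \<open>mhom_weq\<close>; for
  the left adjoint it is \<open>act_weq\<close> with an identity.\<close>

lemma adjunction_hom:
  assumes X: "X \<in> SN"
  shows "deformable_adjunction V (Weq V) (Qf V) q (VQ V) N WN RN r TN
    \<lparr>FO = (\<lambda>K. K \<odot> X), FA = (\<lambda>k. k \<odot>\<^sub>1 iN X)\<rparr> \<lparr>FO = mhom X, FA = mhom_arr X\<rparr> (mev X)"
proof -
  have O: "X \<in> Obj N" using X by simp
  interpret F: cat_functor V N "\<lparr>FO = (\<lambda>K. K \<odot> X), FA = (\<lambda>k. k \<odot>\<^sub>1 iN X)\<rparr>"
    by (rule act.functor_left[OF O])
  interpret G: cat_functor N V "\<lparr>FO = mhom X, FA = mhom_arr X\<rparr>"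
    by (rule mhom_arr_functor[OF O])
  show ?thesis
  proof unfold_locales
    fix w assume "w \<in> weq_on V (Weq V) (VQ V)"
    then show "FA \<lparr>FO = (\<lambda>K. K \<odot> X), FA = (\<lambda>k. k \<odot>\<^sub>1 iN X)\<rparr> w \<in> WN"
      using X act_weq[of w "iN X"] by simp
  next
    fix g Y assume "g \<in> Arr N" "Cod N g = Y"
    then show "mev X Y \<bullet> FA \<lparr>FO = (\<lambda>K. K \<odot> X), FA = (\<lambda>k. k \<odot>\<^sub>1 iN X)\<rparr>
        (FA \<lparr>FO = mhom X, FA = mhom_arr X\<rparr> g) = g \<bullet> mev X (Dom N g)"
      using O mhom_arr_simps(4)[of X g] by (auto simp: flat_def)
  next
    fix K Y f assume "K \<in> Obj V" "Y \<in> Obj N" "f \<in> hom N (FO \<lparr>FO = (\<lambda>K. K \<odot> X), FA = (\<lambda>k. k \<odot>\<^sub>1 iN X)\<rparr> K) Y"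
    then show "\<exists>!g. g \<in> hom V K (FO \<lparr>FO = mhom X, FA = mhom_arr X\<rparr> Y)
        \<and> mev X Y \<bullet> FA \<lparr>FO = (\<lambda>K. K \<odot> X), FA = (\<lambda>k. k \<odot>\<^sub>1 iN X)\<rparr> g = f"
      using O mev_universal[of K X Y f] by simp
  qed (use X O mhom_weq in auto)
qed

text \<open>For the adjunction at \<open>P X\<close>, the derived left adjoint unfolds to
  \<open>dT_left X\<close> and the derived counit to \<open>dmev X Y\<close>, so this is an instance
  of \<open>derived_counit_universal\<close>.\<close>

lemma dmev_universal:
  assumes "K \<in> Obj V" "X \<in> Obj N" "Y \<in> Obj N" "f \<in> hom HN (DN.dT0 K X) Y"
  shows "\<exists>!g. g \<in> hom HV K (dmhom X Y) \<and> dmev X Y \<star> DN.dT1 g (Ide HN X) = f"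
proof -
  interpret A: deformable_adjunction V "Weq V" "Qf V" q "VQ V" N WN RN r TN
    "\<lparr>FO = (\<lambda>K. K \<odot> P X), FA = (\<lambda>k. k \<odot>\<^sub>1 iN (P X))\<rparr>" "\<lparr>FO = mhom (P X), FA = mhom_arr (P X)\<rparr>" "mev (P X)"
    by (rule adjunction_hom) (use assms in simp)
  have LF: "A.LF = DN.dT_left X"
    by (simp add: A.LF_def DN.dT_left_def)
  have counit: "A.derived_counit Y = dmev X Y"
    by (simp add: A.derived_counit_def dmev_def)
  have "\<exists>!g. g \<in> hom HV K (dmhom X Y) \<and> dmev X Y \<star> FA (DN.dT_left X) g = f"
    using A.derived_counit_universal[OF assms(1,3), of f] assms(4)
    unfolding LF counit by (simp add: dmhom_def DN.dT0_def)
  moreover have "g \<in> hom HV K (dmhom X Y) \<and> dmev X Y \<star> DN.dT1 g (Ide HN X) = f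
      \<longleftrightarrow> g \<in> hom HV K (dmhom X Y) \<and> dmev X Y \<star> FA (DN.dT_left X) g = f" for g
    by (rule conj_cong[OF HOL.refl], subst DN.dT1_left[OF homD(1) assms(2)]) simp_all
  ultimately show ?thesis by simp
qed

lemma dmhom_simps [simp]:
  assumes "X \<in> Obj N" "Y \<in> Obj N"
  shows "dmhom X Y \<in> Obj V" "dmev X Y \<in> Arr HN" "Dom HN (dmev X Y) = DN.dT0 (dmhom X Y) X"
    "Cod HN (dmev X Y) = Y"
  using assms by (simp_all add: dmhom_def dmev_def DN.dT0_def)

end

locale homotopical_biclosed_module =
  homotopical_closed_module I V N act act1 massoc munit WN QN p SN mhom mev RN r TN +
  biclosed_module V N act act1 massoc munit mhom mev mcot mcev
  for I :: "'i itself" and V :: "('o, 'a, 'z) hcsm_scheme" (structure)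
    and N :: "('n, 'b, 'y) cat_scheme" and act (infixr "\<odot>" 75) and act1 (infixr "\<odot>\<^sub>1" 75)
    and massoc munit WN QN p SN mhom mev RN r TN mcot mcev +
  assumes mcot_weq: "K \<in> VQ V \<Longrightarrow> g \<in> weq_on N WN TN \<Longrightarrow> mcot_arr K g \<in> WN"
begin

definition dmcot :: "'o \<Rightarrow> 'n \<Rightarrow> 'n" where
  "dmcot K Y = mcot (Q K) (FO RN Y)"

definition dmcev :: "'o \<Rightarrow> 'n \<Rightarrow> ('n, 'b) ho_arr" where
  "dmcev K Y = inv_arr HN (\<gamma> (r Y))
     \<star> \<gamma> (mcev (Q K) (FO RN Y) \<bullet> (iV (Q K) \<odot>\<^sub>1 p (mcot (Q K) (FO RN Y))))"

lemma adjunction_cot: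
  assumes K: "K \<in> VQ V"
  shows "deformable_adjunction N WN QN p SN N WN RN r TN
    \<lparr>FO = act K, FA = act1 (iV K)\<rparr> \<lparr>FO = mcot K, FA = mcot_arr K\<rparr> (mcev K)"
proof -
  have O: "K \<in> Obj V" using K by simp
  interpret F: cat_functor N N "\<lparr>FO = act K, FA = act1 (iV K)\<rparr>"
    by (rule act.functor_right[OF O])
  interpret G: cat_functor N N "\<lparr>FO = mcot K, FA = mcot_arr K\<rparr>"
    by (rule mcot_arr_functor[OF O])
  show ?thesis
  proof unfold_locales
    fix w assume "w \<in> weq_on N WN SN"
    then show "FA \<lparr>FO = act K, FA = act1 (iV K)\<rparr> w \<in> WN"
      using K act_weq[of "iV K" w] by simp
  next
    fix g Y assume "g \<in> Arr N" "Cod N g = Y"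
    then show "mcev K Y \<bullet> FA \<lparr>FO = act K, FA = act1 (iV K)\<rparr> (FA \<lparr>FO = mcot K, FA = mcot_arr K\<rparr> g)
        = g \<bullet> mcev K (Dom N g)"
      using O mcot_arr_simps(4)[of K g] by auto
  next
    fix X Y f assume "X \<in> Obj N" "Y \<in> Obj N" "f \<in> hom N (FO \<lparr>FO = act K, FA = act1 (iV K)\<rparr> X) Y"
    then show "\<exists>!g. g \<in> hom N X (FO \<lparr>FO = mcot K, FA = mcot_arr K\<rparr> Y)
        \<and> mcev K Y \<bullet> FA \<lparr>FO = act K, FA = act1 (iV K)\<rparr> g = f"
      using O mcev_universal[of K X Y f] by simp
  qed (use K O mcot_weq in auto)
qed

text \<open>The same for the adjunction at \<open>Q K\<close>, whose derived left adjoint is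
  \<open>dT_right K\<close>.\<close>

lemma dmcev_universal:
  assumes "K \<in> Obj V" "X \<in> Obj N" "Y \<in> Obj N" "f \<in> hom HN (DN.dT0 K X) Y"
  shows "\<exists>!g. g \<in> hom HN X (dmcot K Y) \<and> dmcev K Y \<star> DN.dT1 (Ide HV K) g = f"
proof -
  interpret A: deformable_adjunction N WN QN p SN N WN RN r TN
    "\<lparr>FO = act (Q K), FA = act1 (iV (Q K))\<rparr>" "\<lparr>FO = mcot (Q K), FA = mcot_arr (Q K)\<rparr>" "mcev (Q K)"
    by (rule adjunction_cot) (use assms in simp)
  have LF: "A.LF = DN.dT_right K"
    by (simp add: A.LF_def DN.dT_right_def)
  have counit: "A.derived_counit Y = dmcev K Y"
    by (simp add: A.derived_counit_def dmcev_def)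
  have "\<exists>!g. g \<in> hom HN X (dmcot K Y) \<and> dmcev K Y \<star> FA (DN.dT_right K) g = f"
    using A.derived_counit_universal[OF assms(2,3), of f] assms(4)
    unfolding LF counit by (simp add: dmcot_def DN.dT0_def)
  moreover have "g \<in> hom HN X (dmcot K Y) \<and> dmcev K Y \<star> DN.dT1 (Ide HV K) g = f
      \<longleftrightarrow> g \<in> hom HN X (dmcot K Y) \<and> dmcev K Y \<star> FA (DN.dT_right K) g = f" for g
    by (rule conj_cong[OF HOL.refl], subst DN.dT1_right[OF homD(1) assms(1)]) simp_all
  ultimately show ?thesis by simp
qed

lemma dmcot_simps [simp]:
  assumes "K \<in> Obj V" "Y \<in> Obj N"
  shows "dmcot K Y \<in> Obj N" "dmcev K Y \<in> Arr HN" "Dom HN (dmcev K Y) = DN.dT0 K (dmcot K Y)"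
    "Cod HN (dmcev K Y) = Y"
  using assms by (simp_all add: dmcot_def dmcev_def DN.dT0_def)

end

section \<open>The homotopy category of the base\<close>

context closed_symmetric_monoidal_homotopical_category
begin

abbreviation "HoV \<equiv> V_ho_cat V"
abbreviation "\<nu> \<equiv> V_ho_arr V"

lemma Ho_sel [simp]:
  "Obj (Ho V) = Obj V" "Arr (Ho V) = Arr HoV" "Dom (Ho V) = Dom HoV" "Cod (Ho V) = Cod HoV"
  "Ide (Ho V) = Ide HoV" "Comp (Ho V) = Comp HoV" "tens (Ho V) = DV.dT0" "tens_arr (Ho V) = DV.dT1"
  "unit_obj (Ho V) = unit_obj V" "assoc (Ho V) = derived_assoc V" "lunit (Ho V) = derived_lunit V"
  "runit (Ho V) = derived_runit V" "symm (Ho V) = derived_symm V" "ihom (Ho V) = derived_ihom V"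
  "ev (Ho V) = derived_ev V"
  by (simp_all add: Ho_def cat.defs csm.defs DV.dT0_def[abs_def] dT1_eq_derived_tens_arr ho_cat_def)

lemma hom_Ho [simp]: "hom (Ho V) X Y = hom HoV X Y"
  by (simp add: hom_def)

lemma inverse_arrs_Ho [simp]: "inverse_arrs (Ho V) = inverse_arrs HoV"
  by (intro ext) (simp add: inverse_arrs_def)

lemma iso_Ho [simp]: "iso (Ho V) = iso HoV" "inv_arr (Ho V) = inv_arr HoV"
  by (intro ext; simp add: iso_def inv_arr_def)+

text \<open>\<open>Ho V\<close> and \<open>HoV\<close> share their categorical fields but have
  different record types, so facts about categories and functors are transferred explicitly.\<close>

lemma category_Ho: "category (Ho V)"
  using Ho.category_axioms unfolding category_def by simp

lemma functor_to_Ho: "cat_functor C HoV F \<Longrightarrow> cat_functor C (Ho V) F"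
  unfolding cat_functor_def cat_functor_axioms_def using category_Ho by simp

lemma bifunctor_from_Ho:
  assumes "bifunctor HoV B D T0 T1"
  shows "bifunctor (Ho V) B D T0 T1"
  using assms category_Ho unfolding bifunctor_def bifunctor_axioms_def by simp

text \<open>\<open>V\<close> acts on itself from the left; the axiom \<open>mtriangle_left\<close>
  is the identity \<open>lunit_tens\<close>.\<close>

lemma self_closed_module: "closed_module V V (tens V) (tens_arr V) (assoc V) (lunit V) (ihom V) (ev V)"
  by unfold_locales (simp_all add: assoc_nat lunit_nat pentagon triangle lunit_tens ev_universal)

lemma self_homotopical_closed_module:
  "homotopical_closed_module I V V (tens V) (tens_arr V) (assoc V) (lunit V) (Weq V) (Qf V) (qt V) (VQ V)
     (ihom V) (ev V) (Rf V) (rt V) (VR V)"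
proof -
  interpret M: closed_module V V "tens V" "tens_arr V" "assoc V" "lunit V" "ihom V" "ev V"
    by (rule self_closed_module)
  \<comment> \<open>The functoriality recovered from the adjunction is \<open>ihom_arr\<close> with
    an identity, so that \<open>ihom_homotopical\<close> can supply \<open>mhom_weq\<close>.\<close>
  have h: "M.mhom_arr X f = ihom_arr V (Ide V X) f" if X: "X \<in> Obj V" and f: "f \<in> Arr V" for X f
  proof (rule M.flat_inj[of X "Cod V f"])
    note c = curry[of "f \<cdot> ev V X (Dom V f)" "ihom V X (Dom V f)" X "Cod V f"]
    show "M.flat X (Cod V f) (M.mhom_arr X f) = M.flat X (Cod V f) (ihom_arr V (Ide V X) f)"
      using X f M.mhom_arr_simps(4)[OF X f] c(4) by (simp add: ihom_arr_def M.flat_def)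
    show "ihom_arr V (Ide V X) f \<in> Arr V" "Dom V (M.mhom_arr X f) = Dom V (ihom_arr V (Ide V X) f)"
      "Cod V (ihom_arr V (Ide V X) f) = ihom V X (Cod V f)"
      using X f c(1-3) by (simp_all add: ihom_arr_def)
  qed (use X f in auto)
  show ?thesis
  proof unfold_locales
    fix X f assume X: "X \<in> VQ V" and f: "f \<in> weq_on V (Weq V) (VR V)"
    then have "f \<in> Arr V" using weq_in_Arr by (auto simp: weq_on_def)
    then show "M.mhom_arr X f \<in> Weq V"
      using X f ihom_homotopical[of "Ide V X" f] by (simp add: h)
  qed (simp_all add: tens_homotopical lunit_weq)
qed

section \<open>Right unit and symmetry of the derived tensor product\<close>

lemma derived_runit_simps [simp]:
  assumes "X \<in> Obj V"
  shows "derived_runit V X \<in> Arr HoV" "Dom HoV (derived_runit V X) = DV.dT0 X (unit_obj V)"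
    "Cod HoV (derived_runit V X) = X" "iso HoV (derived_runit V X)"
proof -
  let ?X = "FO (Qf V) X"
  have "runit V ?X \<cdot> (Ide V ?X \<otimes>\<^sub>1 qt V (unit_obj V)) \<in> Weq V" using assms by (simp add: runit_weq)
  then have "qt V X \<cdot> runit V ?X \<cdot> (Ide V ?X \<otimes>\<^sub>1 qt V (unit_obj V)) \<in> Weq V"
    by (rule weq_Comp) (use assms in auto)
  then show "iso HoV (derived_runit V X)" by (simp add: derived_runit_def Let_def)
qed (use assms in \<open>simp_all add: derived_runit_def Let_def DV.dT0_def\<close>)

text \<open>As module data, \<open>V\<close> carries only its left unit constraint; the right unit
  and the symmetry are therefore derived directly, on arrows of \<open>V\<close> and then by
  \<open>ho_natural\<close>.\<close>

lemma derived_runit_nat: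
  assumes f: "f \<in> Arr HoV"
  shows "derived_runit V (Cod HoV f) \<cdot>\<^bsub>HoV\<^esub> DV.dT1 f (Ide HoV (unit_obj V))
    = f \<cdot>\<^bsub>HoV\<^esub> derived_runit V (Dom HoV f)"
proof -
  let ?E = "unit_obj V"
  have "derived_runit V (Cod V f) \<cdot>\<^bsub>HoV\<^esub> \<nu> (FA (Qf V) f \<otimes>\<^sub>1 Ide V (FO (Qf V) ?E))
      = \<nu> f \<cdot>\<^bsub>HoV\<^esub> derived_runit V (Dom V f)" if f: "f \<in> Arr V" for f
  proof -
    let ?X = "FO (Qf V) (Dom V f)" and ?Y = "FO (Qf V) (Cod V f)"
    have "(qt V (Cod V f) \<cdot> runit V ?Y \<cdot> (Ide V ?Y \<otimes>\<^sub>1 qt V ?E)) \<cdot> (FA (Qf V) f \<otimes>\<^sub>1 Ide V (FO (Qf V) ?E))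
        = qt V (Cod V f) \<cdot> runit V ?Y \<cdot> (FA (Qf V) f \<otimes>\<^sub>1 Ide V ?E) \<cdot> (Ide V ?X \<otimes>\<^sub>1 qt V ?E)"
      using f by (simp add: assoc' T.T1_merge)
    also have "\<dots> = qt V (Cod V f) \<cdot> FA (Qf V) f \<cdot> runit V ?X \<cdot> (Ide V ?X \<otimes>\<^sub>1 qt V ?E)"
      using f square_tail[OF runit_nat[of "FA (Qf V) f" ?Y]] by simp
    also have "\<dots> = f \<cdot> qt V (Dom V f) \<cdot> runit V ?X \<cdot> (Ide V ?X \<otimes>\<^sub>1 qt V ?E)"
      using f square_tail[OF L.q_nat[of f "Cod V f"]] by simp
    finally show ?thesis using f by (simp add: derived_runit_def Let_def ho_merge)
  qed
  then show ?thesis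
    using ho_natural[OF f DV.dT.functor_left Ho.id_functor, of ?E "derived_runit V"] by simp
qed

lemma derived_symm_simps [simp]:
  assumes "X \<in> Obj V" "Y \<in> Obj V"
  shows "derived_symm V X Y \<in> Arr HoV" "Dom HoV (derived_symm V X Y) = DV.dT0 X Y"
    "Cod HoV (derived_symm V X Y) = DV.dT0 Y X"
  using assms by (simp_all add: derived_symm_def DV.dT0_def)

lemma derived_symm_nat:
  assumes f: "f \<in> Arr HoV" and h: "h \<in> Arr HoV"
  shows "derived_symm V (Cod HoV f) (Cod HoV h) \<cdot>\<^bsub>HoV\<^esub> DV.dT1 f h
    = DV.dT1 h f \<cdot>\<^bsub>HoV\<^esub> derived_symm V (Dom HoV f) (Dom HoV h)"
proof -
  note O = DV.Obj_Ho(1,2)[OF f] DV.Obj_Ho(1,2)[OF h]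
  have 1: "derived_symm V (Cod HoV f) Y \<cdot>\<^bsub>HoV\<^esub> DV.dT1 f (Ide HoV Y)
      = DV.dT1 (Ide HoV Y) f \<cdot>\<^bsub>HoV\<^esub> derived_symm V (Dom HoV f) Y" if "Y \<in> Obj V" for Y
    using ho_natural[OF f DV.dT.functor_left DV.dT.functor_right, of Y Y "\<lambda>X. derived_symm V X Y"] that
    by (simp add: derived_symm_def ho_merge symm_nat DV.dT0_def)
  have 2: "derived_symm V X (Cod HoV h) \<cdot>\<^bsub>HoV\<^esub> DV.dT1 (Ide HoV X) h
      = DV.dT1 h (Ide HoV X) \<cdot>\<^bsub>HoV\<^esub> derived_symm V X (Dom HoV h)" if "X \<in> Obj V" for X
    using ho_natural[OF h DV.dT.functor_right DV.dT.functor_left, of X X "derived_symm V X"] that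
    by (simp add: derived_symm_def ho_merge symm_nat DV.dT0_def)
  have "derived_symm V (Cod HoV f) (Cod HoV h) \<cdot>\<^bsub>HoV\<^esub> DV.dT1 f h
      = derived_symm V (Cod HoV f) (Cod HoV h) \<cdot>\<^bsub>HoV\<^esub> DV.dT1 f (Ide HoV (Cod HoV h))
        \<cdot>\<^bsub>HoV\<^esub> DV.dT1 (Ide HoV (Dom HoV f)) h"
    using f h O by (simp add: DV.dT.T1_merge)
  also have "\<dots> = DV.dT1 (Ide HoV (Cod HoV h)) f \<cdot>\<^bsub>HoV\<^esub> derived_symm V (Dom HoV f) (Cod HoV h)
        \<cdot>\<^bsub>HoV\<^esub> DV.dT1 (Ide HoV (Dom HoV f)) h"
    by (rule Ho.square_tail[OF 1]) (use f h O in auto)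
  also have "\<dots> = DV.dT1 (Ide HoV (Cod HoV h)) f \<cdot>\<^bsub>HoV\<^esub> DV.dT1 h (Ide HoV (Dom HoV f))
        \<cdot>\<^bsub>HoV\<^esub> derived_symm V (Dom HoV f) (Dom HoV h)"
    using O by (simp add: 2)
  also have "\<dots> = DV.dT1 h f \<cdot>\<^bsub>HoV\<^esub> derived_symm V (Dom HoV f) (Dom HoV h)"
    using f h O by (simp add: DV.dT.T1_merge_tail)
  finally show ?thesis .
qed

text \<open>As in \<open>dmpentagon\<close>: the invertible \<open>?Phi\<close> clears the inverse
  in the associator at the target, the other inverses cancel in turn, and the original hexagon is
  applied to the deformed objects.\<close>

lemma derived_hexagon:
  assumes O: "X \<in> Obj V" "Y \<in> Obj V" "Z \<in> Obj V"
  shows "derived_assoc V Y Z X \<cdot>\<^bsub>HoV\<^esub> derived_symm V X (DV.dT0 Y Z) \<cdot>\<^bsub>HoV\<^esub> derived_assoc V X Y Z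
    = DV.dT1 (Ide HoV Y) (derived_symm V X Z) \<cdot>\<^bsub>HoV\<^esub> derived_assoc V Y X Z
        \<cdot>\<^bsub>HoV\<^esub> DV.dT1 (derived_symm V X Y) (Ide HoV Z)"
proof -
  let ?X = "FO (Qf V) X" and ?Y = "FO (Qf V) Y" and ?Z = "FO (Qf V) Z"
  let ?q = "qt V"
  let ?Phi = "\<nu> (Ide V ?Y \<otimes>\<^sub>1 ?q (?Z \<otimes> ?X))"
  have T: "derived_assoc V X Y Z \<in> Arr HoV" "Cod HoV (derived_assoc V X Y Z) = ?X \<otimes> FO (Qf V) (?Y \<otimes> ?Z)"
    "derived_assoc V Y X Z \<in> Arr HoV" "Cod HoV (derived_assoc V Y X Z) = ?Y \<otimes> FO (Qf V) (?X \<otimes> ?Z)"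
    "Dom HoV (derived_assoc V Y X Z) = FO (Qf V) (?Y \<otimes> ?X) \<otimes> ?Z"
    "derived_assoc V Y Z X \<in> Arr HoV" "Cod HoV (derived_assoc V Y Z X) = ?Y \<otimes> FO (Qf V) (?Z \<otimes> ?X)"
    "Dom HoV (derived_assoc V Y Z X) = FO (Qf V) (?Y \<otimes> ?Z) \<otimes> ?X"
    "Dom HoV (derived_assoc V X Y Z) = FO (Qf V) (?X \<otimes> ?Y) \<otimes> ?Z"
    using O by (simp_all add: DV.dT0_def)
  have S: "derived_symm V X (DV.dT0 Y Z) = \<nu> (symm V ?X (FO (Qf V) (?Y \<otimes> ?Z)))"
    "DV.dT1 (Ide HoV Y) (derived_symm V X Z) = \<nu> (Ide V ?Y \<otimes>\<^sub>1 FA (Qf V) (symm V ?X ?Z))"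
    "DV.dT1 (derived_symm V X Y) (Ide HoV Z) = \<nu> (FA (Qf V) (symm V ?X ?Y) \<otimes>\<^sub>1 Ide V ?Z)"
    using O by (simp_all add: derived_symm_def DV.dT0_def)
  have "?Phi \<cdot>\<^bsub>HoV\<^esub> derived_assoc V Y Z X \<cdot>\<^bsub>HoV\<^esub> \<nu> (symm V ?X (FO (Qf V) (?Y \<otimes> ?Z)))
        \<cdot>\<^bsub>HoV\<^esub> derived_assoc V X Y Z
      = \<nu> (assoc V ?Y ?Z ?X \<cdot> (?q (?Y \<otimes> ?Z) \<otimes>\<^sub>1 Ide V ?X)) \<cdot>\<^bsub>HoV\<^esub> \<nu> (symm V ?X (FO (Qf V) (?Y \<otimes> ?Z)))
        \<cdot>\<^bsub>HoV\<^esub> derived_assoc V X Y Z"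
    by (rule Ho.triangle_tail[OF derived_assoc_char]) (use O T in auto)
  also have "\<dots> = \<nu> (assoc V ?Y ?Z ?X \<cdot> symm V ?X (?Y \<otimes> ?Z)) \<cdot>\<^bsub>HoV\<^esub> \<nu> (Ide V ?X \<otimes>\<^sub>1 ?q (?Y \<otimes> ?Z))
        \<cdot>\<^bsub>HoV\<^esub> derived_assoc V X Y Z"
    using O T symm_nat[of "Ide V ?X" "?q (?Y \<otimes> ?Z)"] by (simp add: ho_merge_tail assoc')
  also have "\<dots> = \<nu> ((assoc V ?Y ?Z ?X \<cdot> symm V ?X (?Y \<otimes> ?Z) \<cdot> assoc V ?X ?Y ?Z)
        \<cdot> (?q (?X \<otimes> ?Y) \<otimes>\<^sub>1 Ide V ?Z))"
    using O by (simp add: derived_assoc_char ho_merge assoc')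
  also have "\<dots> = \<nu> (((Ide V ?Y \<otimes>\<^sub>1 symm V ?X ?Z) \<cdot> assoc V ?Y ?X ?Z \<cdot> (symm V ?X ?Y \<otimes>\<^sub>1 Ide V ?Z))
        \<cdot> (?q (?X \<otimes> ?Y) \<otimes>\<^sub>1 Ide V ?Z))"
    using O by (simp add: hexagon)
  also have "\<dots> = \<nu> (Ide V ?Y \<otimes>\<^sub>1 symm V ?X ?Z) \<cdot>\<^bsub>HoV\<^esub> \<nu> (assoc V ?Y ?X ?Z \<cdot> (?q (?Y \<otimes> ?X) \<otimes>\<^sub>1 Ide V ?Z))
        \<cdot>\<^bsub>HoV\<^esub> \<nu> (FA (Qf V) (symm V ?X ?Y) \<otimes>\<^sub>1 Ide V ?Z)"
    using O L.q_nat[of "symm V ?X ?Y" "?Y \<otimes> ?X"] by (simp add: ho_merge assoc' T.T1_merge del: iso_ho_arr)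
  also have "\<dots> = \<nu> (Ide V ?Y \<otimes>\<^sub>1 symm V ?X ?Z) \<cdot>\<^bsub>HoV\<^esub> (\<nu> (Ide V ?Y \<otimes>\<^sub>1 ?q (?X \<otimes> ?Z))
        \<cdot>\<^bsub>HoV\<^esub> derived_assoc V Y X Z) \<cdot>\<^bsub>HoV\<^esub> \<nu> (FA (Qf V) (symm V ?X ?Y) \<otimes>\<^sub>1 Ide V ?Z)"
    using O by (simp add: derived_assoc_char)
  also have "\<dots> = \<nu> (Ide V ?Y \<otimes>\<^sub>1 symm V ?X ?Z) \<cdot>\<^bsub>HoV\<^esub> \<nu> (Ide V ?Y \<otimes>\<^sub>1 ?q (?X \<otimes> ?Z))
        \<cdot>\<^bsub>HoV\<^esub> derived_assoc V Y X Z \<cdot>\<^bsub>HoV\<^esub> \<nu> (FA (Qf V) (symm V ?X ?Y) \<otimes>\<^sub>1 Ide V ?Z)"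
    using O T by (subst Ho.assoc') auto
  also have "\<dots> = ?Phi \<cdot>\<^bsub>HoV\<^esub> \<nu> (Ide V ?Y \<otimes>\<^sub>1 FA (Qf V) (symm V ?X ?Z))
        \<cdot>\<^bsub>HoV\<^esub> derived_assoc V Y X Z \<cdot>\<^bsub>HoV\<^esub> \<nu> (FA (Qf V) (symm V ?X ?Y) \<otimes>\<^sub>1 Ide V ?Z)"
    using O T L.q_nat[of "symm V ?X ?Z" "?Z \<otimes> ?X"] by (simp add: ho_merge_tail T.T1_merge)
  finally show ?thesis
    unfolding S by (rule Ho.iso_cancel_left) (use O T in auto)
qed

text \<open>The derived module of \<open>V\<close> over itself provides associator, left unit and
  evaluation, which unfold to the structure maps of \<open>Ho V\<close>; right unit, symmetry and
  hexagon come from the preceding lemmas.\<close>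

theorem closed_symmetric_monoidal_category_Ho: "closed_symmetric_monoidal_category (Ho V)"
proof -
  interpret S: homotopical_closed_module I V V "tens V" "tens_arr V" "assoc V" "lunit V" "Weq V" "Qf V"
    "qt V" "VQ V" "ihom V" "ev V" "Rf V" "rt V" "VR V"
    by (rule self_homotopical_closed_module)
  have a: "S.dmassoc X Y Z = derived_assoc V X Y Z" for X Y Z
    by (simp add: S.dmassoc_def derived_assoc_def Let_def)
  have l: "S.dmunit X = derived_lunit V X" for X
    by (simp add: S.dmunit_def derived_lunit_def Let_def)
  have h: "S.dmhom X Y = derived_ihom V X Y" for X Y
    by (simp add: S.dmhom_def derived_ihom_def)
  have e: "S.dmev X Y = derived_ev V X Y" for X Y
    by (simp add: S.dmev_def derived_ev_def Let_def)
  have fn: "cat_functor (prod_cat (Ho V) (Ho V)) (Ho V) (tens_ftor (Ho V))"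
    using functor_to_Ho[OF DV.dT.prod_functor] by (simp add: prod_cat_def tens_ftor_def)
  show ?thesis
  proof (intro closed_symmetric_monoidal_category.intro closed_symmetric_monoidal_category_axioms.intro
      category_Ho fn; unfold Ho_sel hom_Ho iso_Ho)
    fix X X' Y Y' Z Z' f h k
    assume t: "f \<in> hom HoV X X'" "h \<in> hom HoV Y Y'" "k \<in> hom HoV Z Z'"
    show "derived_assoc V X' Y' Z' \<cdot>\<^bsub>HoV\<^esub> DV.dT1 (DV.dT1 f h) k
        = DV.dT1 f (DV.dT1 h k) \<cdot>\<^bsub>HoV\<^esub> derived_assoc V X Y Z"
      using S.dmassoc_nat[OF homD(1)[OF t(1)] homD(1)[OF t(2)] homD(1)[OF t(3)]] t by (simp add: a homD)
  next
    fix f X Y assume t: "f \<in> hom HoV X Y"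
    show "derived_lunit V Y \<cdot>\<^bsub>HoV\<^esub> DV.dT1 (Ide HoV (unit_obj V)) f = f \<cdot>\<^bsub>HoV\<^esub> derived_lunit V X"
      using S.dmunit_nat[OF homD(1)[OF t]] t by (simp add: l homD)
    show "derived_runit V Y \<cdot>\<^bsub>HoV\<^esub> DV.dT1 f (Ide HoV (unit_obj V)) = f \<cdot>\<^bsub>HoV\<^esub> derived_runit V X"
      using derived_runit_nat[OF homD(1)[OF t]] t by (simp add: homD)
  next
    fix X X' Y Y' f h assume t: "f \<in> hom HoV X X'" "h \<in> hom HoV Y Y'"
    show "derived_symm V X' Y' \<cdot>\<^bsub>HoV\<^esub> DV.dT1 f h = DV.dT1 h f \<cdot>\<^bsub>HoV\<^esub> derived_symm V X Y"
      using derived_symm_nat[OF homD(1)[OF t(1)] homD(1)[OF t(2)]] t by (simp add: homD)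
  next
    fix X Y assume O: "X \<in> Obj V" "Y \<in> Obj V"
    show "derived_symm V Y X \<cdot>\<^bsub>HoV\<^esub> derived_symm V X Y = Ide HoV (DV.dT0 X Y)"
      using O by (simp add: derived_symm_def ho_merge symm_symm DV.dT0_def)
    show "DV.dT1 (Ide HoV X) (derived_lunit V Y) \<cdot>\<^bsub>HoV\<^esub> derived_assoc V X (unit_obj V) Y
        = DV.dT1 (derived_runit V X) (Ide HoV Y)"
      using S.dmtriangle_right[OF O] by (simp add: a l)
  next
    fix W X Y Z assume O: "W \<in> Obj V" "X \<in> Obj V" "Y \<in> Obj V" "Z \<in> Obj V"
    show "DV.dT1 (Ide HoV W) (derived_assoc V X Y Z) \<cdot>\<^bsub>HoV\<^esub> derived_assoc V W (DV.dT0 X Y) Z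
          \<cdot>\<^bsub>HoV\<^esub> DV.dT1 (derived_assoc V W X Y) (Ide HoV Z)
        = derived_assoc V W X (DV.dT0 Y Z) \<cdot>\<^bsub>HoV\<^esub> derived_assoc V (DV.dT0 W X) Y Z"
      using S.dmpentagon[OF O] by (simp add: a)
  next
    fix X Y Z f assume O: "X \<in> Obj V" "Y \<in> Obj V" "Z \<in> Obj V" and f: "f \<in> hom HoV (DV.dT0 X Y) Z"
    show "\<exists>!k. k \<in> hom HoV X (derived_ihom V Y Z) \<and> derived_ev V Y Z \<cdot>\<^bsub>HoV\<^esub> DV.dT1 k (Ide HoV Y) = f"
      using S.dmev_universal[OF O f] by (simp add: h e)
  qed (simp_all add: hom_def derived_hexagon S.dmunit_simps[unfolded l] S.dmhom_simps[unfolded h e])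
qed

end

section \<open>The homotopy category of a module\<close>

context homotopical_biclosed_module
begin

lemma biclosed_module_Ho:
  "biclosed_module (Ho V) HN DN.dT0 DN.dT1 dmassoc dmunit dmhom dmev dmcot dmcev"
proof -
  interpret HoC: closed_symmetric_monoidal_category "Ho V"
    by (rule closed_symmetric_monoidal_category_Ho)
  interpret HoT: bifunctor "Ho V" HN HN DN.dT0 DN.dT1
    by (rule bifunctor_from_Ho[OF DN.dT.bifunctor_axioms])
  show ?thesis
  proof unfold_locales
    show "dmassoc K L X \<star> DN.dT1 (tens_arr (Ho V) k l) f
        = DN.dT1 k (DN.dT1 l f) \<star> dmassoc (Dom (Ho V) k) (Dom (Ho V) l) (Dom HN f)"
      if "k \<in> Arr (Ho V)" "l \<in> Arr (Ho V)" "f \<in> Arr HN" "Cod (Ho V) k = K" "Cod (Ho V) l = L" "Cod HN f = X"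
      for k l f K L X
      using dmassoc_nat[of k l f] that by auto
    show "dmunit X \<star> DN.dT1 (Ide (Ho V) (unit_obj (Ho V))) f = f \<star> dmunit (Dom HN f)"
      if "f \<in> Arr HN" "Cod HN f = X" for f X
      using dmunit_nat[of f] that by auto
  qed (simp_all add: dmpentagon dmtriangle_right dmtriangle_left dmev_universal dmcev_universal)
qed

theorem ex_enrichment_Ho:
  "\<exists>(H :: ('n, 'o, ('o, 'a) ho_arr) tcvcat) F. tensored_cotensored_category (Ho V) H
     \<and> cat_isomorphism HN (underlying (Ho V) H) F \<and> (\<forall>X \<in> Obj N. FO F X = X)"
proof -
  interpret H: biclosed_module "Ho V" HN DN.dT0 DN.dT1 dmassoc dmunit dmhom dmev dmcot dmcev
    by (rule biclosed_module_Ho)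
  \<comment> \<open>The required invertibility of \<open>dmunit\<close> goes back to
    \<open>munit_weq\<close>.\<close>
  have "cat_isomorphism HN (underlying (Ho V) H.enrichment) H.underlying_iso"
    by (rule H.underlying_enrichment_iso) simp
  moreover have "FO H.underlying_iso X = X" for X
    by (simp add: H.underlying_iso_def)
  ultimately show ?thesis using H.enrichment_tensored_cotensored by blast
qed

end

section \<open>The underlying category of an enriched category\<close>

context enriched_category
begin

abbreviation "U \<equiv> underlying V M"
abbreviation "E \<equiv> unit_obj V"
abbreviation "iV \<equiv> Ide V"
abbreviation "post \<equiv> vhom_post V M"
abbreviation "pre \<equiv> vhom_pre V M"

lemma enriched_simps [simp]:
  "X \<in> VObj M \<Longrightarrow> Y \<in> VObj M \<Longrightarrow> VHom M X Y \<in> Obj V"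
  "X \<in> VObj M \<Longrightarrow> Y \<in> VObj M \<Longrightarrow> Z \<in> VObj M \<Longrightarrow> vcomp M X Y Z \<in> Arr V"
  "X \<in> VObj M \<Longrightarrow> Y \<in> VObj M \<Longrightarrow> Z \<in> VObj M \<Longrightarrow> Dom V (vcomp M X Y Z) = VHom M Y Z \<otimes> VHom M X Y"
  "X \<in> VObj M \<Longrightarrow> Y \<in> VObj M \<Longrightarrow> Z \<in> VObj M \<Longrightarrow> Cod V (vcomp M X Y Z) = VHom M X Z"
  "X \<in> VObj M \<Longrightarrow> vid M X \<in> Arr V" "X \<in> VObj M \<Longrightarrow> Dom V (vid M X) = E"
  "X \<in> VObj M \<Longrightarrow> Cod V (vid M X) = VHom M X X"
  using VHom_in_Obj vcomp_in_hom vid_in_hom by (auto simp: hom_def)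

definition val :: "('m, 'a) und_arr \<Rightarrow> 'a" where
  "val f = snd (snd f)"

lemma Obj_U [simp]: "Obj U = VObj M"
  by (simp add: underlying_def)

lemma Arr_U_simps [simp]:
  assumes "f \<in> Arr U"
  shows "Dom U f \<in> VObj M" "Cod U f \<in> VObj M" "val f \<in> Arr V" "Dom V (val f) = E"
    "Cod V (val f) = VHom M (Dom U f) (Cod U f)"
  using assms by (auto simp: underlying_def val_def hom_def)

lemma U_eqI: "f \<in> Arr U \<Longrightarrow> g \<in> Arr U \<Longrightarrow> Dom U f = Dom U g \<Longrightarrow> Cod U f = Cod U g \<Longrightarrow> val f = val g
    \<Longrightarrow> f = g"
  by (auto simp: underlying_def val_def)

lemma U_triple [simp]:
  assumes "X \<in> VObj M" "Y \<in> VObj M" "f \<in> Arr V" "Dom V f = E" "Cod V f = VHom M X Y"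
  shows "(X, Y, f) \<in> Arr U" "Dom U (X, Y, f) = X" "Cod U (X, Y, f) = Y" "val (X, Y, f) = f"
  using assms by (auto simp: underlying_def val_def hom_def)

lemma Ide_U [simp]:
  assumes "X \<in> VObj M"
  shows "Ide U X \<in> Arr U" "Dom U (Ide U X) = X" "Cod U (Ide U X) = X" "val (Ide U X) = vid M X"
  using assms by (auto simp: underlying_def val_def hom_def)

lemma post_def':
  "f \<in> Arr U \<Longrightarrow> post X f = vcomp M X (Dom U f) (Cod U f) \<cdot> (val f \<otimes>\<^sub>1 iV (VHom M X (Dom U f)))
     \<cdot> inv_arr V (lunit V (VHom M X (Dom U f)))"
  by (auto simp: vhom_post_def underlying_def val_def)

lemma pre_def':
  "f \<in> Arr U \<Longrightarrow> pre f Y = vcomp M (Dom U f) (Cod U f) Y \<cdot> (iV (VHom M (Cod U f) Y) \<otimes>\<^sub>1 val f)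
     \<cdot> inv_arr V (runit V (VHom M (Cod U f) Y))"
  by (auto simp: vhom_pre_def underlying_def val_def)

lemma post_simps [simp]:
  assumes "f \<in> Arr U" "X \<in> VObj M"
  shows "post X f \<in> Arr V" "Dom V (post X f) = VHom M X (Dom U f)" "Cod V (post X f) = VHom M X (Cod U f)"
  using assms by (simp_all add: post_def')

lemma pre_simps [simp]:
  assumes "f \<in> Arr U" "Y \<in> VObj M"
  shows "pre f Y \<in> Arr V" "Dom V (pre f Y) = VHom M (Cod U f) Y" "Cod V (pre f Y) = VHom M (Dom U f) Y"
  using assms by (simp_all add: pre_def')

lemma linv_nat:
  "f \<in> Arr V \<Longrightarrow> Dom V f = X \<Longrightarrow> (iV E \<otimes>\<^sub>1 f) \<cdot> inv_arr V (lunit V X) = inv_arr V (lunit V (Cod V f)) \<cdot> f"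
  using lunit_nat[of f "Cod V f"] by (intro slide) auto

lemma rinv_nat:
  "f \<in> Arr V \<Longrightarrow> Dom V f = X \<Longrightarrow> (f \<otimes>\<^sub>1 iV E) \<cdot> inv_arr V (runit V X) = inv_arr V (runit V (Cod V f)) \<cdot> f"
  using runit_nat[of f "Cod V f"] by (intro slide) auto

lemma post_Comp_arr:
  assumes "f \<in> Arr U" "X \<in> VObj M" "k \<in> Arr V" "Cod V k = VHom M X (Dom U f)"
  shows "post X f \<cdot> k = vcomp M X (Dom U f) (Cod U f) \<cdot> (val f \<otimes>\<^sub>1 k) \<cdot> inv_arr V (lunit V (Dom V k))"
proof -
  have "inv_arr V (lunit V (VHom M X (Dom U f))) \<cdot> k = (iV E \<otimes>\<^sub>1 k) \<cdot> inv_arr V (lunit V (Dom V k))"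
    using assms linv_nat[of k "Dom V k"] by simp
  then show ?thesis using assms by (simp add: post_def' assoc' T.T1_merge_tail)
qed

lemma pre_Comp_arr:
  assumes "f \<in> Arr U" "Y \<in> VObj M" "k \<in> Arr V" "Cod V k = VHom M (Cod U f) Y"
  shows "pre f Y \<cdot> k = vcomp M (Dom U f) (Cod U f) Y \<cdot> (k \<otimes>\<^sub>1 val f) \<cdot> inv_arr V (runit V (Dom V k))"
proof -
  have "inv_arr V (runit V (VHom M (Cod U f) Y)) \<cdot> k = (k \<otimes>\<^sub>1 iV E) \<cdot> inv_arr V (runit V (Dom V k))"
    using assms rinv_nat[of k "Dom V k"] by simp
  then show ?thesis using assms by (simp add: pre_def' assoc' T.T1_merge_tail)
qed

lemma Comp_U:
  assumes "f \<in> Arr U" "g \<in> Arr U" "Dom U g = Cod U f"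
  shows "g \<cdot>\<^bsub>U\<^esub> f \<in> Arr U" "Dom U (g \<cdot>\<^bsub>U\<^esub> f) = Dom U f" "Cod U (g \<cdot>\<^bsub>U\<^esub> f) = Cod U g"
    "val (g \<cdot>\<^bsub>U\<^esub> f) = post (Dom U f) g \<cdot> val f"
proof -
  have "g \<cdot>\<^bsub>U\<^esub> f = (Dom U f, Cod U g, vcomp M (Dom U f) (Dom U g) (Cod U g)
      \<cdot> (val g \<otimes>\<^sub>1 val f) \<cdot> inv_arr V (lunit V E))"
    using assms by (auto simp: underlying_def val_def)
  also have "\<dots> = (Dom U f, Cod U g, post (Dom U f) g \<cdot> val f)"
    using assms post_Comp_arr[of g "Dom U f" "val f"] by simp
  finally show "g \<cdot>\<^bsub>U\<^esub> f \<in> Arr U" "Dom U (g \<cdot>\<^bsub>U\<^esub> f) = Dom U f" "Cod U (g \<cdot>\<^bsub>U\<^esub> f) = Cod U g"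
    "val (g \<cdot>\<^bsub>U\<^esub> f) = post (Dom U f) g \<cdot> val f"
    using assms by simp_all
qed

text \<open>Composition in \<open>U\<close> is defined with \<open>lunit\<close>, but
  \<open>pre\<close> with \<open>runit\<close>; on the unit object the two coincide by
  \<open>lunit_unit\<close>.\<close>

lemma val_Comp_pre:
  assumes "f \<in> Arr U" "g \<in> Arr U" "Dom U g = Cod U f"
  shows "val (g \<cdot>\<^bsub>U\<^esub> f) = pre f (Cod U g) \<cdot> val g"
  using assms by (simp add: Comp_U post_Comp_arr pre_Comp_arr lunit_unit)

text \<open>Associativity of \<open>vcomp\<close> with an arrow of \<open>U\<close> as outermost
  factor; \<open>lunit_tens\<close> moves the unit constraint across the associator. The next two
  lemmas treat the innermost and the middle factor, with \<open>runit_tens\<close> and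
  \<open>triangle\<close>.\<close>

lemma vcomp_post_left:
  assumes O: "X \<in> VObj M" "Y \<in> VObj M" and g: "g \<in> Arr U"
  shows "vcomp M X Y (Cod U g) \<cdot> (post Y g \<otimes>\<^sub>1 iV (VHom M X Y)) = post X g \<cdot> vcomp M X Y (Dom U g)"
proof -
  let ?Z = "Dom U g" and ?Z' = "Cod U g"
  let ?A = "VHom M Y ?Z" and ?B = "VHom M X Y"
  have l: "assoc V E ?A ?B \<cdot> (inv_arr V (lunit V ?A) \<otimes>\<^sub>1 iV ?B) = inv_arr V (lunit V (?A \<otimes> ?B))"
    using O g slide[of "lunit V (?A \<otimes> ?B)" "assoc V E ?A ?B" "iV (?A \<otimes> ?B)" "lunit V ?A \<otimes>\<^sub>1 iV ?B"]
      lunit_tens[of ?A ?B] by simp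
  have "vcomp M X Y ?Z' \<cdot> (post Y g \<otimes>\<^sub>1 iV ?B) = vcomp M X Y ?Z' \<cdot> (vcomp M Y ?Z ?Z' \<otimes>\<^sub>1 iV ?B)
      \<cdot> ((val g \<otimes>\<^sub>1 iV ?A) \<otimes>\<^sub>1 iV ?B) \<cdot> (inv_arr V (lunit V ?A) \<otimes>\<^sub>1 iV ?B)"
    using O g by (simp add: post_def' T.T1_merge)
  also have "\<dots> = (vcomp M X Y ?Z' \<cdot> (vcomp M Y ?Z ?Z' \<otimes>\<^sub>1 iV ?B))
      \<cdot> ((val g \<otimes>\<^sub>1 iV ?A) \<otimes>\<^sub>1 iV ?B) \<cdot> (inv_arr V (lunit V ?A) \<otimes>\<^sub>1 iV ?B)"
    using O g by (subst assoc') auto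
  also have "\<dots> = (vcomp M X ?Z ?Z' \<cdot> (iV (VHom M ?Z ?Z') \<otimes>\<^sub>1 vcomp M X Y ?Z) \<cdot> assoc V (VHom M ?Z ?Z') ?A ?B)
      \<cdot> ((val g \<otimes>\<^sub>1 iV ?A) \<otimes>\<^sub>1 iV ?B) \<cdot> (inv_arr V (lunit V ?A) \<otimes>\<^sub>1 iV ?B)"
    using O g by (simp add: vcomp_assoc)
  also have "\<dots> = vcomp M X ?Z ?Z' \<cdot> (iV (VHom M ?Z ?Z') \<otimes>\<^sub>1 vcomp M X Y ?Z)
      \<cdot> (val g \<otimes>\<^sub>1 iV ?A \<otimes>\<^sub>1 iV ?B) \<cdot> assoc V E ?A ?B \<cdot> (inv_arr V (lunit V ?A) \<otimes>\<^sub>1 iV ?B)"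
    using O g square_tail[OF assoc_nat[of "val g" "iV ?A" "iV ?B" "VHom M ?Z ?Z'" ?A ?B]]
    by (simp add: assoc' del: T.T1_Ide)
  also have "\<dots> = vcomp M X ?Z ?Z' \<cdot> (val g \<otimes>\<^sub>1 vcomp M X Y ?Z) \<cdot> inv_arr V (lunit V (?A \<otimes> ?B))"
    using O g by (simp add: l T.T1_merge_tail)
  also have "\<dots> = post X g \<cdot> vcomp M X Y ?Z"
    using O g by (simp add: post_Comp_arr)
  finally show ?thesis .
qed

lemma vcomp_pre_right:
  assumes O: "Y \<in> VObj M" "Z \<in> VObj M" and f: "f \<in> Arr U"
  shows "vcomp M (Dom U f) Y Z \<cdot> (iV (VHom M Y Z) \<otimes>\<^sub>1 pre f Y) = pre f Z \<cdot> vcomp M (Cod U f) Y Z"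
proof -
  let ?X' = "Dom U f" and ?X = "Cod U f"
  let ?A = "VHom M Y Z" and ?B = "VHom M ?X Y"
  have r: "iV ?A \<otimes>\<^sub>1 inv_arr V (runit V ?B) = assoc V ?A ?B E \<cdot> inv_arr V (runit V (?A \<otimes> ?B))"
    using O f slide[of "iV ?A \<otimes>\<^sub>1 runit V ?B" "assoc V ?A ?B E" "iV (?A \<otimes> ?B)" "runit V (?A \<otimes> ?B)"]
      runit_tens[of ?A ?B] by simp
  have "vcomp M ?X' Y Z \<cdot> (iV ?A \<otimes>\<^sub>1 pre f Y) = vcomp M ?X' Y Z \<cdot> (iV ?A \<otimes>\<^sub>1 vcomp M ?X' ?X Y)
      \<cdot> (iV ?A \<otimes>\<^sub>1 iV ?B \<otimes>\<^sub>1 val f) \<cdot> (iV ?A \<otimes>\<^sub>1 inv_arr V (runit V ?B))"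
    using O f by (simp add: pre_def' T.T1_merge)
  also have "\<dots> = vcomp M ?X' Y Z \<cdot> (iV ?A \<otimes>\<^sub>1 vcomp M ?X' ?X Y)
      \<cdot> assoc V ?A ?B (VHom M ?X' ?X) \<cdot> ((iV ?A \<otimes>\<^sub>1 iV ?B) \<otimes>\<^sub>1 val f) \<cdot> inv_arr V (runit V (?A \<otimes> ?B))"
    using O f r square_tail[OF assoc_nat[of "iV ?A" "iV ?B" "val f" ?A ?B "VHom M ?X' ?X"]]
    by (simp del: T.T1_Ide)
  also have "\<dots> = (vcomp M ?X' Y Z \<cdot> (iV ?A \<otimes>\<^sub>1 vcomp M ?X' ?X Y) \<cdot> assoc V ?A ?B (VHom M ?X' ?X))
      \<cdot> (iV (?A \<otimes> ?B) \<otimes>\<^sub>1 val f) \<cdot> inv_arr V (runit V (?A \<otimes> ?B))"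
    using O f by (simp add: assoc')
  also have "\<dots> = vcomp M ?X' ?X Z \<cdot> (vcomp M ?X Y Z \<otimes>\<^sub>1 val f) \<cdot> inv_arr V (runit V (?A \<otimes> ?B))"
    using O f vcomp_assoc[of ?X' ?X Y Z] by (simp add: assoc' T.T1_merge_tail)
  also have "\<dots> = pre f Z \<cdot> vcomp M ?X Y Z"
    using O f by (simp add: pre_Comp_arr)
  finally show ?thesis .
qed

lemma vcomp_post_pre:
  assumes O: "X \<in> VObj M" "Z \<in> VObj M" and g: "g \<in> Arr U"
  shows "vcomp M X (Cod U g) Z \<cdot> (iV (VHom M (Cod U g) Z) \<otimes>\<^sub>1 post X g)
    = vcomp M X (Dom U g) Z \<cdot> (pre g Z \<otimes>\<^sub>1 iV (VHom M X (Dom U g)))"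
proof -
  let ?Y = "Dom U g" and ?Y' = "Cod U g"
  let ?A = "VHom M ?Y' Z" and ?B = "VHom M X ?Y"
  have t: "iV ?A \<otimes>\<^sub>1 inv_arr V (lunit V ?B) = assoc V ?A E ?B \<cdot> (inv_arr V (runit V ?A) \<otimes>\<^sub>1 iV ?B)"
    using O g slide[of "iV ?A \<otimes>\<^sub>1 lunit V ?B" "assoc V ?A E ?B" "iV (?A \<otimes> ?B)" "runit V ?A \<otimes>\<^sub>1 iV ?B"]
      triangle[of ?A ?B] by simp
  have "vcomp M X ?Y' Z \<cdot> (iV ?A \<otimes>\<^sub>1 post X g) = vcomp M X ?Y' Z \<cdot> (iV ?A \<otimes>\<^sub>1 vcomp M X ?Y ?Y')
      \<cdot> (iV ?A \<otimes>\<^sub>1 val g \<otimes>\<^sub>1 iV ?B) \<cdot> (iV ?A \<otimes>\<^sub>1 inv_arr V (lunit V ?B))"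
    using O g by (simp add: post_def' T.T1_merge)
  also have "\<dots> = vcomp M X ?Y' Z \<cdot> (iV ?A \<otimes>\<^sub>1 vcomp M X ?Y ?Y') \<cdot> assoc V ?A (VHom M ?Y ?Y') ?B
      \<cdot> ((iV ?A \<otimes>\<^sub>1 val g) \<otimes>\<^sub>1 iV ?B) \<cdot> (inv_arr V (runit V ?A) \<otimes>\<^sub>1 iV ?B)"
    using O g t square_tail[OF assoc_nat[of "iV ?A" "val g" "iV ?B" ?A "VHom M ?Y ?Y'" ?B]] by simp
  also have "\<dots> = (vcomp M X ?Y' Z \<cdot> (iV ?A \<otimes>\<^sub>1 vcomp M X ?Y ?Y') \<cdot> assoc V ?A (VHom M ?Y ?Y') ?B)
      \<cdot> ((iV ?A \<otimes>\<^sub>1 val g) \<otimes>\<^sub>1 iV ?B) \<cdot> (inv_arr V (runit V ?A) \<otimes>\<^sub>1 iV ?B)"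
    using O g by (simp add: assoc')
  also have "\<dots> = vcomp M X ?Y Z \<cdot> (pre g Z \<otimes>\<^sub>1 iV ?B)"
    using O g vcomp_assoc[of X ?Y ?Y' Z] by (simp add: assoc' T.T1_merge pre_def')
  finally show ?thesis .
qed

lemma post_Comp:
  assumes "f \<in> Arr U" "g \<in> Arr U" "Dom U g = Cod U f" "X \<in> VObj M"
  shows "post X (g \<cdot>\<^bsub>U\<^esub> f) = post X g \<cdot> post X f"
proof -
  let ?Y = "Dom U f"
  have "post X (g \<cdot>\<^bsub>U\<^esub> f) = (vcomp M X ?Y (Cod U g) \<cdot> (post ?Y g \<otimes>\<^sub>1 iV (VHom M X ?Y)))
      \<cdot> (val f \<otimes>\<^sub>1 iV (VHom M X ?Y)) \<cdot> inv_arr V (lunit V (VHom M X ?Y))"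
    using assms by (simp add: post_def'[OF Comp_U(1)] Comp_U assoc' T.T1_merge_tail)
  also have "\<dots> = post X g \<cdot> post X f"
    using assms vcomp_post_left[of X ?Y g] by (simp add: assoc') (simp add: post_def'[of f])
  finally show ?thesis .
qed

lemma pre_Comp:
  assumes "f \<in> Arr U" "g \<in> Arr U" "Dom U g = Cod U f" "Z \<in> VObj M"
  shows "pre (g \<cdot>\<^bsub>U\<^esub> f) Z = pre f Z \<cdot> pre g Z"
proof -
  let ?Y = "Cod U g"
  have "pre (g \<cdot>\<^bsub>U\<^esub> f) Z = (vcomp M (Dom U f) ?Y Z \<cdot> (iV (VHom M ?Y Z) \<otimes>\<^sub>1 pre f ?Y))
      \<cdot> (iV (VHom M ?Y Z) \<otimes>\<^sub>1 val g) \<cdot> inv_arr V (runit V (VHom M ?Y Z))"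
    using assms by (simp add: pre_def'[OF Comp_U(1)] Comp_U(1-3) val_Comp_pre assoc' T.T1_merge_tail)
  also have "\<dots> = pre f Z \<cdot> pre g Z"
    using assms vcomp_pre_right[of ?Y Z f] by (simp add: assoc') (simp add: pre_def'[of g])
  finally show ?thesis .
qed

lemma post_pre:
  assumes "f \<in> Arr U" "g \<in> Arr U"
  shows "post (Dom U f) g \<cdot> pre f (Dom U g) = pre f (Cod U g) \<cdot> post (Cod U f) g"
proof -
  let ?A = "VHom M (Cod U f) (Dom U g)"
  have "post (Dom U f) g \<cdot> pre f (Dom U g)
      = (post (Dom U f) g \<cdot> vcomp M (Dom U f) (Cod U f) (Dom U g)) \<cdot> (iV ?A \<otimes>\<^sub>1 val f) \<cdot> inv_arr V (runit V ?A)"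
    using assms by (simp add: assoc') (simp add: pre_def'[of f])
  also have "\<dots> = vcomp M (Dom U f) (Cod U f) (Cod U g) \<cdot> (post (Cod U f) g \<otimes>\<^sub>1 val f) \<cdot> inv_arr V (runit V ?A)"
    using assms vcomp_post_left[of "Dom U f" "Cod U f" g, symmetric] by (simp add: assoc' T.T1_merge_tail)
  also have "\<dots> = pre f (Cod U g) \<cdot> post (Cod U f) g"
    using assms by (simp add: pre_Comp_arr)
  finally show ?thesis .
qed

lemma post_Ide [simp]: "X \<in> VObj M \<Longrightarrow> Y \<in> VObj M \<Longrightarrow> post X (Ide U Y) = iV (VHom M X Y)"
  using triangle_tail[OF vcomp_vid_left[of X Y], of "inv_arr V (lunit V (VHom M X Y))"] by (simp add: post_def')

lemma pre_Ide [simp]: "X \<in> VObj M \<Longrightarrow> Y \<in> VObj M \<Longrightarrow> pre (Ide U X) Y = iV (VHom M X Y)"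
  using triangle_tail[OF vcomp_vid_right[of X Y], of "inv_arr V (runit V (VHom M X Y))"] by (simp add: pre_def')

lemma post_vid: "f \<in> Arr U \<Longrightarrow> Dom U f = X \<Longrightarrow> post X f \<cdot> vid M X = val f"
  using val_Comp_pre[of "Ide U X" f] Comp_U(4)[of "Ide U X" f] by auto

lemma pre_vid: "f \<in> Arr U \<Longrightarrow> Cod U f = Y \<Longrightarrow> pre f Y \<cdot> vid M Y = val f"
  using val_Comp_pre[of f "Ide U Y"] Comp_U(4)[of f "Ide U Y"] by auto

sublocale U: category U
proof
  fix f X Y assume "f \<in> hom U X Y"
  then have f: "f \<in> Arr U" "Dom U f = X" "Cod U f = Y" by (auto simp: hom_def)
  then have O: "X \<in> VObj M" "Y \<in> VObj M" by auto
  show "f \<cdot>\<^bsub>U\<^esub> Ide U X = f" by (rule U_eqI) (use f O Comp_U post_vid in auto)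
  show "Ide U Y \<cdot>\<^bsub>U\<^esub> f = f" by (rule U_eqI) (use f O Comp_U in auto)
next
  fix f g h W X Y Z assume "f \<in> hom U W X" "g \<in> hom U X Y" "h \<in> hom U Y Z"
  then have f: "f \<in> Arr U" "Dom U f = W" "Cod U f = X" "g \<in> Arr U" "Dom U g = X" "Cod U g = Y"
    "h \<in> Arr U" "Dom U h = Y" "Cod U h = Z" by (auto simp: hom_def)
  then have O: "W \<in> VObj M" "X \<in> VObj M" "Y \<in> VObj M" "Z \<in> VObj M" by auto
  show "(h \<cdot>\<^bsub>U\<^esub> g) \<cdot>\<^bsub>U\<^esub> f = h \<cdot>\<^bsub>U\<^esub> g \<cdot>\<^bsub>U\<^esub> f"
    by (rule U_eqI) (use f O in \<open>simp_all add: Comp_U post_Comp assoc'\<close>)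
qed (auto simp: hom_def Comp_U)

end

section \<open>The module structure of a tensored and cotensored category\<close>

context tensored_cotensored_category
begin

lemma tc_simps [simp]:
  "K \<in> Obj V \<Longrightarrow> X \<in> VObj M \<Longrightarrow> ten M K X \<in> VObj M"
  "K \<in> Obj V \<Longrightarrow> X \<in> VObj M \<Longrightarrow> cot M K X \<in> VObj M"
  "K \<in> Obj V \<Longrightarrow> X \<in> VObj M \<Longrightarrow> Y \<in> VObj M \<Longrightarrow> ten_iso M K X Y \<in> Arr V"
  "K \<in> Obj V \<Longrightarrow> X \<in> VObj M \<Longrightarrow> Y \<in> VObj M \<Longrightarrow> Dom V (ten_iso M K X Y) = VHom M (ten M K X) Y"
  "K \<in> Obj V \<Longrightarrow> X \<in> VObj M \<Longrightarrow> Y \<in> VObj M \<Longrightarrow> Cod V (ten_iso M K X Y) = ihom V K (VHom M X Y)"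
  "K \<in> Obj V \<Longrightarrow> X \<in> VObj M \<Longrightarrow> Y \<in> VObj M \<Longrightarrow> iso V (ten_iso M K X Y)"
  "K \<in> Obj V \<Longrightarrow> X \<in> VObj M \<Longrightarrow> Y \<in> VObj M \<Longrightarrow> cot_iso M K X Y \<in> Arr V"
  "K \<in> Obj V \<Longrightarrow> X \<in> VObj M \<Longrightarrow> Y \<in> VObj M \<Longrightarrow> Dom V (cot_iso M K X Y) = VHom M X (cot M K Y)"
  "K \<in> Obj V \<Longrightarrow> X \<in> VObj M \<Longrightarrow> Y \<in> VObj M \<Longrightarrow> Cod V (cot_iso M K X Y) = ihom V K (VHom M X Y)"
  "K \<in> Obj V \<Longrightarrow> X \<in> VObj M \<Longrightarrow> Y \<in> VObj M \<Longrightarrow> iso V (cot_iso M K X Y)"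
  using ten_in_VObj cot_in_VObj ten_iso_in_hom ten_iso_iso cot_iso_in_hom cot_iso_iso
  by (auto simp: hom_def)

section \<open>Universal maps of tensors and cotensors\<close>

abbreviation "u \<equiv> ten_univ V M"
abbreviation "v \<equiv> cot_univ V M"

lemma name:
  assumes "K \<in> Obj V" "h \<in> Arr V" "Dom V h = K"
  shows "name V K (Cod V h) h \<in> Arr V" "Dom V (name V K (Cod V h) h) = E"
    "Cod V (name V K (Cod V h) h) = ihom V K (Cod V h)"
    "ev V K (Cod V h) \<cdot> (name V K (Cod V h) h \<otimes>\<^sub>1 iV K) = h \<cdot> lunit V K"
  using curry[of "h \<cdot> lunit V K" E K "Cod V h"] assms by (simp_all add: name_def)

lemma unname:
  assumes "K \<in> Obj V" "L \<in> Obj V" "e \<in> Arr V" "Dom V e = E" "Cod V e = ihom V K L"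
  shows "unname V K L e \<in> Arr V" "Dom V (unname V K L e) = K" "Cod V (unname V K L e) = L"
    "unname V K L e \<cdot> lunit V K = ev V K L \<cdot> (e \<otimes>\<^sub>1 iV K)"
  using assms by (simp_all add: unname_def assoc')

lemma u_simps [simp]:
  assumes "K \<in> Obj V" "X \<in> VObj M"
  shows "u K X \<in> Arr V" "Dom V (u K X) = K" "Cod V (u K X) = VHom M X (ten M K X)"
  using assms unname[of K "VHom M X (ten M K X)" "ten_iso M K X (ten M K X) \<cdot> vid M (ten M K X)"]
  by (simp_all add: ten_univ_def)

lemma v_simps [simp]:
  assumes "K \<in> Obj V" "Y \<in> VObj M"
  shows "v K Y \<in> Arr V" "Dom V (v K Y) = K" "Cod V (v K Y) = VHom M (cot M K Y) Y"
  using assms unname[of K "VHom M (cot M K Y) Y" "cot_iso M K (cot M K Y) Y \<cdot> vid M (cot M K Y)"]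
  by (simp_all add: cot_univ_def)

text \<open>Enriched Yoneda: the tensor isomorphism is determined by the universal map.\<close>

lemma ev_ten_iso:
  assumes O: "K \<in> Obj V" "X \<in> VObj M" "Y \<in> VObj M"
    and g: "g \<in> Arr V" "Cod V g = VHom M (ten M K X) Y"
  shows "ev V K (VHom M X Y) \<cdot> ((ten_iso M K X Y \<cdot> g) \<otimes>\<^sub>1 iV K) = vcomp M X (ten M K X) Y \<cdot> (g \<otimes>\<^sub>1 u K X)"
proof -
  let ?T = "ten M K X" and ?L = "Dom V g"
  let ?N = "VHom M ?T Y" and ?H = "VHom M X ?T"
  let ?n = "ten_iso M K X ?T \<cdot> vid M ?T"
  let ?c = "cov_act V M K X ?T Y"
  have n: "?n \<in> Arr V" "Dom V ?n = E" "Cod V ?n = ihom V K ?H" using O by simp_all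
  have un: "ev V K ?H \<cdot> (?n \<otimes>\<^sub>1 iV K) = u K X \<cdot> lunit V K"
    using O n unname(4)[of K ?H ?n] by (simp add: ten_univ_def)
  note c = curry[of "vcomp M X ?T Y \<cdot> (iV ?N \<otimes>\<^sub>1 ev V K ?H) \<cdot> assoc V ?N (ihom V K ?H) K"
      "?N \<otimes> ihom V K ?H" K "VHom M X Y", folded cov_act_def]
  have c': "?c \<in> Arr V" "Dom V ?c = ?N \<otimes> ihom V K ?H" "Cod V ?c = ihom V K (VHom M X Y)"
    "ev V K (VHom M X Y) \<cdot> (?c \<otimes>\<^sub>1 iV K)
       = vcomp M X ?T Y \<cdot> (iV ?N \<otimes>\<^sub>1 ev V K ?H) \<cdot> assoc V ?N (ihom V K ?H) K"
    using c O by simp_all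
  \<comment> \<open>Writing \<open>g\<close> as a composite with the identity of
    \<open>K \<odot> X\<close> lets \<open>ten_natural\<close> reduce the value of
    \<open>ten_iso\<close> at \<open>g\<close> to its value \<open>?n\<close> at that identity,
    whose transpose is \<open>u K X\<close>.\<close>
  have "(ten_iso M K X Y \<cdot> g) \<cdot> runit V ?L = ten_iso M K X Y \<cdot> runit V ?N \<cdot> (g \<otimes>\<^sub>1 iV E)"
    using O g runit_nat[of g ?N] by (simp add: assoc')
  also have "\<dots> = (ten_iso M K X Y \<cdot> vcomp M ?T ?T Y) \<cdot> (iV ?N \<otimes>\<^sub>1 vid M ?T) \<cdot> (g \<otimes>\<^sub>1 iV E)"
    using O g triangle_tail[OF vcomp_vid_right[of ?T Y], of "g \<otimes>\<^sub>1 iV E"] by (simp add: assoc')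
  also have "\<dots> = ?c \<cdot> (g \<otimes>\<^sub>1 ?n)"
    using O g c'(1-3) by (simp add: ten_natural assoc' T.T1_merge)
  finally have e: "(ten_iso M K X Y \<cdot> g) \<cdot> runit V ?L = ?c \<cdot> (g \<otimes>\<^sub>1 ?n)" .
  have "(ev V K (VHom M X Y) \<cdot> ((ten_iso M K X Y \<cdot> g) \<otimes>\<^sub>1 iV K)) \<cdot> (runit V ?L \<otimes>\<^sub>1 iV K)
      = ev V K (VHom M X Y) \<cdot> ((?c \<cdot> (g \<otimes>\<^sub>1 ?n)) \<otimes>\<^sub>1 iV K)"
    using O g by (simp add: assoc' T.T1_merge flip: e)
  also have "\<dots> = ev V K (VHom M X Y) \<cdot> (?c \<otimes>\<^sub>1 iV K) \<cdot> ((g \<otimes>\<^sub>1 ?n) \<otimes>\<^sub>1 iV K)"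
    using O g c'(1-3) by (simp add: T.T1_merge)
  also have "\<dots> = (vcomp M X ?T Y \<cdot> (iV ?N \<otimes>\<^sub>1 ev V K ?H) \<cdot> assoc V ?N (ihom V K ?H) K)
      \<cdot> ((g \<otimes>\<^sub>1 ?n) \<otimes>\<^sub>1 iV K)"
    by (rule triangle_tail[OF c'(4)]) (use O g c'(1-3) in auto)
  also have "\<dots> = vcomp M X ?T Y \<cdot> (iV ?N \<otimes>\<^sub>1 ev V K ?H) \<cdot> (g \<otimes>\<^sub>1 ?n \<otimes>\<^sub>1 iV K) \<cdot> assoc V ?L E K"
    using O g assoc_nat[of g ?n "iV K"] by (simp add: assoc')
  also have "\<dots> = vcomp M X ?T Y \<cdot> (g \<otimes>\<^sub>1 (u K X \<cdot> lunit V K)) \<cdot> assoc V ?L E K"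
    using O g n by (simp add: T.T1_merge_tail un)
  also have "\<dots> = vcomp M X ?T Y \<cdot> (g \<otimes>\<^sub>1 u K X) \<cdot> (iV ?L \<otimes>\<^sub>1 lunit V K) \<cdot> assoc V ?L E K"
    using O g by (simp add: T.T1_merge_tail)
  also have "\<dots> = (vcomp M X ?T Y \<cdot> (g \<otimes>\<^sub>1 u K X)) \<cdot> (runit V ?L \<otimes>\<^sub>1 iV K)"
    using O g by (simp add: triangle assoc')
  finally show ?thesis
    by (rule iso_cancel_right) (use O g in auto)
qed

text \<open>The same Yoneda argument in the contravariant variable, with the identity of the
  cotensor inserted through \<open>lunit\<close>. The symmetry stems from \<open>contra_act\<close>,
  where \<open>K\<close> has to pass the argument \<open>g\<close>.\<close>

lemma ev_cot_iso:
  assumes O: "K \<in> Obj V" "X \<in> VObj M" "Y \<in> VObj M"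
    and g: "g \<in> Arr V" "Cod V g = VHom M X (cot M K Y)"
  shows "ev V K (VHom M X Y) \<cdot> ((cot_iso M K X Y \<cdot> g) \<otimes>\<^sub>1 iV K)
    = vcomp M X (cot M K Y) Y \<cdot> (v K Y \<otimes>\<^sub>1 g) \<cdot> symm V (Dom V g) K"
proof -
  let ?C = "cot M K Y" and ?L = "Dom V g"
  let ?N = "VHom M X ?C" and ?H = "VHom M ?C Y"
  let ?I = "ihom V K ?H"
  let ?n = "cot_iso M K ?C Y \<cdot> vid M ?C"
  let ?c = "contra_act V M K X ?C Y"
  let ?s = "assoc V ?I K ?N"
  have n: "?n \<in> Arr V" "Dom V ?n = E" "Cod V ?n = ?I" using O by simp_all
  have un: "ev V K ?H \<cdot> (?n \<otimes>\<^sub>1 iV K) = v K Y \<cdot> lunit V K"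
    using O n unname(4)[of K ?H ?n] by (simp add: cot_univ_def)
  have c: "?c \<in> Arr V" "Dom V ?c = ?I \<otimes> ?N" "Cod V ?c = ihom V K (VHom M X Y)"
    "ev V K (VHom M X Y) \<cdot> (?c \<otimes>\<^sub>1 iV K) = vcomp M X ?C Y \<cdot> (ev V K ?H \<otimes>\<^sub>1 iV ?N) \<cdot> inv_arr V ?s
       \<cdot> (iV ?I \<otimes>\<^sub>1 symm V ?N K) \<cdot> assoc V ?I ?N K"
    unfolding contra_act_def Let_def by (rule curry; use O in simp)+
  have inv_nat: "inv_arr V ?s \<cdot> (?n \<otimes>\<^sub>1 iV K \<otimes>\<^sub>1 g)
      = ((?n \<otimes>\<^sub>1 iV K) \<otimes>\<^sub>1 g) \<cdot> inv_arr V (assoc V E K ?L)"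
    using O g n assoc_nat[of ?n "iV K" g] by (intro slide[symmetric]) auto
  have l: "lunit V K \<otimes>\<^sub>1 iV ?L = lunit V (K \<otimes> ?L) \<cdot> assoc V E K ?L"
    using O g by (simp add: lunit_tens)
  have "(cot_iso M K X Y \<cdot> g) \<cdot> lunit V ?L = cot_iso M K X Y \<cdot> lunit V ?N \<cdot> (iV E \<otimes>\<^sub>1 g)"
    using O g lunit_nat[of g ?N] by (simp add: assoc')
  also have "\<dots> = (cot_iso M K X Y \<cdot> vcomp M X ?C ?C) \<cdot> (vid M ?C \<otimes>\<^sub>1 iV ?N) \<cdot> (iV E \<otimes>\<^sub>1 g)"
    using O g triangle_tail[OF vcomp_vid_left[of X ?C], of "iV E \<otimes>\<^sub>1 g"] by (simp add: assoc')
  also have "\<dots> = ?c \<cdot> (?n \<otimes>\<^sub>1 g)"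
    using O g c(1-3) by (simp add: cot_natural assoc' T.T1_merge)
  finally have e: "(cot_iso M K X Y \<cdot> g) \<cdot> lunit V ?L = ?c \<cdot> (?n \<otimes>\<^sub>1 g)" .
  have "(ev V K (VHom M X Y) \<cdot> ((cot_iso M K X Y \<cdot> g) \<otimes>\<^sub>1 iV K)) \<cdot> (lunit V ?L \<otimes>\<^sub>1 iV K)
      = ev V K (VHom M X Y) \<cdot> ((?c \<cdot> (?n \<otimes>\<^sub>1 g)) \<otimes>\<^sub>1 iV K)"
    using O g by (simp add: assoc' T.T1_merge flip: e)
  also have "\<dots> = ev V K (VHom M X Y) \<cdot> (?c \<otimes>\<^sub>1 iV K) \<cdot> ((?n \<otimes>\<^sub>1 g) \<otimes>\<^sub>1 iV K)"
    using O g c(1-3) by (simp add: T.T1_merge)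
  also have "\<dots> = (vcomp M X ?C Y \<cdot> (ev V K ?H \<otimes>\<^sub>1 iV ?N) \<cdot> inv_arr V ?s
       \<cdot> (iV ?I \<otimes>\<^sub>1 symm V ?N K) \<cdot> assoc V ?I ?N K) \<cdot> ((?n \<otimes>\<^sub>1 g) \<otimes>\<^sub>1 iV K)"
    by (rule triangle_tail[OF c(4)]) (use O g c(1-3) in auto)
  also have "\<dots> = vcomp M X ?C Y \<cdot> (ev V K ?H \<otimes>\<^sub>1 iV ?N) \<cdot> inv_arr V ?s
       \<cdot> (?n \<otimes>\<^sub>1 iV K \<otimes>\<^sub>1 g) \<cdot> (iV E \<otimes>\<^sub>1 symm V ?L K) \<cdot> assoc V E ?L K"
    using O g n assoc_nat[of ?n g "iV K"] symm_nat[of g "iV K"] by (simp add: assoc' T.T1_merge_tail)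
  also have "\<dots> = vcomp M X ?C Y \<cdot> (ev V K ?H \<otimes>\<^sub>1 iV ?N) \<cdot> ((?n \<otimes>\<^sub>1 iV K) \<otimes>\<^sub>1 g)
       \<cdot> inv_arr V (assoc V E K ?L) \<cdot> (iV E \<otimes>\<^sub>1 symm V ?L K) \<cdot> assoc V E ?L K"
    using O g n by (subst square_tail[OF inv_nat]) auto
  also have "\<dots> = vcomp M X ?C Y \<cdot> ((v K Y \<cdot> lunit V K) \<otimes>\<^sub>1 g)
       \<cdot> inv_arr V (assoc V E K ?L) \<cdot> (iV E \<otimes>\<^sub>1 symm V ?L K) \<cdot> assoc V E ?L K"
    using O g n by (simp add: T.T1_merge_tail un)
  also have "\<dots> = vcomp M X ?C Y \<cdot> (v K Y \<otimes>\<^sub>1 g) \<cdot> (lunit V K \<otimes>\<^sub>1 iV ?L)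
       \<cdot> inv_arr V (assoc V E K ?L) \<cdot> (iV E \<otimes>\<^sub>1 symm V ?L K) \<cdot> assoc V E ?L K"
    using O g by (simp add: T.T1_merge_tail)
  also have "\<dots> = vcomp M X ?C Y \<cdot> (v K Y \<otimes>\<^sub>1 g) \<cdot> lunit V (K \<otimes> ?L)
       \<cdot> (iV E \<otimes>\<^sub>1 symm V ?L K) \<cdot> assoc V E ?L K"
    unfolding l using O g by (simp add: assoc')
  also have "\<dots> = vcomp M X ?C Y \<cdot> (v K Y \<otimes>\<^sub>1 g) \<cdot> symm V ?L K \<cdot> lunit V (?L \<otimes> K) \<cdot> assoc V E ?L K"
    using O g square_tail[OF lunit_nat[of "symm V ?L K"]] by simp
  also have "\<dots> = (vcomp M X ?C Y \<cdot> (v K Y \<otimes>\<^sub>1 g) \<cdot> symm V ?L K) \<cdot> (lunit V ?L \<otimes>\<^sub>1 iV K)"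
    using O g by (simp add: lunit_tens assoc')
  finally show ?thesis
    by (rule iso_cancel_right) (use O g in auto)
qed

text \<open>By \<open>ev_ten_iso\<close> this amounts to cancelling \<open>ev\<close> and the
  invertible \<open>ten_iso\<close>. With \<open>u_param_ex\<close> it shows that
  \<open>u K X\<close> is universal even with a parameter \<open>L\<close>, as
  \<open>ten_assoc_iso\<close> requires.\<close>

lemma u_param_cancel:
  assumes "vcomp M X (ten M K X) Y \<cdot> (g \<otimes>\<^sub>1 u K X) = vcomp M X (ten M K X) Y \<cdot> (g' \<otimes>\<^sub>1 u K X)"
    "K \<in> Obj V" "X \<in> VObj M" "Y \<in> VObj M" "g \<in> Arr V" "g' \<in> Arr V" "Dom V g = Dom V g'"
    "Cod V g = VHom M (ten M K X) Y" "Cod V g' = VHom M (ten M K X) Y"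
  shows "g = g'"
proof -
  have "ev V K (VHom M X Y) \<cdot> ((ten_iso M K X Y \<cdot> g) \<otimes>\<^sub>1 iV K)
      = ev V K (VHom M X Y) \<cdot> ((ten_iso M K X Y \<cdot> g') \<otimes>\<^sub>1 iV K)"
    using assms ev_ten_iso[of K X Y g] ev_ten_iso[of K X Y g'] by simp
  then have "ten_iso M K X Y \<cdot> g = ten_iso M K X Y \<cdot> g'"
    by (rule ev_cancel) (use assms(2-) in auto)
  then show ?thesis by (rule iso_cancel_left) (use assms(2-) in auto)
qed

lemma u_param_ex:
  assumes O: "K \<in> Obj V" "X \<in> VObj M" "Y \<in> VObj M" "L \<in> Obj V"
    and h: "h \<in> Arr V" "Dom V h = L \<otimes> K" "Cod V h = VHom M X Y"
  obtains g where "g \<in> Arr V" "Dom V g = L" "Cod V g = VHom M (ten M K X) Y"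
    "vcomp M X (ten M K X) Y \<cdot> (g \<otimes>\<^sub>1 u K X) = h"
proof -
  note c = curry[OF h O(4,1)]
  let ?g = "inv_arr V (ten_iso M K X Y) \<cdot> curry V L K (VHom M X Y) h"
  have g: "?g \<in> Arr V" "Dom V ?g = L" "Cod V ?g = VHom M (ten M K X) Y"
    using O c(1-3) by simp_all
  then have "vcomp M X (ten M K X) Y \<cdot> (?g \<otimes>\<^sub>1 u K X) = h"
    using O c ev_ten_iso[of K X Y ?g] by simp
  with g show thesis by (rule that)
qed

lemma post_u:
  assumes "f \<in> Arr U" "Dom U f = ten M K X" "K \<in> Obj V" "X \<in> VObj M"
  shows "post X f \<cdot> u K X = vcomp M X (ten M K X) (Cod U f) \<cdot> (val f \<otimes>\<^sub>1 u K X) \<cdot> inv_arr V (lunit V K)"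
  using assms post_Comp_arr[of f X "u K X"] by simp

text \<open>The case where the parameter is the unit: arrows out of \<open>K \<odot> X\<close> are
  determined by their restrictions along \<open>u K X\<close>. The equations of the module structure
  are proved by computing such restrictions.\<close>

lemma post_u_cancel:
  assumes e: "post X f \<cdot> u K X = post X g \<cdot> u K X" and O: "K \<in> Obj V" "X \<in> VObj M"
    and f: "f \<in> Arr U" "g \<in> Arr U" "Dom U f = ten M K X" "Dom U g = ten M K X" "Cod U f = Cod U g"
  shows "f = g"
proof (rule U_eqI)
  have "(vcomp M X (ten M K X) (Cod U f) \<cdot> (val f \<otimes>\<^sub>1 u K X)) \<cdot> inv_arr V (lunit V K)
      = (vcomp M X (ten M K X) (Cod U f) \<cdot> (val g \<otimes>\<^sub>1 u K X)) \<cdot> inv_arr V (lunit V K)"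
    using e f O post_u[of f K X] post_u[of g K X] by (simp add: assoc')
  then have "vcomp M X (ten M K X) (Cod U f) \<cdot> (val f \<otimes>\<^sub>1 u K X)
      = vcomp M X (ten M K X) (Cod U f) \<cdot> (val g \<otimes>\<^sub>1 u K X)"
    by (rule iso_cancel_right) (use f O in auto)
  then show "val f = val g" by (rule u_param_cancel) (use f O in auto)
qed (use f in auto)

lemma ten_transpose [simp]:
  assumes O: "K \<in> Obj V" "X \<in> VObj M" "Y \<in> VObj M" and h: "h \<in> Arr V" "Dom V h = K" "Cod V h = VHom M X Y"
  shows "ten_transpose V M K X Y h \<in> Arr U" "Dom U (ten_transpose V M K X Y h) = ten M K X"
    "Cod U (ten_transpose V M K X Y h) = Y" "post X (ten_transpose V M K X Y h) \<cdot> u K X = h"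
proof -
  let ?n = "name V K (VHom M X Y) h"
  have n: "?n \<in> Arr V" "Dom V ?n = E" "Cod V ?n = ihom V K (VHom M X Y)"
    "ev V K (VHom M X Y) \<cdot> (?n \<otimes>\<^sub>1 iV K) = h \<cdot> lunit V K"
    using name[OF O(1) h(1,2)] h by simp_all
  let ?g = "inv_arr V (ten_iso M K X Y) \<cdot> ?n"
  have t: "ten_transpose V M K X Y h = (ten M K X, Y, ?g)" by (simp add: ten_transpose_def)
  have g: "?g \<in> Arr V" "Dom V ?g = E" "Cod V ?g = VHom M (ten M K X) Y"
    using O n(1-3) by simp_all
  show 1: "ten_transpose V M K X Y h \<in> Arr U" "Dom U (ten_transpose V M K X Y h) = ten M K X"
    "Cod U (ten_transpose V M K X Y h) = Y"
    unfolding t using O g by simp_all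
  have "vcomp M X (ten M K X) Y \<cdot> (?g \<otimes>\<^sub>1 u K X) = h \<cdot> lunit V K"
    using ev_ten_iso[OF O g(1,3)] O n by simp
  then have "(vcomp M X (ten M K X) Y \<cdot> (?g \<otimes>\<^sub>1 u K X)) \<cdot> inv_arr V (lunit V K) = h"
    using O h by (simp add: assoc')
  moreover have "val (ten_transpose V M K X Y h) = ?g" unfolding t using O g by simp
  ultimately show "post X (ten_transpose V M K X Y h) \<cdot> u K X = h"
    using O g by (subst post_u[OF 1(1,2)]) (simp_all add: 1 assoc')
qed

text \<open>Counterpart of \<open>post_u_cancel\<close> for arrows into a cotensor; precomposing
  with \<open>symm V E K\<close> brings the equation into the shape of
  \<open>ev_cot_iso\<close>.\<close>

lemma pre_v_cancel:
  assumes e: "pre f Y \<cdot> v K Y = pre g Y \<cdot> v K Y" and O: "K \<in> Obj V" "Y \<in> VObj M"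
    and f: "f \<in> Arr U" "g \<in> Arr U" "Cod U f = cot M K Y" "Cod U g = cot M K Y" "Dom U f = Dom U g"
  shows "f = g"
proof (rule U_eqI)
  let ?X = "Dom U f"
  have "vcomp M ?X (cot M K Y) Y \<cdot> (v K Y \<otimes>\<^sub>1 val f) \<cdot> inv_arr V (runit V K)
      = vcomp M ?X (cot M K Y) Y \<cdot> (v K Y \<otimes>\<^sub>1 val g) \<cdot> inv_arr V (runit V K)"
    using e f O pre_Comp_arr[of f Y "v K Y"] pre_Comp_arr[of g Y "v K Y"] by simp
  then have "(vcomp M ?X (cot M K Y) Y \<cdot> (v K Y \<otimes>\<^sub>1 val f)) \<cdot> inv_arr V (runit V K)
      = (vcomp M ?X (cot M K Y) Y \<cdot> (v K Y \<otimes>\<^sub>1 val g)) \<cdot> inv_arr V (runit V K)"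
    using f O by (simp add: assoc')
  then have e': "vcomp M ?X (cot M K Y) Y \<cdot> (v K Y \<otimes>\<^sub>1 val f) = vcomp M ?X (cot M K Y) Y \<cdot> (v K Y \<otimes>\<^sub>1 val g)"
    by (rule iso_cancel_right) (use f O in auto)
  have "(vcomp M ?X (cot M K Y) Y \<cdot> (v K Y \<otimes>\<^sub>1 val f)) \<cdot> symm V E K
      = (vcomp M ?X (cot M K Y) Y \<cdot> (v K Y \<otimes>\<^sub>1 val g)) \<cdot> symm V E K" by (simp only: e')
  then have "ev V K (VHom M ?X Y) \<cdot> ((cot_iso M K ?X Y \<cdot> val f) \<otimes>\<^sub>1 iV K)
      = ev V K (VHom M ?X Y) \<cdot> ((cot_iso M K ?X Y \<cdot> val g) \<otimes>\<^sub>1 iV K)"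
    using f O ev_cot_iso[of K ?X Y "val f"] ev_cot_iso[of K ?X Y "val g"] by (simp add: assoc')
  then have "cot_iso M K ?X Y \<cdot> val f = cot_iso M K ?X Y \<cdot> val g"
    by (rule ev_cancel) (use f O in auto)
  then show "val f = val g" by (rule iso_cancel_left) (use f O in auto)
qed (use f in auto)

lemma cot_transpose [simp]:
  assumes O: "K \<in> Obj V" "X \<in> VObj M" "Y \<in> VObj M" and h: "h \<in> Arr V" "Dom V h = K" "Cod V h = VHom M X Y"
  shows "cot_transpose V M K X Y h \<in> Arr U" "Dom U (cot_transpose V M K X Y h) = X"
    "Cod U (cot_transpose V M K X Y h) = cot M K Y" "pre (cot_transpose V M K X Y h) Y \<cdot> v K Y = h"
proof -
  let ?n = "name V K (VHom M X Y) h"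
  have n: "?n \<in> Arr V" "Dom V ?n = E" "Cod V ?n = ihom V K (VHom M X Y)"
    "ev V K (VHom M X Y) \<cdot> (?n \<otimes>\<^sub>1 iV K) = h \<cdot> lunit V K"
    using name[OF O(1) h(1,2)] h by simp_all
  let ?g = "inv_arr V (cot_iso M K X Y) \<cdot> ?n"
  let ?t = "cot_transpose V M K X Y h"
  have t: "?t = (X, cot M K Y, ?g)" by (simp add: cot_transpose_def)
  have g: "?g \<in> Arr V" "Dom V ?g = E" "Cod V ?g = VHom M X (cot M K Y)"
    using O n(1-3) by simp_all
  show 1: "?t \<in> Arr U" "Dom U ?t = X" "Cod U ?t = cot M K Y"
    unfolding t using O g by simp_all
  have val: "val ?t = ?g" unfolding t using O g by simp
  have "(vcomp M X (cot M K Y) Y \<cdot> (v K Y \<otimes>\<^sub>1 ?g)) \<cdot> symm V E K = h \<cdot> lunit V K"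
    using ev_cot_iso[OF O g(1,3)] O n g by (simp add: assoc')
  \<comment> \<open>By \<open>lunit_symm\<close>; now the symmetry can be cancelled on both
    sides.\<close>
  also have "\<dots> = (h \<cdot> runit V K) \<cdot> symm V E K"
  proof -
    have "runit V K \<cdot> symm V E K = lunit V K \<cdot> symm V K E \<cdot> symm V E K"
      using O by (simp add: lunit_symm[symmetric] assoc')
    then show ?thesis using O h by (simp add: symm_symm assoc')
  qed
  finally have "vcomp M X (cot M K Y) Y \<cdot> (v K Y \<otimes>\<^sub>1 ?g) = h \<cdot> runit V K"
    by (rule iso_cancel_right) (use O g h in auto)
  then have "(vcomp M X (cot M K Y) Y \<cdot> (v K Y \<otimes>\<^sub>1 ?g)) \<cdot> inv_arr V (runit V K) = h"
    using O h by (simp add: assoc')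
  then show "pre ?t Y \<cdot> v K Y = h"
    using O g 1 val pre_Comp_arr[of ?t Y "v K Y"] by (simp add: assoc')
qed

section \<open>The action of the base on the underlying category\<close>

lemma ten_arr_simps [simp]:
  assumes k: "k \<in> Arr V" and f: "f \<in> Arr U"
  shows "ten_arr V M k f \<in> Arr U" "Dom U (ten_arr V M k f) = ten M (Dom V k) (Dom U f)"
    "Cod U (ten_arr V M k f) = ten M (Cod V k) (Cod U f)"
    "post (Dom U f) (ten_arr V M k f) \<cdot> u (Dom V k) (Dom U f)
       = pre f (ten M (Cod V k) (Cod U f)) \<cdot> u (Cod V k) (Cod U f) \<cdot> k"
proof -
  have "ten_arr V M k f = ten_transpose V M (Dom V k) (Dom U f) (ten M (Cod V k) (Cod U f))
      (pre f (ten M (Cod V k) (Cod U f)) \<cdot> u (Cod V k) (Cod U f) \<cdot> k)"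
    using f by (auto simp: ten_arr_def underlying_def)
  then show "ten_arr V M k f \<in> Arr U" "Dom U (ten_arr V M k f) = ten M (Dom V k) (Dom U f)"
    "Cod U (ten_arr V M k f) = ten M (Cod V k) (Cod U f)"
    "post (Dom U f) (ten_arr V M k f) \<cdot> u (Dom V k) (Dom U f)
       = pre f (ten M (Cod V k) (Cod U f)) \<cdot> u (Cod V k) (Cod U f) \<cdot> k"
    using k f by simp_all
qed

lemma post_ten_arr:
  assumes "k \<in> Arr V" "f \<in> Arr U" "Dom V k = K" "Dom U f = X"
  shows "post X (ten_arr V M k f) \<cdot> u K X = pre f (ten M (Cod V k) (Cod U f)) \<cdot> u (Cod V k) (Cod U f) \<cdot> k"
  using assms ten_arr_simps(4) by auto

lemma post_Comp_u:
  assumes "g \<in> Arr U" "f \<in> Arr U" "Dom U g = Cod U f" "Dom U f = ten M K X" "K \<in> Obj V" "X \<in> VObj M"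
    "post X f \<cdot> u K X = h"
  shows "post X (g \<cdot>\<^bsub>U\<^esub> f) \<cdot> u K X = post X g \<cdot> h"
  using assms(1-6) by (simp add: post_Comp assoc' flip: assms(7))

sublocale ten: bifunctor V U U "ten M" "ten_arr V M"
proof
  fix K X assume O: "K \<in> Obj V" "X \<in> Obj U"
  show "ten_arr V M (iV K) (Ide U X) = Ide U (ten M K X)"
    by (rule post_u_cancel[of X _ K]) (use O in \<open>simp_all add: post_ten_arr\<close>)
next
  fix k k' f f' assume t: "k \<in> Arr V" "k' \<in> Arr V" "f \<in> Arr U" "f' \<in> Arr U" "Dom V k' = Cod V k"
    "Dom U f' = Cod U f"
  let ?Z = "ten M (Cod V k') (Cod U f')"
  have "post (Dom U f) (ten_arr V M k' f' \<cdot>\<^bsub>U\<^esub> ten_arr V M k f) \<cdot> u (Dom V k) (Dom U f)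
      = post (Dom U f) (ten_arr V M k' f') \<cdot> pre f (ten M (Cod V k) (Cod U f)) \<cdot> u (Cod V k) (Cod U f) \<cdot> k"
    by (rule post_Comp_u) (use t in \<open>auto simp: post_ten_arr\<close>)
  also have "\<dots> = pre f ?Z \<cdot> post (Cod U f) (ten_arr V M k' f') \<cdot> u (Cod V k) (Cod U f) \<cdot> k"
    using t square_tail[OF post_pre[of f "ten_arr V M k' f'"], of "u (Cod V k) (Cod U f) \<cdot> k"] by simp
  also have "\<dots> = pre f ?Z \<cdot> pre f' ?Z \<cdot> u (Cod V k') (Cod U f') \<cdot> k' \<cdot> k"
    using t triangle_tail[OF post_ten_arr[of k' f' "Cod V k" "Cod U f"], of k] by (simp add: assoc')
  also have "\<dots> = post (Dom U f) (ten_arr V M (k' \<cdot> k) (f' \<cdot>\<^bsub>U\<^esub> f)) \<cdot> u (Dom V k) (Dom U f)"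
    using t by (simp add: post_ten_arr pre_Comp assoc')
  finally show "ten_arr V M (k' \<cdot> k) (f' \<cdot>\<^bsub>U\<^esub> f) = ten_arr V M k' f' \<cdot>\<^bsub>U\<^esub> ten_arr V M k f"
    by (intro post_u_cancel[of "Dom U f" _ "Dom V k"]) (use t in simp_all)
qed simp_all

definition ten_assoc :: "'o \<Rightarrow> 'o \<Rightarrow> 'm \<Rightarrow> ('m, 'a) und_arr" where
  "ten_assoc K L X = ten_transpose V M (K \<otimes> L) X (ten M K (ten M L X))
     (vcomp M X (ten M L X) (ten M K (ten M L X)) \<cdot> (u K (ten M L X) \<otimes>\<^sub>1 u L X))"

lemma ten_assoc_simps [simp]:
  assumes "K \<in> Obj V" "L \<in> Obj V" "X \<in> VObj M"
  shows "ten_assoc K L X \<in> Arr U" "Dom U (ten_assoc K L X) = ten M (K \<otimes> L) X"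
    "Cod U (ten_assoc K L X) = ten M K (ten M L X)"
    "post X (ten_assoc K L X) \<cdot> u (K \<otimes> L) X
       = vcomp M X (ten M L X) (ten M K (ten M L X)) \<cdot> (u K (ten M L X) \<otimes>\<^sub>1 u L X)"
  using assms by (simp_all add: ten_assoc_def)

lemma ten_unit_simps [simp]:
  assumes "X \<in> VObj M"
  shows "ten_unit V M X \<in> Arr U" "Dom U (ten_unit V M X) = ten M E X" "Cod U (ten_unit V M X) = X"
    "post X (ten_unit V M X) \<cdot> u E X = vid M X"
  using assms by (simp_all add: ten_unit_def)

definition ten_ev :: "'m \<Rightarrow> 'm \<Rightarrow> ('m, 'a) und_arr" where
  "ten_ev X Y = ten_transpose V M (VHom M X Y) X Y (iV (VHom M X Y))"

lemma ten_ev_simps [simp]: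
  assumes "X \<in> VObj M" "Y \<in> VObj M"
  shows "ten_ev X Y \<in> Arr U" "Dom U (ten_ev X Y) = ten M (VHom M X Y) X" "Cod U (ten_ev X Y) = Y"
    "post X (ten_ev X Y) \<cdot> u (VHom M X Y) X = iV (VHom M X Y)"
  using assms by (simp_all add: ten_ev_def)

text \<open>Transposing the universal map \<open>v K Y\<close> along the tensor turns it into the
  counit of the adjunction between \<open>K \<odot> -\<close> and \<open>{K, -}\<close>.\<close>

definition cot_ev :: "'o \<Rightarrow> 'm \<Rightarrow> ('m, 'a) und_arr" where
  "cot_ev K Y = ten_transpose V M K (cot M K Y) Y (v K Y)"

lemma cot_ev_simps [simp]:
  assumes "K \<in> Obj V" "Y \<in> VObj M"
  shows "cot_ev K Y \<in> Arr U" "Dom U (cot_ev K Y) = ten M K (cot M K Y)" "Cod U (cot_ev K Y) = Y"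
    "post (cot M K Y) (cot_ev K Y) \<cdot> u K (cot M K Y) = v K Y"
  using assms by (simp_all add: cot_ev_def)

text \<open>This lemma, \<open>pre_vcomp\<close> and \<open>vcomp_slide\<close> restate the three
  whiskering laws for arbitrary arrows \<open>b\<close> and \<open>c\<close> into hom objects, as
  they are needed on universal maps.\<close>

lemma post_vcomp:
  assumes "X \<in> VObj M" "Y \<in> VObj M" "g \<in> Arr U" "b \<in> Arr V" "c \<in> Arr V" "Cod V b = VHom M Y (Dom U g)"
    "Cod V c = VHom M X Y"
  shows "post X g \<cdot> vcomp M X Y (Dom U g) \<cdot> (b \<otimes>\<^sub>1 c) = vcomp M X Y (Cod U g) \<cdot> ((post Y g \<cdot> b) \<otimes>\<^sub>1 c)"
proof -
  have "post X g \<cdot> vcomp M X Y (Dom U g) \<cdot> (b \<otimes>\<^sub>1 c)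
      = vcomp M X Y (Cod U g) \<cdot> (post Y g \<otimes>\<^sub>1 iV (VHom M X Y)) \<cdot> (b \<otimes>\<^sub>1 c)"
    by (rule square_tail[OF vcomp_post_left[symmetric]]) (use assms in auto)
  then show ?thesis using assms by (simp add: T.T1_merge)
qed

lemma pre_vcomp:
  assumes "Y \<in> VObj M" "Z \<in> VObj M" "f \<in> Arr U" "b \<in> Arr V" "c \<in> Arr V" "Cod V b = VHom M Y Z"
    "Cod V c = VHom M (Cod U f) Y"
  shows "pre f Z \<cdot> vcomp M (Cod U f) Y Z \<cdot> (b \<otimes>\<^sub>1 c) = vcomp M (Dom U f) Y Z \<cdot> (b \<otimes>\<^sub>1 (pre f Y \<cdot> c))"
proof -
  have "pre f Z \<cdot> vcomp M (Cod U f) Y Z \<cdot> (b \<otimes>\<^sub>1 c)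
      = vcomp M (Dom U f) Y Z \<cdot> (iV (VHom M Y Z) \<otimes>\<^sub>1 pre f Y) \<cdot> (b \<otimes>\<^sub>1 c)"
    by (rule square_tail[OF vcomp_pre_right[symmetric]]) (use assms in auto)
  then show ?thesis using assms by (simp add: T.T1_merge)
qed

lemma vcomp_slide:
  assumes "X \<in> VObj M" "Z \<in> VObj M" "g \<in> Arr U" "b \<in> Arr V" "c \<in> Arr V" "Cod V b = VHom M (Cod U g) Z"
    "Cod V c = VHom M X (Dom U g)"
  shows "vcomp M X (Dom U g) Z \<cdot> ((pre g Z \<cdot> b) \<otimes>\<^sub>1 c) = vcomp M X (Cod U g) Z \<cdot> (b \<otimes>\<^sub>1 (post X g \<cdot> c))"
proof -
  have "vcomp M X (Cod U g) Z \<cdot> (iV (VHom M (Cod U g) Z) \<otimes>\<^sub>1 post X g) \<cdot> (b \<otimes>\<^sub>1 c)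
      = vcomp M X (Dom U g) Z \<cdot> (pre g Z \<otimes>\<^sub>1 iV (VHom M X (Dom U g))) \<cdot> (b \<otimes>\<^sub>1 c)"
    by (rule square_tail[OF vcomp_post_pre]) (use assms in auto)
  then show ?thesis using assms by (simp add: T.T1_merge)
qed

lemma vcomp_assoc_arr:
  assumes "W \<in> VObj M" "X \<in> VObj M" "Y \<in> VObj M" "Z \<in> VObj M" "b \<in> Arr V" "c \<in> Arr V" "d \<in> Arr V"
    "Cod V b = VHom M Y Z" "Cod V c = VHom M X Y" "Cod V d = VHom M W X"
  shows "vcomp M W X Z \<cdot> ((vcomp M X Y Z \<cdot> (b \<otimes>\<^sub>1 c)) \<otimes>\<^sub>1 d)
    = vcomp M W Y Z \<cdot> (b \<otimes>\<^sub>1 (vcomp M W X Y \<cdot> (c \<otimes>\<^sub>1 d))) \<cdot> assoc V (Dom V b) (Dom V c) (Dom V d)"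
proof -
  have "vcomp M W X Z \<cdot> ((vcomp M X Y Z \<cdot> (b \<otimes>\<^sub>1 c)) \<otimes>\<^sub>1 d)
      = (vcomp M W X Z \<cdot> (vcomp M X Y Z \<otimes>\<^sub>1 iV (VHom M W X))) \<cdot> ((b \<otimes>\<^sub>1 c) \<otimes>\<^sub>1 d)"
    using assms by (simp add: assoc' T.T1_merge)
  also have "\<dots> = (vcomp M W Y Z \<cdot> (iV (VHom M Y Z) \<otimes>\<^sub>1 vcomp M W X Y)
      \<cdot> assoc V (VHom M Y Z) (VHom M X Y) (VHom M W X)) \<cdot> ((b \<otimes>\<^sub>1 c) \<otimes>\<^sub>1 d)"
    using assms by (simp only: vcomp_assoc)
  also have "\<dots> = vcomp M W Y Z \<cdot> (b \<otimes>\<^sub>1 (vcomp M W X Y \<cdot> (c \<otimes>\<^sub>1 d))) \<cdot> assoc V (Dom V b) (Dom V c) (Dom V d)"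
    using assms by (simp add: assoc' assoc_nat T.T1_merge_tail)
  finally show ?thesis .
qed

text \<open>Both sides restrict along \<open>u\<close> to the composite of two universal maps, with
  \<open>k\<close>, \<open>l\<close> and \<open>f\<close> applied; \<open>ten_arr V M l f\<close>
  crosses the middle object by \<open>vcomp_slide\<close>.\<close>

lemma ten_assoc_nat:
  assumes k: "k \<in> Arr V" and l: "l \<in> Arr V" and f: "f \<in> Arr U"
  shows "ten_assoc (Cod V k) (Cod V l) (Cod U f) \<cdot>\<^bsub>U\<^esub> ten_arr V M (k \<otimes>\<^sub>1 l) f
    = ten_arr V M k (ten_arr V M l f) \<cdot>\<^bsub>U\<^esub> ten_assoc (Dom V k) (Dom V l) (Dom U f)"
proof -
  let ?K = "Dom V k" and ?L = "Dom V l" and ?X = "Dom U f"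
  let ?K' = "Cod V k" and ?L' = "Cod V l" and ?X' = "Cod U f"
  let ?lf = "ten_arr V M l f"
  let ?Z = "ten M ?K' (ten M ?L' ?X')"
  have "post ?X (ten_assoc ?K' ?L' ?X' \<cdot>\<^bsub>U\<^esub> ten_arr V M (k \<otimes>\<^sub>1 l) f) \<cdot> u (?K \<otimes> ?L) ?X
      = post ?X (ten_assoc ?K' ?L' ?X') \<cdot> pre f (ten M (?K' \<otimes> ?L') ?X') \<cdot> u (?K' \<otimes> ?L') ?X' \<cdot> (k \<otimes>\<^sub>1 l)"
    by (rule post_Comp_u) (use assms in \<open>auto simp: post_ten_arr\<close>)
  also have "\<dots> = pre f ?Z \<cdot> post ?X' (ten_assoc ?K' ?L' ?X') \<cdot> u (?K' \<otimes> ?L') ?X' \<cdot> (k \<otimes>\<^sub>1 l)"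
    using assms square_tail[OF post_pre[of f "ten_assoc ?K' ?L' ?X'"], of "u (?K' \<otimes> ?L') ?X' \<cdot> (k \<otimes>\<^sub>1 l)"]
    by simp
  also have "\<dots> = pre f ?Z \<cdot> vcomp M ?X' (ten M ?L' ?X') ?Z \<cdot> ((u ?K' (ten M ?L' ?X') \<cdot> k) \<otimes>\<^sub>1 (u ?L' ?X' \<cdot> l))"
    using assms triangle_tail[OF ten_assoc_simps(4)[of ?K' ?L' ?X'], of "k \<otimes>\<^sub>1 l"]
    by (simp add: assoc' T.T1_merge)
  also have "\<dots> = vcomp M ?X (ten M ?L' ?X') ?Z
      \<cdot> ((u ?K' (ten M ?L' ?X') \<cdot> k) \<otimes>\<^sub>1 (pre f (ten M ?L' ?X') \<cdot> u ?L' ?X' \<cdot> l))"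
    using assms by (simp add: pre_vcomp)
  also have "\<dots> = vcomp M ?X (Cod U ?lf) ?Z
      \<cdot> ((u ?K' (ten M ?L' ?X') \<cdot> k) \<otimes>\<^sub>1 (post ?X ?lf \<cdot> u ?L ?X))"
    using assms by (simp add: post_ten_arr)
  also have "\<dots> = vcomp M ?X (Dom U ?lf) ?Z
      \<cdot> ((pre ?lf ?Z \<cdot> u ?K' (ten M ?L' ?X') \<cdot> k) \<otimes>\<^sub>1 u ?L ?X)"
    by (rule vcomp_slide[symmetric]) (use assms in auto)
  also have "\<dots> = vcomp M ?X (Dom U ?lf) ?Z
      \<cdot> ((post (Dom U ?lf) (ten_arr V M k ?lf) \<cdot> u ?K (ten M ?L ?X)) \<otimes>\<^sub>1 u ?L ?X)"
    using assms by (simp add: post_ten_arr)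
  also have "\<dots> = post ?X (ten_arr V M k ?lf) \<cdot> vcomp M ?X (ten M ?L ?X) (ten M ?K (ten M ?L ?X))
      \<cdot> (u ?K (ten M ?L ?X) \<otimes>\<^sub>1 u ?L ?X)"
    using assms post_vcomp[of ?X "ten M ?L ?X" "ten_arr V M k ?lf" "u ?K (ten M ?L ?X)" "u ?L ?X"] by simp
  also have "\<dots> = post ?X (ten_arr V M k ?lf \<cdot>\<^bsub>U\<^esub> ten_assoc ?K ?L ?X) \<cdot> u (?K \<otimes> ?L) ?X"
    by (rule post_Comp_u[symmetric]) (use assms in auto)
  finally show ?thesis
    by (rule post_u_cancel) (use assms in auto)
qed

text \<open>\<open>h\<close> factors \<open>u (K \<otimes> L) X\<close> through
  \<open>u L X\<close>, with \<open>K\<close> as a parameter; its transpose \<open>?n\<close> is the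
  inverse.\<close>

lemma ten_assoc_iso:
  assumes O: "K \<in> Obj V" "L \<in> Obj V" "X \<in> VObj M"
  shows "iso U (ten_assoc K L X)"
proof -
  let ?m = "ten_assoc K L X" and ?T = "ten M L X" and ?A = "ten M (K \<otimes> L) X"
  obtain h where h: "h \<in> Arr V" "Dom V h = K" "Cod V h = VHom M ?T ?A"
    "vcomp M X ?T ?A \<cdot> (h \<otimes>\<^sub>1 u L X) = u (K \<otimes> L) X"
    by (rule u_param_ex[of L X ?A K "u (K \<otimes> L) X"]) (use O in auto)
  let ?n = "ten_transpose V M K ?T ?A h"
  have n: "?n \<in> Arr U" "Dom U ?n = ten M K ?T" "Cod U ?n = ?A" "post ?T ?n \<cdot> u K ?T = h"
    using O h by simp_all
  have "post X (?n \<cdot>\<^bsub>U\<^esub> ?m) \<cdot> u (K \<otimes> L) X = post X ?n \<cdot> vcomp M X ?T (ten M K ?T) \<cdot> (u K ?T \<otimes>\<^sub>1 u L X)"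
    by (rule post_Comp_u) (use O n in auto)
  also have "\<dots> = vcomp M X ?T ?A \<cdot> (h \<otimes>\<^sub>1 u L X)"
    using O n post_vcomp[of X ?T ?n "u K ?T" "u L X"] by simp
  finally have nm: "?n \<cdot>\<^bsub>U\<^esub> ?m = Ide U ?A"
    by (intro post_u_cancel[of X _ "K \<otimes> L"]) (use O n h in simp_all)
  have "vcomp M X ?T (ten M K ?T) \<cdot> ((post ?T ?m \<cdot> h) \<otimes>\<^sub>1 u L X) = post X ?m \<cdot> vcomp M X ?T ?A \<cdot> (h \<otimes>\<^sub>1 u L X)"
    using O h post_vcomp[of X ?T ?m h "u L X"] by simp
  also have "\<dots> = vcomp M X ?T (ten M K ?T) \<cdot> (u K ?T \<otimes>\<^sub>1 u L X)"
    using O h(4) by simp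
  finally have "post ?T ?m \<cdot> h = u K ?T"
    by (rule u_param_cancel) (use O h in auto)
  moreover have "post ?T (?m \<cdot>\<^bsub>U\<^esub> ?n) \<cdot> u K ?T = post ?T ?m \<cdot> h"
    by (rule post_Comp_u) (use O n h in auto)
  ultimately have "?m \<cdot>\<^bsub>U\<^esub> ?n = Ide U (ten M K ?T)"
    by (intro post_u_cancel[of ?T _ K]) (use O n in simp_all)
  with nm show ?thesis using O n by (intro U.isoI[of ?m ?n]) auto
qed

lemma ten_unit_nat:
  assumes f: "f \<in> Arr U"
  shows "ten_unit V M (Cod U f) \<cdot>\<^bsub>U\<^esub> ten_arr V M (iV E) f = f \<cdot>\<^bsub>U\<^esub> ten_unit V M (Dom U f)"
proof -
  let ?X = "Dom U f" and ?Y = "Cod U f"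
  have "post ?X (ten_unit V M ?Y \<cdot>\<^bsub>U\<^esub> ten_arr V M (iV E) f) \<cdot> u E ?X
      = post ?X (ten_unit V M ?Y) \<cdot> pre f (ten M E ?Y) \<cdot> u E ?Y"
    by (rule post_Comp_u) (use f in \<open>auto simp: post_ten_arr\<close>)
  also have "\<dots> = pre f ?Y \<cdot> post ?Y (ten_unit V M ?Y) \<cdot> u E ?Y"
    using f square_tail[OF post_pre[of f "ten_unit V M ?Y"], of "u E ?Y"] by simp
  also have "\<dots> = post ?X f \<cdot> vid M ?X"
    using f by (simp add: pre_vid post_vid)
  also have "\<dots> = post ?X (f \<cdot>\<^bsub>U\<^esub> ten_unit V M ?X) \<cdot> u E ?X"
    by (rule post_Comp_u[symmetric]) (use f in auto)
  finally show ?thesis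
    by (rule post_u_cancel) (use f in auto)
qed

text \<open>Both sides restrict along \<open>u\<close> to \<open>?uuu\<close>, the composite of
  three universal maps; their different bracketings are matched by
  \<open>vcomp_assoc_arr\<close>.\<close>

lemma ten_pentagon:
  assumes O: "J \<in> Obj V" "K \<in> Obj V" "L \<in> Obj V" "X \<in> VObj M"
  shows "ten_arr V M (iV J) (ten_assoc K L X) \<cdot>\<^bsub>U\<^esub> ten_assoc J (K \<otimes> L) X
      \<cdot>\<^bsub>U\<^esub> ten_arr V M (assoc V J K L) (Ide U X)
    = ten_assoc J K (ten M L X) \<cdot>\<^bsub>U\<^esub> ten_assoc (J \<otimes> K) L X"
proof -
  let ?T = "ten M L X" and ?A = "ten M (K \<otimes> L) X"
  let ?KT = "ten M K ?T"
  let ?Z = "ten M J ?KT"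
  let ?m = "ten_assoc K L X" and ?a = "assoc V J K L"
  let ?p = "ten_arr V M (iV J) ?m"
  let ?uuu = "vcomp M X ?KT ?Z \<cdot> (u J ?KT \<otimes>\<^sub>1 (vcomp M X ?T ?KT \<cdot> (u K ?T \<otimes>\<^sub>1 u L X))) \<cdot> ?a"
  have "post X (ten_assoc J (K \<otimes> L) X \<cdot>\<^bsub>U\<^esub> ten_arr V M ?a (Ide U X)) \<cdot> u ((J \<otimes> K) \<otimes> L) X
      = post X (ten_assoc J (K \<otimes> L) X) \<cdot> u (J \<otimes> K \<otimes> L) X \<cdot> ?a"
    by (rule post_Comp_u) (use O in \<open>simp_all add: post_ten_arr\<close>)
  also have "\<dots> = vcomp M X ?A (ten M J ?A) \<cdot> (u J ?A \<otimes>\<^sub>1 u (K \<otimes> L) X) \<cdot> ?a"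
    using O triangle_tail[OF ten_assoc_simps(4)[of J "K \<otimes> L" X], of ?a] by (simp add: assoc')
  finally have 1: "post X (ten_assoc J (K \<otimes> L) X \<cdot>\<^bsub>U\<^esub> ten_arr V M ?a (Ide U X)) \<cdot> u ((J \<otimes> K) \<otimes> L) X
      = vcomp M X ?A (ten M J ?A) \<cdot> (u J ?A \<otimes>\<^sub>1 u (K \<otimes> L) X) \<cdot> ?a" .
  have "post X (?p \<cdot>\<^bsub>U\<^esub> ten_assoc J (K \<otimes> L) X \<cdot>\<^bsub>U\<^esub> ten_arr V M ?a (Ide U X)) \<cdot> u ((J \<otimes> K) \<otimes> L) X
      = post X ?p \<cdot> vcomp M X ?A (ten M J ?A) \<cdot> (u J ?A \<otimes>\<^sub>1 u (K \<otimes> L) X) \<cdot> ?a"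
    by (rule post_Comp_u[OF _ _ _ _ _ _ 1]) (use O in auto)
  also have "\<dots> = (post X ?p \<cdot> vcomp M X ?A (ten M J ?A) \<cdot> (u J ?A \<otimes>\<^sub>1 u (K \<otimes> L) X)) \<cdot> ?a"
    using O by (simp add: assoc')
  also have "\<dots> = (vcomp M X ?A ?Z \<cdot> ((post ?A ?p \<cdot> u J ?A) \<otimes>\<^sub>1 u (K \<otimes> L) X)) \<cdot> ?a"
    using O post_vcomp[of X ?A ?p "u J ?A" "u (K \<otimes> L) X"] by simp
  also have "\<dots> = (vcomp M X ?A ?Z \<cdot> ((pre ?m ?Z \<cdot> u J ?KT) \<otimes>\<^sub>1 u (K \<otimes> L) X)) \<cdot> ?a"
    using O by (simp add: post_ten_arr)
  also have "\<dots> = (vcomp M X ?KT ?Z \<cdot> (u J ?KT \<otimes>\<^sub>1 (post X ?m \<cdot> u (K \<otimes> L) X))) \<cdot> ?a"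
    using O vcomp_slide[of X ?Z ?m "u J ?KT" "u (K \<otimes> L) X"] by simp
  also have "\<dots> = ?uuu"
    using O by (simp add: assoc')
  finally have l: "post X (?p \<cdot>\<^bsub>U\<^esub> ten_assoc J (K \<otimes> L) X \<cdot>\<^bsub>U\<^esub> ten_arr V M ?a (Ide U X))
      \<cdot> u ((J \<otimes> K) \<otimes> L) X = ?uuu" .
  have "post X (ten_assoc J K ?T \<cdot>\<^bsub>U\<^esub> ten_assoc (J \<otimes> K) L X) \<cdot> u ((J \<otimes> K) \<otimes> L) X
      = post X (ten_assoc J K ?T) \<cdot> vcomp M X ?T (ten M (J \<otimes> K) ?T) \<cdot> (u (J \<otimes> K) ?T \<otimes>\<^sub>1 u L X)"
    by (rule post_Comp_u) (use O in auto)
  also have "\<dots> = vcomp M X ?T ?Z \<cdot> ((post ?T (ten_assoc J K ?T) \<cdot> u (J \<otimes> K) ?T) \<otimes>\<^sub>1 u L X)"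
    using O post_vcomp[of X ?T "ten_assoc J K ?T" "u (J \<otimes> K) ?T" "u L X"] by simp
  also have "\<dots> = ?uuu"
    using O vcomp_assoc_arr[of X ?T ?KT ?Z "u J ?KT" "u K ?T" "u L X"] by simp
  finally have r: "post X (ten_assoc J K ?T \<cdot>\<^bsub>U\<^esub> ten_assoc (J \<otimes> K) L X) \<cdot> u ((J \<otimes> K) \<otimes> L) X = ?uuu" .
  show ?thesis
    by (rule post_u_cancel[of X _ "(J \<otimes> K) \<otimes> L"]) (use O in \<open>simp_all add: l r\<close>)
qed

lemma ten_triangle_right:
  assumes O: "K \<in> Obj V" "X \<in> VObj M"
  shows "ten_arr V M (iV K) (ten_unit V M X) \<cdot>\<^bsub>U\<^esub> ten_assoc K E X = ten_arr V M (runit V K) (Ide U X)"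
proof -
  let ?T = "ten M E X" and ?p = "ten_arr V M (iV K) (ten_unit V M X)"
  have "post X (?p \<cdot>\<^bsub>U\<^esub> ten_assoc K E X) \<cdot> u (K \<otimes> E) X
      = post X ?p \<cdot> vcomp M X ?T (ten M K ?T) \<cdot> (u K ?T \<otimes>\<^sub>1 u E X)"
    by (rule post_Comp_u) (use O in auto)
  also have "\<dots> = vcomp M X ?T (ten M K X) \<cdot> ((post ?T ?p \<cdot> u K ?T) \<otimes>\<^sub>1 u E X)"
    using O post_vcomp[of X ?T ?p "u K ?T" "u E X"] by simp
  also have "\<dots> = vcomp M X ?T (ten M K X) \<cdot> ((pre (ten_unit V M X) (ten M K X) \<cdot> u K X) \<otimes>\<^sub>1 u E X)"
    using O by (simp add: post_ten_arr)
  also have "\<dots> = vcomp M X X (ten M K X) \<cdot> (u K X \<otimes>\<^sub>1 vid M X)"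
    using O vcomp_slide[of X "ten M K X" "ten_unit V M X" "u K X" "u E X"] by simp
  also have "\<dots> = vcomp M X X (ten M K X) \<cdot> (iV (VHom M X (ten M K X)) \<otimes>\<^sub>1 vid M X) \<cdot> (u K X \<otimes>\<^sub>1 iV E)"
    using O by (simp add: T.T1_merge)
  also have "\<dots> = u K X \<cdot> runit V K"
    using O triangle_tail[OF vcomp_vid_right[of X "ten M K X"], of "u K X \<otimes>\<^sub>1 iV E"] runit_nat[of "u K X"] by simp
  finally have l: "post X (?p \<cdot>\<^bsub>U\<^esub> ten_assoc K E X) \<cdot> u (K \<otimes> E) X = u K X \<cdot> runit V K" .
  show ?thesis
    by (rule post_u_cancel[of X _ "K \<otimes> E"]) (use O in \<open>simp_all add: l post_ten_arr\<close>)
qed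

lemma ten_triangle_left:
  assumes O: "K \<in> Obj V" "X \<in> VObj M"
  shows "ten_unit V M (ten M K X) \<cdot>\<^bsub>U\<^esub> ten_assoc E K X = ten_arr V M (lunit V K) (Ide U X)"
proof -
  let ?T = "ten M K X"
  have "post X (ten_unit V M ?T \<cdot>\<^bsub>U\<^esub> ten_assoc E K X) \<cdot> u (E \<otimes> K) X
      = post X (ten_unit V M ?T) \<cdot> vcomp M X ?T (ten M E ?T) \<cdot> (u E ?T \<otimes>\<^sub>1 u K X)"
    by (rule post_Comp_u) (use O in auto)
  also have "\<dots> = vcomp M X ?T ?T \<cdot> (vid M ?T \<otimes>\<^sub>1 u K X)"
    using O post_vcomp[of X ?T "ten_unit V M ?T" "u E ?T" "u K X"] by simp
  also have "\<dots> = vcomp M X ?T ?T \<cdot> (vid M ?T \<otimes>\<^sub>1 iV (VHom M X ?T)) \<cdot> (iV E \<otimes>\<^sub>1 u K X)"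
    using O by (simp add: T.T1_merge)
  also have "\<dots> = u K X \<cdot> lunit V K"
    using O triangle_tail[OF vcomp_vid_left[of X ?T], of "iV E \<otimes>\<^sub>1 u K X"] lunit_nat[of "u K X"] by simp
  finally have l: "post X (ten_unit V M ?T \<cdot>\<^bsub>U\<^esub> ten_assoc E K X) \<cdot> u (E \<otimes> K) X = u K X \<cdot> lunit V K" .
  show ?thesis
    by (rule post_u_cancel[of X _ "E \<otimes> K"]) (use O in \<open>simp_all add: l post_ten_arr\<close>)
qed

lemma post_ten_ev_ten_arr:
  assumes O: "K \<in> Obj V" "X \<in> VObj M" "Y \<in> VObj M" and g: "g \<in> Arr V" "Dom V g = K" "Cod V g = VHom M X Y"
  shows "post X (ten_ev X Y \<cdot>\<^bsub>U\<^esub> ten_arr V M g (Ide U X)) \<cdot> u K X = g"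
proof -
  have "post X (ten_ev X Y \<cdot>\<^bsub>U\<^esub> ten_arr V M g (Ide U X)) \<cdot> u K X = post X (ten_ev X Y) \<cdot> u (VHom M X Y) X \<cdot> g"
    by (rule post_Comp_u) (use O g in \<open>simp_all add: post_ten_arr\<close>)
  then show ?thesis using O g triangle_tail[OF ten_ev_simps(4)[of X Y], of g] by simp
qed

text \<open>\<open>ten_ev\<close> is the transpose of an identity, so \<open>g\<close> is recovered
  from \<open>f\<close> as its restriction along \<open>u K X\<close>, which settles existence and
  uniqueness.\<close>

lemma ten_ev_universal:
  assumes O: "K \<in> Obj V" "X \<in> VObj M" "Y \<in> VObj M" and f: "f \<in> hom U (ten M K X) Y"
  shows "\<exists>!g. g \<in> hom V K (VHom M X Y) \<and> ten_ev X Y \<cdot>\<^bsub>U\<^esub> ten_arr V M g (Ide U X) = f"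
proof (rule ex1I)
  have t: "f \<in> Arr U" "Dom U f = ten M K X" "Cod U f = Y" using f by (auto simp: hom_def)
  let ?g = "post X f \<cdot> u K X"
  have g: "?g \<in> Arr V" "Dom V ?g = K" "Cod V ?g = VHom M X Y" using O t by simp_all
  have "ten_ev X Y \<cdot>\<^bsub>U\<^esub> ten_arr V M ?g (Ide U X) = f"
    by (rule post_u_cancel[of X _ K]) (use O t g post_ten_ev_ten_arr[OF O g] in simp_all)
  then show "?g \<in> hom V K (VHom M X Y) \<and> ten_ev X Y \<cdot>\<^bsub>U\<^esub> ten_arr V M ?g (Ide U X) = f"
    using g by (simp add: hom_def)
  show "g = ?g" if "g \<in> hom V K (VHom M X Y) \<and> ten_ev X Y \<cdot>\<^bsub>U\<^esub> ten_arr V M g (Ide U X) = f" for g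
    using that post_ten_ev_ten_arr[OF O, of g] by (auto simp: hom_def)
qed

lemma post_cot_ev_ten_arr:
  assumes O: "K \<in> Obj V" "Y \<in> VObj M" and g: "g \<in> Arr U" "Cod U g = cot M K Y"
  shows "post (Dom U g) (cot_ev K Y \<cdot>\<^bsub>U\<^esub> ten_arr V M (iV K) g) \<cdot> u K (Dom U g) = pre g Y \<cdot> v K Y"
proof -
  have "post (Dom U g) (cot_ev K Y \<cdot>\<^bsub>U\<^esub> ten_arr V M (iV K) g) \<cdot> u K (Dom U g)
      = post (Dom U g) (cot_ev K Y) \<cdot> pre g (ten M K (cot M K Y)) \<cdot> u K (cot M K Y)"
    by (rule post_Comp_u) (use O g in \<open>simp_all add: post_ten_arr\<close>)
  also have "\<dots> = pre g Y \<cdot> post (cot M K Y) (cot_ev K Y) \<cdot> u K (cot M K Y)"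
    using O g square_tail[OF post_pre[of g "cot_ev K Y"], of "u K (cot M K Y)"] by simp
  finally show ?thesis using O g by simp
qed

text \<open>Two transpositions: \<open>f\<close> restricts along \<open>u K X\<close> to
  \<open>?h : K \<rightarrow> M(X, Y)\<close>, and \<open>?h\<close> corresponds through
  \<open>v K Y\<close> to an arrow into the cotensor.\<close>

lemma cot_ev_universal:
  assumes O: "K \<in> Obj V" "X \<in> VObj M" "Y \<in> VObj M" and f: "f \<in> hom U (ten M K X) Y"
  shows "\<exists>!g. g \<in> hom U X (cot M K Y) \<and> cot_ev K Y \<cdot>\<^bsub>U\<^esub> ten_arr V M (iV K) g = f"
proof (rule ex1I)
  have t: "f \<in> Arr U" "Dom U f = ten M K X" "Cod U f = Y" using f by (auto simp: hom_def)
  let ?h = "post X f \<cdot> u K X"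
  let ?g = "cot_transpose V M K X Y ?h"
  have g: "?g \<in> Arr U" "Dom U ?g = X" "Cod U ?g = cot M K Y" "pre ?g Y \<cdot> v K Y = ?h"
    using O t by simp_all
  have "cot_ev K Y \<cdot>\<^bsub>U\<^esub> ten_arr V M (iV K) ?g = f"
    by (rule post_u_cancel[of X _ K]) (use O t g post_cot_ev_ten_arr[OF O(1,3) g(1,3)] in simp_all)
  then show "?g \<in> hom U X (cot M K Y) \<and> cot_ev K Y \<cdot>\<^bsub>U\<^esub> ten_arr V M (iV K) ?g = f"
    using g by (simp add: hom_def)
  show "g' = ?g" if "g' \<in> hom U X (cot M K Y) \<and> cot_ev K Y \<cdot>\<^bsub>U\<^esub> ten_arr V M (iV K) g' = f" for g'
  proof -
    have g': "g' \<in> Arr U" "Dom U g' = X" "Cod U g' = cot M K Y"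
      and e: "cot_ev K Y \<cdot>\<^bsub>U\<^esub> ten_arr V M (iV K) g' = f" using that by (auto simp: hom_def)
    have "pre g' Y \<cdot> v K Y = pre ?g Y \<cdot> v K Y"
      using post_cot_ev_ten_arr[OF O(1,3) g'(1,3)] g' e g(4) by simp
    then show ?thesis by (rule pre_v_cancel) (use O g g' in auto)
  qed
qed

sublocale U: biclosed_module V U "ten M" "ten_arr V M" ten_assoc "ten_unit V M" "VHom M" ten_ev
  "cot M" cot_ev
proof unfold_locales
  show "ten_assoc K L X \<cdot>\<^bsub>U\<^esub> ten_arr V M (k \<otimes>\<^sub>1 l) f
      = ten_arr V M k (ten_arr V M l f) \<cdot>\<^bsub>U\<^esub> ten_assoc (Dom V k) (Dom V l) (Dom U f)"
    if "k \<in> Arr V" "l \<in> Arr V" "f \<in> Arr U" "Cod V k = K" "Cod V l = L" "Cod U f = X" for k l f K L X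
    using ten_assoc_nat[of k l f] that by auto
  show "ten_unit V M X \<cdot>\<^bsub>U\<^esub> ten_arr V M (iV E) f = f \<cdot>\<^bsub>U\<^esub> ten_unit V M (Dom U f)"
    if "f \<in> Arr U" "Cod U f = X" for f X
    using ten_unit_nat[of f] that by auto
qed (simp_all add: ten_assoc_iso ten_pentagon ten_triangle_right ten_triangle_left ten_ev_universal
    cot_ev_universal)

text \<open>Matches the functoriality recovered from the adjunction with postcomposition in
  \<open>M\<close>, so that \<open>vhom_homotopical\<close> can supply
  \<open>mhom_weq\<close>.\<close>

lemma mhom_arr_eq_post:
  assumes X: "X \<in> VObj M" and g: "g \<in> Arr U"
  shows "U.mhom_arr X g = post X g"
proof (rule U.flat_inj[of X "Cod U g"])
  have "post X (g \<cdot>\<^bsub>U\<^esub> ten_ev X (Dom U g)) \<cdot> u (VHom M X (Dom U g)) X = post X g \<cdot> iV (VHom M X (Dom U g))"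
    by (rule post_Comp_u) (use X g in auto)
  then have "ten_ev X (Cod U g) \<cdot>\<^bsub>U\<^esub> ten_arr V M (post X g) (Ide U X) = g \<cdot>\<^bsub>U\<^esub> ten_ev X (Dom U g)"
    using X g post_ten_ev_ten_arr[of "VHom M X (Dom U g)" X "Cod U g" "post X g"]
    by (intro post_u_cancel[of X _ "VHom M X (Dom U g)"]) simp_all
  then show "U.flat X (Cod U g) (U.mhom_arr X g) = U.flat X (Cod U g) (post X g)"
    using X g U.mhom_arr_simps(4)[of X g] by (simp add: U.flat_def)
qed (use X g in auto)

text \<open>Likewise for cotensors, so that \<open>cot_homotopical\<close> can supply
  \<open>mcot_weq\<close>. Both arrows have the same composite with the universal
  \<open>cot_ev\<close>.\<close>

lemma mcot_arr_eq_cot_arr: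
  assumes K: "K \<in> Obj V" and g: "g \<in> Arr U"
  shows "U.mcot_arr K g = cot_arr V M (iV K) g"
proof -
  let ?C = "cot M K (Dom U g)" and ?h = "post (cot M K (Dom U g)) g \<cdot> v K (Dom U g)"
  have e: "cot_arr V M (iV K) g = cot_transpose V M K ?C (Cod U g) ?h"
    using K g by (auto simp: cot_arr_def underlying_def)
  have c: "cot_arr V M (iV K) g \<in> Arr U" "Dom U (cot_arr V M (iV K) g) = ?C"
    "Cod U (cot_arr V M (iV K) g) = cot M K (Cod U g)"
    "pre (cot_arr V M (iV K) g) (Cod U g) \<cdot> v K (Cod U g) = ?h"
    unfolding e using K g by simp_all
  have "post ?C (g \<cdot>\<^bsub>U\<^esub> cot_ev K (Dom U g)) \<cdot> u K ?C = ?h"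
    by (rule post_Comp_u) (use K g in auto)
  then have "cot_ev K (Cod U g) \<cdot>\<^bsub>U\<^esub> ten_arr V M (iV K) (cot_arr V M (iV K) g) = g \<cdot>\<^bsub>U\<^esub> cot_ev K (Dom U g)"
    using K g c post_cot_ev_ten_arr[OF K _ c(1,3)] by (intro post_u_cancel[of ?C _ K]) simp_all
  moreover have "cot_ev K (Cod U g) \<cdot>\<^bsub>U\<^esub> ten_arr V M (iV K) (U.mcot_arr K g) = g \<cdot>\<^bsub>U\<^esub> cot_ev K (Dom U g)"
    using K g by simp
  ultimately show ?thesis
    by (intro U.mcev_cancel[of K "Cod U g" "U.mcot_arr K g"]) (use K g c in simp_all)
qed

end

theorem proposition16p2:
  fixes V :: "('o, 'a) hcsm" and M :: "('m, 'o, 'a) hvcat"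
  assumes "closed_symmetric_monoidal_homotopical_category TYPE('i) V"
    and "enriched_homotopical_category V M"
  shows "\<exists>(H :: ('m, 'o, ('o, 'a) ho_arr) tcvcat) F.
           tensored_cotensored_category (Ho V) H \<and>
           cat_isomorphism (ho_cat (underlying V M) (MWeq M)) (underlying (Ho V) H) F \<and>
           (\<forall>X \<in> VObj M. FO F X = X)"
proof -
  interpret V: closed_symmetric_monoidal_homotopical_category "TYPE('i)" V by fact
  interpret M: enriched_homotopical_category V M by fact
  \<comment> \<open>For \<open>M\<close> the deformations are only known to exist; they are fixed
    here, and the enrichment is built from this choice.\<close>
  obtain Q q where Q: "left_deformation M.U (MWeq M) Q q" "FO Q ` Obj M.U \<subseteq> MQ M" "MQ M \<subseteq> Obj M.U"
    using M.MQ_retract by (auto simp: left_deformation_retract_def)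
  obtain R r where R: "right_deformation M.U (MWeq M) R r" "FO R ` Obj M.U \<subseteq> MR M" "MR M \<subseteq> Obj M.U"
    using M.MR_retract by (auto simp: right_deformation_retract_def)
  interpret L: left_deformed M.U "MWeq M" Q q "MQ M"
    using Q M.M0_homotopical by (intro left_deformed.intro left_deformed_axioms.intro) auto
  interpret R: right_deformed M.U "MWeq M" R r "MR M"
    using R M.M0_homotopical by (intro right_deformed.intro right_deformed_axioms.intro) auto
  have "homotopical_biclosed_module TYPE('i) V M.U (ten M) (ten_arr V M) M.ten_assoc (ten_unit V M)
      (MWeq M) Q q (MQ M) (VHom M) M.ten_ev R r (MR M) (cot M) M.cot_ev"
  proof unfold_locales
    fix X assume X: "X \<in> MQ M"
    then have O: "X \<in> VObj M" using L.S_Obj' by simp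
    show "ten_unit V M X \<cdot>\<^bsub>M.U\<^esub> ten_arr V M (qt V (unit_obj V)) (Ide M.U X) \<in> MWeq M"
      by (rule M.ten_unit_weq[OF X])
    fix g assume g: "g \<in> weq_on M.U (MWeq M) (MR M)"
    then have a: "g \<in> Arr M.U" using L.weq_in_Arr by (auto simp: weq_on_def)
    \<comment> \<open>The first argument is an identity, which is a weak equivalence between objects
      of \<open>MQ M\<close>.\<close>
    have "vhom_arr V M (Ide M.U X) g \<in> Weq V"
      by (rule M.vhom_homotopical[OF _ g]) (use X O in simp)
    moreover have "vhom_arr V M (Ide M.U X) g = M.post X g"
    proof -
      have "fst (Ide M.U X) = X" "fst g = Dom M.U g" by (simp_all add: underlying_def)
      then show ?thesis using O a by (simp add: vhom_arr_def)
    qed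
    ultimately show "M.U.mhom_arr X g \<in> Weq V"
      using O a by (simp add: M.mhom_arr_eq_post)
  next
    fix K g assume K: "K \<in> VQ V" and g: "g \<in> weq_on M.U (MWeq M) (MR M)"
    then have "g \<in> Arr M.U" using L.weq_in_Arr by (auto simp: weq_on_def)
    then show "M.U.mcot_arr K g \<in> MWeq M"
      using K M.cot_homotopical[OF _ g, of "Ide V K"] by (simp add: M.mcot_arr_eq_cot_arr)
  qed (auto intro: M.ten_homotopical M.ten_in_MQ)
  from homotopical_biclosed_module.ex_enrichment_Ho[OF this] show ?thesis by simp
qed

end
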